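(* Let $L,H$ be causal models in a Markov category $\mathcal C$ with variables $V_L,V_H$. An interchange abstraction $L\to H$ with variable alignment $(\pi,\tau)$ is equivalent to a downward abstraction $(\pi,\tau)\colon(\mathrm{Int}(V_L),L)\to(\mathrm{Int}(V_H),H)$ of interchange queries such that $\pi(V_H^{\rm in})=V_L^{\rm in}$, $\pi(V_H^{\rm nin})\subseteq V_L^{\rm nin}$, and on queries $$\pi\big(\mathrm{Int}(S_1,\dots,S_n)\to O\big)=\big(\mathrm{Int}(\pi(S_1),\dots,\pi(S_n))\to\pi(O)\big)$$ for all disjoint $S_1,\dots,S_n\subseteq V_H^{\rm nin}$ and all $O\subseteq V_H^{\rm out}$. That is, restricting $\pi$ and $\tau$ to variables gives a bijection from such downward abstractions to interchange abstractions $L\to H$.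
   Context: **Categories.** A Markov category is a symmetric monoidal category with terminal unit $I$ in which each object has a commutative comonoid structure (copy, discard) compatible with $\otimes$. Morphisms are called channels; $f$ is deterministic if $\mathrm{copy}\circ f=(f\otimes f)\circ\mathrm{copy}$. Functors are strong symmetric monoidal, copy-preserving, with deterministic structure isomorphisms; natural transformations are monoidal with deterministic components; "epic" means all components are epic. **Causal models.** An open DAG is a finite DAG with vertex set $V$ and a subset $V^{\rm in}\subseteq V$ of parentless vertices (inputs); $V^{\rm nin}=V\setminus V^{\rm in}$. A causal model $M$ over it in $\mathcal C$ consists of an object of $\mathcal C$ (again written $X$) for each vertex $X$, a channel (mechanism) $c_X\colon\bigotimes_{Y\in\mathrm{Pa}(X)}Y\to X$ for each $X\in V^{\rm nin}$, and a subset $V^{\rm out}\subseteq V$ of outputs. A set of variables is also used for the list of its elements (lists of distinct variables considered up to permutation) and for the tensor of the corresponding objects. For $O\subseteq V$, $M^{O}\colon V^{\rm in}\to O$ is the channel obtained by wiring together, with copy maps, the mechanisms of all non-input variables having a directed path (possibly of length 0) to $O$, copying each $X\in O$ once more to form an output, and discarding inputs with no path to $O$. For $S\subseteq V^{\rm nin}$, $M_{\mathrm{Do}(S)}$ is obtained by deleting the mechanisms of all $X\in S$ and all edges into $S$ and making each $X\in S$ an input; so $M_{\mathrm{Do}(S)}^{O}\colon V^{\rm in}\otimes S\to O$. **Queries.** A query signature $Q$ is a set of objects (types) and a set of generators (queries), each with finite lists of input and output types; it freely generates a Markov category $\mathbf Q$. A model of $Q$ in $\mathcal C$ is a functor $[\![-]\!]\colon\mathbf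 Q\to\mathcal C$. The signature of interchange queries $\mathrm{Int}(V)$ has types $V$ and, for all $n\ge0$, pairwise disjoint $S_1,\dots,S_n\subseteq V^{\rm nin}$ and $O\subseteq V^{\rm out}$, a query $\mathrm{Int}(S_1,\dots,S_n)\to O$ whose input is $n+1$ copies of $V^{\rm in}$ and whose output is $O$. A causal model $M$ over $V$ models it by $$M_{\mathrm{Int}(S_1,\dots,S_n)}^{O}:=M_{\mathrm{Do}(S_1\cup\dots\cup S_n)}^{O}\circ\big(\mathrm{id}_{V^{\rm in}}\otimes M^{S_1}\otimes\dots\otimes M^{S_n}\big).$$ **Downward abstraction** $(\pi,\tau)\colon(Q_L,L)\to(Q_H,H)$: a functor $\pi\colon\mathbf Q_H\to\mathbf Q_L$ sending each query of $Q_H$ to a query (generator) of $Q_L$, and an epic natural transformation $\tau\colon[\![-]\!]_L\circ\pi\Rightarrow[\![-]\!]_H$. The conditions $\pi(V_H^{\rm in})=V_L^{\rm in}$ and $\pi(V_H^{\rm nin})\subseteq V_L^{\rm nin}$ are on the concatenated lists, which in particular have no repetitions. **Interchange abstraction.** A variable alignment $(\pi,\tau)$ from $V_L$ to $V_H$ is a family of pairwise disjoint subsets $\pi(X)\subseteq V_L$, $X\in V_H$, with $\pi(V_H^{\rm in})=V_L^{\rm in}$ and $\pi(V_H^{\rm out})\subseteq V_L^{\rm out}$ (with $\pi(S)=\bigcup_{X\in S}\pi(X)$), together with an epic deterministic channel $\tau_X\colon\pi(X)\to X$ for each $X\in V_H$; put $\tau_S=\bigotimes_{X\in S}\tau_X$;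 all tensor products of the $\tau_X$ are also required to be epic. It is an interchange abstraction $L\to H$ if for all pairwise disjoint $S_1,\dots,S_n\subseteq V_H^{\rm nin}$, $$\tau_{V_H^{\rm out}}\circ L_{\mathrm{Int}(\pi(S_1),\dots,\pi(S_n))}^{\pi(V_H^{\rm out})}=H_{\mathrm{Int}(S_1,\dots,S_n)}^{V_H^{\rm out}}\circ(\tau_{V_H^{\rm in}})^{\otimes(n+1)}.$$ *)

theory Defs
  imports "HOL-Library.FuncSet" "HOL-Library.Disjoint_Sets"
begin

section \<open>Markov categories\<close>

text \<open>
  The data of a (not necessarily strict) symmetric monoidal category with a chosen copy and
  discard morphism on every object.
\<close>

record ('o, 'm) mcat =
  Ob :: "'o set"
  Ar :: "'m set"
  Src :: "'m \<Rightarrow> 'o"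
  Tgt :: "'m \<Rightarrow> 'o"
  Ident :: "'o \<Rightarrow> 'm"
  Cmp :: "'m \<Rightarrow> 'm \<Rightarrow> 'm" (infixr "\<cdot>\<index>" 55)
  Unit :: "'o"
  TenO :: "'o \<Rightarrow> 'o \<Rightarrow> 'o" (infixr "\<odot>\<index>" 65)
  TenA :: "'m \<Rightarrow> 'm \<Rightarrow> 'm" (infixr "\<otimes>\<index>" 65)
  Assoc :: "'o \<Rightarrow> 'o \<Rightarrow> 'o \<Rightarrow> 'm"
  Lunit :: "'o \<Rightarrow> 'm"
  Runit :: "'o \<Rightarrow> 'm"
  Swap :: "'o \<Rightarrow> 'o \<Rightarrow> 'm"
  Copy :: "'o \<Rightarrow> 'm"
  Disc :: "'o \<Rightarrow> 'm"

definition hom :: "('o, 'm) mcat \<Rightarrow> 'o \<Rightarrow> 'o \<Rightarrow> 'm set" where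
  "hom C a b = {f \<in> Ar C. Src C f = a \<and> Tgt C f = b}"

definition inverse_arrows :: "('o, 'm) mcat \<Rightarrow> 'm \<Rightarrow> 'm \<Rightarrow> bool" where
  "inverse_arrows C f g \<longleftrightarrow> f \<in> Ar C \<and> g \<in> hom C (Tgt C f) (Src C f) \<and>
     g \<cdot>\<^bsub>C\<^esub> f = Ident C (Src C f) \<and> f \<cdot>\<^bsub>C\<^esub> g = Ident C (Tgt C f)"

definition iso :: "('o, 'm) mcat \<Rightarrow> 'm \<Rightarrow> bool" where
  "iso C f \<longleftrightarrow> (\<exists>g. inverse_arrows C f g)"

definition inverse_of :: "('o, 'm) mcat \<Rightarrow> 'm \<Rightarrow> 'm" where
  "inverse_of C f = (THE g. inverse_arrows C f g)"

definition epic :: "('o, 'm) mcat \<Rightarrow> 'm \<Rightarrow> bool" where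
  "epic C f \<longleftrightarrow> f \<in> Ar C \<and>
     (\<forall>c. \<forall>g \<in> hom C (Tgt C f) c. \<forall>h \<in> hom C (Tgt C f) c.
        g \<cdot>\<^bsub>C\<^esub> f = h \<cdot>\<^bsub>C\<^esub> f \<longrightarrow> g = h)"

definition deterministic :: "('o, 'm) mcat \<Rightarrow> 'm \<Rightarrow> bool" where
  "deterministic C f \<longleftrightarrow> f \<in> Ar C \<and>
     Copy C (Tgt C f) \<cdot>\<^bsub>C\<^esub> f = (f \<otimes>\<^bsub>C\<^esub> f) \<cdot>\<^bsub>C\<^esub> Copy C (Src C f)"

locale category =
  fixes C :: "('o, 'm) mcat" (structure)
  assumes src_Ob: "f \<in> Ar C \<Longrightarrow> Src C f \<in> Ob C"
    and tgt_Ob: "f \<in> Ar C \<Longrightarrow> Tgt C f \<in> Ob C"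
    and ident_hom: "a \<in> Ob C \<Longrightarrow> Ident C a \<in> hom C a a"
    and cmp_hom: "\<lbrakk>f \<in> hom C a b; g \<in> hom C b c\<rbrakk> \<Longrightarrow> g \<cdot> f \<in> hom C a c"
    and cmp_ident_left: "f \<in> hom C a b \<Longrightarrow> Ident C b \<cdot> f = f"
    and cmp_ident_right: "f \<in> hom C a b \<Longrightarrow> f \<cdot> Ident C a = f"
    and cmp_assoc: "\<lbrakk>f \<in> hom C a b; g \<in> hom C b c; h \<in> hom C c d\<rbrakk>
          \<Longrightarrow> (h \<cdot> g) \<cdot> f = h \<cdot> (g \<cdot> f)"

locale symmetric_monoidal_category = category +
  assumes unit_Ob: "Unit C \<in> Ob C"
    and tenO_Ob: "\<lbrakk>a \<in> Ob C; b \<in> Ob C\<rbrakk> \<Longrightarrow> a \<odot> b \<in> Ob C"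
    and tenA_hom: "\<lbrakk>f \<in> hom C a b; g \<in> hom C c d\<rbrakk> \<Longrightarrow> f \<otimes> g \<in> hom C (a \<odot> c) (b \<odot> d)"
    and tenA_ident: "\<lbrakk>a \<in> Ob C; b \<in> Ob C\<rbrakk> \<Longrightarrow> Ident C a \<otimes> Ident C b = Ident C (a \<odot> b)"
    and tenA_cmp: "\<lbrakk>f \<in> hom C a b; g \<in> hom C b c; f' \<in> hom C a' b'; g' \<in> hom C b' c'\<rbrakk>
          \<Longrightarrow> (g \<cdot> f) \<otimes> (g' \<cdot> f') = (g \<otimes> g') \<cdot> (f \<otimes> f')"
    and assoc_hom: "\<lbrakk>a \<in> Ob C; b \<in> Ob C; c \<in> Ob C\<rbrakk>
          \<Longrightarrow> Assoc C a b c \<in> hom C ((a \<odot> b) \<odot> c) (a \<odot> (b \<odot> c))"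
    and assoc_iso: "\<lbrakk>a \<in> Ob C; b \<in> Ob C; c \<in> Ob C\<rbrakk> \<Longrightarrow> iso C (Assoc C a b c)"
    and assoc_natural: "\<lbrakk>f \<in> hom C a a'; g \<in> hom C b b'; h \<in> hom C c c'\<rbrakk>
          \<Longrightarrow> Assoc C a' b' c' \<cdot> ((f \<otimes> g) \<otimes> h) = (f \<otimes> (g \<otimes> h)) \<cdot> Assoc C a b c"
    and lunit_hom: "a \<in> Ob C \<Longrightarrow> Lunit C a \<in> hom C (Unit C \<odot> a) a"
    and lunit_iso: "a \<in> Ob C \<Longrightarrow> iso C (Lunit C a)"
    and lunit_natural: "f \<in> hom C a b \<Longrightarrow> Lunit C b \<cdot> (Ident C (Unit C) \<otimes> f) = f \<cdot> Lunit C a"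
    and runit_hom: "a \<in> Ob C \<Longrightarrow> Runit C a \<in> hom C (a \<odot> Unit C) a"
    and runit_iso: "a \<in> Ob C \<Longrightarrow> iso C (Runit C a)"
    and runit_natural: "f \<in> hom C a b \<Longrightarrow> Runit C b \<cdot> (f \<otimes> Ident C (Unit C)) = f \<cdot> Runit C a"
    and pentagon: "\<lbrakk>a \<in> Ob C; b \<in> Ob C; c \<in> Ob C; d \<in> Ob C\<rbrakk>
          \<Longrightarrow> Assoc C a b (c \<odot> d) \<cdot> Assoc C (a \<odot> b) c d =
              (Ident C a \<otimes> Assoc C b c d) \<cdot> Assoc C a (b \<odot> c) d \<cdot> (Assoc C a b c \<otimes> Ident C d)"
    and triangle: "\<lbrakk>a \<in> Ob C; b \<in> Ob C\<rbrakk>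
          \<Longrightarrow> (Ident C a \<otimes> Lunit C b) \<cdot> Assoc C a (Unit C) b = Runit C a \<otimes> Ident C b"
    and swap_hom: "\<lbrakk>a \<in> Ob C; b \<in> Ob C\<rbrakk> \<Longrightarrow> Swap C a b \<in> hom C (a \<odot> b) (b \<odot> a)"
    and swap_natural: "\<lbrakk>f \<in> hom C a a'; g \<in> hom C b b'\<rbrakk>
          \<Longrightarrow> Swap C a' b' \<cdot> (f \<otimes> g) = (g \<otimes> f) \<cdot> Swap C a b"
    and swap_swap: "\<lbrakk>a \<in> Ob C; b \<in> Ob C\<rbrakk> \<Longrightarrow> Swap C b a \<cdot> Swap C a b = Ident C (a \<odot> b)"
    and hexagon: "\<lbrakk>a \<in> Ob C; b \<in> Ob C; c \<in> Ob C\<rbrakk>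
          \<Longrightarrow> Assoc C b c a \<cdot> Swap C a (b \<odot> c) \<cdot> Assoc C a b c =
              (Ident C b \<otimes> Swap C a c) \<cdot> Assoc C b a c \<cdot> (Swap C a b \<otimes> Ident C c)"

text \<open>The middle-four interchange \<open>(a \<odot> b) \<odot> (c \<odot> d) \<rightarrow> (a \<odot> c) \<odot> (b \<odot> d)\<close>.\<close>

definition middle_swap :: "('o, 'm) mcat \<Rightarrow> 'o \<Rightarrow> 'o \<Rightarrow> 'o \<Rightarrow> 'o \<Rightarrow> 'm" where
  "middle_swap C a b c d =
     inverse_of C (Assoc C a c (b \<odot>\<^bsub>C\<^esub> d)) \<cdot>\<^bsub>C\<^esub>
     (Ident C a \<otimes>\<^bsub>C\<^esub>
        (Assoc C c b d \<cdot>\<^bsub>C\<^esub> (Swap C b c \<otimes>\<^bsub>C\<^esub> Ident C d) \<cdot>\<^bsub>C\<^esub> inverse_of C (Assoc C b c d))) \<cdot>\<^bsub>C\<^esub>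
     Assoc C a b (c \<odot>\<^bsub>C\<^esub> d)"

text \<open>
  The remaining compatibility conditions (copy on the unit, discard on tensor products) follow
  from the terminality of the unit.
\<close>

locale markov_category = symmetric_monoidal_category +
  assumes disc_hom: "a \<in> Ob C \<Longrightarrow> Disc C a \<in> hom C a (Unit C)"
    and terminal: "f \<in> hom C a (Unit C) \<Longrightarrow> f = Disc C a"
    and copy_hom: "a \<in> Ob C \<Longrightarrow> Copy C a \<in> hom C a (a \<odot> a)"
    and copy_assoc: "a \<in> Ob C \<Longrightarrow>
          Assoc C a a a \<cdot> (Copy C a \<otimes> Ident C a) \<cdot> Copy C a = (Ident C a \<otimes> Copy C a) \<cdot> Copy C a"
    and copy_counit: "a \<in> Ob C \<Longrightarrow> Lunit C a \<cdot> (Disc C a \<otimes> Ident C a) \<cdot> Copy C a = Ident C a"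
    and copy_commute: "a \<in> Ob C \<Longrightarrow> Swap C a a \<cdot> Copy C a = Copy C a"
    and copy_tensor: "\<lbrakk>a \<in> Ob C; b \<in> Ob C\<rbrakk> \<Longrightarrow>
          Copy C (a \<odot> b) = middle_swap C a a b b \<cdot> (Copy C a \<otimes> Copy C b)"


section \<open>Functors and natural transformations\<close>

text \<open>\<open>lax F a b : F a \<odot> F b \<rightarrow> F (a \<odot> b)\<close> and \<open>unt F : Unit \<rightarrow> F Unit\<close> are the structure morphisms.\<close>

record ('o1, 'm1, 'o2, 'm2) mfunctor =
  fob :: "'o1 \<Rightarrow> 'o2"
  far :: "'m1 \<Rightarrow> 'm2"
  lax :: "'o1 \<Rightarrow> 'o1 \<Rightarrow> 'm2"
  unt :: "'m2"

definition markov_functor ::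
  "('o1, 'm1) mcat \<Rightarrow> ('o2, 'm2) mcat \<Rightarrow> ('o1, 'm1, 'o2, 'm2) mfunctor \<Rightarrow> bool" where
  "markov_functor C D F \<longleftrightarrow>
     (\<forall>a \<in> Ob C. fob F a \<in> Ob D) \<and>
     (\<forall>a b. \<forall>f \<in> hom C a b. far F f \<in> hom D (fob F a) (fob F b)) \<and>
     (\<forall>a \<in> Ob C. far F (Ident C a) = Ident D (fob F a)) \<and>
     (\<forall>a b c. \<forall>f \<in> hom C a b. \<forall>g \<in> hom C b c. far F (g \<cdot>\<^bsub>C\<^esub> f) = far F g \<cdot>\<^bsub>D\<^esub> far F f) \<and>
     unt F \<in> hom D (Unit D) (fob F (Unit C)) \<and> iso D (unt F) \<and> deterministic D (unt F) \<and>
     (\<forall>a \<in> Ob C. \<forall>b \<in> Ob C.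
        lax F a b \<in> hom D (fob F a \<odot>\<^bsub>D\<^esub> fob F b) (fob F (a \<odot>\<^bsub>C\<^esub> b)) \<and>
        iso D (lax F a b) \<and> deterministic D (lax F a b)) \<and>
     (\<forall>a b c d. \<forall>f \<in> hom C a b. \<forall>g \<in> hom C c d.
        far F (f \<otimes>\<^bsub>C\<^esub> g) \<cdot>\<^bsub>D\<^esub> lax F a c = lax F b d \<cdot>\<^bsub>D\<^esub> (far F f \<otimes>\<^bsub>D\<^esub> far F g)) \<and>
     (\<forall>a \<in> Ob C. \<forall>b \<in> Ob C. \<forall>c \<in> Ob C.
        far F (Assoc C a b c) \<cdot>\<^bsub>D\<^esub> lax F (a \<odot>\<^bsub>C\<^esub> b) c \<cdot>\<^bsub>D\<^esub> (lax F a b \<otimes>\<^bsub>D\<^esub> Ident D (fob F c)) =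
        lax F a (b \<odot>\<^bsub>C\<^esub> c) \<cdot>\<^bsub>D\<^esub> (Ident D (fob F a) \<otimes>\<^bsub>D\<^esub> lax F b c) \<cdot>\<^bsub>D\<^esub>
          Assoc D (fob F a) (fob F b) (fob F c)) \<and>
     (\<forall>a \<in> Ob C.
        far F (Lunit C a) \<cdot>\<^bsub>D\<^esub> lax F (Unit C) a \<cdot>\<^bsub>D\<^esub> (unt F \<otimes>\<^bsub>D\<^esub> Ident D (fob F a)) =
          Lunit D (fob F a) \<and>
        far F (Runit C a) \<cdot>\<^bsub>D\<^esub> lax F a (Unit C) \<cdot>\<^bsub>D\<^esub> (Ident D (fob F a) \<otimes>\<^bsub>D\<^esub> unt F) =
          Runit D (fob F a)) \<and>
     (\<forall>a \<in> Ob C. \<forall>b \<in> Ob C.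
        far F (Swap C a b) \<cdot>\<^bsub>D\<^esub> lax F a b = lax F b a \<cdot>\<^bsub>D\<^esub> Swap D (fob F a) (fob F b)) \<and>
     (\<forall>a \<in> Ob C. far F (Copy C a) = lax F a a \<cdot>\<^bsub>D\<^esub> Copy D (fob F a))"

definition functor_comp ::
  "('o3, 'm3) mcat \<Rightarrow> ('o2, 'm2, 'o3, 'm3) mfunctor \<Rightarrow> ('o1, 'm1, 'o2, 'm2) mfunctor
     \<Rightarrow> ('o1, 'm1, 'o3, 'm3) mfunctor" where
  "functor_comp E G F =
     \<lparr> fob = fob G \<circ> fob F,
       far = far G \<circ> far F,
       lax = (\<lambda>a b. far G (lax F a b) \<cdot>\<^bsub>E\<^esub> lax G (fob F a) (fob F b)),
       unt = far G (unt F) \<cdot>\<^bsub>E\<^esub> unt G \<rparr>"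

definition markov_transformation ::
  "('o1, 'm1) mcat \<Rightarrow> ('o2, 'm2) mcat \<Rightarrow> ('o1, 'm1, 'o2, 'm2) mfunctor
     \<Rightarrow> ('o1, 'm1, 'o2, 'm2) mfunctor \<Rightarrow> ('o1 \<Rightarrow> 'm2) \<Rightarrow> bool" where
  "markov_transformation C D F G \<alpha> \<longleftrightarrow>
     (\<forall>a \<in> Ob C. \<alpha> a \<in> hom D (fob F a) (fob G a) \<and> deterministic D (\<alpha> a)) \<and>
     (\<forall>a b. \<forall>f \<in> hom C a b. \<alpha> b \<cdot>\<^bsub>D\<^esub> far F f = far G f \<cdot>\<^bsub>D\<^esub> \<alpha> a) \<and>
     (\<forall>a \<in> Ob C. \<forall>b \<in> Ob C.
        \<alpha> (a \<odot>\<^bsub>C\<^esub> b) \<cdot>\<^bsub>D\<^esub> lax F a b = lax G a b \<cdot>\<^bsub>D\<^esub> (\<alpha> a \<otimes>\<^bsub>D\<^esub> \<alpha> b)) \<and>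
     \<alpha> (Unit C) \<cdot>\<^bsub>D\<^esub> unt F = unt G"


section \<open>Tensor products of lists\<close>

definition list_tensor_ob :: "('o, 'm) mcat \<Rightarrow> 'o list \<Rightarrow> 'o" where
  "list_tensor_ob K as = foldr (TenO K) as (Unit K)"

definition list_tensor_ar :: "('o, 'm) mcat \<Rightarrow> 'm list \<Rightarrow> 'm" where
  "list_tensor_ar K fs = foldr (TenA K) fs (Ident K (Unit K))"

text \<open>
  In a general Markov category the tensor product of a list is bracketed to the right, without a
  trailing unit, so that the tensor of a one-element list is that element itself;
  \<open>join C xs ys\<close> is the coherence isomorphism
  \<open>tlist C xs \<odot> tlist C ys \<rightarrow> tlist C (xs @ ys)\<close>.
\<close>

fun tlist :: "('o, 'm) mcat \<Rightarrow> 'o list \<Rightarrow> 'o" where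
  "tlist C [] = Unit C"
| "tlist C [a] = a"
| "tlist C (a # b # as) = a \<odot>\<^bsub>C\<^esub> tlist C (b # as)"

fun join :: "('o, 'm) mcat \<Rightarrow> 'o list \<Rightarrow> 'o list \<Rightarrow> 'm" where
  "join C [] ys = Lunit C (tlist C ys)"
| "join C [a] [] = Runit C a"
| "join C [a] (b # ys) = Ident C (a \<odot>\<^bsub>C\<^esub> tlist C (b # ys))"
| "join C (a # b # xs) ys =
     (Ident C a \<otimes>\<^bsub>C\<^esub> join C (b # xs) ys) \<cdot>\<^bsub>C\<^esub> Assoc C a (tlist C (b # xs)) (tlist C ys)"

text \<open>
  The strictification of \<open>C\<close>: objects are lists of objects of \<open>C\<close>, and a morphism from \<open>xs\<close> to \<open>ys\<close>
  is a morphism of \<open>C\<close> between the tensor products of these lists.  It keeps the coherence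
  isomorphisms of \<open>C\<close> out of the string diagrams below.
\<close>

definition strictify :: "('o, 'm) mcat \<Rightarrow> ('o list, 'o list \<times> 'm \<times> 'o list) mcat" where
  "strictify C =
     \<lparr> Ob = lists (Ob C),
       Ar = {(xs, f, ys). xs \<in> lists (Ob C) \<and> ys \<in> lists (Ob C) \<and> f \<in> hom C (tlist C xs) (tlist C ys)},
       Src = (\<lambda>(xs, f, ys). xs),
       Tgt = (\<lambda>(xs, f, ys). ys),
       Ident = (\<lambda>xs. (xs, Ident C (tlist C xs), xs)),
       Cmp = (\<lambda>(ys', g, zs) (xs, f, ys). (xs, g \<cdot>\<^bsub>C\<^esub> f, zs)),
       Unit = [],
       TenO = (@),
       TenA = (\<lambda>(xs, f, ys) (xs', f', ys').
                 (xs @ xs',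
                  join C ys ys' \<cdot>\<^bsub>C\<^esub> (f \<otimes>\<^bsub>C\<^esub> f') \<cdot>\<^bsub>C\<^esub> inverse_of C (join C xs xs'),
                  ys @ ys')),
       Assoc = (\<lambda>xs ys zs. (xs @ ys @ zs, Ident C (tlist C (xs @ ys @ zs)), xs @ ys @ zs)),
       Lunit = (\<lambda>xs. (xs, Ident C (tlist C xs), xs)),
       Runit = (\<lambda>xs. (xs, Ident C (tlist C xs), xs)),
       Swap = (\<lambda>xs ys.
                 (xs @ ys,
                  join C ys xs \<cdot>\<^bsub>C\<^esub> Swap C (tlist C xs) (tlist C ys) \<cdot>\<^bsub>C\<^esub> inverse_of C (join C xs ys),
                  ys @ xs)),
       Copy = (\<lambda>xs. (xs, join C xs xs \<cdot>\<^bsub>C\<^esub> Copy C (tlist C xs), xs @ xs)),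
       Disc = (\<lambda>xs. (xs, Disc C (tlist C xs), [])) \<rparr>"

definition underlying :: "'o list \<times> 'm \<times> 'o list \<Rightarrow> 'm" where
  "underlying = (\<lambda>(xs, f, ys). f)"

text \<open>
  \<open>wire K ob xs ys\<close>, for a strict Markov category \<open>K\<close>, distinct \<open>xs\<close> and \<open>set ys \<subseteq> set xs\<close>: the
  string diagram which connects every output variable in \<open>ys\<close> to the input of the same name, using
  copies and discards as needed.  If \<open>ys\<close> is a permutation of \<open>xs\<close>, the copies and discards
  cancel and this is the permutation isomorphism built from symmetries.
\<close>

primrec proj :: "('o, 'm) mcat \<Rightarrow> ('v \<Rightarrow> 'o) \<Rightarrow> 'v list \<Rightarrow> 'v \<Rightarrow> 'm" where
  "proj K ob [] y = Ident K (Unit K)"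
| "proj K ob (x # xs) y =
     (if x = y then Ident K (ob x) \<otimes>\<^bsub>K\<^esub> Disc K (list_tensor_ob K (map ob xs))
      else Disc K (ob x) \<otimes>\<^bsub>K\<^esub> proj K ob xs y)"

primrec wire :: "('o, 'm) mcat \<Rightarrow> ('v \<Rightarrow> 'o) \<Rightarrow> 'v list \<Rightarrow> 'v list \<Rightarrow> 'm" where
  "wire K ob xs [] = Disc K (list_tensor_ob K (map ob xs))"
| "wire K ob xs (y # ys) =
     (proj K ob xs y \<otimes>\<^bsub>K\<^esub> wire K ob xs ys) \<cdot>\<^bsub>K\<^esub> Copy K (list_tensor_ob K (map ob xs))"


section \<open>Signatures and free Markov categories\<close>

record ('t, 'g) signature =
  types :: "'t set"
  gens :: "'g set"
  gsrc :: "'g \<Rightarrow> 't list"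
  gtgt :: "'g \<Rightarrow> 't list"

datatype ('t, 'g) trm =
    TId "'t list"
  | TGen 'g
  | TCmp "('t, 'g) trm" "('t, 'g) trm"
  | TTen "('t, 'g) trm" "('t, 'g) trm"
  | TSwap "'t list" "'t list"
  | TCopy "'t list"
  | TDisc "'t list"

primrec tsrc :: "('t, 'g) signature \<Rightarrow> ('t, 'g) trm \<Rightarrow> 't list" where
  "tsrc Q (TId xs) = xs"
| "tsrc Q (TGen q) = gsrc Q q"
| "tsrc Q (TCmp g f) = tsrc Q f"
| "tsrc Q (TTen f g) = tsrc Q f @ tsrc Q g"
| "tsrc Q (TSwap xs ys) = xs @ ys"
| "tsrc Q (TCopy xs) = xs"
| "tsrc Q (TDisc xs) = xs"

primrec ttgt :: "('t, 'g) signature \<Rightarrow> ('t, 'g) trm \<Rightarrow> 't list" where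
  "ttgt Q (TId xs) = xs"
| "ttgt Q (TGen q) = gtgt Q q"
| "ttgt Q (TCmp g f) = ttgt Q g"
| "ttgt Q (TTen f g) = ttgt Q f @ ttgt Q g"
| "ttgt Q (TSwap xs ys) = ys @ xs"
| "ttgt Q (TCopy xs) = xs @ xs"
| "ttgt Q (TDisc xs) = []"

primrec wt :: "('t, 'g) signature \<Rightarrow> ('t, 'g) trm \<Rightarrow> bool" where
  "wt Q (TId xs) \<longleftrightarrow> xs \<in> lists (types Q)"
| "wt Q (TGen q) \<longleftrightarrow> q \<in> gens Q \<and> gsrc Q q \<in> lists (types Q) \<and> gtgt Q q \<in> lists (types Q)"
| "wt Q (TCmp g f) \<longleftrightarrow> wt Q g \<and> wt Q f \<and> tsrc Q g = ttgt Q f"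
| "wt Q (TTen f g) \<longleftrightarrow> wt Q f \<and> wt Q g"
| "wt Q (TSwap xs ys) \<longleftrightarrow> xs \<in> lists (types Q) \<and> ys \<in> lists (types Q)"
| "wt Q (TCopy xs) \<longleftrightarrow> xs \<in> lists (types Q)"
| "wt Q (TDisc xs) \<longleftrightarrow> xs \<in> lists (types Q)"

text \<open>
  The least congruence on well-typed terms containing the axioms of a Markov category whose
  objects form the free monoid of lists.
\<close>

inductive teq :: "('t, 'g) signature \<Rightarrow> ('t, 'g) trm \<Rightarrow> ('t, 'g) trm \<Rightarrow> bool" for Q where
  refl: "wt Q t \<Longrightarrow> teq Q t t"
| sym: "teq Q s t \<Longrightarrow> teq Q t s"
| trans: "\<lbrakk>teq Q s t; teq Q t u\<rbrakk> \<Longrightarrow> teq Q s u"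
| cong_cmp: "\<lbrakk>teq Q g g'; teq Q f f'; tsrc Q g = ttgt Q f\<rbrakk> \<Longrightarrow> teq Q (TCmp g f) (TCmp g' f')"
| cong_ten: "\<lbrakk>teq Q f f'; teq Q g g'\<rbrakk> \<Longrightarrow> teq Q (TTen f g) (TTen f' g')"
| id_left: "wt Q f \<Longrightarrow> teq Q (TCmp (TId (ttgt Q f)) f) f"
| id_right: "wt Q f \<Longrightarrow> teq Q (TCmp f (TId (tsrc Q f))) f"
| cmp_assoc: "wt Q (TCmp h (TCmp g f)) \<Longrightarrow> teq Q (TCmp (TCmp h g) f) (TCmp h (TCmp g f))"
| ten_id: "\<lbrakk>xs \<in> lists (types Q); ys \<in> lists (types Q)\<rbrakk>
     \<Longrightarrow> teq Q (TTen (TId xs) (TId ys)) (TId (xs @ ys))"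
| ten_cmp: "\<lbrakk>wt Q (TCmp g f); wt Q (TCmp g' f')\<rbrakk>
     \<Longrightarrow> teq Q (TTen (TCmp g f) (TCmp g' f')) (TCmp (TTen g g') (TTen f f'))"
| ten_assoc: "\<lbrakk>wt Q f; wt Q g; wt Q h\<rbrakk> \<Longrightarrow> teq Q (TTen (TTen f g) h) (TTen f (TTen g h))"
| ten_unit_left: "wt Q f \<Longrightarrow> teq Q (TTen (TId []) f) f"
| ten_unit_right: "wt Q f \<Longrightarrow> teq Q (TTen f (TId [])) f"
| swap_natural: "\<lbrakk>wt Q f; wt Q g\<rbrakk>
     \<Longrightarrow> teq Q (TCmp (TSwap (ttgt Q f) (ttgt Q g)) (TTen f g))
               (TCmp (TTen g f) (TSwap (tsrc Q f) (tsrc Q g)))"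
| swap_swap: "\<lbrakk>xs \<in> lists (types Q); ys \<in> lists (types Q)\<rbrakk>
     \<Longrightarrow> teq Q (TCmp (TSwap ys xs) (TSwap xs ys)) (TId (xs @ ys))"
| hexagon: "\<lbrakk>xs \<in> lists (types Q); ys \<in> lists (types Q); zs \<in> lists (types Q)\<rbrakk>
     \<Longrightarrow> teq Q (TSwap xs (ys @ zs))
               (TCmp (TTen (TId ys) (TSwap xs zs)) (TTen (TSwap xs ys) (TId zs)))"
| disc_natural: "wt Q f \<Longrightarrow> teq Q (TCmp (TDisc (ttgt Q f)) f) (TDisc (tsrc Q f))"
| disc_unit: "teq Q (TDisc []) (TId [])"
| copy_assoc: "xs \<in> lists (types Q)
     \<Longrightarrow> teq Q (TCmp (TTen (TCopy xs) (TId xs)) (TCopy xs)) (TCmp (TTen (TId xs) (TCopy xs)) (TCopy xs))"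
| copy_counit: "xs \<in> lists (types Q)
     \<Longrightarrow> teq Q (TCmp (TTen (TDisc xs) (TId xs)) (TCopy xs)) (TId xs)"
| copy_commute: "xs \<in> lists (types Q) \<Longrightarrow> teq Q (TCmp (TSwap xs xs) (TCopy xs)) (TCopy xs)"
| copy_tensor: "\<lbrakk>xs \<in> lists (types Q); ys \<in> lists (types Q)\<rbrakk>
     \<Longrightarrow> teq Q (TCopy (xs @ ys))
               (TCmp (TTen (TId xs) (TTen (TSwap xs ys) (TId ys))) (TTen (TCopy xs) (TCopy ys)))"

definition tclass :: "('t, 'g) signature \<Rightarrow> ('t, 'g) trm \<Rightarrow> ('t, 'g) trm set" where
  "tclass Q t = {u. teq Q t u}"

definition trep :: "('t, 'g) trm set \<Rightarrow> ('t, 'g) trm" where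
  "trep c = (SOME t. t \<in> c)"

definition free_markov :: "('t, 'g) signature \<Rightarrow> ('t list, ('t, 'g) trm set) mcat" where
  "free_markov Q =
     \<lparr> Ob = lists (types Q),
       Ar = tclass Q ` {t. wt Q t},
       Src = (\<lambda>c. tsrc Q (trep c)),
       Tgt = (\<lambda>c. ttgt Q (trep c)),
       Ident = (\<lambda>xs. tclass Q (TId xs)),
       Cmp = (\<lambda>d c. tclass Q (TCmp (trep d) (trep c))),
       Unit = [],
       TenO = (@),
       TenA = (\<lambda>c d. tclass Q (TTen (trep c) (trep d))),
       Assoc = (\<lambda>xs ys zs. tclass Q (TId (xs @ ys @ zs))),
       Lunit = (\<lambda>xs. tclass Q (TId xs)),
       Runit = (\<lambda>xs. tclass Q (TId xs)),
       Swap = (\<lambda>xs ys. tclass Q (TSwap xs ys)),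
       Copy = (\<lambda>xs. tclass Q (TCopy xs)),
       Disc = (\<lambda>xs. tclass Q (TDisc xs)) \<rparr>"

definition query :: "('t, 'g) signature \<Rightarrow> 'g \<Rightarrow> ('t, 'g) trm set" where
  "query Q q = tclass Q (TGen q)"

primrec perm_term :: "('t, 'g) trm \<Rightarrow> bool" where
  "perm_term (TId xs) \<longleftrightarrow> True"
| "perm_term (TGen q) \<longleftrightarrow> False"
| "perm_term (TCmp g f) \<longleftrightarrow> perm_term g \<and> perm_term f"
| "perm_term (TTen f g) \<longleftrightarrow> perm_term f \<and> perm_term g"
| "perm_term (TSwap xs ys) \<longleftrightarrow> True"
| "perm_term (TCopy xs) \<longleftrightarrow> False"
| "perm_term (TDisc xs) \<longleftrightarrow> False"

definition perms :: "('t, 'g) signature \<Rightarrow> 't list \<Rightarrow> 't list \<Rightarrow> ('t, 'g) trm set set" where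
  "perms Q xs ys = {tclass Q t | t. wt Q t \<and> perm_term t \<and> tsrc Q t = xs \<and> ttgt Q t = ys}"

text \<open>
  The functor freely extending an interpretation of types as objects of \<open>C\<close> and of generators as
  morphisms of \<open>C\<close> (given in \<open>strictify C\<close>, that is, together with their lists of input and output
  objects).
\<close>

primrec interp ::
  "('o, 'm) mcat \<Rightarrow> ('t \<Rightarrow> 'o) \<Rightarrow> ('g \<Rightarrow> 'o list \<times> 'm \<times> 'o list) \<Rightarrow> ('t, 'g) trm
     \<Rightarrow> 'o list \<times> 'm \<times> 'o list" where
  "interp C ob g (TId xs) = Ident (strictify C) (map ob xs)"
| "interp C ob g (TGen q) = g q"
| "interp C ob g (TCmp t s) = interp C ob g t \<cdot>\<^bsub>strictify C\<^esub> interp C ob g s"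
| "interp C ob g (TTen s t) = interp C ob g s \<otimes>\<^bsub>strictify C\<^esub> interp C ob g t"
| "interp C ob g (TSwap xs ys) = Swap (strictify C) (map ob xs) (map ob ys)"
| "interp C ob g (TCopy xs) = Copy (strictify C) (map ob xs)"
| "interp C ob g (TDisc xs) = Disc (strictify C) (map ob xs)"

definition free_extension ::
  "('o, 'm) mcat \<Rightarrow> ('t \<Rightarrow> 'o) \<Rightarrow> ('g \<Rightarrow> 'o list \<times> 'm \<times> 'o list)
     \<Rightarrow> ('t list, ('t, 'g) trm set, 'o, 'm) mfunctor" where
  "free_extension C ob g =
     \<lparr> fob = (\<lambda>xs. tlist C (map ob xs)),
       far = (\<lambda>c. underlying (interp C ob g (trep c))),
       lax = (\<lambda>xs ys. join C (map ob xs) (map ob ys)),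
       unt = Ident C (Unit C) \<rparr>"

definition query_model ::
  "('t, 'g) signature \<Rightarrow> ('o, 'm) mcat \<Rightarrow> ('t list, ('t, 'g) trm set, 'o, 'm) mfunctor \<Rightarrow> bool" where
  "query_model Q C F \<longleftrightarrow> markov_functor (free_markov Q) C F"


section \<open>Downward abstractions\<close>

text \<open>
  The comparison \<open>F [t1] \<odot> \<dots> \<odot> F [tn] \<rightarrow> F [t1, \<dots>, tn]\<close> for a functor between free Markov
  categories, obtained by iterating its structure morphisms.
\<close>

primrec comparison ::
  "('s, 'h) signature
     \<Rightarrow> ('t list, ('t, 'g) trm set, 's list, ('s, 'h) trm set) mfunctor \<Rightarrow> 't list \<Rightarrow> ('s, 'h) trm set" where
  "comparison Q F [] = unt F"
| "comparison Q F (t # ts) =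
     lax F [t] ts \<cdot>\<^bsub>free_markov Q\<^esub> (Ident (free_markov Q) (fob F [t]) \<otimes>\<^bsub>free_markov Q\<^esub> comparison Q F ts)"

definition concat_image ::
  "('t list, ('t, 'g) trm set, 's list, ('s, 'h) trm set) mfunctor \<Rightarrow> 't list \<Rightarrow> 's list" where
  "concat_image F ts = concat (map (\<lambda>t. fob F [t]) ts)"

text \<open>
  A query is sent to a query up to the structure isomorphisms of \<open>\<pi>\<close> and up to reordering its lists
  of inputs and outputs.
\<close>

definition sends_queries_to_queries ::
  "('s, 'h) signature \<Rightarrow> ('t, 'g) signature
     \<Rightarrow> ('t list, ('t, 'g) trm set, 's list, ('s, 'h) trm set) mfunctor \<Rightarrow> bool" where
  "sends_queries_to_queries QL QH \<pi> \<longleftrightarrow>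
     (\<forall>q \<in> gens QH. \<exists>q' \<in> gens QL.
        \<exists>p \<in> perms QL (gsrc QL q') (concat_image \<pi> (gsrc QH q)).
        \<exists>p' \<in> perms QL (gtgt QL q') (concat_image \<pi> (gtgt QH q)).
          far \<pi> (query QH q) \<cdot>\<^bsub>free_markov QL\<^esub> comparison QL \<pi> (gsrc QH q) \<cdot>\<^bsub>free_markov QL\<^esub> p =
          comparison QL \<pi> (gtgt QH q) \<cdot>\<^bsub>free_markov QL\<^esub> p' \<cdot>\<^bsub>free_markov QL\<^esub> query QL q')"

definition downward_abstraction ::
  "('o, 'm) mcat \<Rightarrow>
   ('s, 'h) signature \<Rightarrow> ('s list, ('s, 'h) trm set, 'o, 'm) mfunctor \<Rightarrow>
   ('t, 'g) signature \<Rightarrow> ('t list, ('t, 'g) trm set, 'o, 'm) mfunctor \<Rightarrow>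
   ('t list, ('t, 'g) trm set, 's list, ('s, 'h) trm set) mfunctor \<Rightarrow> ('t list \<Rightarrow> 'm) \<Rightarrow> bool" where
  "downward_abstraction C QL FL QH FH \<pi> \<tau> \<longleftrightarrow>
     query_model QL C FL \<and> query_model QH C FH \<and>
     markov_functor (free_markov QH) (free_markov QL) \<pi> \<and>
     sends_queries_to_queries QL QH \<pi> \<and>
     markov_transformation (free_markov QH) C (functor_comp C FL \<pi>) FH \<tau> \<and>
     (\<forall>xs \<in> Ob (free_markov QH). epic C (\<tau> xs))"


section \<open>Causal models\<close>

text \<open>A fixed enumeration of a finite set, used when a set of variables has to be read as a list.\<close>

definition list_of :: "'a set \<Rightarrow> 'a list" where
  "list_of A = (SOME xs. distinct xs \<and> set xs = A)"

record 'v open_dag =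
  verts :: "'v set"
  edges :: "('v \<times> 'v) set"
  ins :: "'v set"

definition parents :: "('v, 'z) open_dag_scheme \<Rightarrow> 'v \<Rightarrow> 'v set" where
  "parents G x = {y. (y, x) \<in> edges G}"

definition nins :: "('v, 'z) open_dag_scheme \<Rightarrow> 'v set" where
  "nins G = verts G - ins G"

definition open_dag :: "('v, 'z) open_dag_scheme \<Rightarrow> bool" where
  "open_dag G \<longleftrightarrow> finite (verts G) \<and> edges G \<subseteq> verts G \<times> verts G \<and> acyclic (edges G) \<and>
     ins G \<subseteq> verts G \<and> (\<forall>x \<in> ins G. parents G x = {})"

record ('v, 'o, 'm) causal_model = "'v open_dag" +
  val :: "'v \<Rightarrow> 'o"
  mech :: "'v \<Rightarrow> 'm"
  outs :: "'v set"

definition causal_model :: "('o, 'm) mcat \<Rightarrow> ('v, 'o, 'm) causal_model \<Rightarrow> bool" where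
  "causal_model C M \<longleftrightarrow> open_dag M \<and> (\<forall>x \<in> verts M. val M x \<in> Ob C) \<and>
     (\<forall>x \<in> nins M. mech M x \<in> hom C (tlist C (map (val M) (list_of (parents M x)))) (val M x)) \<and>
     outs M \<subseteq> verts M"

definition ancestors :: "('v, 'o, 'm) causal_model \<Rightarrow> 'v set \<Rightarrow> 'v set" where
  "ancestors M S = {x \<in> nins M. \<exists>y \<in> S. (x, y) \<in> (edges M)\<^sup>*}"

definition topological_order :: "('v, 'o, 'm) causal_model \<Rightarrow> 'v set \<Rightarrow> 'v list" where
  "topological_order M A =
     (SOME xs. distinct xs \<and> set xs = A \<and> sorted_wrt (\<lambda>x y. (y, x) \<notin> edges M) xs)"

abbreviation wireM :: "('o, 'm) mcat \<Rightarrow> ('v, 'o, 'm) causal_model \<Rightarrow> 'v list \<Rightarrow> 'v list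
     \<Rightarrow> 'o list \<times> 'm \<times> 'o list" where
  "wireM C M \<equiv> wire (strictify C) (\<lambda>x. [val M x])"

text \<open>
  \<open>run C M cs xs\<close> applies the mechanisms of \<open>xs\<close> in turn to a diagram with open wires \<open>cs\<close>: the
  wires of the parents are copied, and the new variable is appended to the open wires.
\<close>

primrec run :: "('o, 'm) mcat \<Rightarrow> ('v, 'o, 'm) causal_model \<Rightarrow> 'v list \<Rightarrow> 'v list
     \<Rightarrow> 'o list \<times> 'm \<times> 'o list" where
  "run C M cs [] = Ident (strictify C) (map (val M) cs)"
| "run C M cs (x # xs) =
     run C M (cs @ [x]) xs \<cdot>\<^bsub>strictify C\<^esub>
     (Ident (strictify C) (map (val M) cs) \<otimes>\<^bsub>strictify C\<^esub>
        ((map (val M) (list_of (parents M x)), mech M x, [val M x])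
           \<cdot>\<^bsub>strictify C\<^esub> wireM C M cs (list_of (parents M x)))) \<cdot>\<^bsub>strictify C\<^esub>
     Copy (strictify C) (map (val M) cs)"

text \<open>
  The channel \<open>M\<^sup>O\<close>; the enumerations \<open>is\<close> of the inputs and \<open>os\<close> of \<open>O\<close> are explicit.  By the
  comonoid laws the result does not depend on the topological order in which the boxes are drawn.
\<close>

definition channel :: "('o, 'm) mcat \<Rightarrow> ('v, 'o, 'm) causal_model \<Rightarrow> 'v list \<Rightarrow> 'v list
     \<Rightarrow> 'o list \<times> 'm \<times> 'o list" where
  "channel C M is os =
     (let xs = topological_order M (ancestors M (set os))
      in wireM C M (is @ xs) os \<cdot>\<^bsub>strictify C\<^esub> run C M is xs)"

definition do_model :: "('v, 'o, 'm) causal_model \<Rightarrow> 'v set \<Rightarrow> ('v, 'o, 'm) causal_model" where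
  "do_model M S = M \<lparr> edges := {(x, y) \<in> edges M. y \<notin> S}, ins := ins M \<union> S \<rparr>"

definition interchange_channel ::
  "('o, 'm) mcat \<Rightarrow> ('v, 'o, 'm) causal_model \<Rightarrow> 'v set list \<Rightarrow> 'v set \<Rightarrow> 'o list \<times> 'm \<times> 'o list" where
  "interchange_channel C M Ss A =
     channel C (do_model M (\<Union>(set Ss))) (list_of (ins M) @ concat (map list_of Ss)) (list_of A)
     \<cdot>\<^bsub>strictify C\<^esub>
     (Ident (strictify C) (map (val M) (list_of (ins M))) \<otimes>\<^bsub>strictify C\<^esub>
        list_tensor_ar (strictify C) (map (\<lambda>S. channel C M (list_of (ins M)) (list_of S)) Ss))"

text \<open>Disjointness is required of the indexed family, so the empty set may occur repeatedly.\<close>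

definition intervention_sets :: "('v, 'o, 'm) causal_model \<Rightarrow> 'v set list \<Rightarrow> bool" where
  "intervention_sets M Ss \<longleftrightarrow>
     (\<forall>S \<in> set Ss. S \<subseteq> nins M) \<and> disjoint_family_on (\<lambda>i. Ss ! i) {..<length Ss}"

definition int_signature ::
  "('v, 'o, 'm) causal_model \<Rightarrow> ('v, 'v set list \<times> 'v set) signature" where
  "int_signature M =
     \<lparr> types = verts M,
       gens = {(Ss, A). intervention_sets M Ss \<and> A \<subseteq> outs M},
       gsrc = (\<lambda>(Ss, A). concat (replicate (length Ss + 1) (list_of (ins M)))),
       gtgt = (\<lambda>(Ss, A). list_of A) \<rparr>"

definition int_model ::
  "('o, 'm) mcat \<Rightarrow> ('v, 'o, 'm) causal_model
     \<Rightarrow> ('v list, ('v, 'v set list \<times> 'v set) trm set, 'o, 'm) mfunctor" where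
  "int_model C M = free_extension C (val M) (\<lambda>(Ss, A). interchange_channel C M Ss A)"


section \<open>Interchange abstractions\<close>

definition image_set :: "('u \<Rightarrow> 'v set) \<Rightarrow> 'u set \<Rightarrow> 'v set" where
  "image_set \<pi> S = (\<Union>X \<in> S. \<pi> X)"

text \<open>
  \<open>tau_list\<close> is the tensor product of the \<open>\<tau>\<^sub>X\<close> along a list; for \<open>\<tau>\<^sub>S\<close> the input \<open>\<pi>(S)\<close>, read as
  one list, is first reordered into the concatenation of the lists \<open>\<pi>(X)\<close>, \<open>X \<in> S\<close>.
\<close>

definition tau_list ::
  "('o, 'm) mcat \<Rightarrow> ('v, 'o, 'm) causal_model \<Rightarrow> ('u, 'o, 'm) causal_model
     \<Rightarrow> ('u \<Rightarrow> 'v set) \<Rightarrow> ('u \<Rightarrow> 'm) \<Rightarrow> 'u list \<Rightarrow> 'o list \<times> 'm \<times> 'o list" where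
  "tau_list C L H \<pi> \<tau> xs =
     list_tensor_ar (strictify C) (map (\<lambda>X. (map (val L) (list_of (\<pi> X)), \<tau> X, [val H X])) xs)"

definition tau_set ::
  "('o, 'm) mcat \<Rightarrow> ('v, 'o, 'm) causal_model \<Rightarrow> ('u, 'o, 'm) causal_model
     \<Rightarrow> ('u \<Rightarrow> 'v set) \<Rightarrow> ('u \<Rightarrow> 'm) \<Rightarrow> 'u set \<Rightarrow> 'o list \<times> 'm \<times> 'o list" where
  "tau_set C L H \<pi> \<tau> S =
     tau_list C L H \<pi> \<tau> (list_of S) \<cdot>\<^bsub>strictify C\<^esub>
     wireM C L (list_of (image_set \<pi> S)) (concat (map (\<lambda>X. list_of (\<pi> X)) (list_of S)))"

definition variable_alignment ::
  "('o, 'm) mcat \<Rightarrow> ('v, 'o, 'm) causal_model \<Rightarrow> ('u, 'o, 'm) causal_model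
     \<Rightarrow> ('u \<Rightarrow> 'v set) \<Rightarrow> ('u \<Rightarrow> 'm) \<Rightarrow> bool" where
  "variable_alignment C L H \<pi> \<tau> \<longleftrightarrow>
     \<pi> \<in> extensional (verts H) \<and> \<tau> \<in> extensional (verts H) \<and>
     (\<forall>X \<in> verts H. \<pi> X \<subseteq> verts L) \<and>
     disjoint_family_on \<pi> (verts H) \<and>
     image_set \<pi> (ins H) = ins L \<and>
     image_set \<pi> (outs H) \<subseteq> outs L \<and>
     (\<forall>X \<in> verts H. \<tau> X \<in> hom C (tlist C (map (val L) (list_of (\<pi> X)))) (val H X) \<and>
        epic C (\<tau> X) \<and> deterministic C (\<tau> X)) \<and>
     (\<forall>xs \<in> lists (verts H). epic C (underlying (tau_list C L H \<pi> \<tau> xs)))"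

definition interchange_abstraction ::
  "('o, 'm) mcat \<Rightarrow> ('v, 'o, 'm) causal_model \<Rightarrow> ('u, 'o, 'm) causal_model
     \<Rightarrow> ('u \<Rightarrow> 'v set) \<Rightarrow> ('u \<Rightarrow> 'm) \<Rightarrow> bool" where
  "interchange_abstraction C L H \<pi> \<tau> \<longleftrightarrow>
     variable_alignment C L H \<pi> \<tau> \<and>
     (\<forall>Ss. intervention_sets H Ss \<longrightarrow>
        tau_set C L H \<pi> \<tau> (outs H) \<cdot>\<^bsub>strictify C\<^esub>
          interchange_channel C L (map (image_set \<pi>) Ss) (image_set \<pi> (outs H)) =
        interchange_channel C H Ss (outs H) \<cdot>\<^bsub>strictify C\<^esub>
          list_tensor_ar (strictify C) (replicate (length Ss + 1) (tau_set C L H \<pi> \<tau> (ins H))))"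


section \<open>Downward abstractions of interchange queries\<close>

type_synonym ('u, 'v) int_functor =
  "('u list, ('u, 'u set list \<times> 'u set) trm set, 'v list, ('v, 'v set list \<times> 'v set) trm set) mfunctor"

definition var_set :: "('u, 'v) int_functor \<Rightarrow> 'u set \<Rightarrow> 'v set" where
  "var_set \<pi> S = image_set (\<lambda>X. set (fob \<pi> [X])) S"

abbreviation wireQ :: "('v, 'o, 'm) causal_model \<Rightarrow> 'v list \<Rightarrow> 'v list
     \<Rightarrow> ('v, 'v set list \<times> 'v set) trm set" where
  "wireQ M \<equiv> wire (free_markov (int_signature M)) (\<lambda>x. [x])"

definition maps_variables :: "('v, 'o, 'm) causal_model \<Rightarrow> ('u, 'o, 'm) causal_model
     \<Rightarrow> ('u, 'v) int_functor \<Rightarrow> bool" where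
  "maps_variables L H \<pi> \<longleftrightarrow>
     distinct (concat_image \<pi> (list_of (ins H))) \<and>
     set (concat_image \<pi> (list_of (ins H))) = ins L \<and>
     distinct (concat_image \<pi> (list_of (nins H))) \<and>
     set (concat_image \<pi> (list_of (nins H))) \<subseteq> nins L"

text \<open>
  \<open>\<pi> (Int(S\<^sub>1,\<dots>,S\<^sub>n) \<rightarrow> A) = (Int(\<pi>(S\<^sub>1),\<dots>,\<pi>(S\<^sub>n)) \<rightarrow> \<pi>(A))\<close>, where the sources and targets of both
  sides are identified along the structure isomorphisms of \<open>\<pi>\<close> and the permutations reordering
  \<open>list_of (\<pi>(S))\<close> into the concatenation of the lists \<open>\<pi>(X)\<close>, \<open>X \<in> S\<close>.
\<close>

definition maps_queries :: "('v, 'o, 'm) causal_model \<Rightarrow> ('u, 'o, 'm) causal_model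
     \<Rightarrow> ('u, 'v) int_functor \<Rightarrow> bool" where
  "maps_queries L H \<pi> \<longleftrightarrow>
     (let QL = int_signature L; QH = int_signature H; K = free_markov QL in
      \<forall>Ss A. intervention_sets H Ss \<and> A \<subseteq> outs H \<longrightarrow>
        (map (var_set \<pi>) Ss, var_set \<pi> A) \<in> gens QL \<and>
        far \<pi> (query QH (Ss, A)) \<cdot>\<^bsub>K\<^esub> comparison QL \<pi> (gsrc QH (Ss, A)) \<cdot>\<^bsub>K\<^esub>
          list_tensor_ar K (replicate (length Ss + 1)
            (wireQ L (list_of (ins L)) (concat_image \<pi> (list_of (ins H))))) =
        comparison QL \<pi> (list_of A) \<cdot>\<^bsub>K\<^esub>
          wireQ L (list_of (var_set \<pi> A)) (concat_image \<pi> (list_of A)) \<cdot>\<^bsub>K\<^esub>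
          query QL (map (var_set \<pi>) Ss, var_set \<pi> A))"

definition downward_int_abstractions ::
  "('o, 'm) mcat \<Rightarrow> ('v, 'o, 'm) causal_model \<Rightarrow> ('u, 'o, 'm) causal_model
     \<Rightarrow> (('u, 'v) int_functor \<times> ('u list \<Rightarrow> 'm)) set" where
  "downward_int_abstractions C L H =
     {(\<pi>, \<tau>). downward_abstraction C (int_signature L) (int_model C L) (int_signature H) (int_model C H) \<pi> \<tau>
        \<and> maps_variables L H \<pi> \<and> maps_queries L H \<pi>}"

text \<open>
  Lists of distinct variables are taken up to permutation, and functors are strong rather than
  strict; accordingly, two downward abstractions are the same if they are related by a monoidal
  natural isomorphism whose components at single variables permute the lists \<open>\<pi>(X)\<close>.
\<close>

definition same_abstraction ::
  "('o, 'm) mcat \<Rightarrow> ('v, 'o, 'm) causal_model \<Rightarrow> ('u, 'o, 'm) causal_model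
     \<Rightarrow> ((('u, 'v) int_functor \<times> ('u list \<Rightarrow> 'm)) \<times> (('u, 'v) int_functor \<times> ('u list \<Rightarrow> 'm))) set" where
  "same_abstraction C L H =
     {((\<pi>, \<tau>), (\<pi>', \<tau>')).
        (\<pi>, \<tau>) \<in> downward_int_abstractions C L H \<and> (\<pi>', \<tau>') \<in> downward_int_abstractions C L H \<and>
        (\<exists>\<alpha>. markov_transformation (free_markov (int_signature H)) (free_markov (int_signature L)) \<pi> \<pi>' \<alpha> \<and>
           (\<forall>xs \<in> lists (verts H). iso (free_markov (int_signature L)) (\<alpha> xs)) \<and>
           (\<forall>X \<in> verts H. \<alpha> [X] \<in> perms (int_signature L) (fob \<pi> [X]) (fob \<pi>' [X])) \<and>
           (\<forall>xs \<in> lists (verts H). \<tau>' xs \<cdot>\<^bsub>C\<^esub> far (int_model C L) (\<alpha> xs) = \<tau> xs))}"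

text \<open>
  Restriction to variables: \<open>\<pi>(X)\<close> is read as a set, and \<open>\<tau>\<^sub>X\<close> is transported along the
  reordering of \<open>list_of (\<pi>(X))\<close> into \<open>\<pi>(X)\<close>.
\<close>

definition restrict_to_variables ::
  "('o, 'm) mcat \<Rightarrow> ('v, 'o, 'm) causal_model \<Rightarrow> ('u, 'o, 'm) causal_model
     \<Rightarrow> ('u, 'v) int_functor \<times> ('u list \<Rightarrow> 'm) \<Rightarrow> ('u \<Rightarrow> 'v set) \<times> ('u \<Rightarrow> 'm)" where
  "restrict_to_variables C L H = (\<lambda>(\<pi>, \<tau>).
     (\<lambda>X \<in> verts H. set (fob \<pi> [X]),
      \<lambda>X \<in> verts H. \<tau> [X] \<cdot>\<^bsub>C\<^esub>
        far (int_model C L) (wireQ L (list_of (set (fob \<pi> [X]))) (fob \<pi> [X]))))"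

end

theory Submission
  imports Defs "HOL-Library.Multiset"
begin

text \<open>
  Every functor \<open>\<pi>\<close> between free Markov categories is isomorphic, through its comparison isomorphisms,
  to a strict one, which is determined by its values on single variables and on queries; by
  monoidality \<open>\<tau>\<close> is likewise determined by its components at single variables.  On queries the value
  of \<open>\<pi>\<close> is prescribed, and a permutation morphism between lists of distinct variables is unique
  because it is the wiring diagram connecting equal names.  Hence two downward abstractions are the
  same iff they have the same restriction.  Conversely, naturality of the tensor products of the
  \<open>\<tau>\<^sub>X\<close> needs to be checked on queries only, and for the outputs \<open>A\<close> it follows from
  the equation for all outputs by marginalization: discarding variables of a causal model, or
  choosing another topological order of its boxes, does not change the channel.  All computations
  take place in the strictification of \<open>C\<close>, whose Markov category axioms come from the coherence of
  \<open>join\<close>.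
\<close>

section \<open>Coherence in symmetric monoidal categories\<close>

text \<open>The recurring obstacle is order: \<open>list_of\<close> enumerates each set arbitrarily,
  so the list of \<open>\<pi>(S)\<close> and the concatenation of the lists of its members agree
  only up to a permutation. Permutations, copies and discards are therefore treated together as
  diagrams \<open>wire\<close> indexed by names. Their composition law \<open>wire_wire\<close>
  replaces coherence arguments, and distinctness of the names turns \<open>wire K ob xs xs\<close>
  into an identity. The law rests on the fact that precomposition with a deterministic morphism
  distributes over pairings. Mechanisms need not be deterministic, so channels are not governed by
  such a law; exchanging boxes is instead reduced to two adjacent boxes that both read the same old
  wires. Determinism of the \<open>\<tau>\<^sub>X\<close> enters for the same reason: it lets them
  slide through copies, both when naturality is extended from queries to all morphisms and when
  outputs are marginalized. The strictification and the free categories are instances of one locale,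
  \<open>strict_markov\<close>, so models and functors between free categories arise from the same
  recursion \<open>interp_in\<close>.\<close>

lemma in_hom_iff: "f \<in> hom C a b \<longleftrightarrow> f \<in> Ar C \<and> Src C f = a \<and> Tgt C f = b"
  by (auto simp: hom_def)

section \<open>Typed composition, isomorphisms and epimorphisms\<close>

context category
begin

lemma src_tgt_Ob [simp]:
  "f \<in> Ar C \<Longrightarrow> Src C f \<in> Ob C" "f \<in> Ar C \<Longrightarrow> Tgt C f \<in> Ob C"
  by (auto intro: src_Ob tgt_Ob)

lemma ident_typing [simp]:
  assumes "a \<in> Ob C"
  shows "Ident C a \<in> Ar C" "Src C (Ident C a) = a" "Tgt C (Ident C a) = a"
  using ident_hom[OF assms] by (auto simp: in_hom_iff)

lemma cmp_typing [simp]: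
  assumes "f \<in> Ar C" "g \<in> Ar C" "Src C g = Tgt C f"
  shows "g \<cdot> f \<in> Ar C" "Src C (g \<cdot> f) = Src C f" "Tgt C (g \<cdot> f) = Tgt C g"
  using cmp_hom[of f "Src C f" "Tgt C f" g "Tgt C g"] assms by (auto simp: in_hom_iff)

lemma ident_cmp [simp]: "\<lbrakk>f \<in> Ar C; Tgt C f = b\<rbrakk> \<Longrightarrow> Ident C b \<cdot> f = f"
  by (rule cmp_ident_left) (auto simp: in_hom_iff)

lemma cmp_ident [simp]: "\<lbrakk>f \<in> Ar C; Src C f = a\<rbrakk> \<Longrightarrow> f \<cdot> Ident C a = f"
  by (rule cmp_ident_right) (auto simp: in_hom_iff)

lemma cmp_cmp [simp]:
  "\<lbrakk>f \<in> Ar C; g \<in> Ar C; h \<in> Ar C; Src C g = Tgt C f; Src C h = Tgt C g\<rbrakk>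
    \<Longrightarrow> (h \<cdot> g) \<cdot> f = h \<cdot> (g \<cdot> f)"
  by (rule cmp_assoc) (auto simp: in_hom_iff)

text \<open>Composites are kept nested to the right by \<open>cmp_cmp\<close>, so
  \<open>g \<cdot> f\<close> is not a subterm of \<open>g \<cdot> f \<cdot> k\<close>; this form
  makes an equation for the former applicable in the latter.\<close>

lemma cmp_extend:
  "\<lbrakk>g \<cdot> f = h; f \<in> Ar C; g \<in> Ar C; Src C g = Tgt C f; k \<in> Ar C; Tgt C k = Src C f\<rbrakk>
    \<Longrightarrow> g \<cdot> f \<cdot> k = h \<cdot> k"
  using cmp_cmp[of k f g] by simp

lemma inverse_of_eq: "inverse_arrows C f g \<Longrightarrow> inverse_of C f = g"
  unfolding inverse_of_def
proof (rule the_equality)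
  fix g' assume "inverse_arrows C f g" "inverse_arrows C f g'"
  then show "g' = g"
    unfolding inverse_arrows_def in_hom_iff by (metis cmp_cmp cmp_ident ident_cmp)
qed

lemma iso_Ar [simp]: "iso C f \<Longrightarrow> f \<in> Ar C"
  by (auto simp: iso_def inverse_arrows_def)

lemma inverse_arrows_inverse_of: "iso C f \<Longrightarrow> inverse_arrows C f (inverse_of C f)"
  using inverse_of_eq by (auto simp: iso_def)

lemma inverse_of_simps [simp]:
  assumes "iso C f"
  shows "inverse_of C f \<in> Ar C" "Src C (inverse_of C f) = Tgt C f" "Tgt C (inverse_of C f) = Src C f"
    "inverse_of C f \<cdot> f = Ident C (Src C f)" "f \<cdot> inverse_of C f = Ident C (Tgt C f)"
    "\<lbrakk>h \<in> Ar C; Tgt C h = Src C f\<rbrakk> \<Longrightarrow> inverse_of C f \<cdot> f \<cdot> h = h"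
    "\<lbrakk>h \<in> Ar C; Tgt C h = Tgt C f\<rbrakk> \<Longrightarrow> f \<cdot> inverse_of C f \<cdot> h = h"
proof -
  note * = inverse_arrows_inverse_of[OF assms, unfolded inverse_arrows_def in_hom_iff]
  show A: "inverse_of C f \<in> Ar C" "Src C (inverse_of C f) = Tgt C f"
    "Tgt C (inverse_of C f) = Src C f"
    "inverse_of C f \<cdot> f = Ident C (Src C f)" "f \<cdot> inverse_of C f = Ident C (Tgt C f)"
    using * by auto
  show "inverse_of C f \<cdot> f \<cdot> h = h" if "h \<in> Ar C" "Tgt C h = Src C f"
    using cmp_cmp[of h f "inverse_of C f"] that A assms by simp
  show "f \<cdot> inverse_of C f \<cdot> h = h" if "h \<in> Ar C" "Tgt C h = Tgt C f"
    using cmp_cmp[of h "inverse_of C f" f] that A assms by simp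
qed

lemma inverse_arrowsI:
  "\<lbrakk>f \<in> Ar C; g \<in> Ar C; Src C g = Tgt C f; Tgt C g = Src C f;
    g \<cdot> f = Ident C (Src C f); f \<cdot> g = Ident C (Tgt C f)\<rbrakk> \<Longrightarrow> inverse_arrows C f g"
  by (auto simp: inverse_arrows_def in_hom_iff)

lemma isoI: "inverse_arrows C f g \<Longrightarrow> iso C f"
  by (auto simp: iso_def)

lemma iso_ident [simp]: "a \<in> Ob C \<Longrightarrow> iso C (Ident C a)"
  by (rule isoI[where g = "Ident C a"]) (simp add: inverse_arrowsI)

lemma iso_inverse_of [simp]: "iso C f \<Longrightarrow> iso C (inverse_of C f)"
  by (rule isoI[where g = f]) (simp add: inverse_arrowsI)

lemma inverse_of_ident [simp]: "a \<in> Ob C \<Longrightarrow> inverse_of C (Ident C a) = Ident C a"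
  by (rule inverse_of_eq) (simp add: inverse_arrowsI)

lemma iso_cmp [simp]: "\<lbrakk>iso C f; iso C g; Src C g = Tgt C f\<rbrakk> \<Longrightarrow> iso C (g \<cdot> f)"
  by (rule isoI[where g = "inverse_of C f \<cdot> inverse_of C g"]) (simp add: inverse_arrowsI)

lemma iso_cancel_right:
  assumes "iso C f" "g \<cdot> f = h \<cdot> f" "g \<in> Ar C" "h \<in> Ar C" "Src C g = Tgt C f" "Src C h = Tgt C f"
  shows "g = h"
proof -
  have "(g \<cdot> f) \<cdot> inverse_of C f = (h \<cdot> f) \<cdot> inverse_of C f" using assms(2) by simp
  then show ?thesis using assms(1,3-) by simp
qed

lemma iso_cancel_left:
  assumes "iso C f" "f \<cdot> g = f \<cdot> h" "g \<in> Ar C" "h \<in> Ar C" "Tgt C g = Src C f" "Tgt C h = Src C f"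
  shows "g = h"
proof -
  have "inverse_of C f \<cdot> f \<cdot> g = inverse_of C f \<cdot> f \<cdot> h" using assms(2) by simp
  then show ?thesis using assms(1,3-) by simp
qed

text \<open>Used to transfer epicness of \<open>\<tau>\<close> along reorderings and comparison
  isomorphisms: first \<open>g\<close> is cancelled, then \<open>f\<close>.\<close>

lemma epic_cmp_iso:
  assumes "epic C f" "iso C g" "Tgt C g = Src C f"
  shows "epic C (f \<cdot> g)"
  unfolding epic_def
proof (intro conjI allI ballI impI)
  have f: "f \<in> Ar C" using assms by (simp add: epic_def)
  show "f \<cdot> g \<in> Ar C" using assms f by simp
  fix c h k
  assume "h \<in> hom C (Tgt C (f \<cdot> g)) c" "k \<in> hom C (Tgt C (f \<cdot> g)) c" and eq: "h \<cdot> f \<cdot> g = k \<cdot> f \<cdot> g"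
  then have h: "h \<in> hom C (Tgt C f) c" and k: "k \<in> hom C (Tgt C f) c"
    using f assms by (simp_all add: in_hom_iff)
  then have hk: "h \<in> Ar C" "Src C h = Tgt C f" "k \<in> Ar C" "Src C k = Tgt C f"
    by (simp_all add: in_hom_iff)
  have "(h \<cdot> f) \<cdot> g = (k \<cdot> f) \<cdot> g" using eq hk f assms(2,3) by simp
  then have "h \<cdot> f = k \<cdot> f"
    by (rule iso_cancel_right[OF assms(2)]) (use hk f assms(3) in simp_all)
  then show "h = k" using assms(1) h k unfolding epic_def by blast
qed

end

context symmetric_monoidal_category
begin

lemma ten_typing [simp]:
  assumes "f \<in> Ar C" "g \<in> Ar C"
  shows "f \<otimes> g \<in> Ar C" "Src C (f \<otimes> g) = Src C f \<odot> Src C g" "Tgt C (f \<otimes> g) = Tgt C f \<odot> Tgt C g"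
  using tenA_hom[of f "Src C f" "Tgt C f" g "Src C g" "Tgt C g"] assms by (auto simp: in_hom_iff)

lemmas Ob_simps [simp] = unit_Ob tenO_Ob
lemmas ten_ident [simp] = tenA_ident

text \<open>Oriented so that composites move inside tensor products. Together with
  \<open>cmp_cmp\<close> this gives a normal form; calculations that must keep the factors apart
  remove the rule locally.\<close>

lemma interchange [simp]:
  "\<lbrakk>f \<in> Ar C; g \<in> Ar C; f' \<in> Ar C; g' \<in> Ar C; Src C g = Tgt C f; Src C g' = Tgt C f'\<rbrakk>
    \<Longrightarrow> (g \<otimes> g') \<cdot> (f \<otimes> f') = (g \<cdot> f) \<otimes> (g' \<cdot> f')"
  by (rule tenA_cmp[symmetric]) (auto simp: in_hom_iff)

lemma interchange_cmp [simp]: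
  "\<lbrakk>f \<in> Ar C; g \<in> Ar C; f' \<in> Ar C; g' \<in> Ar C; Src C g = Tgt C f; Src C g' = Tgt C f';
    h \<in> Ar C; Tgt C h = Src C f \<odot> Src C f'\<rbrakk>
    \<Longrightarrow> (g \<otimes> g') \<cdot> (f \<otimes> f') \<cdot> h = ((g \<cdot> f) \<otimes> (g' \<cdot> f')) \<cdot> h"
  by (subst cmp_cmp[symmetric]) auto

lemma assoc_typing [simp]:
  assumes "a \<in> Ob C" "b \<in> Ob C" "c \<in> Ob C"
  shows "Assoc C a b c \<in> Ar C" "Src C (Assoc C a b c) = (a \<odot> b) \<odot> c"
    "Tgt C (Assoc C a b c) = a \<odot> (b \<odot> c)" "iso C (Assoc C a b c)"
  using assoc_hom[OF assms] assoc_iso[OF assms] by (auto simp: in_hom_iff)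

lemma unitor_typing [simp]:
  assumes "a \<in> Ob C"
  shows "Lunit C a \<in> Ar C" "Src C (Lunit C a) = Unit C \<odot> a" "Tgt C (Lunit C a) = a" "iso C (Lunit C a)"
    "Runit C a \<in> Ar C" "Src C (Runit C a) = a \<odot> Unit C" "Tgt C (Runit C a) = a" "iso C (Runit C a)"
  using lunit_hom[OF assms] lunit_iso[OF assms] runit_hom[OF assms] runit_iso[OF assms]
  by (auto simp: in_hom_iff)

lemma swap_typing [simp]:
  assumes "a \<in> Ob C" "b \<in> Ob C"
  shows "Swap C a b \<in> Ar C" "Src C (Swap C a b) = a \<odot> b" "Tgt C (Swap C a b) = b \<odot> a"
  using swap_hom[OF assms] by (auto simp: in_hom_iff)

lemma inverse_arrows_ten:
  "\<lbrakk>iso C f; iso C g\<rbrakk> \<Longrightarrow> inverse_arrows C (f \<otimes> g) (inverse_of C f \<otimes> inverse_of C g)"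
  by (rule inverse_arrowsI) simp_all

lemma iso_ten [simp]: "\<lbrakk>iso C f; iso C g\<rbrakk> \<Longrightarrow> iso C (f \<otimes> g)"
  by (rule isoI[OF inverse_arrows_ten])

lemma assoc_nat:
  "\<lbrakk>f \<in> Ar C; g \<in> Ar C; h \<in> Ar C; Tgt C f = a'; Tgt C g = b'; Tgt C h = c'\<rbrakk> \<Longrightarrow>
    Assoc C a' b' c' \<cdot> ((f \<otimes> g) \<otimes> h) = (f \<otimes> (g \<otimes> h)) \<cdot> Assoc C (Src C f) (Src C g) (Src C h)"
  by (rule assoc_natural) (auto simp: in_hom_iff)

lemma assoc_nat_cmp:
  assumes "f \<in> Ar C" "g \<in> Ar C" "h \<in> Ar C" "Tgt C f = a'" "Tgt C g = b'" "Tgt C h = c'"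
    "k \<in> Ar C" "Tgt C k = (Src C f \<odot> Src C g) \<odot> Src C h"
  shows "Assoc C a' b' c' \<cdot> ((f \<otimes> g) \<otimes> h) \<cdot> k = (f \<otimes> (g \<otimes> h)) \<cdot> Assoc C (Src C f) (Src C g) (Src C h) \<cdot> k"
proof -
  have "(Assoc C a' b' c' \<cdot> ((f \<otimes> g) \<otimes> h)) \<cdot> k
      = ((f \<otimes> (g \<otimes> h)) \<cdot> Assoc C (Src C f) (Src C g) (Src C h)) \<cdot> k"
    using assms by (simp only: assoc_nat)
  then show ?thesis using assms by (auto simp del: interchange)
qed

lemma lunit_nat:
  "\<lbrakk>f \<in> Ar C; Tgt C f = b\<rbrakk> \<Longrightarrow> Lunit C b \<cdot> (Ident C (Unit C) \<otimes> f) = f \<cdot> Lunit C (Src C f)"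
  by (rule lunit_natural) (auto simp: in_hom_iff)

lemma runit_nat:
  "\<lbrakk>f \<in> Ar C; Tgt C f = b\<rbrakk> \<Longrightarrow> Runit C b \<cdot> (f \<otimes> Ident C (Unit C)) = f \<cdot> Runit C (Src C f)"
  by (rule runit_natural) (auto simp: in_hom_iff)

lemma swap_nat:
  "\<lbrakk>f \<in> Ar C; g \<in> Ar C; Tgt C f = a'; Tgt C g = b'\<rbrakk>
    \<Longrightarrow> Swap C a' b' \<cdot> (f \<otimes> g) = (g \<otimes> f) \<cdot> Swap C (Src C f) (Src C g)"
  by (rule swap_natural) (auto simp: in_hom_iff)

text \<open>Naturality of the left unitor conjugates \<open>Ident C (Unit C) \<otimes> f\<close>
  into \<open>f\<close>. This allows unit laws to be proved after tensoring with the unit, where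
  pentagon and triangle apply.\<close>

lemma unit_ten_faithful:
  assumes "Ident C (Unit C) \<otimes> f = Ident C (Unit C) \<otimes> g" "f \<in> Ar C" "g \<in> Ar C"
    "Src C f = Src C g" "Tgt C f = Tgt C g"
  shows "f = g"
proof (rule iso_cancel_right[of "Lunit C (Src C f)"])
  show "f \<cdot> Lunit C (Src C f) = g \<cdot> Lunit C (Src C f)"
    using lunit_nat[of f] lunit_nat[of g] assms by simp
qed (use assms in auto)

lemma ten_unit_faithful:
  assumes "f \<otimes> Ident C (Unit C) = g \<otimes> Ident C (Unit C)" "f \<in> Ar C" "g \<in> Ar C"
    "Src C f = Src C g" "Tgt C f = Tgt C g"
  shows "f = g"
proof (rule iso_cancel_right[of "Runit C (Src C f)"])
  show "f \<cdot> Runit C (Src C f) = g \<cdot> Runit C (Src C f)"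
    using runit_nat[of f] runit_nat[of g] assms by simp
qed (use assms in auto)

text \<open>Kelly's derivation: after tensoring with the unit on the left, the pentagon for unit,
  unit, \<open>a\<close>, \<open>b\<close> and two uses of the triangle identify both sides.
  \<open>?X\<close> is the invertible pair of associators that the pentagon leaves over.\<close>

lemma lunit_ten:
  assumes [simp]: "a \<in> Ob C" "b \<in> Ob C"
  shows "Lunit C (a \<odot> b) \<cdot> Assoc C (Unit C) a b = Lunit C a \<otimes> Ident C b"
proof (rule unit_ten_faithful)
  let ?I = "Unit C" and ?i = "Ident C"
  let ?X = "Assoc C ?I (?I \<odot> a) b \<cdot> (Assoc C ?I ?I a \<otimes> ?i b)"
  have "(?i ?I \<otimes> (Lunit C (a \<odot> b) \<cdot> Assoc C ?I a b)) \<cdot> ?X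
      = (?i ?I \<otimes> Lunit C (a \<odot> b)) \<cdot> (?i ?I \<otimes> Assoc C ?I a b) \<cdot> ?X"
    by simp
  also have "\<dots> = (?i ?I \<otimes> Lunit C (a \<odot> b)) \<cdot> Assoc C ?I ?I (a \<odot> b) \<cdot> Assoc C (?I \<odot> ?I) a b"
    by (subst pentagon[symmetric]) simp_all
  also have "\<dots> = (Runit C ?I \<otimes> ?i (a \<odot> b)) \<cdot> Assoc C (?I \<odot> ?I) a b"
    by (subst cmp_cmp[symmetric]) (simp_all add: triangle)
  also have "\<dots> = Assoc C ?I a b \<cdot> ((Runit C ?I \<otimes> ?i a) \<otimes> ?i b)"
    using assoc_nat[of "Runit C ?I" "?i a" "?i b"] by simp
  also have "\<dots> = Assoc C ?I a b \<cdot> ((?i ?I \<otimes> Lunit C a) \<otimes> ?i b) \<cdot> (Assoc C ?I ?I a \<otimes> ?i b)"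
    by (simp add: triangle)
  also have "\<dots> = (?i ?I \<otimes> (Lunit C a \<otimes> ?i b)) \<cdot> ?X"
    by (subst assoc_nat_cmp) simp_all
  finally show "?i ?I \<otimes> (Lunit C (a \<odot> b) \<cdot> Assoc C ?I a b) = ?i ?I \<otimes> (Lunit C a \<otimes> ?i b)"
    by (rule iso_cancel_right[rotated]) simp_all
qed simp_all

text \<open>Mirror image of \<open>lunit_ten\<close>, with the pentagon for \<open>a\<close>,
  \<open>b\<close>, unit, unit.\<close>

lemma runit_ten:
  assumes [simp]: "a \<in> Ob C" "b \<in> Ob C"
  shows "(Ident C a \<otimes> Runit C b) \<cdot> Assoc C a b (Unit C) = Runit C (a \<odot> b)"
proof (rule ten_unit_faithful)
  let ?I = "Unit C" and ?i = "Ident C"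
  have "Assoc C a b ?I \<cdot> (((?i a \<otimes> Runit C b) \<cdot> Assoc C a b ?I) \<otimes> ?i ?I)
      = Assoc C a b ?I \<cdot> ((?i a \<otimes> Runit C b) \<otimes> ?i ?I) \<cdot> (Assoc C a b ?I \<otimes> ?i ?I)"
    by simp
  also have "\<dots> = (?i a \<otimes> (Runit C b \<otimes> ?i ?I)) \<cdot> Assoc C a (b \<odot> ?I) ?I \<cdot> (Assoc C a b ?I \<otimes> ?i ?I)"
    by (subst assoc_nat_cmp) simp_all
  also have "\<dots> = (?i a \<otimes> (?i b \<otimes> Lunit C ?I)) \<cdot> (?i a \<otimes> Assoc C b ?I ?I) \<cdot>
      Assoc C a (b \<odot> ?I) ?I \<cdot> (Assoc C a b ?I \<otimes> ?i ?I)"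
    by (simp add: triangle)
  also have "\<dots> = (?i a \<otimes> (?i b \<otimes> Lunit C ?I)) \<cdot> Assoc C a b (?I \<odot> ?I) \<cdot> Assoc C (a \<odot> b) ?I ?I"
    by (subst pentagon[symmetric]) simp_all
  also have "\<dots> = Assoc C a b ?I \<cdot> (?i (a \<odot> b) \<otimes> Lunit C ?I) \<cdot> Assoc C (a \<odot> b) ?I ?I"
    using assoc_nat_cmp[of "?i a" "?i b" "Lunit C ?I" a b ?I "Assoc C (a \<odot> b) ?I ?I"] by simp
  also have "\<dots> = Assoc C a b ?I \<cdot> (Runit C (a \<odot> b) \<otimes> ?i ?I)"
    by (simp add: triangle)
  finally show "((?i a \<otimes> Runit C b) \<cdot> Assoc C a b ?I) \<otimes> ?i ?I = Runit C (a \<odot> b) \<otimes> ?i ?I"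
    by (rule iso_cancel_left[rotated]) simp_all
qed simp_all

end

section \<open>Strict categories on lists of objects\<close>

text \<open>Common interface of \<open>strictify C\<close> and \<open>free_markov Q\<close>, both of
  which have lists as objects. The equivalence in \<open>append_Ob\<close> lets the simplifier split
  membership of a long list into membership of its parts.\<close>

locale strict_symmetric = category K for K :: "('a list, 'm) mcat" (structure) +
  assumes unit_nil [simp]: "Unit K = []"
    and tenO_append [simp]: "a \<odot> b = a @ b"
    and nil_Ob [simp]: "[] \<in> Ob K"
    and append_Ob [simp]: "a @ b \<in> Ob K \<longleftrightarrow> a \<in> Ob K \<and> b \<in> Ob K"
    and coherence_ident [simp]: "Assoc K a b c = Ident K (a @ b @ c)"
      "Lunit K a = Ident K a" "Runit K a = Ident K a"
    and ten_typing [simp]: "\<lbrakk>f \<in> Ar K; g \<in> Ar K\<rbrakk> \<Longrightarrow> f \<otimes> g \<in> Ar K"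
      "\<lbrakk>f \<in> Ar K; g \<in> Ar K\<rbrakk> \<Longrightarrow> Src K (f \<otimes> g) = Src K f @ Src K g"
      "\<lbrakk>f \<in> Ar K; g \<in> Ar K\<rbrakk> \<Longrightarrow> Tgt K (f \<otimes> g) = Tgt K f @ Tgt K g"
    and ten_ident [simp]: "\<lbrakk>a \<in> Ob K; b \<in> Ob K\<rbrakk> \<Longrightarrow> Ident K a \<otimes> Ident K b = Ident K (a @ b)"
    and interchange [simp]: "\<lbrakk>f \<in> Ar K; g \<in> Ar K; f' \<in> Ar K; g' \<in> Ar K; Src K g = Tgt K f;
        Src K g' = Tgt K f'\<rbrakk> \<Longrightarrow> (g \<otimes> g') \<cdot> (f \<otimes> f') = (g \<cdot> f) \<otimes> (g' \<cdot> f')"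
    and ten_assoc [simp]: "\<lbrakk>f \<in> Ar K; g \<in> Ar K; h \<in> Ar K\<rbrakk> \<Longrightarrow> (f \<otimes> g) \<otimes> h = f \<otimes> (g \<otimes> h)"
    and ten_nil [simp]: "f \<in> Ar K \<Longrightarrow> Ident K [] \<otimes> f = f" "f \<in> Ar K \<Longrightarrow> f \<otimes> Ident K [] = f"
    and swap_typing [simp]: "\<lbrakk>a \<in> Ob K; b \<in> Ob K\<rbrakk> \<Longrightarrow> Swap K a b \<in> Ar K"
      "\<lbrakk>a \<in> Ob K; b \<in> Ob K\<rbrakk> \<Longrightarrow> Src K (Swap K a b) = a @ b"
      "\<lbrakk>a \<in> Ob K; b \<in> Ob K\<rbrakk> \<Longrightarrow> Tgt K (Swap K a b) = b @ a"
    and swap_nat: "\<lbrakk>f \<in> Ar K; g \<in> Ar K; Tgt K f = a; Tgt K g = b\<rbrakk>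
        \<Longrightarrow> Swap K a b \<cdot> (f \<otimes> g) = (g \<otimes> f) \<cdot> Swap K (Src K f) (Src K g)"
    and swap_swap [simp]: "\<lbrakk>a \<in> Ob K; b \<in> Ob K\<rbrakk> \<Longrightarrow> Swap K b a \<cdot> Swap K a b = Ident K (a @ b)"
    and hexagon: "\<lbrakk>a \<in> Ob K; b \<in> Ob K; c \<in> Ob K\<rbrakk>
        \<Longrightarrow> Swap K a (b @ c) = (Ident K b \<otimes> Swap K a c) \<cdot> (Swap K a b \<otimes> Ident K c)"
begin

lemma interchange_cmp [simp]:
  "\<lbrakk>f \<in> Ar K; g \<in> Ar K; f' \<in> Ar K; g' \<in> Ar K; Src K g = Tgt K f; Src K g' = Tgt K f';
    h \<in> Ar K; Tgt K h = Src K f @ Src K f'\<rbrakk>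
    \<Longrightarrow> (g \<otimes> g') \<cdot> (f \<otimes> f') \<cdot> h = ((g \<cdot> f) \<otimes> (g' \<cdot> f')) \<cdot> h"
  by (subst cmp_cmp[symmetric]) auto

lemma inverse_arrows_ten:
  "\<lbrakk>iso K f; iso K g\<rbrakk> \<Longrightarrow> inverse_arrows K (f \<otimes> g) (inverse_of K f \<otimes> inverse_of K g)"
  by (rule inverse_arrowsI) simp_all

lemma iso_ten [simp]: "\<lbrakk>iso K f; iso K g\<rbrakk> \<Longrightarrow> iso K (f \<otimes> g)"
  by (rule isoI[OF inverse_arrows_ten])

lemma iso_swap [simp]: "\<lbrakk>a \<in> Ob K; b \<in> Ob K\<rbrakk> \<Longrightarrow> iso K (Swap K a b)"
  by (rule isoI[where g = "Swap K b a"]) (simp add: inverse_arrowsI)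

lemma ten_split_left: "\<lbrakk>f \<in> Ar K; g \<in> Ar K\<rbrakk> \<Longrightarrow> f \<otimes> g = (f \<otimes> Ident K (Tgt K g)) \<cdot> (Ident K (Src K f) \<otimes> g)"
  by simp

text \<open>The second hexagon holds because \<open>Swap K (a @ b) c\<close> is inverse to
  \<open>Swap K c (a @ b)\<close>, which the first hexagon decomposes.\<close>

lemma hexagon':
  assumes [simp]: "a \<in> Ob K" "b \<in> Ob K" "c \<in> Ob K"
  shows "Swap K (a @ b) c = (Swap K a c \<otimes> Ident K b) \<cdot> (Ident K a \<otimes> Swap K b c)"
proof (rule iso_cancel_left[of "Swap K c (a @ b)"])
  have "Swap K c (a @ b) \<cdot> (Swap K a c \<otimes> Ident K b) \<cdot> (Ident K a \<otimes> Swap K b c)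
      = (Ident K a \<otimes> Swap K c b) \<cdot> (Swap K c a \<otimes> Ident K b) \<cdot> (Swap K a c \<otimes> Ident K b) \<cdot>
        (Ident K a \<otimes> Swap K b c)"
    by (simp add: hexagon)
  also have "\<dots> = (Ident K a \<otimes> Swap K c b) \<cdot> (Ident K (a @ c) \<otimes> Ident K b) \<cdot> (Ident K a \<otimes> Swap K b c)"
    by (subst interchange_cmp) simp_all
  also have "\<dots> = Swap K c (a @ b) \<cdot> Swap K (a @ b) c"
    by simp
  finally show "Swap K c (a @ b) \<cdot> Swap K (a @ b) c =
      Swap K c (a @ b) \<cdot> (Swap K a c \<otimes> Ident K b) \<cdot> (Ident K a \<otimes> Swap K b c)" ..
qed simp_all

text \<open>The hexagon with two empty lists makes \<open>Swap K a []\<close> idempotent, and an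
  invertible idempotent is the identity.\<close>

lemma swap_nil [simp]:
  assumes [simp]: "a \<in> Ob K"
  shows "Swap K a [] = Ident K a" "Swap K [] a = Ident K a"
proof -
  have "Swap K a [] \<cdot> Swap K a [] = Swap K a [] \<cdot> Ident K a"
    using hexagon[of a "[]" "[]"] by simp
  then show "Swap K a [] = Ident K a"
    by (rule iso_cancel_left[rotated]) simp_all
  then show "Swap K [] a = Ident K a"
    using swap_swap[of "[]" a] by simp
qed

text \<open>Both sides are the permutation \<open>a a' b b' c c' \<rightarrow> a b c a' b' c'\<close>.\<close>

lemma middle_swap_assoc:
  assumes [simp]: "a \<in> Ob K" "a' \<in> Ob K" "b \<in> Ob K" "b' \<in> Ob K" "c \<in> Ob K" "c' \<in> Ob K"
  shows "(Ident K (a @ b) \<otimes> Swap K (a' @ b') c \<otimes> Ident K c') \<cdot>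
      (Ident K a \<otimes> Swap K a' b \<otimes> Ident K (b' @ c @ c'))
    = (Ident K a \<otimes> Swap K a' (b @ c) \<otimes> Ident K (b' @ c')) \<cdot>
      (Ident K (a @ a' @ b) \<otimes> Swap K b' c \<otimes> Ident K c')"
proof -
  let ?i = "Ident K"
  \<comment> \<open>Both sides normalize to one diagram: \<open>a' b\<close> and \<open>b' c\<close>
    are exchanged side by side, then \<open>a'\<close> passes \<open>c\<close>.\<close>
  have 1: "(?i b \<otimes> Swap K (a' @ b') c) \<cdot> (Swap K a' b \<otimes> ?i (b' @ c))
      = (?i b \<otimes> Swap K a' c \<otimes> ?i b') \<cdot> (Swap K a' b \<otimes> Swap K b' c)"
  proof -
    have "(?i b \<otimes> Swap K (a' @ b') c) \<cdot> (Swap K a' b \<otimes> ?i (b' @ c))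
      = (?i b \<otimes> (Swap K a' c \<otimes> ?i b')) \<cdot> ((?i b \<otimes> ?i a') \<otimes> Swap K b' c) \<cdot> (Swap K a' b \<otimes> ?i (b' @ c))"
      by (simp add: hexagon' del: ten_ident)
    then show ?thesis by simp
  qed
  have 2: "(Swap K a' (b @ c) \<otimes> ?i b') \<cdot> (?i (a' @ b) \<otimes> Swap K b' c)
      = (?i b \<otimes> Swap K a' c \<otimes> ?i b') \<cdot> (Swap K a' b \<otimes> Swap K b' c)"
  proof -
    have "Swap K a' (b @ c) \<otimes> ?i b' = ((?i b \<otimes> Swap K a' c) \<otimes> ?i b') \<cdot> ((Swap K a' b \<otimes> ?i c) \<otimes> ?i b')"
      by (simp add: hexagon del: ten_assoc)
    then have "Swap K a' (b @ c) \<otimes> ?i b' = (?i b \<otimes> Swap K a' c \<otimes> ?i b') \<cdot> (Swap K a' b \<otimes> ?i (c @ b'))"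
      by simp
    then show ?thesis by simp
  qed
  have e: "?i (a @ b) \<otimes> Swap K (a' @ b') c \<otimes> ?i c' = ?i a \<otimes> (?i b \<otimes> Swap K (a' @ b') c) \<otimes> ?i c'"
    "?i a \<otimes> Swap K a' b \<otimes> ?i (b' @ c @ c') = ?i a \<otimes> (Swap K a' b \<otimes> ?i (b' @ c)) \<otimes> ?i c'"
    "?i a \<otimes> Swap K a' (b @ c) \<otimes> ?i (b' @ c') = ?i a \<otimes> (Swap K a' (b @ c) \<otimes> ?i b') \<otimes> ?i c'"
    "?i (a @ a' @ b) \<otimes> Swap K b' c \<otimes> ?i c' = ?i a \<otimes> (?i (a' @ b) \<otimes> Swap K b' c) \<otimes> ?i c'"
    by (simp_all flip: ten_ident)
  show ?thesis
    unfolding e by (simp add: 1 2 del: ten_assoc)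
qed

end

locale strict_markov = strict_symmetric +
  assumes disc_typing [simp]: "a \<in> Ob K \<Longrightarrow> Disc K a \<in> Ar K"
      "a \<in> Ob K \<Longrightarrow> Src K (Disc K a) = a" "a \<in> Ob K \<Longrightarrow> Tgt K (Disc K a) = []"
    and terminal: "\<lbrakk>f \<in> Ar K; Tgt K f = []\<rbrakk> \<Longrightarrow> f = Disc K (Src K f)"
    and copy_typing [simp]: "a \<in> Ob K \<Longrightarrow> Copy K a \<in> Ar K"
      "a \<in> Ob K \<Longrightarrow> Src K (Copy K a) = a" "a \<in> Ob K \<Longrightarrow> Tgt K (Copy K a) = a @ a"
    and copy_assoc: "a \<in> Ob K \<Longrightarrow>
        (Copy K a \<otimes> Ident K a) \<cdot> Copy K a = (Ident K a \<otimes> Copy K a) \<cdot> Copy K a"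
    and copy_counit [simp]: "a \<in> Ob K \<Longrightarrow> (Disc K a \<otimes> Ident K a) \<cdot> Copy K a = Ident K a"
    and copy_commute [simp]: "a \<in> Ob K \<Longrightarrow> Swap K a a \<cdot> Copy K a = Copy K a"
    and copy_append: "\<lbrakk>a \<in> Ob K; b \<in> Ob K\<rbrakk> \<Longrightarrow>
        Copy K (a @ b) = (Ident K a \<otimes> Swap K a b \<otimes> Ident K b) \<cdot> (Copy K a \<otimes> Copy K b)"

section \<open>The strictification of a Markov category\<close>

context markov_category
begin

abbreviation strict_cmp (infixr "\<bullet>" 55) where
  "g \<bullet> f \<equiv> g \<cdot>\<^bsub>strictify C\<^esub> f"

abbreviation strict_ten (infixr "\<boxtimes>" 65) where
  "f \<boxtimes> g \<equiv> f \<otimes>\<^bsub>strictify C\<^esub> g"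

lemma tlist_Cons: "xs \<noteq> [] \<Longrightarrow> tlist C (a # xs) = a \<odot> tlist C xs"
  by (cases xs) auto

lemma join_singleton [simp]: "xs \<noteq> [] \<Longrightarrow> join C [a] xs = Ident C (a \<odot> tlist C xs)"
  by (cases xs) auto

lemma join_Cons:
  "xs \<noteq> [] \<Longrightarrow> join C (a # xs) ys = (Ident C a \<otimes> join C xs ys) \<cdot> Assoc C a (tlist C xs) (tlist C ys)"
  by (cases xs) auto

lemma tlist_Ob [simp]: "xs \<in> lists (Ob C) \<Longrightarrow> tlist C xs \<in> Ob C"
  by (induction xs rule: induct_list012) auto

lemma join_typing [simp]:
  assumes "xs \<in> lists (Ob C)" "ys \<in> lists (Ob C)"
  shows "join C xs ys \<in> Ar C" "Src C (join C xs ys) = tlist C xs \<odot> tlist C ys"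
    "Tgt C (join C xs ys) = tlist C (xs @ ys)" "iso C (join C xs ys)"
proof -
  have "join C xs ys \<in> Ar C \<and> Src C (join C xs ys) = tlist C xs \<odot> tlist C ys \<and>
      Tgt C (join C xs ys) = tlist C (xs @ ys) \<and> iso C (join C xs ys)"
    using assms
  proof (induction xs rule: induct_list012)
    case (2 a)
    then show ?case by (cases ys) auto
  qed auto
  then show "join C xs ys \<in> Ar C" "Src C (join C xs ys) = tlist C xs \<odot> tlist C ys"
    "Tgt C (join C xs ys) = tlist C (xs @ ys)" "iso C (join C xs ys)" by auto
qed

lemma disc_unique: "\<lbrakk>f \<in> Ar C; Tgt C f = Unit C\<rbrakk> \<Longrightarrow> f = Disc C (Src C f)"
  by (rule terminal) (auto simp: in_hom_iff)

lemma disc_typing [simp]: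
  assumes "a \<in> Ob C"
  shows "Disc C a \<in> Ar C" "Src C (Disc C a) = a" "Tgt C (Disc C a) = Unit C"
  using disc_hom[OF assms] by (auto simp: in_hom_iff)

lemma copy_typing [simp]:
  assumes "a \<in> Ob C"
  shows "Copy C a \<in> Ar C" "Src C (Copy C a) = a" "Tgt C (Copy C a) = a \<odot> a"
  using copy_hom[OF assms] by (auto simp: in_hom_iff)

text \<open>In a general monoidal category this is a coherence theorem; here any two morphisms into
  the terminal unit with the same source agree.\<close>

lemma lunit_unit: "Lunit C (Unit C) = Runit C (Unit C)"
  using disc_unique[of "Lunit C (Unit C)"] disc_unique[of "Runit C (Unit C)"] by simp

lemma join_Nil_right: "xs \<in> lists (Ob C) \<Longrightarrow> join C xs [] = Runit C (tlist C xs)"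
proof (induction xs rule: induct_list012)
  case 1
  show ?case by (simp add: lunit_unit)
next
  case (3 a b xs)
  then show ?case using runit_ten[of a "tlist C (b # xs)"] by simp
qed simp

text \<open>The coherence law of \<open>join\<close>, from which associativity, the hexagon and
  coassociativity of copies in the strictification are obtained. The induction step is the pentagon;
  \<open>lunit_ten\<close> handles empty \<open>xs\<close>, and the triangle the case where the
  singleton convention of \<open>tlist\<close> exposes unitors.\<close>

lemma join_assoc:
  assumes "xs \<in> lists (Ob C)" and [simp]: "ys \<in> lists (Ob C)" "zs \<in> lists (Ob C)"
  shows "join C (xs @ ys) zs \<cdot> (join C xs ys \<otimes> Ident C (tlist C zs)) =
    join C xs (ys @ zs) \<cdot> (Ident C (tlist C xs) \<otimes> join C ys zs) \<cdot>
      Assoc C (tlist C xs) (tlist C ys) (tlist C zs)"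
  using assms(1)
proof (induction xs)
  case Nil
  let ?Y = "tlist C ys" and ?Z = "tlist C zs" and ?I = "Unit C"
  have "join C ys zs \<cdot> (Lunit C ?Y \<otimes> Ident C ?Z) = join C ys zs \<cdot> Lunit C (?Y \<odot> ?Z) \<cdot> Assoc C ?I ?Y ?Z"
    by (simp add: lunit_ten)
  also have "\<dots> = Lunit C (tlist C (ys @ zs)) \<cdot> (Ident C ?I \<otimes> join C ys zs) \<cdot> Assoc C ?I ?Y ?Z"
    using cmp_extend[OF lunit_nat[of "join C ys zs"], of "tlist C (ys @ zs)" "Assoc C ?I ?Y ?Z"] by simp
  finally show ?case by simp
next
  case (Cons a xs)
  then have [simp]: "a \<in> Ob C" "xs \<in> lists (Ob C)" by auto
  let ?X = "tlist C xs" and ?Y = "tlist C ys" and ?Z = "tlist C zs" and ?i = "Ident C"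
  show ?case
  proof (cases "xs = []")
    case [simp]: True
    show ?thesis
    proof (cases "ys = []")
      case True
      then show ?thesis using triangle[of a "tlist C zs"] by simp
    next
      case False
      then show ?thesis by (simp add: join_Cons tlist_Cons)
    qed
  next
    case [simp]: False
  \<comment> \<open>\<open>interchange\<close> is switched off here because merging the tensor
    products would destroy the pattern to which naturality of the associator applies.\<close>
  have nat: "Assoc C a (tlist C (xs @ ys)) ?Z \<cdot> ((?i a \<otimes> join C xs ys) \<otimes> ?i ?Z) \<cdot> (Assoc C a ?X ?Y \<otimes> ?i ?Z)
     = (?i a \<otimes> (join C xs ys \<otimes> ?i ?Z)) \<cdot> Assoc C a (?X \<odot> ?Y) ?Z \<cdot> (Assoc C a ?X ?Y \<otimes> ?i ?Z)"
    using assoc_nat_cmp[of "?i a" "join C xs ys" "?i ?Z" a "tlist C (xs @ ys)" ?Z "Assoc C a ?X ?Y \<otimes> ?i ?Z"]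
    by (simp del: interchange interchange_cmp)
  have nat2: "(?i a \<otimes> (?i ?X \<otimes> join C ys zs)) \<cdot> Assoc C a ?X (?Y \<odot> ?Z) \<cdot> Assoc C (a \<odot> ?X) ?Y ?Z
     = Assoc C a ?X (tlist C (ys @ zs)) \<cdot> (?i (a \<odot> ?X) \<otimes> join C ys zs) \<cdot> Assoc C (a \<odot> ?X) ?Y ?Z"
    using assoc_nat_cmp[of "?i a" "?i ?X" "join C ys zs" a ?X "tlist C (ys @ zs)" "Assoc C (a \<odot> ?X) ?Y ?Z"]
    by (simp del: interchange interchange_cmp)
  have "join C ((a # xs) @ ys) zs \<cdot> (join C (a # xs) ys \<otimes> ?i ?Z)
      = (?i a \<otimes> join C (xs @ ys) zs) \<cdot> Assoc C a (tlist C (xs @ ys)) ?Z \<cdot>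
        ((?i a \<otimes> join C xs ys) \<otimes> ?i ?Z) \<cdot> (Assoc C a ?X ?Y \<otimes> ?i ?Z)"
    by (simp add: join_Cons tlist_Cons)
  also have "\<dots> = (?i a \<otimes> (join C (xs @ ys) zs \<cdot> (join C xs ys \<otimes> ?i ?Z))) \<cdot>
      Assoc C a (?X \<odot> ?Y) ?Z \<cdot> (Assoc C a ?X ?Y \<otimes> ?i ?Z)"
    by (subst nat) (simp)
  also have "\<dots> = (?i a \<otimes> (join C xs (ys @ zs) \<cdot> (?i ?X \<otimes> join C ys zs) \<cdot> Assoc C ?X ?Y ?Z)) \<cdot>
      Assoc C a (?X \<odot> ?Y) ?Z \<cdot> (Assoc C a ?X ?Y \<otimes> ?i ?Z)"
    by (simp only: Cons.IH \<open>xs \<in> lists (Ob C)\<close>)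
  also have "\<dots> = (?i a \<otimes> join C xs (ys @ zs)) \<cdot> (?i a \<otimes> (?i ?X \<otimes> join C ys zs)) \<cdot>
      (?i a \<otimes> Assoc C ?X ?Y ?Z) \<cdot> Assoc C a (?X \<odot> ?Y) ?Z \<cdot> (Assoc C a ?X ?Y \<otimes> ?i ?Z)"
    by (simp)
  also have "\<dots> = (?i a \<otimes> join C xs (ys @ zs)) \<cdot> (?i a \<otimes> (?i ?X \<otimes> join C ys zs)) \<cdot>
      Assoc C a ?X (?Y \<odot> ?Z) \<cdot> Assoc C (a \<odot> ?X) ?Y ?Z"
    by (subst pentagon[symmetric]) (simp_all)
  also have "\<dots> = (?i a \<otimes> join C xs (ys @ zs)) \<cdot> Assoc C a ?X (tlist C (ys @ zs)) \<cdot>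
      (?i (a \<odot> ?X) \<otimes> join C ys zs) \<cdot> Assoc C (a \<odot> ?X) ?Y ?Z"
    by (subst nat2) simp
  also have "\<dots> = join C (a # xs) (ys @ zs) \<cdot> (?i (tlist C (a # xs)) \<otimes> join C ys zs) \<cdot>
      Assoc C (tlist C (a # xs)) ?Y ?Z"
    by (simp add: join_Cons tlist_Cons)
  finally show ?thesis .
  qed
qed

lemma strictify_simps [simp]:
  "Ob (strictify C) = lists (Ob C)"
  "(xs, f, ys) \<in> Ar (strictify C) \<longleftrightarrow> xs \<in> lists (Ob C) \<and> ys \<in> lists (Ob C) \<and> f \<in> Ar C \<and>
     Src C f = tlist C xs \<and> Tgt C f = tlist C ys"
  "Src (strictify C) (xs, f, ys) = xs" "Tgt (strictify C) (xs, f, ys) = ys"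
  "Ident (strictify C) xs = (xs, Ident C (tlist C xs), xs)"
  "(ys', g, zs) \<bullet> (xs, f, ys) = (xs, g \<cdot> f, zs)"
  "Unit (strictify C) = []" "TenO (strictify C) = (@)"
  "(xs, f, ys) \<boxtimes> (xs', f', ys') =
     (xs @ xs', join C ys ys' \<cdot> (f \<otimes> f') \<cdot> inverse_of C (join C xs xs'), ys @ ys')"
  "Assoc (strictify C) xs ys zs = (xs @ ys @ zs, Ident C (tlist C (xs @ ys @ zs)), xs @ ys @ zs)"
  "Lunit (strictify C) xs = (xs, Ident C (tlist C xs), xs)"
  "Runit (strictify C) xs = (xs, Ident C (tlist C xs), xs)"
  "Swap (strictify C) xs ys =
     (xs @ ys, join C ys xs \<cdot> Swap C (tlist C xs) (tlist C ys) \<cdot> inverse_of C (join C xs ys), ys @ xs)"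
  "Copy (strictify C) xs = (xs, join C xs xs \<cdot> Copy C (tlist C xs), xs @ xs)"
  "Disc (strictify C) xs = (xs, Disc C (tlist C xs), [])"
  by (auto simp: strictify_def in_hom_iff)

text \<open>Both sides are compared after precomposition with the invertible double join
  \<open>?P\<close>. By \<open>join_assoc\<close> it can be bracketed to suit either side, and
  naturality of the associator connects the two.\<close>

lemma strictify_ten_assoc:
  assumes "f \<in> Ar (strictify C)" "g \<in> Ar (strictify C)" "h \<in> Ar (strictify C)"
  shows "(f \<boxtimes> g) \<boxtimes> h = f \<boxtimes> (g \<boxtimes> h)"
proof -
  obtain xs u ys xs' v ys' xs'' w ys'' where
    [simp]: "f = (xs, u, ys)" "g = (xs', v, ys')" "h = (xs'', w, ys'')"
    by (cases f; cases g; cases h)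
  have xs [simp]: "xs \<in> lists (Ob C)" "xs' \<in> lists (Ob C)" "xs'' \<in> lists (Ob C)"
    and ys [simp]: "ys \<in> lists (Ob C)" "ys' \<in> lists (Ob C)" "ys'' \<in> lists (Ob C)"
    and [simp]: "u \<in> Ar C" "v \<in> Ar C" "w \<in> Ar C"
      "Src C u = tlist C xs" "Tgt C u = tlist C ys" "Src C v = tlist C xs'" "Tgt C v = tlist C ys'"
      "Src C w = tlist C xs''" "Tgt C w = tlist C ys''"
    using assms by auto
  let ?i = "Ident C" and ?A = "Assoc C (tlist C xs) (tlist C xs') (tlist C xs'')"
  let ?P = "join C (xs @ xs') xs'' \<cdot> (join C xs xs' \<otimes> ?i (tlist C xs''))"
  let ?l = "underlying ((f \<boxtimes> g) \<boxtimes> h)"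
  let ?r = "underlying (f \<boxtimes> (g \<boxtimes> h))"
  have "?r \<cdot> ?P = ?r \<cdot> join C xs (xs' @ xs'') \<cdot> (?i (tlist C xs) \<otimes> join C xs' xs'') \<cdot> ?A"
    by (simp only: join_assoc xs)
  also have "\<dots> = join C ys (ys' @ ys'') \<cdot> (?i (tlist C ys) \<otimes> join C ys' ys'') \<cdot> (u \<otimes> (v \<otimes> w)) \<cdot> ?A"
    by (simp add: underlying_def)
  also have "\<dots> = join C ys (ys' @ ys'') \<cdot> (?i (tlist C ys) \<otimes> join C ys' ys'') \<cdot>
      Assoc C (tlist C ys) (tlist C ys') (tlist C ys'') \<cdot> ((u \<otimes> v) \<otimes> w)"
    by (simp add: assoc_nat)
  also have "\<dots> = (join C (ys @ ys') ys'' \<cdot> (join C ys ys' \<otimes> ?i (tlist C ys''))) \<cdot> ((u \<otimes> v) \<otimes> w)"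
    by (subst join_assoc) simp_all
  also have "\<dots> = ?l \<cdot> ?P"
    by (simp add: underlying_def)
  finally have "?r = ?l"
    by (rule iso_cancel_right[rotated]) (simp_all add: underlying_def)
  then show ?thesis by (simp add: underlying_def)
qed

text \<open>Again \<open>?P\<close> is cancelled; joins are slid through the symmetry by naturality
  until the hexagon of \<open>C\<close> applies to the three tensor products.\<close>

lemma strictify_hexagon:
  assumes [simp]: "xs \<in> lists (Ob C)" "ys \<in> lists (Ob C)" "zs \<in> lists (Ob C)"
  shows "Swap (strictify C) xs (ys @ zs) =
    (Ident (strictify C) ys \<boxtimes> Swap (strictify C) xs zs) \<bullet>
    (Swap (strictify C) xs ys \<boxtimes> Ident (strictify C) zs)" (is "?L = ?R")
proof -
  let ?i = "Ident C" and ?J = "join C" and ?X = "tlist C xs" and ?Y = "tlist C ys" and ?Z = "tlist C zs"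
  let ?P = "?J (xs @ ys) zs \<cdot> (?J xs ys \<otimes> ?i ?Z)"
  have "underlying ?L \<cdot> ?P
      = underlying ?L \<cdot> ?J xs (ys @ zs) \<cdot> (?i ?X \<otimes> ?J ys zs) \<cdot> Assoc C ?X ?Y ?Z"
    by (simp only: join_assoc assms)
  also have "\<dots> = ?J (ys @ zs) xs \<cdot> (Swap C ?X (tlist C (ys @ zs)) \<cdot> (?i ?X \<otimes> ?J ys zs)) \<cdot> Assoc C ?X ?Y ?Z"
    by (simp add: underlying_def)
  also have "\<dots> = (?J (ys @ zs) xs \<cdot> (?J ys zs \<otimes> ?i ?X)) \<cdot> Swap C ?X (?Y \<odot> ?Z) \<cdot> Assoc C ?X ?Y ?Z"
    by (subst swap_nat) simp_all
  also have "\<dots> = (?J ys (zs @ xs) \<cdot> (?i ?Y \<otimes> ?J zs xs)) \<cdot> Assoc C ?Y ?Z ?X \<cdot> Swap C ?X (?Y \<odot> ?Z) \<cdot> Assoc C ?X ?Y ?Z"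
    by (subst join_assoc) simp_all
  also have "\<dots> = (?J ys (zs @ xs) \<cdot> (?i ?Y \<otimes> ?J zs xs)) \<cdot> (?i ?Y \<otimes> Swap C ?X ?Z) \<cdot> Assoc C ?Y ?X ?Z \<cdot> (Swap C ?X ?Y \<otimes> ?i ?Z)"
    by (subst hexagon) simp_all
  finally have l: "underlying ?L \<cdot> ?P = \<dots>" .
  have "underlying ?R \<cdot> ?P = ?J ys (zs @ xs) \<cdot> (?i ?Y \<otimes> (?J zs xs \<cdot> Swap C ?X ?Z \<cdot> inverse_of C (?J xs zs))) \<cdot>
      inverse_of C (?J ys (xs @ zs)) \<cdot> (?J (ys @ xs) zs \<cdot> (?J ys xs \<otimes> ?i ?Z)) \<cdot> (Swap C ?X ?Y \<otimes> ?i ?Z)"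
    by (simp add: underlying_def)
  also have "\<dots> = underlying ?L \<cdot> ?P"
    unfolding l by (subst join_assoc) simp_all
  finally have "underlying ?R = underlying ?L"
    by (rule iso_cancel_right[rotated]) (simp_all add: underlying_def)
  then show ?thesis by (simp add: underlying_def)
qed

lemma category_strictify: "category (strictify C)"
  by unfold_locales (auto simp: hom_def)

lemma strict_symmetric_strictify: "strict_symmetric (strictify C)"
proof -
  interpret S: category "strictify C" by (rule category_strictify)
  show ?thesis
  proof (unfold_locales, goal_cases)
    case (12 f g f' g')
    then show ?case by (cases f; cases g; cases f'; cases g') auto
  next
    case (13 f g h)
    then show ?case by (rule strictify_ten_assoc)
  next
    case (14 f)
    then show ?case
      using cmp_extend[OF lunit_nat, of "fst (snd f)" _ "inverse_of C (Lunit C (tlist C (fst f)))"]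
      by (cases f) simp
  next
    case (15 f)
    then show ?case
      using cmp_extend[OF runit_nat, of "fst (snd f)" _ "inverse_of C (Runit C (tlist C (fst f)))"]
      by (cases f) (simp add: join_Nil_right)
  next
    case (19 f g a b)
    obtain xs u ys xs' v ys' where [simp]: "f = (xs, u, ys)" "g = (xs', v, ys')" by (cases f; cases g)
    show ?case using 19
      cmp_extend[OF swap_nat[of u v "tlist C ys" "tlist C ys'"], of "inverse_of C (join C xs xs')"] by auto
  next
    case (20 a b)
    then show ?case using cmp_extend[of "Swap C (tlist C b) (tlist C a)" "Swap C (tlist C a) (tlist C b)" _ "inverse_of C (join C a b)"]
      by (auto simp: swap_swap)
  next
    case (21 a b c)
    then show ?case using strictify_hexagon by simp
  qed auto
qed

text \<open>Unfolding the strict tensor on singleton lists produces exactly the associators of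
  \<open>middle_swap\<close>, so this is the axiom \<open>copy_tensor\<close>.\<close>

lemma strictify_copy_two:
  assumes [simp]: "a \<in> Ob C" "b \<in> Ob C"
  shows "Copy (strictify C) [a, b] =
    (Ident (strictify C) [a] \<boxtimes> Swap (strictify C) [a] [b] \<boxtimes>
      Ident (strictify C) [b]) \<bullet>
    (Copy (strictify C) [a] \<boxtimes> Copy (strictify C) [b])"
  by (simp add: copy_tensor middle_swap_def)

text \<open>The identity of \<open>tlist C xs\<close> is an isomorphism \<open>[tlist C xs] \<rightarrow> xs\<close> of the strictification.\<close>

lemma strictify_copy_flatten:
  assumes [simp]: "xs \<in> lists (Ob C)"
  shows "Copy (strictify C) xs =
    (([tlist C xs], Ident C (tlist C xs), xs) \<boxtimes> ([tlist C xs], Ident C (tlist C xs), xs))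
      \<bullet> Copy (strictify C) [tlist C xs] \<bullet> (xs, Ident C (tlist C xs), [tlist C xs])"
  by simp

text \<open>The axiom of \<open>C\<close> speaks of a binary tensor, so the tail is first collapsed
  into the single object \<open>tlist C xs\<close>. The collapsing isomorphisms \<open>v\<close>,
  \<open>v'\<close> are then moved through the symmetry by naturality and absorbed into the copy of
  \<open>xs\<close>.\<close>

lemma strictify_copy_Cons:
  assumes [simp]: "a \<in> Ob C" "xs \<in> lists (Ob C)"
  shows "Copy (strictify C) (a # xs) =
    (Ident (strictify C) [a] \<boxtimes> Swap (strictify C) [a] xs \<boxtimes>
      Ident (strictify C) xs) \<bullet>
    (Copy (strictify C) [a] \<boxtimes> Copy (strictify C) xs)"
proof -
  interpret S: strict_symmetric "strictify C" by (rule strict_symmetric_strictify)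
  show ?thesis
  proof (cases "xs = []")
    case True
    have "Copy (strictify C) [] = Ident (strictify C) []"
      using disc_unique[of "Lunit C (Unit C) \<cdot> Copy C (Unit C)"] disc_unique[of "Ident C (Unit C)"] by simp
    moreover have "Copy (strictify C) [a] \<in> Ar (strictify C)" by simp
    moreover have "Tgt (strictify C) (Copy (strictify C) [a]) = [a, a]" by simp
    ultimately show ?thesis using True by (simp del: strictify_simps(5,9,13-15))
  next
    case False
    let ?S = "strictify C" and ?X = "tlist C xs"
    define v where "v = ([?X], Ident C ?X, xs)"
    define v' where "v' = (xs, Ident C ?X, [?X])"
    define i where "i = Ident ?S [a]"
    define s where "s = Swap ?S [a] [?X]"
    define ca where "ca = Copy ?S [a]"
    define cx where "cx = Copy ?S [?X]"
    have [simp]: "v \<in> Ar ?S" "v' \<in> Ar ?S" "i \<in> Ar ?S" "s \<in> Ar ?S" "ca \<in> Ar ?S" "cx \<in> Ar ?S"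
      "Src ?S v = [?X]" "Tgt ?S v = xs" "Src ?S v' = xs" "Tgt ?S v' = [?X]"
      "Src ?S i = [a]" "Tgt ?S i = [a]" "Src ?S s = [a, ?X]" "Tgt ?S s = [?X, a]"
      "Src ?S ca = [a]" "Tgt ?S ca = [a, a]" "Src ?S cx = [?X]" "Tgt ?S cx = [?X, ?X]"
      unfolding v_def v'_def i_def s_def ca_def cx_def by simp_all
    have [simp]: "v \<bullet> v' = Ident ?S xs" "i \<bullet> i = i" "ca \<bullet> i = ca"
      unfolding v_def v'_def i_def ca_def using False by simp_all
    have [simp]: "(i \<boxtimes> i) \<bullet> ca = ca"
      unfolding i_def ca_def by simp
    have w: "(a # xs, Ident C (a \<odot> ?X), [a, ?X]) = i \<boxtimes> v'"
      "([a, ?X], Ident C (a \<odot> ?X), a # xs) = i \<boxtimes> v"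
      unfolding i_def v_def v'_def using False by (simp_all add: tlist_Cons)
    have "Copy ?S (a # xs) = ((i \<boxtimes> v) \<boxtimes> (i \<boxtimes> v)) \<bullet> Copy ?S [a, ?X] \<bullet> (i \<boxtimes> v')"
      unfolding w[symmetric] using False by (simp add: tlist_Cons)
    also have "\<dots> = (i \<boxtimes> ((v \<boxtimes> i) \<boxtimes> v)) \<bullet>
        (i \<boxtimes> s \<boxtimes> Ident ?S [?X]) \<bullet> (ca \<boxtimes> cx) \<bullet> (i \<boxtimes> v')"
      using strictify_copy_two[of a ?X] unfolding i_def[symmetric] s_def[symmetric] ca_def[symmetric] cx_def[symmetric]
      by (simp del: strictify_simps(5,13-15) S.interchange S.interchange_cmp add: strictify_simps(1))
    also have "\<dots> = (i \<boxtimes> ((v \<boxtimes> i) \<bullet> s) \<boxtimes> v) \<bullet> (ca \<boxtimes> (cx \<bullet> v'))"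
      by (simp del: strictify_simps(5,13-15) S.ten_assoc)
    also have "(v \<boxtimes> i) \<bullet> s = Swap ?S [a] xs \<bullet> (i \<boxtimes> v)"
      using S.swap_nat[of i v "[a]" xs] by (simp add: s_def del: strictify_simps(5,13-15))
    also have "(i \<boxtimes> (Swap ?S [a] xs \<bullet> (i \<boxtimes> v)) \<boxtimes> v) \<bullet> (ca \<boxtimes> (cx \<bullet> v'))
      = (i \<boxtimes> Swap ?S [a] xs \<boxtimes> Ident ?S xs) \<bullet>
        (i \<boxtimes> (i \<boxtimes> v) \<boxtimes> v) \<bullet> (ca \<boxtimes> (cx \<bullet> v'))"
      by (simp del: strictify_simps(5,13-15) S.ten_assoc)
    also have "i \<boxtimes> (i \<boxtimes> v) \<boxtimes> v = (i \<boxtimes> i) \<boxtimes> (v \<boxtimes> v)"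
      by (simp del: strictify_simps(5,13-15))
    also have "(i \<boxtimes> Swap ?S [a] xs \<boxtimes> Ident ?S xs) \<bullet>
        ((i \<boxtimes> i) \<boxtimes> (v \<boxtimes> v)) \<bullet> (ca \<boxtimes> (cx \<bullet> v'))
      = (i \<boxtimes> Swap ?S [a] xs \<boxtimes> Ident ?S xs) \<bullet>
        (ca \<boxtimes> ((v \<boxtimes> v) \<bullet> cx \<bullet> v'))"
      by (subst S.interchange) (simp_all del: strictify_simps(5,9,13-15))
    also have "(v \<boxtimes> v) \<bullet> cx \<bullet> v' = Copy ?S xs"
      unfolding v_def v'_def cx_def using strictify_copy_flatten[of xs] by (simp only: assms)
    finally show ?thesis by (simp only: i_def ca_def)
  qed
qed

text \<open>Induction on \<open>xs\<close>: splitting off the head leaves two ways of shuffling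
  \<open>a a xs xs ys ys\<close>, which \<open>S.middle_swap_assoc\<close> identifies.\<close>

lemma strictify_copy_append:
  assumes "xs \<in> lists (Ob C)" and [simp]: "ys \<in> lists (Ob C)"
  shows "Copy (strictify C) (xs @ ys) =
    (Ident (strictify C) xs \<boxtimes> Swap (strictify C) xs ys \<boxtimes>
      Ident (strictify C) ys) \<bullet>
    (Copy (strictify C) xs \<boxtimes> Copy (strictify C) ys)"
proof -
  interpret S: strict_symmetric "strictify C" by (rule strict_symmetric_strictify)
  let ?S = "strictify C"
  let ?i = "Ident ?S" and ?c = "Copy ?S" and ?s = "Swap ?S"
  have c [simp]: "?c zs \<in> Ar ?S" "Src ?S (?c zs) = zs" "Tgt ?S (?c zs) = zs @ zs" if "zs \<in> lists (Ob C)" for zs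
    using that by simp_all
  show ?thesis
    using assms(1)
  proof (induction xs)
    case Nil
    have "?c [] = ?i []"
      using disc_unique[of "Lunit C (Unit C) \<cdot> Copy C (Unit C)"] disc_unique[of "Ident C (Unit C)"] by simp
    then show ?case by (simp del: strictify_simps(5,9,13-15))
  next
    case (Cons a xs)
    then have [simp]: "a \<in> Ob C" "xs \<in> lists (Ob C)" by auto
    have "?c (a # xs @ ys) = (?i [a] \<boxtimes> ?s [a] (xs @ ys) \<boxtimes> ?i (xs @ ys)) \<bullet>
        (?c [a] \<boxtimes> ((?i xs \<boxtimes> ?s xs ys \<boxtimes> ?i ys) \<bullet> (?c xs \<boxtimes> ?c ys)))"
      using strictify_copy_Cons[of a "xs @ ys"] Cons.IH by (simp del: strictify_simps(5,9,13-15))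
    also have "\<dots> = ((?i [a] \<boxtimes> ?s [a] (xs @ ys) \<boxtimes> ?i (xs @ ys)) \<bullet>
        (?i ([a] @ [a] @ xs) \<boxtimes> ?s xs ys \<boxtimes> ?i ys)) \<bullet> (?c [a] \<boxtimes> ?c xs \<boxtimes> ?c ys)"
    proof -
      have "?i ([a] @ [a] @ xs) \<boxtimes> ?s xs ys \<boxtimes> ?i ys
          = (?i [a] \<boxtimes> ?i [a]) \<boxtimes> (?i xs \<boxtimes> ?s xs ys \<boxtimes> ?i ys)"
      proof -
        have "?i ([a] @ [a] @ xs) = (?i [a] \<boxtimes> ?i [a]) \<boxtimes> ?i xs"
          by (simp del: strictify_simps(5,9,13-15))
        then show ?thesis by (simp del: strictify_simps(5,9,13-15) S.ten_ident)
      qed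
      then show ?thesis
        by (simp del: strictify_simps(5,9,13-15) S.ten_assoc)
    qed
    also have "\<dots> = ((?i ([a] @ xs) \<boxtimes> ?s ([a] @ xs) ys \<boxtimes> ?i ys) \<bullet>
        (?i [a] \<boxtimes> ?s [a] xs \<boxtimes> ?i (xs @ ys @ ys))) \<bullet> (?c [a] \<boxtimes> ?c xs \<boxtimes> ?c ys)"
      by (subst S.middle_swap_assoc[of "[a]" "[a]" xs xs ys ys])
        (simp_all del: strictify_simps(5,9,13-15))
    also have "\<dots> = (?i ([a] @ xs) \<boxtimes> ?s ([a] @ xs) ys \<boxtimes> ?i ys) \<bullet>
        (((?i [a] \<boxtimes> ?s [a] xs \<boxtimes> ?i xs) \<bullet> (?c [a] \<boxtimes> ?c xs)) \<boxtimes> ?c ys)"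
    proof -
      have "?i [a] \<boxtimes> ?s [a] xs \<boxtimes> ?i (xs @ ys @ ys)
          = (?i [a] \<boxtimes> ?s [a] xs \<boxtimes> ?i xs) \<boxtimes> ?i (ys @ ys)"
        by (simp flip: S.ten_ident del: strictify_simps(5,9,13-15))
      moreover have "?c [a] \<boxtimes> ?c xs \<boxtimes> ?c ys = (?c [a] \<boxtimes> ?c xs) \<boxtimes> ?c ys"
        by (simp del: strictify_simps(5,9,13-15))
      ultimately show ?thesis
        by (simp del: strictify_simps(5,9,13-15) S.ten_assoc)
    qed
    also have "(?i [a] \<boxtimes> ?s [a] xs \<boxtimes> ?i xs) \<bullet> (?c [a] \<boxtimes> ?c xs) = ?c (a # xs)"
      by (rule strictify_copy_Cons[symmetric]) simp_all
    finally show ?case by (simp del: strictify_simps(5,9,13-15))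
  qed
qed

lemma strict_markov_strictify: "strict_markov (strictify C)"
proof -
  interpret S: strict_symmetric "strictify C" by (rule strict_symmetric_strictify)
  show ?thesis
  proof (unfold_locales, goal_cases)
    case (4 f)
    then show ?case using disc_unique[of "fst (snd f)"] by (cases f) auto
  next
    case (8 xs)
    let ?J = "join C" and ?X = "tlist C xs"
    have [simp]: "xs \<in> lists (Ob C)" using 8 by simp
    have "(?J (xs @ xs) xs \<cdot> (?J xs xs \<otimes> Ident C ?X)) \<cdot> (Copy C ?X \<otimes> Ident C ?X) \<cdot> Copy C ?X
        = ?J xs (xs @ xs) \<cdot> (Ident C ?X \<otimes> ?J xs xs) \<cdot> Assoc C ?X ?X ?X \<cdot> (Copy C ?X \<otimes> Ident C ?X) \<cdot> Copy C ?X"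
      by (subst join_assoc) simp_all
    then show ?case by (simp add: copy_assoc)
  next
    case (9 xs)
    then show ?case using copy_counit[of "tlist C xs"] by simp
  next
    case (10 xs)
    then show ?case using copy_commute[of "tlist C xs"] by simp
  next
    case (11 xs ys)
    then show ?case using strictify_copy_append by simp
  qed auto
qed

text \<open>Copies and tensor products in the strictification both end in the same invertible
  \<open>join\<close>, which cancels from the equation.\<close>

lemma deterministic_strictify_iff:
  "(xs, f, ys) \<in> Ar (strictify C) \<Longrightarrow> deterministic (strictify C) (xs, f, ys) \<longleftrightarrow> deterministic C f"
proof -
  assume "(xs, f, ys) \<in> Ar (strictify C)"
  then have [simp]: "xs \<in> lists (Ob C)" "ys \<in> lists (Ob C)" "f \<in> Ar C" "Src C f = tlist C xs" "Tgt C f = tlist C ys"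
    by auto
  have "join C ys ys \<cdot> Copy C (tlist C ys) \<cdot> f = join C ys ys \<cdot> (f \<otimes> f) \<cdot> Copy C (tlist C xs)
      \<Longrightarrow> Copy C (tlist C ys) \<cdot> f = (f \<otimes> f) \<cdot> Copy C (tlist C xs)"
    by (rule iso_cancel_left[of "join C ys ys"]) simp_all
  then show ?thesis by (auto simp: deterministic_def)
qed

declare strictify_simps [simp del]

end

section \<open>Pairing and deterministic morphisms in a strict Markov category\<close>

context strict_markov
begin

text \<open>The joint channel that runs \<open>f\<close> and \<open>g\<close> independently on a
  shared input. A Markov category need not have products, but deterministic morphisms behave towards
  this operation as they would towards the pairing of a product, see
  \<open>pairing_cmp_det\<close>.\<close>

definition pairing :: "'b \<Rightarrow> 'b \<Rightarrow> 'b" (infixr "\<triangle>" 60) where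
  "f \<triangle> g = (f \<otimes> g) \<cdot> Copy K (Src K f)"

lemma pairing_typing [simp]:
  assumes "f \<in> Ar K" "g \<in> Ar K" "Src K g = Src K f"
  shows "f \<triangle> g \<in> Ar K" "Src K (f \<triangle> g) = Src K f" "Tgt K (f \<triangle> g) = Tgt K f @ Tgt K g"
  using assms by (simp_all add: pairing_def)

lemma disc_cmp [simp]: "\<lbrakk>f \<in> Ar K; Tgt K f = b\<rbrakk> \<Longrightarrow> Disc K b \<cdot> f = Disc K (Src K f)"
  using terminal[of "Disc K b \<cdot> f"] by auto

lemma disc_nil [simp]: "Disc K [] = Ident K []"
  using terminal[of "Ident K []"] by simp

lemma disc_ten [simp]: "\<lbrakk>a \<in> Ob K; b \<in> Ob K\<rbrakk> \<Longrightarrow> Disc K a \<otimes> Disc K b = Disc K (a @ b)"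
  using terminal[of "Disc K a \<otimes> Disc K b"] by simp

lemma copy_counit_right [simp]:
  assumes [simp]: "a \<in> Ob K"
  shows "(Ident K a \<otimes> Disc K a) \<cdot> Copy K a = Ident K a"
proof -
  have "(Ident K a \<otimes> Disc K a) \<cdot> Copy K a = (Ident K a \<otimes> Disc K a) \<cdot> Swap K a a \<cdot> Copy K a"
    by simp
  also have "\<dots> = Swap K [] a \<cdot> (Disc K a \<otimes> Ident K a) \<cdot> Copy K a"
    using cmp_extend[OF swap_nat[of "Disc K a" "Ident K a" "[]" a], of "Copy K a"] by simp
  also have "\<dots> = Ident K a" by simp
  finally show ?thesis .
qed

lemma copy_nil [simp]: "Copy K [] = Ident K []"
  using terminal[of "Copy K []"] by simp

lemma ten_pairing [simp]:
  "\<lbrakk>f \<in> Ar K; g \<in> Ar K; Src K g = Src K f; h \<in> Ar K; k \<in> Ar K; Src K h = Tgt K f; Src K k = Tgt K g\<rbrakk>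
    \<Longrightarrow> (h \<otimes> k) \<cdot> (f \<triangle> g) = (h \<cdot> f) \<triangle> (k \<cdot> g)"
  by (simp add: pairing_def)

lemma disc_pairing [simp]:
  assumes "f \<in> Ar K" "Src K f = a"
  shows "Disc K a \<triangle> f = f" "f \<triangle> Disc K a = f"
proof -
  have "(Disc K a \<otimes> f) = f \<cdot> (Disc K a \<otimes> Ident K a)" "(f \<otimes> Disc K a) = f \<cdot> (Ident K a \<otimes> Disc K a)"
    using assms ten_split_left[of "f" "Disc K a"] interchange[of "Disc K a" "Ident K []" "Ident K a" f]
      interchange[of "Ident K a" f "Disc K a" "Ident K []"] by auto
  then show "Disc K a \<triangle> f = f" "f \<triangle> Disc K a = f"
    using assms by (auto simp: pairing_def)
qed

lemma pairing_nil [simp]: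
  assumes "f \<in> Ar K" "g \<in> Ar K" "Src K g = Src K f"
  shows "Tgt K f = [] \<Longrightarrow> f \<triangle> g = g" "Tgt K g = [] \<Longrightarrow> f \<triangle> g = f"
  using assms terminal[of f] terminal[of g] disc_pairing by metis+

lemma swap_pairing:
  "\<lbrakk>f \<in> Ar K; g \<in> Ar K; Src K g = Src K f; Tgt K f = a; Tgt K g = b\<rbrakk>
    \<Longrightarrow> Swap K a b \<cdot> (f \<triangle> g) = g \<triangle> f"
  using cmp_extend[OF swap_nat[of f g a b], of "Copy K (Src K f)"] swap_typing[of a b]
  by (auto simp: pairing_def)

lemma pairing_assoc [simp]:
  assumes [simp]: "f \<in> Ar K" "g \<in> Ar K" "h \<in> Ar K" "Src K g = Src K f" "Src K h = Src K f"
  shows "(f \<triangle> g) \<triangle> h = f \<triangle> (g \<triangle> h)"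
proof -
  let ?a = "Src K f"
  have "(f \<triangle> g) \<triangle> h = ((f \<otimes> g) \<otimes> h) \<cdot> (Copy K ?a \<otimes> Ident K ?a) \<cdot> Copy K ?a"
    unfolding pairing_def by (subst interchange_cmp) simp_all
  also have "\<dots> = (f \<otimes> (g \<otimes> h)) \<cdot> (Ident K ?a \<otimes> Copy K ?a) \<cdot> Copy K ?a"
    by (simp add: copy_assoc del: interchange_cmp)
  also have "\<dots> = f \<triangle> (g \<triangle> h)"
    unfolding pairing_def by simp
  finally show ?thesis .
qed

text \<open>The input is copied to \<open>a b a b\<close> up to the middle swap; each factor takes
  its own part of one copy and the remaining wires are discarded. This expresses tensor products
  through pairings.\<close>

lemma pairing_disc_ten:
  assumes [simp]: "f \<in> Ar K" "g \<in> Ar K" and "Src K f = a" "Src K g = b"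
  shows "(f \<otimes> Disc K b) \<triangle> (Disc K a \<otimes> g) = f \<otimes> g"
proof -
  have [simp]: "Src K f = a" "Src K g = b" "a \<in> Ob K" "b \<in> Ob K"
    using assms src_Ob by auto
  have "(f \<otimes> Disc K b) \<triangle> (Disc K a \<otimes> g)
      = (f \<otimes> ((Disc K b \<otimes> Disc K a) \<otimes> g)) \<cdot> (Ident K a \<otimes> Swap K a b \<otimes> Ident K b) \<cdot> (Copy K a \<otimes> Copy K b)"
    by (simp add: pairing_def copy_append del: interchange interchange_cmp disc_ten)
  also have "\<dots> = ((f \<otimes> Disc K a) \<otimes> (Disc K b \<otimes> g)) \<cdot> (Copy K a \<otimes> Copy K b)"
  proof -
    have "(f \<otimes> Disc K a) \<otimes> (Disc K b \<otimes> g) = f \<otimes> (Disc K (a @ b) \<otimes> g)"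
      by (simp flip: disc_ten)
    then show ?thesis by (simp del: ten_assoc)
  qed
  also have "\<dots> = (f \<triangle> Disc K a) \<otimes> (Disc K b \<triangle> g)"
    unfolding pairing_def by (subst interchange) simp_all
  also have "\<dots> = f \<otimes> g" by simp
  finally show ?thesis .
qed

abbreviation "det \<equiv> deterministic K"

lemma det_Ar: "det f \<Longrightarrow> f \<in> Ar K"
  by (simp add: deterministic_def)

lemma copy_cmp_det: "\<lbrakk>det f; Tgt K f = b\<rbrakk> \<Longrightarrow> Copy K b \<cdot> f = (f \<otimes> f) \<cdot> Copy K (Src K f)"
  by (auto simp: deterministic_def)

text \<open>For a random \<open>h\<close> the left side shares one outcome between \<open>f\<close>
  and \<open>g\<close>, while the right side draws two. Determinism says precisely that copying the
  outcome of \<open>h\<close> equals running \<open>h\<close> twice.\<close>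

lemma pairing_cmp_det:
  assumes "det h" and [simp]: "f \<in> Ar K" "g \<in> Ar K" "Src K f = Tgt K h" "Src K g = Tgt K h"
  shows "(f \<triangle> g) \<cdot> h = (f \<cdot> h) \<triangle> (g \<cdot> h)"
proof -
  have [simp]: "h \<in> Ar K" using assms(1) by (rule det_Ar)
  show ?thesis by (simp add: pairing_def copy_cmp_det[OF assms(1)])
qed

lemma det_ident [simp]: "a \<in> Ob K \<Longrightarrow> det (Ident K a)"
  by (simp add: deterministic_def)

lemma det_disc [simp]: "a \<in> Ob K \<Longrightarrow> det (Disc K a)"
  using terminal[of "(Disc K a \<otimes> Disc K a) \<cdot> Copy K a"] by (simp add: deterministic_def)

lemma det_cmp [simp]:
  assumes "det f" "det g" "Src K g = Tgt K f"
  shows "det (g \<cdot> f)"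
  unfolding deterministic_def
proof
  have [simp]: "f \<in> Ar K" "g \<in> Ar K" using assms det_Ar by auto
  show "g \<cdot> f \<in> Ar K" using assms by simp
  have "Copy K (Tgt K (g \<cdot> f)) \<cdot> g \<cdot> f = (g \<otimes> g) \<cdot> Copy K (Src K g) \<cdot> f"
    using cmp_extend[OF copy_cmp_det[OF assms(2)], of "Tgt K g" f] assms(3) by simp
  then show "Copy K (Tgt K (g \<cdot> f)) \<cdot> g \<cdot> f = ((g \<cdot> f) \<otimes> (g \<cdot> f)) \<cdot> Copy K (Src K (g \<cdot> f))"
    using assms by (simp add: copy_cmp_det)
qed

text \<open>The copy of a tensor product contains a middle swap, and naturality of the symmetry
  carries \<open>f\<close> and \<open>g\<close> past it.\<close>

lemma det_ten [simp]:
  assumes "det f" "det g"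
  shows "det (f \<otimes> g)"
  unfolding deterministic_def
proof
  have [simp]: "f \<in> Ar K" "g \<in> Ar K" using assms det_Ar by auto
  show "f \<otimes> g \<in> Ar K" by simp
  let ?a = "Src K f" and ?b = "Src K g" and ?c = "Tgt K f" and ?d = "Tgt K g" and ?i = "Ident K"
  have "Copy K (?c @ ?d) \<cdot> (f \<otimes> g) = (?i ?c \<otimes> Swap K ?c ?d \<otimes> ?i ?d) \<cdot> ((Copy K ?c \<cdot> f) \<otimes> (Copy K ?d \<cdot> g))"
    by (simp add: copy_append)
  also have "\<dots> = (?i ?c \<otimes> Swap K ?c ?d \<otimes> ?i ?d) \<cdot> (f \<otimes> (f \<otimes> g) \<otimes> g) \<cdot> (Copy K ?a \<otimes> Copy K ?b)"
    using assms ten_assoc interchange[of "Copy K ?a" "f \<otimes> f" "Copy K ?b" "g \<otimes> g", symmetric]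
    by (simp add: copy_cmp_det del: interchange interchange_cmp)
  also have "\<dots> = (f \<otimes> (Swap K ?c ?d \<cdot> (f \<otimes> g)) \<otimes> g) \<cdot> (Copy K ?a \<otimes> Copy K ?b)"
    by (subst interchange_cmp; (subst interchange)?) simp_all
  also have "\<dots> = (f \<otimes> ((g \<otimes> f) \<cdot> Swap K ?a ?b) \<otimes> g) \<cdot> (Copy K ?a \<otimes> Copy K ?b)"
    by (simp only: swap_nat \<open>f \<in> Ar K\<close> \<open>g \<in> Ar K\<close>)
  also have "\<dots> = (f \<otimes> (g \<otimes> f) \<otimes> g) \<cdot> (?i ?a \<otimes> Swap K ?a ?b \<otimes> ?i ?b) \<cdot> (Copy K ?a \<otimes> Copy K ?b)"
    by (subst interchange_cmp; (subst interchange)?) simp_all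
  also have "\<dots> = ((f \<otimes> g) \<otimes> (f \<otimes> g)) \<cdot> Copy K (?a @ ?b)"
    by (simp add: copy_append del: interchange interchange_cmp)
  finally show "Copy K (Tgt K (f \<otimes> g)) \<cdot> (f \<otimes> g) = ((f \<otimes> g) \<otimes> (f \<otimes> g)) \<cdot> Copy K (Src K (f \<otimes> g))"
    by simp
qed

text \<open>Copying twice yields four equal wires. In the form \<open>mid\<close> the two middle
  ones come from a single copy, so commutativity absorbs the swap introduced by
  \<open>copy_append\<close>.\<close>

lemma det_copy [simp]:
  assumes [simp]: "a \<in> Ob K"
  shows "det (Copy K a)"
  unfolding deterministic_def
proof
  let ?i = "Ident K a" and ?c = "Copy K a"
  have mid: "(?c \<otimes> ?c) \<cdot> ?c = (?i \<otimes> ((?c \<otimes> ?i) \<cdot> ?c)) \<cdot> ?c"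
  proof -
    have "(?c \<otimes> ?c) \<cdot> ?c = ((?i \<otimes> ?i) \<otimes> ?c) \<cdot> (?c \<otimes> ?i) \<cdot> ?c" by (simp del: ten_assoc)
    also have "\<dots> = (?i \<otimes> (?i \<otimes> ?c)) \<cdot> (?i \<otimes> ?c) \<cdot> ?c" by (simp add: copy_assoc del: ten_ident interchange_cmp)
    finally show ?thesis by (simp add: copy_assoc)
  qed
  have "Copy K (a @ a) \<cdot> ?c = (?i \<otimes> (Swap K a a \<otimes> ?i)) \<cdot> (?c \<otimes> ?c) \<cdot> ?c"
    by (simp add: copy_append del: interchange interchange_cmp)
  also have "\<dots> = (?i \<otimes> (((Swap K a a \<cdot> ?c) \<otimes> ?i) \<cdot> ?c)) \<cdot> ?c"
    unfolding mid by (simp del: copy_commute)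
  also have "\<dots> = (?c \<otimes> ?c) \<cdot> ?c" unfolding mid by simp
  finally show "Copy K (Tgt K ?c) \<cdot> ?c = (?c \<otimes> ?c) \<cdot> Copy K (Src K ?c)" by simp
qed simp

lemma det_pairing [simp]: "\<lbrakk>det f; det g; Src K g = Src K f\<rbrakk> \<Longrightarrow> det (f \<triangle> g)"
  using det_Ar by (simp add: pairing_def)

lemma pairing_projections:
  "\<lbrakk>a \<in> Ob K; b \<in> Ob K\<rbrakk> \<Longrightarrow> (Ident K a \<otimes> Disc K b) \<triangle> (Disc K a \<otimes> Ident K b) = Ident K (a @ b)"
  by (simp add: pairing_disc_ten)

lemma swap_eq_pairing:
  assumes [simp]: "a \<in> Ob K" "b \<in> Ob K"
  shows "Swap K a b = (Disc K a \<otimes> Ident K b) \<triangle> (Ident K a \<otimes> Disc K b)"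
  using swap_pairing[of "Ident K a \<otimes> Disc K b" "Disc K a \<otimes> Ident K b" a b]
  by (simp add: pairing_projections)

text \<open>Determinism of \<open>f\<close> gives the equation after precomposition with
  \<open>f\<close>, which is then cancelled.\<close>

lemma det_inverse_of:
  assumes "det f" "iso K f"
  shows "det (inverse_of K f)"
  unfolding deterministic_def
proof
  let ?g = "inverse_of K f"
  have [simp]: "iso K f" "f \<in> Ar K" using assms by auto
  show "?g \<in> Ar K" by simp
  have "(Copy K (Src K f) \<cdot> ?g) \<cdot> f = ((?g \<otimes> ?g) \<cdot> Copy K (Tgt K f)) \<cdot> f"
    using assms(1) by (simp add: copy_cmp_det)
  then have "Copy K (Src K f) \<cdot> ?g = (?g \<otimes> ?g) \<cdot> Copy K (Tgt K f)"
    by (rule iso_cancel_right[rotated]) simp_all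
  then show "Copy K (Tgt K ?g) \<cdot> ?g = (?g \<otimes> ?g) \<cdot> Copy K (Src K ?g)"
    by simp
qed

end

section \<open>Wiring diagrams\<close>

declare wire.simps(2) [simp del]

context strict_markov
begin

lemma list_tensor_ob_eq [simp]: "list_tensor_ob K as = concat as"
  by (induction as) (simp_all add: list_tensor_ob_def)

lemma concat_Ob [simp]: "concat as \<in> Ob K \<longleftrightarrow> set as \<subseteq> Ob K"
  by (induction as) simp_all

lemma list_tensor_ar_Nil [simp]: "list_tensor_ar K [] = Ident K []"
  by (simp add: list_tensor_ar_def)

lemma list_tensor_ar_Cons [simp]: "list_tensor_ar K (f # fs) = f \<otimes> list_tensor_ar K fs"
  by (simp add: list_tensor_ar_def)

lemma list_tensor_ar_typing [simp]:
  assumes "set fs \<subseteq> Ar K"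
  shows "list_tensor_ar K fs \<in> Ar K" "Src K (list_tensor_ar K fs) = concat (map (Src K) fs)"
    "Tgt K (list_tensor_ar K fs) = concat (map (Tgt K) fs)"
proof -
  have "list_tensor_ar K fs \<in> Ar K \<and> Src K (list_tensor_ar K fs) = concat (map (Src K) fs) \<and>
      Tgt K (list_tensor_ar K fs) = concat (map (Tgt K) fs)"
    using assms by (induction fs) simp_all
  then show "list_tensor_ar K fs \<in> Ar K" "Src K (list_tensor_ar K fs) = concat (map (Src K) fs)"
    "Tgt K (list_tensor_ar K fs) = concat (map (Tgt K) fs)" by auto
qed

lemma list_tensor_ar_append:
  "\<lbrakk>set fs \<subseteq> Ar K; set gs \<subseteq> Ar K\<rbrakk>
    \<Longrightarrow> list_tensor_ar K (fs @ gs) = list_tensor_ar K fs \<otimes> list_tensor_ar K gs"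
  by (induction fs) simp_all

lemma det_list_tensor_ar: "(\<And>f. f \<in> set fs \<Longrightarrow> det f) \<Longrightarrow> det (list_tensor_ar K fs)"
  by (induction fs) simp_all

lemma iso_list_tensor_ar: "(\<And>f. f \<in> set fs \<Longrightarrow> iso K f) \<Longrightarrow> iso K (list_tensor_ar K fs)"
  by (induction fs) simp_all

lemma list_tensor_ar_cmp:
  assumes "\<And>x. x \<in> set xs \<Longrightarrow> f x \<in> Ar K" "\<And>x. x \<in> set xs \<Longrightarrow> g x \<in> Ar K"
    "\<And>x. x \<in> set xs \<Longrightarrow> Src K (g x) = Tgt K (f x)"
  shows "list_tensor_ar K (map g xs) \<cdot> list_tensor_ar K (map f xs) = list_tensor_ar K (map (\<lambda>x. g x \<cdot> f x) xs)"
  using assms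
proof (induction xs)
  case (Cons x xs)
  have [simp]: "concat (map (Src K \<circ> g) xs) = concat (map (Tgt K \<circ> f) xs)"
    using Cons.prems(3) by (intro arg_cong[of _ _ concat] map_cong) auto
  have "set (map f xs) \<subseteq> Ar K" "set (map g xs) \<subseteq> Ar K" using Cons.prems by auto
  then show ?case using Cons by simp
qed simp

lemma proj_typing [simp]:
  assumes "ob ` set xs \<subseteq> Ob K"
  shows "proj K ob xs y \<in> Ar K" "Src K (proj K ob xs y) = concat (map ob xs)"
    "Tgt K (proj K ob xs y) = (if y \<in> set xs then ob y else [])"
proof -
  have "proj K ob xs y \<in> Ar K \<and> Src K (proj K ob xs y) = concat (map ob xs) \<and>
      Tgt K (proj K ob xs y) = (if y \<in> set xs then ob y else [])"
    using assms by (induction xs) auto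
  then show "proj K ob xs y \<in> Ar K" "Src K (proj K ob xs y) = concat (map ob xs)"
    "Tgt K (proj K ob xs y) = (if y \<in> set xs then ob y else [])" by auto
qed

lemma wire_typing:
  "ob ` set xs \<subseteq> Ob K \<Longrightarrow> wire K ob xs ys \<in> Ar K \<and> Src K (wire K ob xs ys) = concat (map ob xs)"
  by (induction ys) (simp_all add: wire.simps(2))

lemma wire_simps [simp]:
  assumes "ob ` set xs \<subseteq> Ob K"
  shows "wire K ob xs ys \<in> Ar K" "Src K (wire K ob xs ys) = concat (map ob xs)"
    "wire K ob xs (y # ys) = proj K ob xs y \<triangle> wire K ob xs ys"
  using wire_typing[OF assms] assms by (simp_all add: wire.simps(2) pairing_def)

lemma wire_Tgt [simp]:
  "\<lbrakk>ob ` set xs \<subseteq> Ob K; set ys \<subseteq> set xs\<rbrakk> \<Longrightarrow> Tgt K (wire K ob xs ys) = concat (map ob ys)"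
  by (induction ys) simp_all

lemma det_proj [simp]: "ob ` set xs \<subseteq> Ob K \<Longrightarrow> det (proj K ob xs y)"
  by (induction xs) auto

lemma det_wire [simp]: "ob ` set xs \<subseteq> Ob K \<Longrightarrow> det (wire K ob xs ys)"
  by (induction ys) simp_all

lemma wire_append:
  "ob ` set xs \<subseteq> Ob K \<Longrightarrow> wire K ob xs (ys @ zs) = wire K ob xs ys \<triangle> wire K ob xs zs"
  by (induction ys) simp_all

lemma proj_wire:
  assumes "y \<in> set ys" "set ys \<subseteq> set ws" and [simp]: "ob ` set ws \<subseteq> Ob K"
  shows "proj K ob ys y \<cdot> wire K ob ws ys = proj K ob ws y"
proof -
  have [simp]: "ob y \<in> Ob K" using assms by blast
  show ?thesis
    using assms(1,2)
  proof (induction ys)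
    case (Cons x ys)
    have [simp]: "ob ` set ys \<subseteq> Ob K" "ob x \<in> Ob K" using Cons.prems(2) assms(3) by fastforce+
    show ?case using Cons by (cases "x = y") auto
  qed simp
qed

text \<open>Following names through two diagrams in turn is following them through one. All parts
  are deterministic, so precomposition distributes over the pairings of which \<open>wire\<close> is
  built. Composition of permutations and of marginalizations are both instances.\<close>

lemma wire_wire:
  assumes "set zs \<subseteq> set ys" "set ys \<subseteq> set ws" and [simp]: "ob ` set ws \<subseteq> Ob K"
  shows "wire K ob ys zs \<cdot> wire K ob ws ys = wire K ob ws zs"
proof -
  have [simp]: "ob ` set ys \<subseteq> Ob K" using assms(2,3) by blast
  show ?thesis using assms(1)
    by (induction zs) (use assms(2) in \<open>simp_all add: pairing_cmp_det proj_wire\<close>)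
qed

lemma ten_disc_eq:
  assumes "f \<in> Ar K" "b \<in> Ob K"
  shows "f \<otimes> Disc K b = f \<cdot> (Ident K (Src K f) \<otimes> Disc K b)" "Disc K b \<otimes> f = f \<cdot> (Disc K b \<otimes> Ident K (Src K f))"
  using assms interchange[of "Ident K (Src K f)" f "Disc K b" "Ident K []"]
    interchange[of "Disc K b" "Ident K []" "Ident K (Src K f)" f] by simp_all

lemma proj_append_left:
  "\<lbrakk>ob ` set xs \<subseteq> Ob K; ob ` set zs \<subseteq> Ob K; y \<in> set xs\<rbrakk>
    \<Longrightarrow> proj K ob (xs @ zs) y = proj K ob xs y \<otimes> Disc K (concat (map ob zs))"
  by (induction xs) auto

lemma proj_append_right:
  "\<lbrakk>ob ` set xs \<subseteq> Ob K; ob ` set zs \<subseteq> Ob K; y \<notin> set xs\<rbrakk>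
    \<Longrightarrow> proj K ob (xs @ zs) y = Disc K (concat (map ob xs)) \<otimes> proj K ob zs y"
  by (induction xs) (auto simp flip: disc_ten)

lemma wire_append_left:
  assumes [simp]: "ob ` set xs \<subseteq> Ob K" "ob ` set zs \<subseteq> Ob K" and "set ys \<subseteq> set xs"
  shows "wire K ob (xs @ zs) ys = wire K ob xs ys \<otimes> Disc K (concat (map ob zs))"
  using assms(3)
proof (induction ys)
  case (Cons y ys)
  let ?p = "Ident K (concat (map ob xs)) \<otimes> Disc K (concat (map ob zs))"
  have "wire K ob (xs @ zs) (y # ys) = (proj K ob xs y \<cdot> ?p) \<triangle> (wire K ob xs ys \<cdot> ?p)"
    using Cons ten_disc_eq(1)[of "proj K ob xs y" "concat (map ob zs)"]
      ten_disc_eq(1)[of "wire K ob xs ys" "concat (map ob zs)"]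
    by (simp add: proj_append_left image_Un)
  also have "\<dots> = (proj K ob xs y \<triangle> wire K ob xs ys) \<cdot> ?p"
    by (simp add: pairing_cmp_det)
  finally show ?case
    using ten_disc_eq(1)[of "proj K ob xs y \<triangle> wire K ob xs ys" "concat (map ob zs)"] by simp
qed simp

lemma wire_append_right:
  assumes [simp]: "ob ` set xs \<subseteq> Ob K" "ob ` set zs \<subseteq> Ob K" and "set ys \<inter> set xs = {}"
  shows "wire K ob (xs @ zs) ys = Disc K (concat (map ob xs)) \<otimes> wire K ob zs ys"
  using assms(3)
proof (induction ys)
  case (Cons y ys)
  let ?p = "Disc K (concat (map ob xs)) \<otimes> Ident K (concat (map ob zs))"
  have "wire K ob (xs @ zs) (y # ys) = (proj K ob zs y \<cdot> ?p) \<triangle> (wire K ob zs ys \<cdot> ?p)"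
    using Cons ten_disc_eq(2)[of "proj K ob zs y" "concat (map ob xs)"]
      ten_disc_eq(2)[of "wire K ob zs ys" "concat (map ob xs)"]
    by (simp add: proj_append_right image_Un)
  also have "\<dots> = (proj K ob zs y \<triangle> wire K ob zs ys) \<cdot> ?p"
    by (simp add: pairing_cmp_det)
  finally show ?case
    using ten_disc_eq(2)[of "proj K ob zs y \<triangle> wire K ob zs ys" "concat (map ob xs)"] by simp
qed simp

text \<open>Since \<open>proj\<close> picks the first wire carrying a name, \<open>vs\<close> has to
  avoid \<open>xs\<close> for its wires to start in the second block.\<close>

lemma wire_ten:
  assumes "ob ` set xs \<subseteq> Ob K" "ob ` set zs \<subseteq> Ob K" "set ys \<subseteq> set xs" "set vs \<inter> set xs = {}"
  shows "wire K ob (xs @ zs) (ys @ vs) = wire K ob xs ys \<otimes> wire K ob zs vs"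
  using assms
  by (simp add: wire_append image_Un wire_append_left wire_append_right pairing_disc_ten)

lemma wire_self:
  "\<lbrakk>distinct xs; ob ` set xs \<subseteq> Ob K\<rbrakk> \<Longrightarrow> wire K ob xs xs = Ident K (concat (map ob xs))"
proof (induction xs)
  case (Cons x xs)
  then show ?case
    using wire_ten[where ob = ob and xs = "[x]" and ys = "[x]" and zs = xs and vs = xs] by simp
qed simp

lemma iso_wire:
  assumes "distinct xs" "distinct ys" "set xs = set ys" "ob ` set xs \<subseteq> Ob K"
  shows "inverse_arrows K (wire K ob xs ys) (wire K ob ys xs)"
  using assms by (intro inverse_arrowsI) (simp_all add: wire_wire wire_self)

text \<open>Copies and discards commute with deterministic morphisms, so the components slide from
  the inputs of a diagram to its outputs and are duplicated or dropped on the way. Applied to the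
  \<open>\<tau>\<close> components, it moves a marginalization from the high to the low
  level.\<close>

lemma wire_natural:
  assumes t: "\<And>x. x \<in> set xs \<Longrightarrow> det (t x)" "\<And>x. x \<in> set xs \<Longrightarrow> Src K (t x) = obA x"
      "\<And>x. x \<in> set xs \<Longrightarrow> Tgt K (t x) = obB x"
    and "set ys \<subseteq> set xs"
  shows "wire K obB xs ys \<cdot> list_tensor_ar K (map t xs) = list_tensor_ar K (map t ys) \<cdot> wire K obA xs ys"
proof -
  have Ar: "t ` set zs \<subseteq> Ar K" "concat (map (Src K \<circ> t) zs) = concat (map obA zs)"
      "concat (map (Tgt K \<circ> t) zs) = concat (map obB zs)" if "set zs \<subseteq> set xs" for zs
    using that by (auto intro!: arg_cong[of _ _ concat] map_cong simp: t det_Ar subset_iff)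
  have Ob_t: "obA x \<in> Ob K" "obB x \<in> Ob K" if "x \<in> set xs" for x
    using src_Ob[of "t x"] tgt_Ob[of "t x"] t[OF that] det_Ar by auto
  then have Ob: "obA ` set zs \<subseteq> Ob K" "obB ` set zs \<subseteq> Ob K" if "set zs \<subseteq> set xs" for zs
    using that by auto
  have D: "det (list_tensor_ar K (map t xs))" by (rule det_list_tensor_ar) (use t in auto)
  note [simp] = Ar[OF subset_refl] Ob[OF subset_refl]
  \<comment> \<open>For a single projection all components but one are absorbed by discards.\<close>
  have p: "proj K obB zs y \<cdot> list_tensor_ar K (map t zs) = t y \<cdot> proj K obA zs y"
    if "y \<in> set zs" "set zs \<subseteq> set xs" for y zs
    using that
  proof (induction zs)
    case (Cons z zs)
    then have [simp]: "z \<in> set xs" "t z \<in> Ar K" "Src K (t z) = obA z" "Tgt K (t z) = obB z" and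
       zs: "set zs \<subseteq> set xs" using t det_Ar by auto
    note [simp] = Ar[OF zs] Ob[OF zs]
    have [simp]: "obA z \<in> Ob K" "obB z \<in> Ob K" using Ob_t[of z] by auto
    have [simp]: "y \<in> set zs \<Longrightarrow> t y \<in> Ar K" "y \<in> set zs \<Longrightarrow> Src K (t y) = obA y" using zs t det_Ar by auto
    show ?case
    proof (cases "z = y")
      case True
      then have y: "y = z" by simp
      show ?thesis unfolding y
        using interchange[of "Ident K (obA z)" "t z" "Disc K (concat (map obA zs))" "Ident K []"] by simp
    next
      case False
      then show ?thesis using Cons
        interchange[of "Disc K (obA z)" "Ident K []" "proj K obA zs y" "t y"] by auto
    qed
  qed simp
  show ?thesis using assms(4)
  proof (induction ys)
    case (Cons y ys)
    then have ys: "set ys \<subseteq> set xs" and [simp]: "t y \<in> Ar K" "Src K (t y) = obA y" "y \<in> set xs"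
      using t det_Ar by auto
    note [simp] = Ar[OF ys] Ob[OF ys]
    show ?case using Cons.IH[OF ys] ys D p[of y xs] by (simp add: pairing_cmp_det)
  qed simp
qed

text \<open>High-level names carrying blocks of low-level wires form a diagram of low-level names.
  Disjointness ensures that a low-level name determines its block, and distinctness within a block
  makes a block passed on unchanged an identity.\<close>

lemma wire_block:
  assumes p: "\<And>x. x \<in> set xs \<Longrightarrow> distinct (p x)"
    "\<And>x y. \<lbrakk>x \<in> set xs; y \<in> set xs; x \<noteq> y\<rbrakk> \<Longrightarrow> set (p x) \<inter> set (p y) = {}"
    "\<And>x. x \<in> set xs \<Longrightarrow> ob ` set (p x) \<subseteq> Ob K"
    and "set ys \<subseteq> set xs"
  shows "wire K (\<lambda>x. concat (map ob (p x))) xs ys = wire K ob (concat (map p xs)) (concat (map p ys))"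
proof -
  let ?o = "\<lambda>x. concat (map ob (p x))"
  have Ob: "?o ` set zs \<subseteq> Ob K" "ob ` set (concat (map p zs)) \<subseteq> Ob K" if "set zs \<subseteq> set xs" for zs
    using p(3) that by (auto simp: image_subset_iff subset_iff)
  have cc: "concat (map ob (concat (map p zs))) = concat (map ?o zs)" for zs
    by (induction zs) simp_all
  have *: "proj K ?o zs y = wire K ob (concat (map p zs)) (p y)" if "y \<in> set zs" "set zs \<subseteq> set xs" for zs y
    using that
  proof (induction zs)
    case (Cons z zs)
    then have zs: "set zs \<subseteq> set xs" and z: "z \<in> set xs" by auto
    note [simp] = Ob[OF zs]
    have [simp]: "ob ` set (p z) \<subseteq> Ob K" using p(3) z by auto
    show ?case
    proof (cases "z = y")
      case True
      moreover have "ob ` set (p y) \<subseteq> Ob K" using p(3) z True by auto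
      ultimately show ?thesis using p(1)[OF z] wire_append_left[of ob "p z" "concat (map p zs)" "p y"] Ob[OF zs]
        by (simp add: wire_self cc)
    next
      case False
      then have "set (p y) \<inter> set (p z) = {}" using p(2)[of y z] Cons z by auto
      then show ?thesis using False Cons wire_append_right[of ob "p z" "concat (map p zs)" "p y"] Ob[OF zs]
        by simp
    qed
  qed simp
  note [simp] = Ob[OF subset_refl]
  show ?thesis using assms(4)
  proof (induction ys)
    case Nil
    show ?case by (simp add: cc)
  next
    case (Cons y ys)
    then show ?case using Ob[OF subset_refl] by (simp add: wire_append *)
  qed
qed

text \<open>Wires are first distributed into blocks and then rearranged inside each block. The
  blocks may overlap, because all of them are fed from \<open>ws\<close>.\<close>

lemma list_tensor_wires:
  assumes [simp]: "ob ` set ws \<subseteq> Ob K"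
    and "\<And>x. x \<in> set xs \<Longrightarrow> set (q x) \<subseteq> set (p x)" "\<And>x. x \<in> set xs \<Longrightarrow> set (p x) \<subseteq> set ws"
  shows "list_tensor_ar K (map (\<lambda>x. wire K ob (p x) (q x)) xs) \<cdot> wire K ob ws (concat (map p xs))
    = wire K ob ws (concat (map q xs))"
  using assms(2,3)
proof (induction xs)
  case (Cons x xs)
  have Ob: "ob ` set (p y) \<subseteq> Ob K" if "y \<in> set (x # xs)" for y using assms(1) Cons.prems(2)[OF that] by blast
  then have [simp]: "ob ` set (p x) \<subseteq> Ob K" by simp
  have A: "(\<lambda>y. wire K ob (p y) (q y)) ` set xs \<subseteq> Ar K" using Ob by auto
  have S: "concat (map (Src K \<circ> (\<lambda>y. wire K ob (p y) (q y))) zs) = concat (map ob (concat (map p zs)))"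
    if "set zs \<subseteq> set (x # xs)" for zs
    using that by (induction zs) (simp_all add: Ob)
  note S = S[OF set_subset_Cons]
  have "set (concat (map p xs)) \<subseteq> set ws" using Cons.prems by auto
  then show ?case using Cons A S by (simp add: wire_append wire_wire)
qed simp

end

section \<open>Free Markov categories and their interpretations\<close>

lemma wt_lists: "wt Q t \<Longrightarrow> tsrc Q t \<in> lists (types Q) \<and> ttgt Q t \<in> lists (types Q)"
  by (induction t) auto

lemma wt_types:
  assumes "wt Q t"
  shows "x \<in> set (tsrc Q t) \<Longrightarrow> x \<in> types Q" "x \<in> set (ttgt Q t) \<Longrightarrow> x \<in> types Q"
  using wt_lists[OF assms] by auto

lemma teq_wt: "teq Q s t \<Longrightarrow> wt Q s \<and> wt Q t \<and> tsrc Q s = tsrc Q t \<and> ttgt Q s = ttgt Q t"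
  by (induction rule: teq.induct) (simp_all add: wt_lists)

lemma tclass_eq_iff: "wt Q s \<Longrightarrow> tclass Q s = tclass Q t \<longleftrightarrow> teq Q s t"
  unfolding tclass_def using teq.refl teq.sym teq.trans by blast

lemma tclass_eqI: "teq Q s t \<Longrightarrow> tclass Q s = tclass Q t"
  unfolding tclass_def using teq.sym teq.trans by blast

lemma teq_trep: "wt Q t \<Longrightarrow> teq Q t (trep (tclass Q t))"
  unfolding trep_def by (rule someI2[of _ t]) (auto simp: tclass_def intro: teq.refl)

lemma trep_simps [simp]:
  assumes "wt Q t"
  shows "wt Q (trep (tclass Q t))" "tsrc Q (trep (tclass Q t)) = tsrc Q t"
    "ttgt Q (trep (tclass Q t)) = ttgt Q t"
  using teq_wt[OF teq_trep[OF assms]] by auto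

lemma free_markov_simps [simp]:
  "Ob (free_markov Q) = lists (types Q)"
  "wt Q t \<Longrightarrow> tclass Q t \<in> Ar (free_markov Q)"
  "wt Q t \<Longrightarrow> Src (free_markov Q) (tclass Q t) = tsrc Q t"
  "wt Q t \<Longrightarrow> Tgt (free_markov Q) (tclass Q t) = ttgt Q t"
  "Ident (free_markov Q) xs = tclass Q (TId xs)"
  "\<lbrakk>wt Q s; wt Q t; tsrc Q t = ttgt Q s\<rbrakk> \<Longrightarrow> tclass Q t \<cdot>\<^bsub>free_markov Q\<^esub> tclass Q s = tclass Q (TCmp t s)"
  "\<lbrakk>wt Q s; wt Q t\<rbrakk> \<Longrightarrow> tclass Q s \<otimes>\<^bsub>free_markov Q\<^esub> tclass Q t = tclass Q (TTen s t)"
  "Unit (free_markov Q) = []" "TenO (free_markov Q) = (@)"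
  "Assoc (free_markov Q) xs ys zs = tclass Q (TId (xs @ ys @ zs))"
  "Lunit (free_markov Q) xs = tclass Q (TId xs)"
  "Runit (free_markov Q) xs = tclass Q (TId xs)"
  "Swap (free_markov Q) xs ys = tclass Q (TSwap xs ys)"
  "Copy (free_markov Q) xs = tclass Q (TCopy xs)"
  "Disc (free_markov Q) xs = tclass Q (TDisc xs)"
  by (auto simp: free_markov_def tclass_eq_iff intro!: teq.cong_cmp teq.cong_ten teq.sym[OF teq_trep])

lemma free_markov_Ar_E:
  assumes "c \<in> Ar (free_markov Q)"
  obtains t where "wt Q t" "c = tclass Q t"
  using assms by (auto simp: free_markov_def)

lemma trep_Ar:
  assumes "c \<in> Ar (free_markov Q)"
  shows "wt Q (trep c)" "tclass Q (trep c) = c" "tsrc Q (trep c) = Src (free_markov Q) c"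
    "ttgt Q (trep c) = Tgt (free_markov Q) c"
  using assms by (auto elim!: free_markov_Ar_E intro!: tclass_eqI[OF teq.sym[OF teq_trep]])

lemma category_free_markov: "category (free_markov Q)"
proof (unfold_locales, goal_cases)
  case (5 f a b)
  then show ?case
    by (clarsimp simp: in_hom_iff wt_lists elim!: free_markov_Ar_E)
        (rule tclass_eqI, rule teq.id_left, simp_all)
next
  case (6 f a b)
  then show ?case
    by (clarsimp simp: in_hom_iff wt_lists elim!: free_markov_Ar_E)
        (rule tclass_eqI, rule teq.id_right, simp_all)
next
  case (7 f a b g c h d)
  then show ?case
    by (clarsimp simp: in_hom_iff wt_lists elim!: free_markov_Ar_E)
        (rule tclass_eqI, rule teq.cmp_assoc, simp_all)
qed (auto simp: in_hom_iff elim!: free_markov_Ar_E dest: wt_types)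

lemma strict_markov_free_markov: "strict_markov (free_markov Q)"
proof -
  interpret category "free_markov Q" by (rule category_free_markov)
  show ?thesis
  proof (unfold_locales, goal_cases)
    case (11 a b)
    then show ?case by (simp add: tclass_eq_iff teq.ten_id)
  next
    case (12 f g f' g')
    then show ?case
      by (clarsimp simp: in_hom_iff wt_lists elim!: free_markov_Ar_E)
        (rule tclass_eqI, rule teq.sym[OF teq.ten_cmp], simp_all)
  next
    case (13 f g h)
    then show ?case
      by (clarsimp simp: in_hom_iff wt_lists elim!: free_markov_Ar_E)
        (rule tclass_eqI, rule teq.ten_assoc, simp_all)
  next
    case (14 f)
    then show ?case
      by (clarsimp simp: in_hom_iff wt_lists elim!: free_markov_Ar_E)
        (rule tclass_eqI, rule teq.ten_unit_left, simp_all)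
  next
    case (15 f)
    then show ?case
      by (clarsimp simp: in_hom_iff wt_lists elim!: free_markov_Ar_E)
        (rule tclass_eqI, rule teq.ten_unit_right, simp_all)
  next
    case (19 f g a b)
    then show ?case
      by (clarsimp simp: in_hom_iff wt_lists elim!: free_markov_Ar_E)
        (rule tclass_eqI, rule teq.swap_natural, simp_all)
  next
    case (20 a b)
    then show ?case by (simp add: tclass_eq_iff teq.swap_swap)
  next
    case (21 a b c)
    then show ?case by (simp add: tclass_eq_iff teq.hexagon)
  next
    \<comment> \<open>The term axioms only make discards natural. Terminality of the empty list
      follows by discarding an empty target, which is the identity by
      \<open>teq.disc_unit\<close>.\<close>
    case (25 f)
    have "teq Q t (TDisc (tsrc Q t))" if "wt Q t" "ttgt Q t = []" for t
    proof -
      have "teq Q (TCmp (TId []) t) t" using that teq.id_left[of Q t] by simp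
      moreover have "teq Q (TCmp (TId []) t) (TCmp (TDisc []) t)"
        using that by (auto intro!: teq.cong_cmp teq.refl teq.sym[OF teq.disc_unit])
      moreover have "teq Q (TCmp (TDisc []) t) (TDisc (tsrc Q t))"
        using that teq.disc_natural[of Q t] by simp
      ultimately show ?thesis by (blast intro: teq.sym teq.trans)
    qed
    then show ?case using 25 by (clarsimp elim!: free_markov_Ar_E) (rule tclass_eqI, simp)
  next
    case (29 a)
    then show ?case by (simp add: tclass_eq_iff teq.copy_assoc)
  next
    case (30 a)
    then show ?case by (simp add: tclass_eq_iff teq.copy_counit)
  next
    case (31 a)
    then show ?case by (simp add: tclass_eq_iff teq.copy_commute)
  next
    case (32 a b)
    then show ?case by (simp add: tclass_eq_iff teq.copy_tensor)
  qed (auto elim!: free_markov_Ar_E dest: wt_types)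
qed


text \<open>A version of \<open>interp\<close> in which a type may go to a whole list and the target
  is any strict category. It yields models when \<open>K\<close> is \<open>strictify C\<close>, and
  functors when \<open>K\<close> is another free category.\<close>

primrec interp_in ::
  "('a list, 'm) mcat \<Rightarrow> ('t \<Rightarrow> 'a list) \<Rightarrow> ('g \<Rightarrow> 'm) \<Rightarrow> ('t, 'g) trm \<Rightarrow> 'm" where
  "interp_in K ob g (TId xs) = Ident K (concat (map ob xs))"
| "interp_in K ob g (TGen q) = g q"
| "interp_in K ob g (TCmp t s) = interp_in K ob g t \<cdot>\<^bsub>K\<^esub> interp_in K ob g s"
| "interp_in K ob g (TTen s t) = interp_in K ob g s \<otimes>\<^bsub>K\<^esub> interp_in K ob g t"
| "interp_in K ob g (TSwap xs ys) = Swap K (concat (map ob xs)) (concat (map ob ys))"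
| "interp_in K ob g (TCopy xs) = Copy K (concat (map ob xs))"
| "interp_in K ob g (TDisc xs) = Disc K (concat (map ob xs))"

text \<open>Objects are mapped entrywise by \<open>ob\<close>, so all structure morphisms are
  identities. Preservation of discards is derived from terminality.\<close>

locale strict_functor = A: strict_markov A + B: strict_markov B
  for A :: "('a list, 'm) mcat" and B :: "('b list, 'n) mcat" +
  fixes ob :: "'a \<Rightarrow> 'b list" and F :: "'m \<Rightarrow> 'n"
  assumes ob_Ob [simp]: "a \<in> Ob A \<Longrightarrow> ob ` set a \<subseteq> Ob B"
    and typing [simp]: "f \<in> Ar A \<Longrightarrow> F f \<in> Ar B"
      "f \<in> Ar A \<Longrightarrow> Src B (F f) = concat (map ob (Src A f))"
      "f \<in> Ar A \<Longrightarrow> Tgt B (F f) = concat (map ob (Tgt A f))"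
    and ident [simp]: "a \<in> Ob A \<Longrightarrow> F (Ident A a) = Ident B (concat (map ob a))"
    and cmp [simp]: "\<lbrakk>f \<in> Ar A; g \<in> Ar A; Src A g = Tgt A f\<rbrakk> \<Longrightarrow> F (g \<cdot>\<^bsub>A\<^esub> f) = F g \<cdot>\<^bsub>B\<^esub> F f"
    and ten [simp]: "\<lbrakk>f \<in> Ar A; g \<in> Ar A\<rbrakk> \<Longrightarrow> F (f \<otimes>\<^bsub>A\<^esub> g) = F f \<otimes>\<^bsub>B\<^esub> F g"
    and swap [simp]: "\<lbrakk>a \<in> Ob A; b \<in> Ob A\<rbrakk>
        \<Longrightarrow> F (Swap A a b) = Swap B (concat (map ob a)) (concat (map ob b))"
    and copy [simp]: "a \<in> Ob A \<Longrightarrow> F (Copy A a) = Copy B (concat (map ob a))"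
begin

lemma disc [simp]: "a \<in> Ob A \<Longrightarrow> F (Disc A a) = Disc B (concat (map ob a))"
  using B.terminal[of "F (Disc A a)"] by simp

lemma pairing: "\<lbrakk>f \<in> Ar A; g \<in> Ar A; Src A g = Src A f\<rbrakk>
    \<Longrightarrow> F (A.pairing f g) = B.pairing (F f) (F g)"
  by (simp add: A.pairing_def B.pairing_def)

lemma Ob_image: "o' ` set xs \<subseteq> Ob A \<Longrightarrow> (\<lambda>x. concat (map ob (o' x))) ` set xs \<subseteq> Ob B"
proof clarify
  fix x assume "o' ` set xs \<subseteq> Ob A" "x \<in> set xs"
  then have "o' x \<in> Ob A" by auto
  then show "concat (map ob (o' x)) \<in> Ob B" by simp
qed

lemma concat_map_ob: "concat (map ob (concat (map o' xs))) = concat (map (\<lambda>x. concat (map ob (o' x))) xs)"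
  by (induction xs) simp_all

lemma map_proj:
  "o' ` set xs \<subseteq> Ob A \<Longrightarrow> F (proj A o' xs y) = proj B (\<lambda>x. concat (map ob (o' x))) xs y"
  by (induction xs) (auto simp: concat_map_ob)

lemma map_wire:
  "o' ` set xs \<subseteq> Ob A \<Longrightarrow> F (wire A o' xs ys) = wire B (\<lambda>x. concat (map ob (o' x))) xs ys"
proof (induction ys)
  case (Cons y ys)
  then show ?case using Ob_image[OF Cons.prems] by (simp add: pairing map_proj)
qed (simp add: concat_map_ob)

lemma map_list_tensor_ar:
  "set fs \<subseteq> Ar A \<Longrightarrow> F (list_tensor_ar A fs) = list_tensor_ar B (map F fs)"
  by (induction fs) simp_all

lemma map_iso:
  assumes "iso A f"
  shows "inverse_arrows B (F f) (F (inverse_of A f))"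
  using assms by (intro B.inverse_arrowsI) (simp_all flip: cmp)

end

text \<open>\<open>wt Q (TGen q)\<close> selects the generators whose input and output lists consist
  of types of \<open>Q\<close>; these are the ones that give morphisms of the free category.\<close>

locale term_interpretation = strict_markov +
  fixes Q :: "('t, 'g) signature" and ob :: "'t \<Rightarrow> 'a list" and g :: "'g \<Rightarrow> 'b"
  assumes ob_Ob: "t \<in> types Q \<Longrightarrow> ob t \<in> Ob K"
    and gen_typing: "wt Q (TGen q) \<Longrightarrow> g q \<in> Ar K \<and> Src K (g q) = concat (map ob (gsrc Q q)) \<and>
      Tgt K (g q) = concat (map ob (gtgt Q q))"
begin

lemma ob_image [simp]: "xs \<in> lists (types Q) \<Longrightarrow> ob ` set xs \<subseteq> Ob K"
  using ob_Ob by auto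

lemma interp_in_typing:
  "wt Q t \<Longrightarrow> interp_in K ob g t \<in> Ar K \<and> Src K (interp_in K ob g t) = concat (map ob (tsrc Q t)) \<and>
    Tgt K (interp_in K ob g t) = concat (map ob (ttgt Q t))"
proof (induction t)
  case (TGen q)
  then show ?case using gen_typing[of q] by simp
qed auto

lemma interp_in_simps [simp]:
  assumes "wt Q t"
  shows "interp_in K ob g t \<in> Ar K" "Src K (interp_in K ob g t) = concat (map ob (tsrc Q t))"
    "Tgt K (interp_in K ob g t) = concat (map ob (ttgt Q t))"
  using interp_in_typing[OF assms] by auto

lemmas swap_append = hexagon and copy_coassoc = copy_assoc

text \<open>Soundness: each rule of \<open>teq\<close> is a law of strict Markov categories, so the
  interpretation is well defined on classes of terms.\<close>

lemma interp_in_teq: "teq Q s t \<Longrightarrow> interp_in K ob g s = interp_in K ob g t"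
proof (induction rule: teq.induct)
  case (swap_natural f h)
  then show ?case by (simp add: swap_nat)
next
  case (hexagon xs ys zs)
  then show ?case using ob_image by (simp add: swap_append)
next
  case (copy_assoc xs)
  then show ?case using ob_image by (simp add: copy_coassoc)
next
  case (copy_tensor xs ys)
  then show ?case using ob_image by (simp add: copy_append)
qed simp_all

lemma interp_in_trep: "wt Q t \<Longrightarrow> interp_in K ob g (trep (tclass Q t)) = interp_in K ob g t"
  using interp_in_teq[OF teq_trep] by simp

text \<open>The existence half of the universal property of the free Markov category.\<close>

sublocale strict_functor "free_markov Q" K ob "\<lambda>c. interp_in K ob g (trep c)"
proof -
  interpret A: strict_markov "free_markov Q" by (rule strict_markov_free_markov)
  show "strict_functor (free_markov Q) K ob (\<lambda>c. interp_in K ob g (trep c))"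
    by unfold_locales (auto simp: interp_in_trep elim!: free_markov_Ar_E)
qed

end

section \<open>Channels of causal models\<close>

declare free_markov_simps(5,10-15) [simp del]

text \<open>Induction on \<open>xs\<close>: the tail is permuted into \<open>as @ bs\<close>, and
  then the head is moved past \<open>as\<close> by one symmetry.\<close>

lemma ex_perm_term:
  assumes "mset xs = mset ys" "set xs \<subseteq> types Q"
  shows "\<exists>t. perm_term t \<and> wt Q t \<and> tsrc Q t = xs \<and> ttgt Q t = ys"
  using assms
proof (induction xs arbitrary: ys)
  case Nil
  then show ?case by (intro exI[of _ "TId []"]) simp
next
  case (Cons x xs)
  then have "x \<in> set ys" by (metis list.set_intros(1) set_mset_mset)
  then obtain as bs where ys: "ys = as @ x # bs" by (meson split_list)
  then have "mset xs = mset (as @ bs)" using Cons.prems by simp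
  moreover have "set (as @ bs) \<subseteq> types Q"
    using Cons.prems ys by (metis calculation mset_eq_setD set_subset_Cons subset_trans)
  ultimately obtain t where t: "perm_term t" "wt Q t" "tsrc Q t = xs" "ttgt Q t = as @ bs"
    using Cons.IH[of "as @ bs"] Cons.prems by auto
  then show ?case
    using ys Cons.prems \<open>set (as @ bs) \<subseteq> types Q\<close>
    by (intro exI[of _ "TCmp (TTen (TSwap [x] as) (TId bs)) (TTen (TId [x]) t)"]) auto
qed

lemma perm_term_mset: "perm_term t \<Longrightarrow> wt Q t \<Longrightarrow> mset (ttgt Q t) = mset (tsrc Q t)"
  by (induction t) auto

text \<open>The diagram starts from an arbitrary list \<open>ws\<close> for the sake of the tensor
  case: each factor handles only some of the wires, but both are fed from the same
  \<open>ws\<close>.\<close>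

lemma perm_term_cmp_wire:
  assumes "perm_term t" "wt Q t" "set (tsrc Q t) \<subseteq> set ws" and ws: "set ws \<subseteq> types Q"
  shows "tclass Q t \<cdot>\<^bsub>free_markov Q\<^esub> wire (free_markov Q) (\<lambda>x. [x]) ws (tsrc Q t)
    = wire (free_markov Q) (\<lambda>x. [x]) ws (ttgt Q t)"
proof -
  interpret strict_markov "free_markov Q" by (rule strict_markov_free_markov)
  have [simp]: "(\<lambda>x. [x]) ` set xs \<subseteq> lists (types Q)" if "set xs \<subseteq> types Q" for xs
    using that by auto
  note [simp] = this[OF ws]
  show ?thesis
    using assms(1-3)
  proof (induction t)
    case (TId xs)
    then show ?case by (simp flip: free_markov_simps(5))
  next
    case (TCmp s t)
    have "mset (ttgt Q t) = mset (tsrc Q t)" using TCmp.prems by (intro perm_term_mset) auto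
    then have st: "set (ttgt Q t) = set (tsrc Q t)" by (rule mset_eq_setD)
    have "tclass Q (TCmp s t) = tclass Q s \<cdot>\<^bsub>free_markov Q\<^esub> tclass Q t"
      using TCmp.prems by simp
    moreover have "tclass Q s \<in> Ar (free_markov Q)" "Src (free_markov Q) (tclass Q s) = tsrc Q s"
      "tclass Q t \<in> Ar (free_markov Q)" "Src (free_markov Q) (tclass Q t) = tsrc Q t"
      "Tgt (free_markov Q) (tclass Q t) = ttgt Q t"
      using TCmp.prems by auto
    ultimately show ?case using TCmp st by (simp del: free_markov_simps(6))
  next
    case (TTen s t)
    have "tclass Q (TTen s t) = tclass Q s \<otimes>\<^bsub>free_markov Q\<^esub> tclass Q t"
      using TTen.prems by simp
    then show ?case using TTen by (simp add: wire_append del: free_markov_simps(7))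
  next
    case (TSwap xs ys)
    then show ?case by (simp add: wire_append swap_pairing flip: free_markov_simps(13))
  qed auto
qed

text \<open>For distinct names the diagram from \<open>xs\<close> to itself is the identity, so a
  permutation morphism is determined by its source and target. With a repeated name there could be
  several between the same lists.\<close>

lemma perms_eq_wire:
  assumes "p \<in> perms Q xs ys" "distinct xs"
  shows "p = wire (free_markov Q) (\<lambda>x. [x]) xs ys" "mset ys = mset xs"
proof -
  interpret strict_markov "free_markov Q" by (rule strict_markov_free_markov)
  obtain t where t: "p = tclass Q t" "wt Q t" "perm_term t" "tsrc Q t = xs" "ttgt Q t = ys"
    using assms(1) by (auto simp: perms_def)
  then have xs: "set xs \<subseteq> types Q" using wt_types(1)[of Q t] by blast
  then have [simp]: "(\<lambda>x. [x]) ` set xs \<subseteq> lists (types Q)" by auto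
  show "mset ys = mset xs" using perm_term_mset t by blast
  show "p = wire (free_markov Q) (\<lambda>x. [x]) xs ys"
    using perm_term_cmp_wire[of t Q xs] t xs assms(2) by (simp add: wire_self)
qed

lemma wire_in_perms:
  assumes "distinct xs" "distinct ys" "set xs = set ys" "set xs \<subseteq> types Q"
  shows "wire (free_markov Q) (\<lambda>x. [x]) xs ys \<in> perms Q xs ys"
proof -
  have "mset xs = mset ys" using assms set_eq_iff_mset_eq_distinct by blast
  then obtain t where "perm_term t" "wt Q t" "tsrc Q t = xs" "ttgt Q t = ys"
    using ex_perm_term assms(4) by blast
  then have "tclass Q t \<in> perms Q xs ys" by (auto simp: perms_def)
  then show ?thesis using perms_eq_wire(1) assms(1) by metis
qed

section \<open>Runnable lists of boxes and topological orders\<close>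

lemma list_of [simp]: "finite A \<Longrightarrow> distinct (list_of A)" "finite A \<Longrightarrow> set (list_of A) = A"
  using someI_ex[OF finite_distinct_list[of A]] by (auto simp: list_of_def conj_commute)

text \<open>The condition, for \<open>A = set cs\<close>, under which \<open>run C M cs xs\<close>
  is well typed and creates no wire twice. It depends on the open wires only as a set and is
  therefore insensitive to reordering \<open>cs\<close>.\<close>

primrec runnable :: "('v, 'z) open_dag_scheme \<Rightarrow> 'v set \<Rightarrow> 'v list \<Rightarrow> bool" where
  "runnable M A [] \<longleftrightarrow> True"
| "runnable M A (x # xs) \<longleftrightarrow> x \<in> nins M \<and> x \<notin> A \<and> parents M x \<subseteq> A \<and> runnable M (insert x A) xs"

lemma runnable_append: "runnable M A (xs @ ys) \<longleftrightarrow> runnable M A xs \<and> runnable M (A \<union> set xs) ys"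
  by (induction xs arbitrary: A) auto

lemma runnable_D:
  "runnable M A xs \<Longrightarrow> distinct xs \<and> set xs \<inter> A = {} \<and> set xs \<subseteq> nins M \<and> (\<forall>x \<in> set xs. parents M x \<subseteq> A \<union> set xs)"
proof (induction xs arbitrary: A)
  case (Cons x xs)
  then show ?case using Cons.IH[of "insert x A"] by auto
qed simp

lemma runnable_remove:
  "\<lbrakk>runnable M (insert y A) xs; \<forall>x \<in> set xs. y \<notin> parents M x\<rbrakk> \<Longrightarrow> runnable M A xs"
proof (induction xs arbitrary: A)
  case (Cons x xs)
  then show ?case using Cons.IH[of "insert x A"] by (auto simp: insert_commute)
qed simp

lemma runnable_Cons_snoc:
  "\<lbrakk>runnable M A (y # xs); \<forall>x \<in> set xs. y \<notin> parents M x\<rbrakk> \<Longrightarrow> runnable M A (xs @ [y])"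
  using runnable_D[of M "insert y A" xs] runnable_remove[of M y A xs] by (auto simp: runnable_append)

text \<open>Sortedness excludes edges from a later entry to an earlier one, and acyclicity excludes
  loops; hence the parents that occur in the list come strictly earlier.\<close>

lemma sorted_runnable:
  assumes "acyclic (edges M)" "sorted_wrt (\<lambda>x y. (y, x) \<notin> edges M) xs" "distinct xs" "set xs \<inter> A = {}"
    "set xs \<subseteq> nins M" "\<forall>x \<in> set xs. parents M x \<subseteq> A \<union> set xs"
  shows "runnable M A xs"
  using assms(2-)
proof (induction xs arbitrary: A)
  case (Cons x xs)
  have "(x, x) \<notin> edges M" using assms(1) by (meson acyclic_def r_into_trancl')
  then show ?case using Cons.prems Cons.IH[of "insert x A"] by (auto simp: parents_def)
qed simp

text \<open>A sink within \<open>A\<close> exists because the converse of a finite acyclic relation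
  is well-founded; it is placed last.\<close>

lemma ex_topological_order:
  assumes "finite A" "finite E" "acyclic E"
  shows "\<exists>xs. distinct xs \<and> set xs = A \<and> sorted_wrt (\<lambda>x y. (y, x) \<notin> E) xs"
  using assms(1)
proof (induction A rule: finite_psubset_induct)
  case (psubset A)
  show ?case
  proof (cases "A = {}")
    case False
    have "wf (E\<inverse>)" using assms by (simp add: finite_acyclic_wf_converse)
    then obtain m where m: "m \<in> A" "\<And>x. (m, x) \<in> E \<Longrightarrow> x \<notin> A"
      using False by (metis converse_iff wf_eq_minimal ex_in_conv)
    then obtain xs where "distinct xs" "set xs = A - {m}" "sorted_wrt (\<lambda>x y. (y, x) \<notin> E) xs"
      using psubset.IH[of "A - {m}"] by auto
    then show ?thesis using m by (intro exI[of _ "xs @ [m]"]) (auto simp: sorted_wrt_append)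
  qed simp
qed

lemma topological_order:
  assumes "open_dag M" "A \<subseteq> verts M"
  shows "distinct (topological_order M A)" "set (topological_order M A) = A"
    "sorted_wrt (\<lambda>x y. (y, x) \<notin> edges M) (topological_order M A)"
proof -
  have "finite A" "finite (edges M)" "acyclic (edges M)"
    using assms unfolding open_dag_def by (auto intro: finite_subset)
  then show "distinct (topological_order M A)" "set (topological_order M A) = A"
    "sorted_wrt (\<lambda>x y. (y, x) \<notin> edges M) (topological_order M A)"
    using someI_ex[OF ex_topological_order] unfolding topological_order_def by blast+
qed

section \<open>Rewriting the string diagrams of a causal model\<close>

locale markov_model = markov_category C for C :: "('o, 'm) mcat" +
  fixes M :: "('v, 'o, 'm) causal_model"
  assumes model: "causal_model C M"
begin

sublocale S: strict_markov "strictify C" by (rule strict_markov_strictify)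

lemma Ob_strictify [simp]: "Ob (strictify C) = lists (Ob C)"
  by (rule strictify_simps)

lemma dag: "open_dag M"
  using model by (simp add: causal_model_def)

lemma finite_verts: "finite (verts M)"
  using dag by (simp add: open_dag_def)

lemma ins_verts: "ins M \<subseteq> verts M"
  using dag by (simp add: open_dag_def)

lemma nins_verts: "nins M \<subseteq> verts M"
  by (auto simp: nins_def)

lemma parents_verts: "parents M x \<subseteq> verts M"
  using dag by (auto simp: open_dag_def parents_def)

lemma finite_parents [simp]: "finite (parents M x)"
  using parents_verts finite_verts finite_subset by blast

lemma val_Ob: "x \<in> verts M \<Longrightarrow> val M x \<in> Ob C"
  using model by (simp add: causal_model_def)

lemma val_image [simp]:
  "A \<subseteq> verts M \<Longrightarrow> (\<lambda>x. [val M x]) ` A \<subseteq> lists (Ob C)"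
  "A \<subseteq> verts M \<Longrightarrow> val M ` A \<subseteq> Ob C"
  by (auto intro!: val_Ob)

lemma map_val_Ob [simp]: "set xs \<subseteq> verts M \<Longrightarrow> map (val M) xs \<in> lists (Ob C)"
  by (auto intro!: val_Ob)

abbreviation "W \<equiv> wireM C M"

text \<open>The layer that \<open>run\<close> adds for one box, phrased with
  \<open>S.pairing\<close> so that the calculus of pairings applies.\<close>

definition step :: "'v list \<Rightarrow> 'v \<Rightarrow> 'o list \<times> 'm \<times> 'o list" where
  "step cs x = S.pairing (Ident (strictify C) (map (val M) cs))
     ((map (val M) (list_of (parents M x)), mech M x, [val M x]) \<bullet> W cs (list_of (parents M x)))"

lemma box_typing:
  assumes "x \<in> nins M"
  shows "(map (val M) (list_of (parents M x)), mech M x, [val M x]) \<in> Ar (strictify C)"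
  using model assms parents_verts[of x] nins_verts val_Ob
  by (auto simp: causal_model_def in_hom_iff strictify_simps)

lemma box_Src_Tgt [simp]:
  "Src (strictify C) (xs, f, ys) = xs" "Tgt (strictify C) (xs, f, ys) = ys"
  by (simp_all add: strictify_simps)

lemma step_typing [simp]:
  assumes "set cs \<subseteq> verts M" "x \<in> nins M" "parents M x \<subseteq> set cs"
  shows "step cs x \<in> Ar (strictify C)" "Src (strictify C) (step cs x) = map (val M) cs"
    "Tgt (strictify C) (step cs x) = map (val M) (cs @ [x])"
  using assms box_typing[OF assms(2)] by (simp_all add: step_def)

lemma run_Cons [simp]:
  "set cs \<subseteq> verts M \<Longrightarrow> run C M cs (x # xs) = run C M (cs @ [x]) xs \<bullet> step cs x"
  by (simp add: step_def S.pairing_def)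

declare run.simps(2) [simp del]

lemma run_typing:
  assumes "runnable M (set cs) xs" "set cs \<subseteq> verts M"
  shows "run C M cs xs \<in> Ar (strictify C) \<and> Src (strictify C) (run C M cs xs) = map (val M) cs \<and>
    Tgt (strictify C) (run C M cs xs) = map (val M) (cs @ xs)"
  using assms
proof (induction xs arbitrary: cs)
  case (Cons x xs)
  then have "set (cs @ [x]) \<subseteq> verts M" using nins_verts by auto
  moreover have "runnable M (set (cs @ [x])) xs" using Cons.prems by simp
  ultimately show ?case using Cons.IH[of "cs @ [x]"] Cons.prems by simp
qed simp

lemma run_simps [simp]:
  assumes "runnable M (set cs) xs" "set cs \<subseteq> verts M"
  shows "run C M cs xs \<in> Ar (strictify C)" "Src (strictify C) (run C M cs xs) = map (val M) cs"
    "Tgt (strictify C) (run C M cs xs) = map (val M) cs @ map (val M) xs"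
  using run_typing[OF assms] by auto

lemma run_append:
  assumes "runnable M (set cs) (xs @ ys)" "set cs \<subseteq> verts M"
  shows "run C M cs (xs @ ys) = run C M (cs @ xs) ys \<bullet> run C M cs xs"
  using assms
proof (induction xs arbitrary: cs)
  case (Cons x xs)
  then have 1: "set (cs @ [x]) \<subseteq> verts M" using nins_verts by auto
  have 2: "runnable M (set (cs @ [x])) (xs @ ys)" using Cons.prems by simp
  have 3: "runnable M (set (cs @ [x])) xs" "runnable M (set ((cs @ [x]) @ xs)) ys" "set xs \<subseteq> verts M"
    using 2 runnable_D[of M "insert x (set cs)" xs] nins_verts by (auto simp: runnable_append insert_commute)
  show ?case using Cons.IH[OF 2 1] 1 3 Cons.prems by simp
next
  case Nil
  then show ?case by simp
qed

text \<open>The box reads only its parents, which are still present in \<open>cs'\<close>, so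
  permuting or dropping open wires may take place before or after it.\<close>

lemma step_equivariant:
  assumes "set cs' \<subseteq> set cs" "set cs \<subseteq> verts M" "x \<in> nins M" "x \<notin> set cs" "parents M x \<subseteq> set cs'"
  shows "step cs' x \<bullet> W cs cs' = W (cs @ [x]) (cs' @ [x]) \<bullet> step cs x"
proof -
  have [simp]: "set cs' \<subseteq> verts M" "x \<in> verts M" using assms nins_verts by auto
  have "W (cs @ [x]) (cs' @ [x]) = W cs cs' \<boxtimes> Ident (strictify C) [val M x]"
    using assms S.wire_ten[where ob = "\<lambda>x. [val M x]" and xs = cs and zs = "[x]" and ys = cs' and vs = "[x]"] val_Ob
    by simp
  moreover have "parents M x \<subseteq> set cs" "[val M x] \<in> lists (Ob C)" using assms val_Ob nins_verts by auto
  ultimately show ?thesis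
    using assms box_typing[OF assms(3)]
    by (simp add: step_def S.pairing_cmp_det S.wire_wire del: S.wire_simps(3))
qed

lemma run_equivariant:
  assumes "set cs' \<subseteq> set cs" "set cs \<subseteq> verts M" "runnable M (set cs) xs" "runnable M (set cs') xs"
  shows "run C M cs' xs \<bullet> W cs cs' = W (cs @ xs) (cs' @ xs) \<bullet> run C M cs xs"
  using assms
proof (induction xs arbitrary: cs cs')
  case Nil
  then have "set cs' \<subseteq> verts M" by auto
  then show ?case using Nil by simp
next
  case (Cons x xs)
  let ?cs = "cs @ [x]" and ?cs' = "cs' @ [x]"
  have 1: "set ?cs' \<subseteq> set ?cs" "set ?cs \<subseteq> verts M" "runnable M (set ?cs) xs" "runnable M (set ?cs') xs"
    using Cons.prems nins_verts by auto
  then have 2: "set cs \<subseteq> verts M" "set cs' \<subseteq> verts M" "set ?cs' \<subseteq> verts M" "set xs \<subseteq> verts M" "x \<in> verts M"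
    using runnable_D[of M "set ?cs" xs] nins_verts by auto
  have vx: "[val M x] \<in> lists (Ob C)" using val_Ob 2 by auto
  have 3: "x \<in> nins M" "x \<notin> set cs" "parents M x \<subseteq> set cs'" "parents M x \<subseteq> set cs"
    using Cons.prems by auto
  have "run C M cs' (x # xs) \<bullet> W cs cs'
      = run C M ?cs' xs \<bullet> step cs' x \<bullet> W cs cs'"
    using 1 2 3 Cons.prems by simp
  also have "\<dots> = (run C M ?cs' xs \<bullet> W ?cs ?cs') \<bullet> step cs x"
    using 1 2 3 Cons.prems vx
    by (subst step_equivariant) (simp_all del: S.wire_simps(3))
  also have "\<dots> = W (?cs @ xs) (?cs' @ xs) \<bullet> run C M ?cs xs \<bullet> step cs x"
    using 1 2 3 Cons.prems vx
    by (subst Cons.IH[OF 1]) (auto simp del: S.wire_simps(3))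
  finally show ?case using 2 by simp
qed

text \<open>Boxes whose outputs are all discarded vanish one at a time, because discarding is
  natural.\<close>

lemma wire_run:
  assumes "set ys \<subseteq> set cs" "set cs \<subseteq> verts M" "runnable M (set cs) xs"
  shows "W (cs @ xs) ys \<bullet> run C M cs xs = W cs ys"
  using assms
proof (induction xs arbitrary: cs)
  case Nil
  then show ?case by simp
next
  case (Cons x xs)
  let ?cs = "cs @ [x]"
  have 1: "set ys \<subseteq> set ?cs" "set ?cs \<subseteq> verts M" "runnable M (set ?cs) xs" "x \<in> verts M"
    using Cons.prems nins_verts by auto
  have 2: "set xs \<subseteq> verts M"
    using 1 runnable_D[of M "set ?cs" xs] nins_verts by auto
  have 3: "x \<in> nins M" "parents M x \<subseteq> set cs" "set cs \<subseteq> verts M" "set ys \<subseteq> set cs"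
    using Cons.prems by auto
  have "W (cs @ x # xs) ys \<bullet> run C M cs (x # xs)
      = (W (?cs @ xs) ys \<bullet> run C M ?cs xs) \<bullet> step cs x"
    using 1 2 3 val_Ob by simp
  also have "\<dots> = W ?cs ys \<bullet> step cs x"
    by (subst Cons.IH[OF 1(1-3)]) simp
  also have "\<dots> = W cs ys"
    using S.wire_append_left[where ob = "\<lambda>x. [val M x]" and xs = cs and zs = "[x]" and ys = ys] 1 3 val_Ob
      box_typing[of x]
    by (simp add: step_def)
  finally show ?case .
qed

end

lemmas subset_extend = subset_insertI2 le_supI1 le_supI2

context markov_model
begin

lemma wireM_wireM_cmp:
  assumes "set xs \<subseteq> verts M" "set ys \<subseteq> set xs" "set zs \<subseteq> set ys" "k \<in> Ar (strictify C)"
    "Tgt (strictify C) k = map (val M) xs"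
  shows "W ys zs \<bullet> W xs ys \<bullet> k = W xs zs \<bullet> k"
proof -
  have "set ys \<subseteq> verts M" using assms by auto
  then show ?thesis using assms by (intro S.cmp_extend) (simp_all add: S.wire_wire)
qed


text \<open>Both boxes find their parents in \<open>cs\<close>. Two layers thus become a single
  pairing of the old wires with both boxes, a form symmetric in \<open>x\<close> and
  \<open>y\<close> up to the order of the last two wires.\<close>

lemma step_step:
  assumes "set cs \<subseteq> verts M" "x \<in> nins M" "y \<in> nins M" "parents M x \<subseteq> set cs" "parents M y \<subseteq> set cs"
  shows "step (cs @ [y]) x \<bullet> step cs y =
    S.pairing (Ident (strictify C) (map (val M) cs))
      (S.pairing ((map (val M) (list_of (parents M y)), mech M y, [val M y]) \<bullet> W cs (list_of (parents M y)))
        ((map (val M) (list_of (parents M x)), mech M x, [val M x]) \<bullet> W cs (list_of (parents M x))))"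
    (is "_ = S.pairing ?i (S.pairing ?ky ?kx)")
proof -
  let ?S = "strictify C" and ?cs = "map (val M) cs" and ?y = "[val M y]" and ?x = "[val M x]"
  let ?bx = "(map (val M) (list_of (parents M x)), mech M x, ?x)"
  let ?iy = "Ident ?S ?y" and ?dy = "Disc ?S ?y" and ?dc = "Disc ?S ?cs"
  have yv: "?y \<in> lists (Ob C)" "?x \<in> lists (Ob C)" "y \<in> verts M" "val M y \<in> Ob C" using val_Ob assms nins_verts by auto
  note bx = box_typing[OF assms(2)] box_typing[OF assms(3)]
  define kx where "kx = ?kx"
  define ky where "ky = ?ky"
  have k [simp]: "kx \<in> Ar ?S" "Src ?S kx = ?cs" "Tgt ?S kx = ?x"
    "ky \<in> Ar ?S" "Src ?S ky = ?cs" "Tgt ?S ky = ?y"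
    using assms bx by (simp_all add: kx_def ky_def)
  have "?bx \<bullet> W (cs @ [y]) (list_of (parents M x)) = kx \<boxtimes> ?dy"
    using S.wire_append_left[of "\<lambda>x. [val M x]" cs "[y]" "list_of (parents M x)"] yv assms bx
      S.interchange[of "W cs (list_of (parents M x))" ?bx ?dy "Ident ?S []"]
    by (simp add: kx_def)
  then have "step (cs @ [y]) x = S.pairing (Ident ?S (?cs @ ?y)) (kx \<boxtimes> ?dy)"
    by (simp add: step_def)
  also have "\<dots> = S.pairing (?i \<boxtimes> ?dy) (S.pairing (?dc \<boxtimes> ?iy) (kx \<boxtimes> ?dy))"
    using assms yv by (simp flip: S.pairing_projections)
  \<comment> \<open>The output of \<open>x\<close> is put next to the old wires, so that the two can
    be merged into \<open>S.pairing ?i kx\<close> beside the wire of \<open>y\<close>.\<close>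
  also have "\<dots> = (?i \<boxtimes> Swap ?S ?x ?y) \<bullet>
      S.pairing (S.pairing (?i \<boxtimes> ?dy) (kx \<boxtimes> ?dy)) (?dc \<boxtimes> ?iy)"
    using assms yv by (simp add: S.swap_pairing)
  also have "S.pairing (?i \<boxtimes> ?dy) (kx \<boxtimes> ?dy) = S.pairing ?i kx \<boxtimes> ?dy"
  proof -
    have "S.pairing ?i kx \<boxtimes> ?dy = S.pairing ?i kx \<bullet> (?i \<boxtimes> ?dy)"
      using S.ten_disc_eq(1)[of "S.pairing ?i kx" ?y] assms yv by simp
    also have "\<dots> = S.pairing (?i \<boxtimes> ?dy) (kx \<bullet> (?i \<boxtimes> ?dy))"
      using assms yv by (simp add: S.pairing_cmp_det)
    also have "kx \<bullet> (?i \<boxtimes> ?dy) = kx \<boxtimes> ?dy"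
      using S.ten_disc_eq(1)[of kx ?y] yv by simp
    finally show ?thesis ..
  qed
  also have "S.pairing (S.pairing ?i kx \<boxtimes> ?dy) (?dc \<boxtimes> ?iy) = S.pairing ?i kx \<boxtimes> ?iy"
    using assms yv by (simp add: S.pairing_disc_ten)
  finally have "step (cs @ [y]) x = (?i \<boxtimes> Swap ?S ?x ?y) \<bullet> (S.pairing ?i kx \<boxtimes> ?iy)" .
  moreover have "step cs y = S.pairing ?i ky" by (simp add: step_def ky_def)
  ultimately have "step (cs @ [y]) x \<bullet> step cs y
      = (?i \<boxtimes> Swap ?S ?x ?y) \<bullet> (S.pairing ?i kx \<boxtimes> ?iy) \<bullet> S.pairing ?i ky"
    using assms yv by (simp del: S.interchange S.interchange_cmp S.ten_pairing)
  also have "\<dots> = (?i \<boxtimes> Swap ?S ?x ?y) \<bullet> S.pairing ?i (S.pairing kx ky)"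
    using assms yv by (subst S.ten_pairing) simp_all
  also have "\<dots> = S.pairing ?i (S.pairing ky kx)"
    using assms yv by (simp add: S.swap_pairing)
  finally show ?thesis by (simp add: kx_def ky_def)
qed

text \<open>Both sides are brought into the form of \<open>step_step\<close>, where exchanging the
  boxes is the symmetry applied to a pairing.\<close>

lemma run_adjacent:
  assumes "set cs \<subseteq> verts M" "distinct cs" "runnable M (set cs) [x, y]" "runnable M (set cs) [y, x]"
  shows "run C M cs [y, x] = W (cs @ [x, y]) (cs @ [y, x]) \<bullet> run C M cs [x, y]"
proof -
  let ?S = "strictify C" and ?cs = "map (val M) cs" and ?y = "[val M y]" and ?x = "[val M x]"
  have 1: "x \<in> nins M" "y \<in> nins M" "x \<noteq> y" "x \<notin> set cs" "y \<notin> set cs"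
      "parents M x \<subseteq> set cs" "parents M y \<subseteq> set cs" using assms by auto
  have yv: "?y \<in> lists (Ob C)" "?x \<in> lists (Ob C)" "y \<in> verts M" "x \<in> verts M" "val M y \<in> Ob C" "val M x \<in> Ob C"
    using val_Ob 1 nins_verts by auto
  have W2: "W [x, y] [y, x] = Swap ?S ?x ?y"
    using 1 yv by (simp add: S.swap_eq_pairing)
  have W: "W (cs @ [x, y]) (cs @ [y, x]) = Ident ?S ?cs \<boxtimes> Swap ?S ?x ?y"
    unfolding W2[symmetric]
    using S.wire_ten[of "\<lambda>x. [val M x]" cs "[x, y]" cs "[y, x]"] 1 yv assms by (simp add: S.wire_self del: S.wire_simps(3))
  have r: "run C M cs [u, v] = step (cs @ [u]) v \<bullet> step cs u" if "{u, v} = {x, y}" for u v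
    using 1 yv assms(1) that by (auto simp: doubleton_eq_iff subset_extend)
  note bx = box_typing[OF 1(1)] box_typing[OF 1(2)]
  have r1: "run C M cs [x, y] = step (cs @ [x]) y \<bullet> step cs x"
    and r2: "run C M cs [y, x] = step (cs @ [y]) x \<bullet> step cs y"
    using r by auto
  have sw: "S.pairing (Ident ?S ?cs) (S.pairing ky kx) =
      (Ident ?S ?cs \<boxtimes> Swap ?S ?x ?y) \<bullet> S.pairing (Ident ?S ?cs) (S.pairing kx ky)"
    if "kx \<in> Ar ?S" "Src ?S kx = ?cs" "Tgt ?S kx = ?x" "ky \<in> Ar ?S" "Src ?S ky = ?cs" "Tgt ?S ky = ?y" for kx ky
    using that yv assms(1) by (simp add: S.swap_pairing)
  show ?thesis
    unfolding W r1 r2 step_step[OF assms(1) 1(1,2,6,7)] step_step[OF assms(1) 1(2,1,7,6)]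
    by (rule sw) (use 1 yv assms(1) bx in simp_all)
qed

text \<open>\<open>run_adjacent\<close> takes \<open>y\<close> past the head \<open>x\<close>,
  \<open>run_equivariant\<close> pushes the resulting transposition through the rest of the run, and
  the induction hypothesis moves \<open>y\<close> onwards from \<open>cs @ [x]\<close>.\<close>

lemma run_move:
  assumes "set cs \<subseteq> verts M" "distinct cs" "runnable M (set cs) (y # xs)" "runnable M (set cs) (xs @ [y])"
  shows "run C M cs (y # xs) = W (cs @ xs @ [y]) (cs @ y # xs) \<bullet> run C M cs (xs @ [y])"
  using assms
proof (induction xs arbitrary: cs)
  case Nil
  have "y \<in> verts M" "val M y \<in> Ob C" using Nil nins_verts val_Ob by auto
  then show ?case using Nil by (simp add: S.wire_self del: S.wire_simps(3))
next
  case (Cons x xs)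
  let ?S = "strictify C"
  have ns: "runnable M (set cs) [x, y]" "runnable M (set cs) [y, x]"
    using Cons.prems by (auto simp: runnable_append)
  have 1: "set (cs @ [x]) \<subseteq> verts M" "distinct (cs @ [x])" "runnable M (set (cs @ [x])) (y # xs)"
     "runnable M (set (cs @ [x])) (xs @ [y])"
    using Cons.prems nins_verts by (auto simp: insert_commute)
  have 2: "set (cs @ [x, y]) \<subseteq> verts M" "set (cs @ [y, x]) \<subseteq> verts M" "set xs \<subseteq> verts M" "x \<in> verts M" "y \<in> verts M"
    "set cs \<subseteq> verts M"
    "runnable M (set (cs @ [x, y])) xs" "runnable M (set (cs @ [y, x])) xs"
    using Cons.prems nins_verts runnable_D[of M "insert x (insert y (set cs))" xs] by (auto simp: insert_commute)
  have "run C M cs (y # x # xs) = run C M (cs @ [y, x]) xs \<bullet> run C M cs [y, x]"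
    using run_append[of cs "[y, x]" xs] Cons.prems by simp
  also have "\<dots> = run C M (cs @ [y, x]) xs \<bullet> W (cs @ [x, y]) (cs @ [y, x]) \<bullet> run C M cs [x, y]"
    by (simp only: run_adjacent[OF Cons.prems(1,2) ns])
  also have "\<dots> = (run C M (cs @ [y, x]) xs \<bullet> W (cs @ [x, y]) (cs @ [y, x])) \<bullet> run C M cs [x, y]"
    using 2 ns run_typing[OF ns(1)] val_Ob by (simp add: subset_extend del: S.wire_simps(3) run_Cons runnable.simps)
  also have "\<dots> = W (cs @ x # y # xs) (cs @ y # x # xs) \<bullet> run C M (cs @ [x, y]) xs \<bullet> run C M cs [x, y]"
    using 2 ns run_typing[OF ns(1)] val_Ob
    by (subst run_equivariant) (simp_all add: insert_commute subset_extend del: S.wire_simps(3) run_Cons runnable.simps)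
  also have "run C M (cs @ [x, y]) xs \<bullet> run C M cs [x, y] = run C M cs ([x, y] @ xs)"
    using run_append[of cs "[x, y]" xs] ns 2 by (auto simp: runnable_append insert_commute)
  also have "run C M cs ([x, y] @ xs) = run C M (cs @ [x]) (y # xs) \<bullet> step cs x"
    using 2 by (simp del: run_Cons add: run_Cons[of cs])
  also have "\<dots> = (W ((cs @ [x]) @ xs @ [y]) ((cs @ [x]) @ y # xs) \<bullet> run C M (cs @ [x]) (xs @ [y])) \<bullet> step cs x"
    using Cons.IH[OF 1] by (simp only:)
  also have "\<dots> = W (cs @ x # xs @ [y]) (cs @ x # y # xs) \<bullet> run C M cs (x # xs @ [y])"
  proof -
    have "x \<in> nins M" "parents M x \<subseteq> set cs" using ns by auto
    moreover have "runnable M (insert x (set cs)) (xs @ [y])" using 1 by simp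
    moreover have "val M x \<in> Ob C" "val M y \<in> Ob C" using val_Ob 2 by auto
    ultimately show ?thesis using 2 by (simp add: subset_extend del: S.wire_simps(3))
  qed
  also have "W (cs @ x # y # xs) (cs @ y # x # xs) \<bullet> W (cs @ x # xs @ [y]) (cs @ x # y # xs) \<bullet> run C M cs (x # xs @ [y])
    = W (cs @ x # xs @ [y]) (cs @ y # x # xs) \<bullet> run C M cs (x # xs @ [y])"
    by (rule wireM_wireM_cmp) (use 2 Cons.prems(4) run_typing[of cs "x # xs @ [y]"] in auto)
  finally show ?case by simp
qed

text \<open>
  By induction on the last box \<open>y\<close> of \<open>ys\<close>: if \<open>y\<close> does not occur in \<open>xs\<close>, it is discarded; otherwise
  no later box of \<open>xs\<close> uses \<open>y\<close>, so \<open>y\<close> can be moved to the end of \<open>xs\<close>.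
\<close>

lemma run_restrict:
  assumes "set is \<subseteq> verts M" "distinct is" "runnable M (set is) ys" "runnable M (set is) xs" "set xs \<subseteq> set ys"
  shows "W (is @ ys) (is @ xs) \<bullet> run C M is ys = run C M is xs"
  using assms(3-5)
proof (induction ys arbitrary: xs rule: rev_induct)
  case Nil
  then show ?case using assms(1,2) by (simp add: S.wire_self)
next
  case (snoc y ys)
  let ?S = "strictify C"
  have ys: "runnable M (set is) ys" "y \<in> nins M" "y \<notin> set is \<union> set ys" "parents M y \<subseteq> set is \<union> set ys"
    "set ys \<subseteq> verts M" "distinct ys" "set ys \<inter> set is = {}" "y \<in> verts M"
    "\<forall>x \<in> set ys. y \<notin> parents M x"
    using snoc.prems(1) runnable_D[of M "set is" ys] nins_verts by (auto simp: runnable_append)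
  have vy: "val M y \<in> Ob C" using ys val_Ob by auto
  have r: "run C M is (ys @ [y]) = step (is @ ys) y \<bullet> run C M is ys"
    using run_append[of "is" ys "[y]"] snoc.prems assms(1) ys by simp
  have xsv: "set xs \<subseteq> verts M" "distinct xs" "set xs \<inter> set is = {}"
    using runnable_D[OF snoc.prems(2)] nins_verts by auto
  show ?case
  proof (cases "y \<in> set xs")
    case False
    then have xs: "set xs \<subseteq> set ys" using snoc.prems by auto
    have "W (is @ ys @ [y]) (is @ xs) \<bullet> run C M is (ys @ [y])
        = (W ((is @ ys) @ [y]) (is @ xs) \<bullet> run C M (is @ ys) [y]) \<bullet> run C M is ys"
      using assms(1) ys vy xs by (simp add: r subset_extend del: S.wire_simps(3)) 
    also have "\<dots> = W (is @ ys) (is @ xs) \<bullet> run C M is ys"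
      using assms(1) ys xs by (subst wire_run) auto
    also have "\<dots> = run C M is xs"
      using snoc.IH[OF ys(1) snoc.prems(2) xs] .
    finally show ?thesis .
  next
    case True
    then obtain us vs where xs: "xs = us @ y # vs" by (meson split_list)
    have uv: "set (us @ vs) \<subseteq> set ys" using xsv(2) snoc.prems xs by auto
    have up: "runnable M (set is) us" "runnable M (set is \<union> set us) (y # vs)"
      using snoc.prems(2) xs by (auto simp: runnable_append)
    \<comment> \<open>Being last in the runnable list \<open>ys @ [y]\<close>, the variable
      \<open>y\<close> is read by no box of \<open>ys\<close>, in particular by none of
      \<open>vs\<close>.\<close>
    have uvy: "runnable M (set is \<union> set us) (vs @ [y])"
      using up(2) by (rule runnable_Cons_snoc) (use uv ys in auto)
    then have uv': "runnable M (set is) (us @ vs)" "runnable M (set is \<union> set us \<union> set vs) [y]"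
      using up(1) by (auto simp: runnable_append)
    have isus: "set (is @ us) \<subseteq> verts M" "distinct (is @ us)" using assms xsv xs by auto
    have vsv: "set vs \<subseteq> verts M" using xsv xs by auto
    have "run C M is xs = run C M (is @ us) (y # vs) \<bullet> run C M is us"
      using run_append[of "is" us "y # vs"] assms(1) snoc.prems(2) xs by simp
    also have "\<dots> = (W (is @ us @ vs @ [y]) (is @ us @ y # vs) \<bullet> run C M (is @ us) (vs @ [y])) \<bullet> run C M is us"
      using run_move[of "is @ us" y vs] isus up uvy by simp
    also have "\<dots> = W (is @ us @ vs @ [y]) (is @ us @ y # vs) \<bullet> run C M (is @ us) (vs @ [y]) \<bullet> run C M is us"
      using isus up uvy vsv ys vy by (simp add: subset_extend del: S.wire_simps(3) run_Cons)
    also have "run C M (is @ us) (vs @ [y]) \<bullet> run C M is us = run C M is ((us @ vs) @ [y])"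
      using run_append[of "is" us "vs @ [y]"] assms(1) up uvy by (simp add: runnable_append)
    also have "\<dots> = run C M (is @ us @ vs) [y] \<bullet> run C M is (us @ vs)"
      using run_append[of "is" "us @ vs" "[y]"] assms(1) uv' by (simp add: runnable_append Un_assoc)
    \<comment> \<open>With \<open>y\<close> removed the induction hypothesis applies; the box
      \<open>y\<close> is afterwards exchanged with the resulting diagram \<open>W\<close> by
      \<open>run_equivariant\<close>.\<close>
    also have "run C M is (us @ vs) = W (is @ ys) (is @ us @ vs) \<bullet> run C M is ys"
      using snoc.IH[OF ys(1) uv'(1) uv] by simp
    also have "run C M (is @ us @ vs) [y] \<bullet> W (is @ ys) (is @ us @ vs) \<bullet> run C M is ys
       = (run C M (is @ us @ vs) [y] \<bullet> W (is @ ys) (is @ us @ vs)) \<bullet> run C M is ys"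
      using assms(1) ys isus vsv uv uv' by (simp add: Un_assoc subset_extend del: S.wire_simps(3))
    also have "\<dots> = (W (is @ ys @ [y]) (is @ us @ vs @ [y]) \<bullet> run C M (is @ ys) [y]) \<bullet> run C M is ys"
      using assms(1) ys isus vsv uv uv'
      by (subst run_equivariant) (auto simp add: Un_assoc simp del: S.wire_simps(3) run_Cons)
    also have "\<dots> = W (is @ ys @ [y]) (is @ us @ vs @ [y]) \<bullet> run C M is (ys @ [y])"
      using assms(1) ys isus vsv uv uv' vy by (simp add: r subset_extend del: S.wire_simps(3))
    also have "W (is @ us @ vs @ [y]) (is @ us @ y # vs) \<bullet> W (is @ ys @ [y]) (is @ us @ vs @ [y]) \<bullet> run C M is (ys @ [y])
       = W (is @ ys @ [y]) (is @ us @ y # vs) \<bullet> run C M is (ys @ [y])"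
      by (rule wireM_wireM_cmp)
        (use assms(1) ys isus vsv uv snoc.prems(1) run_typing[of "is" "ys @ [y]"] in auto)
    finally show ?thesis using xs by simp
  qed
qed

end

section \<open>Interventions, channels and their marginals\<close>

lemma intervention_sets_Cons:
  "intervention_sets M (S # Ss) \<longleftrightarrow>
     S \<subseteq> nins M \<and> (\<forall>T \<in> set Ss. S \<inter> T = {}) \<and> intervention_sets M Ss"
proof -
  have "disjoint_family_on (\<lambda>i. (S # Ss) ! i) {..<length (S # Ss)} \<longleftrightarrow>
      (\<forall>T \<in> set Ss. S \<inter> T = {}) \<and> disjoint_family_on (\<lambda>i. Ss ! i) {..<length Ss}" (is "?l \<longleftrightarrow> ?r")
  proof
    assume l: ?l
    have "S \<inter> T = {}" if T: "T \<in> set Ss" for T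
    proof -
      obtain i where "i < length Ss" "T = Ss ! i" using T by (metis in_set_conv_nth)
      then show ?thesis using disjoint_family_onD[OF l, of 0 "Suc i"] by auto
    qed
    moreover have "Ss ! i \<inter> Ss ! j = {}" if "i < length Ss" "j < length Ss" "i \<noteq> j" for i j
      using disjoint_family_onD[OF l, of "Suc i" "Suc j"] that by auto
    ultimately show ?r by (auto simp: disjoint_family_on_def)
  next
    assume r: ?r
    have "(S # Ss) ! i \<inter> (S # Ss) ! j = {}" if "i < length (S # Ss)" "j < length (S # Ss)" "i \<noteq> j" for i j
      using r that by (cases i; cases j) (auto simp: disjoint_family_on_def Int_commute)
    then show ?l by (auto simp: disjoint_family_on_def)
  qed
  then show ?thesis by (auto simp: intervention_sets_def)
qed

lemma intervention_sets_Nil [simp]: "intervention_sets M []"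
  by (simp add: intervention_sets_def disjoint_family_on_def)

lemma distinct_concat_list_of:
  assumes "intervention_sets M Ss" "finite (nins M)"
  shows "distinct (concat (map list_of Ss)) \<and> set (concat (map list_of Ss)) = \<Union>(set Ss)"
  using assms(1)
proof (induction Ss)
  case (Cons S Ss)
  then have S: "S \<subseteq> nins M" "\<forall>T \<in> set Ss. S \<inter> T = {}" "intervention_sets M Ss"
    by (simp_all add: intervention_sets_Cons)
  have "finite S" using S(1) assms(2) finite_subset by blast
  then show ?case using Cons.IH[OF S(3)] S by auto
qed simp

lemma do_model_simps [simp]:
  "verts (do_model M S) = verts M" "val (do_model M S) = val M" "mech (do_model M S) = mech M"
  "ins (do_model M S) = ins M \<union> S" "outs (do_model M S) = outs M"
  "edges (do_model M S) = {(x, y) \<in> edges M. y \<notin> S}" "nins (do_model M S) = nins M - S"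
  by (auto simp: do_model_def nins_def)

text \<open>Vertices outside \<open>S\<close> keep exactly their parents and hence the same
  enumeration of them by \<open>list_of\<close>, so the old mechanisms still have the right type.
  Vertices in \<open>S\<close> lose all parents, as inputs must.\<close>

lemma causal_model_do:
  assumes "causal_model C M" "S \<subseteq> nins M"
  shows "causal_model C (do_model M S)"
proof -
  have "acyclic (edges (do_model M S))"
    using assms(1) by (auto simp: causal_model_def open_dag_def intro: acyclic_subset)
  moreover have p: "parents (do_model M S) x = (if x \<in> S then {} else parents M x)" for x
    by (auto simp: parents_def)
  ultimately show ?thesis
    using assms by (auto simp: causal_model_def open_dag_def nins_def p)
qed

context markov_model
begin

lemma finite_nins: "finite (nins M)"
  using nins_verts finite_verts finite_subset by blast

lemma ancestors_nins: "ancestors M A \<subseteq> nins M"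
  by (auto simp: ancestors_def)

text \<open>A parent of an ancestor is again an ancestor unless it is an input, so every box in the
  order finds its parents among the inputs and the listed boxes.\<close>

lemma runnable_topological_order: "runnable M (ins M) (topological_order M (ancestors M A))"
proof -
  have A: "ancestors M A \<subseteq> verts M" using ancestors_nins nins_verts by blast
  note t = topological_order[OF dag A]
  show ?thesis
  proof (rule sorted_runnable)
    show "acyclic (edges M)" using dag by (simp add: open_dag_def)
    show "set (topological_order M (ancestors M A)) \<inter> ins M = {}"
      using t ancestors_nins by (auto simp: nins_def)
    show "\<forall>x \<in> set (topological_order M (ancestors M A)).
        parents M x \<subseteq> ins M \<union> set (topological_order M (ancestors M A))"
    proof (intro ballI subsetI)
      fix x y assume x: "x \<in> set (topological_order M (ancestors M A))" and y: "y \<in> parents M x"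
      then have "(y, x) \<in> edges M" "x \<in> ancestors M A" "y \<in> verts M"
        using t parents_verts by (auto simp: parents_def)
      then have "y \<in> ins M \<or> y \<in> ancestors M A"
        unfolding ancestors_def nins_def by (auto intro: converse_rtrancl_into_rtrancl)
      then show "y \<in> ins M \<union> set (topological_order M (ancestors M A))" using t by auto
    qed
  qed (use t ancestors_nins in auto)
qed

text \<open>\<open>run_restrict\<close> makes the drawing independent of the order chosen by
  \<open>topological_order\<close> and of additional boxes outside the ancestors of
  \<open>os\<close>.\<close>

lemma channel_eq:
  assumes "set is = ins M" "distinct is" "set os \<subseteq> verts M" "runnable M (ins M) ys"
    "ancestors M (set os) \<subseteq> set ys"
  shows "channel C M is os = W (is @ ys) os \<bullet> run C M is ys"
proof -
  let ?xs = "topological_order M (ancestors M (set os))"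
  have A: "ancestors M (set os) \<subseteq> verts M" using ancestors_nins nins_verts by blast
  note t = topological_order[OF dag A]
  have os: "set os \<subseteq> set is \<union> set ?xs"
    using assms(1,3) t by (auto simp: nins_def ancestors_def)
  have ys: "set ys \<subseteq> verts M" using runnable_D[OF assms(4)] nins_verts by auto
  have r: "runnable M (set is) ?xs" "runnable M (set is) ys" "set is \<subseteq> verts M"
    using runnable_topological_order assms(1,4) ins_verts by auto
  have "channel C M is os = W (is @ ?xs) os \<bullet> run C M is ?xs"
    by (simp add: channel_def Let_def)
  also have "run C M is ?xs = W (is @ ys) (is @ ?xs) \<bullet> run C M is ys"
    using run_restrict[of "is" ys ?xs] r assms t by simp
  also have "W (is @ ?xs) os \<bullet> \<dots> = W (is @ ys) os \<bullet> run C M is ys"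
    by (rule wireM_wireM_cmp) (use r t os assms ys in auto)
  finally show ?thesis .
qed

lemma channel_typing:
  assumes "set is = ins M" "set os \<subseteq> verts M"
  shows "channel C M is os \<in> Ar (strictify C)" "Src (strictify C) (channel C M is os) = map (val M) is"
    "Tgt (strictify C) (channel C M is os) = map (val M) os"
proof -
  let ?xs = "topological_order M (ancestors M (set os))"
  have A: "ancestors M (set os) \<subseteq> verts M" using ancestors_nins nins_verts by blast
  note t = topological_order[OF dag A]
  have os: "set os \<subseteq> set is \<union> set ?xs"
    using assms t by (auto simp: nins_def ancestors_def)
  have r: "runnable M (set is) ?xs" "set is \<subseteq> verts M" "set ?xs \<subseteq> verts M"
    using runnable_topological_order assms(1) ins_verts t A by auto
  show "channel C M is os \<in> Ar (strictify C)" "Src (strictify C) (channel C M is os) = map (val M) is"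
    "Tgt (strictify C) (channel C M is os) = map (val M) os"
    using r os by (simp_all add: channel_def Let_def)
qed

text \<open>Both channels are read off one run over the ancestors of \<open>os\<close>, which
  include those of the smaller list \<open>os'\<close>.\<close>

lemma channel_marginal:
  assumes "set is = ins M" "distinct is" "set os \<subseteq> verts M" "set os' \<subseteq> set os"
  shows "channel C M is os' = W os os' \<bullet> channel C M is os"
proof -
  let ?ys = "topological_order M (ancestors M (set os))"
  have A: "ancestors M (set os) \<subseteq> verts M" using ancestors_nins nins_verts by blast
  note t = topological_order[OF dag A]
  have os: "set os \<subseteq> set is \<union> set ?ys"
    using assms t by (auto simp: nins_def ancestors_def)
  have r: "runnable M (ins M) ?ys" "runnable M (set is) ?ys" "set is \<subseteq> verts M" "set ?ys \<subseteq> verts M"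
    using runnable_topological_order assms(1) ins_verts t A by auto
  have "channel C M is os' = W (is @ ?ys) os' \<bullet> run C M is ?ys"
    using assms r t by (intro channel_eq) (auto simp: ancestors_def)
  also have "\<dots> = W os os' \<bullet> W (is @ ?ys) os \<bullet> run C M is ?ys"
    by (rule wireM_wireM_cmp[symmetric]) (use r os assms in auto)
  finally show ?thesis by (simp add: channel_def Let_def)
qed

text \<open>Only the final channel of the intervened model depends on the output set; the inner
  part, abbreviated \<open>k\<close>, is common to all of them. Marginalization therefore reduces to
  \<open>channel_marginal\<close> for the intervened model.\<close>

lemma
  assumes "intervention_sets M Ss" "A \<subseteq> verts M"
  shows interchange_channel_typing: "interchange_channel C M Ss A \<in> Ar (strictify C)"
    "Src (strictify C) (interchange_channel C M Ss A) =
      map (val M) (concat (replicate (length Ss + 1) (list_of (ins M))))"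
    "Tgt (strictify C) (interchange_channel C M Ss A) = map (val M) (list_of A)"
    and interchange_channel_marginal: "B \<subseteq> A \<Longrightarrow>
      interchange_channel C M Ss B = W (list_of A) (list_of B) \<bullet> interchange_channel C M Ss A"
proof -
  let ?S = "strictify C" and ?is = "list_of (ins M)"
  let ?D = "do_model M (\<Union>(set Ss))" and ?iss = "list_of (ins M) @ concat (map list_of Ss)"
  have U: "\<Union>(set Ss) \<subseteq> nins M" using assms(1) by (auto simp: intervention_sets_def)
  interpret D: markov_model C ?D
    by unfold_locales (rule causal_model_do[OF model U])
  have fin: "finite (ins M)" "finite (verts M)" using finite_verts ins_verts finite_subset by auto
  have finA: "finite A" using assms(2) fin finite_subset by blast
  note cc = distinct_concat_list_of[OF assms(1) finite_nins]
  have iss: "set ?iss = ins ?D" "distinct ?iss" using cc fin U by (auto simp: nins_def)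
  define k where "k = Ident ?S (map (val M) ?is) \<boxtimes> list_tensor_ar ?S (map (\<lambda>S. channel C M ?is (list_of S)) Ss)"
  have chan: "channel C M ?is (list_of S) \<in> Ar ?S" "Src ?S (channel C M ?is (list_of S)) = map (val M) ?is"
    "Tgt ?S (channel C M ?is (list_of S)) = map (val M) (list_of S)" if "S \<in> set Ss" for S
  proof -
    have S: "S \<subseteq> verts M" using assms(1) nins_verts that by (auto simp: intervention_sets_def)
    then have "finite S" using fin(2) finite_subset by blast
    then show "channel C M ?is (list_of S) \<in> Ar ?S" "Src ?S (channel C M ?is (list_of S)) = map (val M) ?is"
      "Tgt ?S (channel C M ?is (list_of S)) = map (val M) (list_of S)"
      using channel_typing[of ?is "list_of S"] fin S by auto
  qed
  have "list_tensor_ar ?S (map (\<lambda>S. channel C M ?is (list_of S)) Ss) \<in> Ar ?S \<and>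
    Src ?S (list_tensor_ar ?S (map (\<lambda>S. channel C M ?is (list_of S)) Ss)) =
      map (val M) (concat (replicate (length Ss) ?is)) \<and>
    Tgt ?S (list_tensor_ar ?S (map (\<lambda>S. channel C M ?is (list_of S)) Ss)) =
      map (val M) (concat (map list_of Ss))"
    using chan by (induction Ss) auto
  then have k: "k \<in> Ar ?S" "Src ?S k = map (val M) (concat (replicate (length Ss + 1) ?is))"
    "Tgt ?S k = map (val M) ?iss"
    using fin ins_verts by (auto simp: k_def)
  have ic: "interchange_channel C M Ss X = channel C ?D ?iss (list_of X) \<bullet> k" for X
    by (simp add: interchange_channel_def k_def)
  have dc: "channel C ?D ?iss (list_of X) \<in> Ar ?S" "Src ?S (channel C ?D ?iss (list_of X)) = map (val M) ?iss"
    "Tgt ?S (channel C ?D ?iss (list_of X)) = map (val M) (list_of X)" if "X \<subseteq> verts M" for X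
    using D.channel_typing[of ?iss "list_of X"] iss that finite_subset[OF that fin(2)] by simp_all
  show "interchange_channel C M Ss A \<in> Ar (strictify C)"
    "Src (strictify C) (interchange_channel C M Ss A) =
      map (val M) (concat (replicate (length Ss + 1) (list_of (ins M))))"
    "Tgt (strictify C) (interchange_channel C M Ss A) = map (val M) (list_of A)"
    using dc[OF assms(2)] k by (simp_all add: ic)
  assume B: "B \<subseteq> A"
  then have "finite B" using finA finite_subset by blast
  then have "channel C ?D ?iss (list_of B) = W (list_of A) (list_of B) \<bullet> channel C ?D ?iss (list_of A)"
    using D.channel_marginal[of ?iss "list_of A" "list_of B"] iss finA assms(2) B by simp
  then show "interchange_channel C M Ss B = W (list_of A) (list_of B) \<bullet> interchange_channel C M Ss A"
    using dc[OF assms(2)] k finA assms(2) B \<open>finite B\<close> by (simp add: ic)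
qed

end

section \<open>Passage between the strictification and \<open>C\<close>\<close>

context markov_category
begin

text \<open>The flattening isomorphism \<open>v zs\<close> is deterministic because copying a list
  is copying its flattening. The underlying morphism of \<open>v xs \<boxtimes> v ys\<close> is
  \<open>join C xs ys\<close>, and tensor products preserve determinism.\<close>

lemma det_join:
  assumes [simp]: "xs \<in> lists (Ob C)" "ys \<in> lists (Ob C)"
  shows "deterministic C (join C xs ys)"
proof -
  interpret S: strict_markov "strictify C" by (rule strict_markov_strictify)
  let ?S = "strictify C"
  define v where "v = (\<lambda>xs. ([tlist C xs], Ident C (tlist C xs), xs))"
  have det: "S.det (v zs)" if [simp]: "zs \<in> lists (Ob C)" for zs
  proof -
    let ?v' = "(zs, Ident C (tlist C zs), [tlist C zs])"
    have [simp]: "v zs \<in> Ar ?S" "Src ?S (v zs) = [tlist C zs]" "Tgt ?S (v zs) = zs"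
      "?v' \<in> Ar ?S" "Src ?S ?v' = zs" "Tgt ?S ?v' = [tlist C zs]" "?v' \<bullet> v zs = Ident ?S [tlist C zs]"
      "[tlist C zs] \<in> Ob ?S"
      by (simp_all add: v_def strictify_simps)
    have "Copy ?S zs = (v zs \<boxtimes> v zs) \<bullet> Copy ?S [tlist C zs] \<bullet> ?v'"
      unfolding v_def by (rule strictify_copy_flatten) simp
    then show ?thesis by (simp add: deterministic_def)
  qed
  have "v xs \<boxtimes> v ys = ([tlist C xs, tlist C ys], join C xs ys, xs @ ys)"
    by (simp add: v_def strictify_simps)
  moreover have "S.det (v xs \<boxtimes> v ys)" by (simp add: det)
  ultimately show ?thesis
    using deterministic_strictify_iff[of "[tlist C xs, tlist C ys]" "join C xs ys" "xs @ ys"]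
    by (simp add: strictify_simps)
qed

lemma strictify_cmp:
  assumes "f \<in> Ar (strictify C)" "g \<in> Ar (strictify C)"
  shows "underlying (g \<bullet> f) = underlying g \<cdot> underlying f"
  using assms by (cases f; cases g) (simp add: underlying_def strictify_simps)

lemma strictify_eqI:
  "\<lbrakk>Src (strictify C) f = Src (strictify C) g; Tgt (strictify C) f = Tgt (strictify C) g;
    underlying f = underlying g\<rbrakk> \<Longrightarrow> f = g"
  by (cases f; cases g) (simp add: underlying_def strictify_simps)

lemma underlying_simps:
  assumes "f \<in> Ar (strictify C)"
  shows "underlying f \<in> Ar C" "Src C (underlying f) = tlist C (Src (strictify C) f)"
    "Tgt C (underlying f) = tlist C (Tgt (strictify C) f)"
  using assms by (cases f; simp add: underlying_def strictify_simps)+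

lemma underlying_ten:
  assumes "f \<in> Ar (strictify C)" "g \<in> Ar (strictify C)"
  shows "underlying (f \<boxtimes> g) \<cdot> join C (Src (strictify C) f) (Src (strictify C) g)
    = join C (Tgt (strictify C) f) (Tgt (strictify C) g) \<cdot> (underlying f \<otimes> underlying g)"
  using assms by (cases f; cases g) (simp add: underlying_def strictify_simps)

lemma underlying_iso:
  assumes "iso (strictify C) f"
  shows "iso C (underlying f)"
proof -
  interpret S: strict_markov "strictify C" by (rule strict_markov_strictify)
  let ?g = "inverse_of (strictify C) f"
  have f: "f \<in> Ar (strictify C)" "?g \<in> Ar (strictify C)" using assms by auto
  have "underlying ?g \<cdot> underlying f = Ident C (Src C (underlying f))"
    "underlying f \<cdot> underlying ?g = Ident C (Tgt C (underlying f))"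
    using strictify_cmp[OF f] strictify_cmp[OF f(2,1)] assms f underlying_simps[OF f(1)]
    by (simp_all add: strictify_simps underlying_def)
  then show ?thesis
    using f underlying_simps[OF f(1)] underlying_simps[OF f(2)] assms
    by (intro isoI[of "underlying f" "underlying ?g"] inverse_arrowsI) auto
qed

end

lemma interp_eq_interp_in: "interp C ob g t = interp_in (strictify C) (\<lambda>x. [ob x]) g t"
  by (induction t) simp_all

section \<open>The interchange query model of a causal model\<close>

context markov_model
begin

abbreviation "Q \<equiv> int_signature M"

lemma int_signature_simps [simp]:
  "types Q = verts M" "(Ss, A) \<in> gens Q \<longleftrightarrow> intervention_sets M Ss \<and> A \<subseteq> outs M"
  "gsrc Q (Ss, A) = concat (replicate (length Ss + 1) (list_of (ins M)))" "gtgt Q (Ss, A) = list_of A"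
  by (auto simp: int_signature_def)

lemma outs_verts: "outs M \<subseteq> verts M"
  using model by (simp add: causal_model_def)

lemma finite_if_subset_verts [simp]: "A \<subseteq> verts M \<Longrightarrow> finite A"
  using finite_verts finite_subset by blast

lemma wt_gen: "(Ss, A) \<in> gens Q \<Longrightarrow> wt Q (TGen (Ss, A))"
proof -
  assume q: "(Ss, A) \<in> gens Q"
  have "list_of A \<in> lists (verts M)" "list_of (ins M) \<in> lists (verts M)"
    using subset_trans[of A "outs M" "verts M"] q outs_verts ins_verts by (auto simp: in_lists_conv_set)
  then show ?thesis using q by (auto simp: in_lists_conv_set)
qed

abbreviation "int_gen \<equiv> \<lambda>(Ss, A). interchange_channel C M Ss A"

sublocale G: term_interpretation "strictify C" Q "\<lambda>x. [val M x]" int_gen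
proof unfold_locales
  fix q assume "wt Q (TGen q)"
  moreover obtain Ss A where q: "q = (Ss, A)" by (cases q)
  ultimately have *: "intervention_sets M Ss" "A \<subseteq> verts M" using outs_verts by auto
  show "int_gen q \<in> Ar (strictify C) \<and> Src (strictify C) (int_gen q) = concat (map (\<lambda>x. [val M x]) (gsrc Q q)) \<and>
      Tgt (strictify C) (int_gen q) = concat (map (\<lambda>x. [val M x]) (gtgt Q q))"
    unfolding q int_signature_simps case_prod_conv concat_map_singleton
    using interchange_channel_typing[OF *] by blast
next
  fix t assume "t \<in> types Q"
  then show "[val M t] \<in> Ob (strictify C)" using val_Ob[of t] by simp
qed

text \<open>The model before passing to underlying morphisms. It remembers input and output lists
  and is therefore strict; all \<open>join\<close> isomorphisms are confined to
  \<open>underlying\<close>.\<close>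

definition sem :: "('v, 'v set list \<times> 'v set) trm set \<Rightarrow> 'o list \<times> 'm \<times> 'o list" where
  "sem c = interp_in (strictify C) (\<lambda>x. [val M x]) int_gen (trep c)"

sublocale F: strict_functor "free_markov Q" "strictify C" "\<lambda>x. [val M x]" sem
  using G.strict_functor_axioms by (simp add: sem_def[abs_def])

lemma sem_query: "(Ss, A) \<in> gens Q \<Longrightarrow> sem (query Q (Ss, A)) = interchange_channel C M Ss A"
  using G.interp_in_trep[OF wt_gen] by (simp add: sem_def query_def)

lemma sem_wire: "set xs \<subseteq> verts M \<Longrightarrow> sem (wireQ M xs ys) = W xs ys"
proof -
  assume "set xs \<subseteq> verts M"
  then have "(\<lambda>x. [x]) ` set xs \<subseteq> Ob (free_markov Q)" by auto
  from F.map_wire[OF this, of ys] show ?thesis by simp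
qed

lemma far_int_model: "far (int_model C M) c = underlying (sem c)"
  by (simp add: int_model_def free_extension_def sem_def interp_eq_interp_in)

lemma int_model_simps [simp]:
  "fob (int_model C M) xs = tlist C (map (val M) xs)"
  "lax (int_model C M) xs ys = join C (map (val M) xs) (map (val M) ys)"
  "unt (int_model C M) = Ident C (Unit C)"
  by (simp_all add: int_model_def free_extension_def)

text \<open>Since \<open>sem\<close> is strict, every functor law of \<open>int_model\<close> is a
  law about \<open>underlying\<close>, with \<open>join\<close> as structure morphism and
  \<open>join_assoc\<close> as its associativity.\<close>

lemma query_model_int_model: "query_model Q C (int_model C M)"
proof -
  let ?K = "free_markov Q" and ?F = "int_model C M" and ?v = "map (val M)"
  have v: "?v xs \<in> lists (Ob C)" if "xs \<in> lists (verts M)" for xs using that val_Ob by auto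
  have det1: "deterministic C (Ident C (Unit C))" by (simp add: deterministic_def)
  have hom: "far ?F f \<in> Ar C" "Src C (far ?F f) = tlist C (?v (Src ?K f))"
    "Tgt C (far ?F f) = tlist C (?v (Tgt ?K f))" if "f \<in> Ar ?K" for f
    using underlying_simps[of "sem f"] that by (simp_all add: far_int_model)
  show ?thesis
    unfolding query_model_def markov_functor_def
  proof (intro conjI allI ballI, goal_cases)
    case (1 a)
    then show ?case using v by simp
  next
    case (2 a b f)
    then show ?case using hom by (auto simp: in_hom_iff)
  next
    case (3 a)
    then show ?case by (simp add: far_int_model strictify_simps underlying_def)
  next
    case (4 a b c f g)
    then show ?case by (simp add: far_int_model in_hom_iff strictify_cmp)
  next
    case 5
    then show ?case by (simp add: in_hom_iff)
  next
    case 6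
    then show ?case by simp
  next
    case 7
    then show ?case using det1 by simp
  next
    case (8 a b)
    then show ?case using v by (simp add: in_hom_iff)
  next
    case (9 a b)
    then show ?case using v by simp
  next
    case (10 a b)
    then show ?case using v det_join by simp
  next
    case (11 a b c d f g)
    then show ?case using underlying_ten[of "sem f" "sem g"] by (simp add: far_int_model in_hom_iff)
  next
    case (12 a b c)
    then show ?case
      using join_assoc[of "?v a" "?v b" "?v c"] v
      by (simp add: far_int_model strictify_simps underlying_def)
  next
    case (13 a)
    then show ?case
      using v by (simp add: far_int_model strictify_simps underlying_def)
  next
    case (14 a)
    then show ?case
      using v by (simp add: far_int_model strictify_simps underlying_def join_Nil_right)
  next
    case (15 a b)
    then show ?case
      using v by (simp add: far_int_model strictify_simps underlying_def)
  next
    case (16 a)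
    then show ?case
      using v by (simp add: far_int_model strictify_simps underlying_def)
  qed
qed

end

text \<open>Both functors are strict, so naturality propagates from generators by induction on
  terms. Determinism of \<open>t\<close> is what the copy case requires; symmetries and discards are
  natural for all morphisms.\<close>

lemma strict_natural:
  assumes "strict_functor (free_markov Q) B ob1 F1" "strict_functor (free_markov Q) B ob2 F2"
    and t: "\<And>x. x \<in> types Q \<Longrightarrow> deterministic B (t x)" "\<And>x. x \<in> types Q \<Longrightarrow> Src B (t x) = ob1 x"
      "\<And>x. x \<in> types Q \<Longrightarrow> Tgt B (t x) = ob2 x"
    and gen: "\<And>q. wt Q (TGen q) \<Longrightarrow> list_tensor_ar B (map t (gtgt Q q)) \<cdot>\<^bsub>B\<^esub> F1 (query Q q) =
      F2 (query Q q) \<cdot>\<^bsub>B\<^esub> list_tensor_ar B (map t (gsrc Q q))"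
    and c: "c \<in> Ar (free_markov Q)"
  shows "list_tensor_ar B (map t (Tgt (free_markov Q) c)) \<cdot>\<^bsub>B\<^esub> F1 c =
    F2 c \<cdot>\<^bsub>B\<^esub> list_tensor_ar B (map t (Src (free_markov Q) c))"
proof -
  interpret B: strict_markov B using assms(1) by (simp add: strict_functor_def)
  interpret F1: strict_functor "free_markov Q" B ob1 F1 by fact
  interpret F2: strict_functor "free_markov Q" B ob2 F2 by fact
  let ?T = "\<lambda>xs. list_tensor_ar B (map t xs)"
  have ob: "ob1 x \<in> Ob B" "ob2 x \<in> Ob B" if "x \<in> types Q" for x
    using F1.ob_Ob[of "[x]"] F2.ob_Ob[of "[x]"] that by simp_all
  have A: "set (map t xs) \<subseteq> Ar B" "concat (map (Src B \<circ> t) xs) = concat (map ob1 xs)"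
     "concat (map (Tgt B \<circ> t) xs) = concat (map ob2 xs)" if "xs \<in> lists (types Q)" for xs
    using that by (auto intro!: arg_cong[of _ _ concat] map_cong simp: t B.det_Ar)
  have T: "?T xs \<in> Ar B" "Src B (?T xs) = concat (map ob1 xs)" "Tgt B (?T xs) = concat (map ob2 xs)"
    "B.det (?T xs)" if "xs \<in> lists (types Q)" for xs
    using A[OF that] that t by (auto intro!: B.det_list_tensor_ar simp: comp_def)
  have Tapp: "?T (xs @ ys) = ?T xs \<otimes>\<^bsub>B\<^esub> ?T ys" if "xs \<in> lists (types Q)" "ys \<in> lists (types Q)" for xs ys
    using B.list_tensor_ar_append[OF A(1)[OF that(1)] A(1)[OF that(2)]] by simp
  have im: "ob1 ` set xs \<subseteq> Ob B" "ob2 ` set xs \<subseteq> Ob B" if "xs \<in> lists (types Q)" for xs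
    using that ob by auto
  have "?T (ttgt Q s) \<cdot>\<^bsub>B\<^esub> F1 (tclass Q s) = F2 (tclass Q s) \<cdot>\<^bsub>B\<^esub> ?T (tsrc Q s)" if "wt Q s" for s
    using that
  proof (induction s)
    case (TId xs)
    then show ?case using T[of xs] im[of xs] F1.ident[of xs] F2.ident[of xs]
      by (simp add: free_markov_simps(5))
  next
    case (TGen q)
    then show ?case using gen[of q] by (simp add: query_def)
  next
    case (TCmp u s)
    let ?u = "tclass Q u" and ?s = "tclass Q s"
    have w: "wt Q u" "wt Q s" "tsrc Q u = ttgt Q s" using TCmp.prems by auto
    have c: "tclass Q (TCmp u s) = ?u \<cdot>\<^bsub>free_markov Q\<^esub> ?s" using w by simp
    have l: "tsrc Q u \<in> lists (types Q)" "ttgt Q u \<in> lists (types Q)" "tsrc Q s \<in> lists (types Q)"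
      using w wt_lists by blast+
    have Fc: "F1 (tclass Q (TCmp u s)) = F1 ?u \<cdot>\<^bsub>B\<^esub> F1 ?s" "F2 (tclass Q (TCmp u s)) = F2 ?u \<cdot>\<^bsub>B\<^esub> F2 ?s"
      unfolding c using w by (simp_all del: free_markov_simps(6))
    have "?T (ttgt Q u) \<cdot>\<^bsub>B\<^esub> F1 ?u \<cdot>\<^bsub>B\<^esub> F1 ?s = (F2 ?u \<cdot>\<^bsub>B\<^esub> ?T (tsrc Q u)) \<cdot>\<^bsub>B\<^esub> F1 ?s"
      by (rule B.cmp_extend[OF TCmp.IH(1)]) (use w l T in simp_all)
    also have "\<dots> = F2 ?u \<cdot>\<^bsub>B\<^esub> (?T (ttgt Q s) \<cdot>\<^bsub>B\<^esub> F1 ?s)" using w l T[OF l(1)] by simp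
    also have "\<dots> = F2 ?u \<cdot>\<^bsub>B\<^esub> F2 ?s \<cdot>\<^bsub>B\<^esub> ?T (tsrc Q s)" using TCmp.IH(2) w by simp
    finally show ?case unfolding Fc using w l T[OF l(3)] by simp
  next
    case (TTen u s)
    let ?u = "tclass Q u" and ?s = "tclass Q s"
    have w: "wt Q u" "wt Q s" using TTen.prems by auto
    have c: "tclass Q (TTen u s) = ?u \<otimes>\<^bsub>free_markov Q\<^esub> ?s" using w by simp
    have l: "tsrc Q u \<in> lists (types Q)" "ttgt Q u \<in> lists (types Q)" "tsrc Q s \<in> lists (types Q)"
      "ttgt Q s \<in> lists (types Q)"
      using w wt_lists by blast+
    have Fc: "F1 (tclass Q (TTen u s)) = F1 ?u \<otimes>\<^bsub>B\<^esub> F1 ?s" "F2 (tclass Q (TTen u s)) = F2 ?u \<otimes>\<^bsub>B\<^esub> F2 ?s"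
      unfolding c using w by (simp_all del: free_markov_simps(7))
    show ?case
      using TTen.IH w T[OF l(1)] T[OF l(2)] T[OF l(3)] T[OF l(4)] by (simp add: Fc Tapp l del: map_append)
  next
    case (TSwap xs ys)
    then have l: "xs \<in> lists (types Q)" "ys \<in> lists (types Q)" by auto
    show ?case
      using l T[OF l(1)] T[OF l(2)] F1.swap[of xs ys] F2.swap[of xs ys] B.swap_nat[of "?T xs" "?T ys"]
      by (simp add: free_markov_simps(13) Tapp del: map_append)
  next
    case (TCopy xs)
    then have l: "xs \<in> lists (types Q)" by auto
    show ?case
      using l T[OF l] F1.copy[of xs] F2.copy[of xs] B.copy_cmp_det[of "?T xs"]
      by (simp add: free_markov_simps(14) Tapp del: map_append)
  next
    case (TDisc xs)
    then have l: "xs \<in> lists (types Q)" by auto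
    show ?case
      using l T[OF l] F1.disc[of xs] F2.disc[of xs] im[OF l]
      by (simp add: free_markov_simps(15))
  qed
  from this[of "trep c"] show ?thesis using trep_Ar[OF c] by simp
qed

section \<open>Functors between free Markov categories\<close>

locale free_functor =
  fixes QH :: "('t, 'g) signature" and QL :: "('s, 'h) signature"
    and \<pi> :: "('t list, ('t, 'g) trm set, 's list, ('s, 'h) trm set) mfunctor"
  assumes is_functor: "markov_functor (free_markov QH) (free_markov QL) \<pi>"
begin

sublocale A: strict_markov "free_markov QH" by (rule strict_markov_free_markov)
sublocale B: strict_markov "free_markov QL" by (rule strict_markov_free_markov)

abbreviation "KH \<equiv> free_markov QH"
abbreviation "KL \<equiv> free_markov QL"

lemma fob_Ob [simp]: "a \<in> lists (types QH) \<Longrightarrow> fob \<pi> a \<in> lists (types QL)"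
  using is_functor by (simp add: markov_functor_def)

lemma far_typing [simp]:
  assumes "f \<in> Ar KH"
  shows "far \<pi> f \<in> Ar KL" "Src KL (far \<pi> f) = fob \<pi> (Src KH f)" "Tgt KL (far \<pi> f) = fob \<pi> (Tgt KH f)"
proof -
  have "\<forall>a b. \<forall>f \<in> hom KH a b. far \<pi> f \<in> hom KL (fob \<pi> a) (fob \<pi> b)"
    using is_functor unfolding markov_functor_def by (elim conjE)
  then show "far \<pi> f \<in> Ar KL" "Src KL (far \<pi> f) = fob \<pi> (Src KH f)" "Tgt KL (far \<pi> f) = fob \<pi> (Tgt KH f)"
    using assms by (auto simp: in_hom_iff)
qed

lemma far_ident [simp]: "a \<in> lists (types QH) \<Longrightarrow> far \<pi> (Ident KH a) = Ident KL (fob \<pi> a)"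
  using is_functor by (simp add: markov_functor_def)

lemma far_cmp [simp]:
  assumes "f \<in> Ar KH" "g \<in> Ar KH" "Src KH g = Tgt KH f"
  shows "far \<pi> (g \<cdot>\<^bsub>KH\<^esub> f) = far \<pi> g \<cdot>\<^bsub>KL\<^esub> far \<pi> f"
proof -
  have "\<forall>a b c. \<forall>f \<in> hom KH a b. \<forall>g \<in> hom KH b c. far \<pi> (g \<cdot>\<^bsub>KH\<^esub> f) = far \<pi> g \<cdot>\<^bsub>KL\<^esub> far \<pi> f"
    using is_functor unfolding markov_functor_def by (elim conjE)
  then show ?thesis using assms by (auto simp: in_hom_iff)
qed

lemma unt_typing [simp]: "unt \<pi> \<in> Ar KL" "Src KL (unt \<pi>) = []" "Tgt KL (unt \<pi>) = fob \<pi> []"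
    "iso KL (unt \<pi>)" "B.det (unt \<pi>)"
  using is_functor by (simp_all add: markov_functor_def in_hom_iff)

lemma lax_typing [simp]:
  assumes "a \<in> lists (types QH)" "b \<in> lists (types QH)"
  shows "lax \<pi> a b \<in> Ar KL" "Src KL (lax \<pi> a b) = fob \<pi> a @ fob \<pi> b" "Tgt KL (lax \<pi> a b) = fob \<pi> (a @ b)"
    "iso KL (lax \<pi> a b)" "B.det (lax \<pi> a b)"
proof -
  have "\<forall>a \<in> Ob KH. \<forall>b \<in> Ob KH.
        lax \<pi> a b \<in> hom KL (fob \<pi> a \<odot>\<^bsub>KL\<^esub> fob \<pi> b) (fob \<pi> (a \<odot>\<^bsub>KH\<^esub> b)) \<and>
        iso KL (lax \<pi> a b) \<and> deterministic KL (lax \<pi> a b)"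
    using is_functor unfolding markov_functor_def by (elim conjE)
  then show "lax \<pi> a b \<in> Ar KL" "Src KL (lax \<pi> a b) = fob \<pi> a @ fob \<pi> b" "Tgt KL (lax \<pi> a b) = fob \<pi> (a @ b)"
    "iso KL (lax \<pi> a b)" "B.det (lax \<pi> a b)"
    using assms by (auto simp: in_hom_iff)
qed

lemma far_ten:
  assumes "f \<in> Ar KH" "g \<in> Ar KH"
  shows "far \<pi> (f \<otimes>\<^bsub>KH\<^esub> g) \<cdot>\<^bsub>KL\<^esub> lax \<pi> (Src KH f) (Src KH g) =
    lax \<pi> (Tgt KH f) (Tgt KH g) \<cdot>\<^bsub>KL\<^esub> (far \<pi> f \<otimes>\<^bsub>KL\<^esub> far \<pi> g)"
proof -
  have "\<forall>a b c d. \<forall>f \<in> hom KH a b. \<forall>g \<in> hom KH c d.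
        far \<pi> (f \<otimes>\<^bsub>KH\<^esub> g) \<cdot>\<^bsub>KL\<^esub> lax \<pi> a c = lax \<pi> b d \<cdot>\<^bsub>KL\<^esub> (far \<pi> f \<otimes>\<^bsub>KL\<^esub> far \<pi> g)"
    using is_functor unfolding markov_functor_def by (elim conjE)
  then show ?thesis using assms by (auto simp: in_hom_iff)
qed

lemma lax_assoc:
  assumes "a \<in> lists (types QH)" "b \<in> lists (types QH)" "c \<in> lists (types QH)"
  shows "lax \<pi> (a @ b) c \<cdot>\<^bsub>KL\<^esub> (lax \<pi> a b \<otimes>\<^bsub>KL\<^esub> Ident KL (fob \<pi> c)) =
    lax \<pi> a (b @ c) \<cdot>\<^bsub>KL\<^esub> (Ident KL (fob \<pi> a) \<otimes>\<^bsub>KL\<^esub> lax \<pi> b c)"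
proof -
  have "\<forall>a \<in> Ob KH. \<forall>b \<in> Ob KH. \<forall>c \<in> Ob KH.
        far \<pi> (Assoc KH a b c) \<cdot>\<^bsub>KL\<^esub> lax \<pi> (a \<odot>\<^bsub>KH\<^esub> b) c \<cdot>\<^bsub>KL\<^esub> (lax \<pi> a b \<otimes>\<^bsub>KL\<^esub> Ident KL (fob \<pi> c)) =
        lax \<pi> a (b \<odot>\<^bsub>KH\<^esub> c) \<cdot>\<^bsub>KL\<^esub> (Ident KL (fob \<pi> a) \<otimes>\<^bsub>KL\<^esub> lax \<pi> b c) \<cdot>\<^bsub>KL\<^esub>
          Assoc KL (fob \<pi> a) (fob \<pi> b) (fob \<pi> c)"
    using is_functor unfolding markov_functor_def by (elim conjE)
  then show ?thesis using assms by (simp del: free_markov_simps(10))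
qed

lemma lax_unit:
  assumes "a \<in> lists (types QH)"
  shows "lax \<pi> [] a \<cdot>\<^bsub>KL\<^esub> (unt \<pi> \<otimes>\<^bsub>KL\<^esub> Ident KL (fob \<pi> a)) = Ident KL (fob \<pi> a)"
    "lax \<pi> a [] \<cdot>\<^bsub>KL\<^esub> (Ident KL (fob \<pi> a) \<otimes>\<^bsub>KL\<^esub> unt \<pi>) = Ident KL (fob \<pi> a)"
proof -
  have "\<forall>a \<in> Ob KH.
        far \<pi> (Lunit KH a) \<cdot>\<^bsub>KL\<^esub> lax \<pi> (Unit KH) a \<cdot>\<^bsub>KL\<^esub> (unt \<pi> \<otimes>\<^bsub>KL\<^esub> Ident KL (fob \<pi> a)) =
          Lunit KL (fob \<pi> a) \<and>
        far \<pi> (Runit KH a) \<cdot>\<^bsub>KL\<^esub> lax \<pi> a (Unit KH) \<cdot>\<^bsub>KL\<^esub> (Ident KL (fob \<pi> a) \<otimes>\<^bsub>KL\<^esub> unt \<pi>) =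
          Runit KL (fob \<pi> a)"
    using is_functor unfolding markov_functor_def by (elim conjE)
  then show "lax \<pi> [] a \<cdot>\<^bsub>KL\<^esub> (unt \<pi> \<otimes>\<^bsub>KL\<^esub> Ident KL (fob \<pi> a)) = Ident KL (fob \<pi> a)"
    "lax \<pi> a [] \<cdot>\<^bsub>KL\<^esub> (Ident KL (fob \<pi> a) \<otimes>\<^bsub>KL\<^esub> unt \<pi>) = Ident KL (fob \<pi> a)"
    using assms by simp_all
qed

lemma far_swap:
  assumes "a \<in> lists (types QH)" "b \<in> lists (types QH)"
  shows "far \<pi> (Swap KH a b) \<cdot>\<^bsub>KL\<^esub> lax \<pi> a b = lax \<pi> b a \<cdot>\<^bsub>KL\<^esub> Swap KL (fob \<pi> a) (fob \<pi> b)"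
proof -
  have "\<forall>a \<in> Ob KH. \<forall>b \<in> Ob KH.
        far \<pi> (Swap KH a b) \<cdot>\<^bsub>KL\<^esub> lax \<pi> a b = lax \<pi> b a \<cdot>\<^bsub>KL\<^esub> Swap KL (fob \<pi> a) (fob \<pi> b)"
    using is_functor unfolding markov_functor_def by (elim conjE)
  then show ?thesis using assms by simp
qed

lemma far_copy:
  assumes "a \<in> lists (types QH)"
  shows "far \<pi> (Copy KH a) = lax \<pi> a a \<cdot>\<^bsub>KL\<^esub> Copy KL (fob \<pi> a)"
proof -
  have "\<forall>a \<in> Ob KH. far \<pi> (Copy KH a) = lax \<pi> a a \<cdot>\<^bsub>KL\<^esub> Copy KL (fob \<pi> a)"
    using is_functor unfolding markov_functor_def by (elim conjE)
  then show ?thesis using assms by simp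
qed

abbreviation "cmpr \<equiv> comparison QL \<pi>"
abbreviation "ob1 \<equiv> \<lambda>X. fob \<pi> [X]"

lemma concat_image_append: "concat_image \<pi> (xs @ ys) = concat_image \<pi> xs @ concat_image \<pi> ys"
  by (simp add: concat_image_def)

lemma comparison_typing:
  "xs \<in> lists (types QH) \<Longrightarrow> cmpr xs \<in> Ar KL \<and> Src KL (cmpr xs) = concat_image \<pi> xs \<and>
    Tgt KL (cmpr xs) = fob \<pi> xs \<and> iso KL (cmpr xs) \<and> B.det (cmpr xs)"
  by (induction xs) (auto simp: concat_image_def)

lemma comparison_simps [simp]:
  assumes "xs \<in> lists (types QH)"
  shows "cmpr xs \<in> Ar KL" "Src KL (cmpr xs) = concat_image \<pi> xs" "Tgt KL (cmpr xs) = fob \<pi> xs"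
    "iso KL (cmpr xs)" "B.det (cmpr xs)"
  using comparison_typing[OF assms] by auto

text \<open>The recursion for \<open>comparison\<close> ends in \<open>unt \<pi>\<close>, which the
  right unit law of \<open>lax\<close> absorbs.\<close>

lemma comparison_single: "X \<in> types QH \<Longrightarrow> cmpr [X] = Ident KL (fob \<pi> [X])"
  using lax_unit(2)[of "[X]"] by simp

text \<open>Coherence of the iterated structure morphisms: each step of the induction on
  \<open>xs\<close> is \<open>lax_assoc\<close>, and the left unit law closes it at the empty
  list.\<close>

lemma comparison_append:
  assumes "xs \<in> lists (types QH)" and ys: "ys \<in> lists (types QH)"
  shows "cmpr (xs @ ys) = lax \<pi> xs ys \<cdot>\<^bsub>KL\<^esub> (cmpr xs \<otimes>\<^bsub>KL\<^esub> cmpr ys)"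
  using assms(1)
proof (induction xs)
  case Nil
  have "lax \<pi> [] ys \<cdot>\<^bsub>KL\<^esub> (unt \<pi> \<otimes>\<^bsub>KL\<^esub> cmpr ys)
      = lax \<pi> [] ys \<cdot>\<^bsub>KL\<^esub> (unt \<pi> \<otimes>\<^bsub>KL\<^esub> Ident KL (fob \<pi> ys)) \<cdot>\<^bsub>KL\<^esub> cmpr ys"
    using ys B.interchange[of "Ident KL []" "unt \<pi>" "cmpr ys" "Ident KL (fob \<pi> ys)"] by simp
  also have "\<dots> = cmpr ys"
    using ys B.cmp_extend[OF lax_unit(1)[OF ys], of "cmpr ys"] by simp
  finally show ?case by simp
next
  case (Cons x xs)
  then have l: "[x] \<in> lists (types QH)" "xs \<in> lists (types QH)" "xs @ ys \<in> lists (types QH)" using ys by auto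
  let ?i = "Ident KL (fob \<pi> [x])"
  have "cmpr ((x # xs) @ ys) = (lax \<pi> [x] (xs @ ys) \<cdot>\<^bsub>KL\<^esub> (?i \<otimes>\<^bsub>KL\<^esub> lax \<pi> xs ys)) \<cdot>\<^bsub>KL\<^esub> (?i \<otimes>\<^bsub>KL\<^esub> (cmpr xs \<otimes>\<^bsub>KL\<^esub> cmpr ys))"
    using Cons l ys by simp
  also have "\<dots> = (lax \<pi> ([x] @ xs) ys \<cdot>\<^bsub>KL\<^esub> (lax \<pi> [x] xs \<otimes>\<^bsub>KL\<^esub> Ident KL (fob \<pi> ys))) \<cdot>\<^bsub>KL\<^esub> ((?i \<otimes>\<^bsub>KL\<^esub> cmpr xs) \<otimes>\<^bsub>KL\<^esub> cmpr ys)"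
    using l ys by (subst lax_assoc) (simp_all del: B.interchange B.interchange_cmp)
  also have "\<dots> = lax \<pi> (x # xs) ys \<cdot>\<^bsub>KL\<^esub> (cmpr (x # xs) \<otimes>\<^bsub>KL\<^esub> cmpr ys)"
    using l ys by (simp del: B.ten_assoc)
  finally show ?case .
qed

text \<open>Conjugation by the comparison isomorphisms makes the functor strict.\<close>

definition strictified :: "('t, 'g) trm set \<Rightarrow> ('s, 'h) trm set" where
  "strictified f = inverse_of KL (cmpr (Tgt KH f)) \<cdot>\<^bsub>KL\<^esub> far \<pi> f \<cdot>\<^bsub>KL\<^esub> cmpr (Src KH f)"

lemma Src_Tgt_lists: "f \<in> Ar KH \<Longrightarrow> Src KH f \<in> lists (types QH) \<and> Tgt KH f \<in> lists (types QH)"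
  using A.src_Ob A.tgt_Ob by simp

lemma comparison_strictified:
  assumes "f \<in> Ar KH"
  shows "cmpr (Tgt KH f) \<cdot>\<^bsub>KL\<^esub> strictified f = far \<pi> f \<cdot>\<^bsub>KL\<^esub> cmpr (Src KH f)"
  using Src_Tgt_lists[OF assms] assms by (simp add: strictified_def)

lemma strictified_typing:
  assumes "f \<in> Ar KH"
  shows "strictified f \<in> Ar KL" "Src KL (strictified f) = concat_image \<pi> (Src KH f)"
    "Tgt KL (strictified f) = concat_image \<pi> (Tgt KH f)"
  using Src_Tgt_lists[OF assms] assms by (simp_all add: strictified_def)

text \<open>Characterizes the conjugated morphism without inverses, so that a law of the strictified
  functor becomes an equation between composites with comparisons.\<close>

lemma strictified_eqI:
  assumes "f \<in> Ar KH" "g \<in> Ar KL" "Tgt KL g = concat_image \<pi> (Tgt KH f)" "Src KL g = concat_image \<pi> (Src KH f)"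
    "cmpr (Tgt KH f) \<cdot>\<^bsub>KL\<^esub> g = far \<pi> f \<cdot>\<^bsub>KL\<^esub> cmpr (Src KH f)"
  shows "strictified f = g"
  using assms Src_Tgt_lists[OF assms(1)] by (simp add: strictified_def flip: assms(5))

text \<open>The laws of \<open>\<pi>\<close> hold up to \<open>lax\<close>, and
  \<open>comparison_append\<close> splits the comparison of a concatenation into exactly this
  \<open>lax\<close> and the comparisons of the parts. Cancelling them leaves strict laws.\<close>

lemma strict_functor_strictified: "strict_functor KH KL ob1 strictified"
proof (unfold_locales, goal_cases)
  case (1 a)
  have "fob \<pi> [X] \<in> lists (types QL)" if "X \<in> set a" for X
    using 1 that by (intro fob_Ob) auto
  then show ?case by auto
next
  case (2 f)
  then show ?case by (rule strictified_typing)
next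
  case (3 f)
  then show ?case by (simp add: strictified_typing concat_image_def)
next
  case (4 f)
  then show ?case by (simp add: strictified_typing concat_image_def)
next
  case (5 a)
  then show ?case by (simp add: strictified_def concat_image_def)
next
  case (6 f g)
  then show ?case using Src_Tgt_lists[of f] Src_Tgt_lists[of g] by (simp add: strictified_def)
next
  case (7 f g)
  note l = Src_Tgt_lists[OF 7(1)] Src_Tgt_lists[OF 7(2)]
  note st = strictified_typing[OF 7(1)] strictified_typing[OF 7(2)]
  have "cmpr (Tgt KH f @ Tgt KH g) \<cdot>\<^bsub>KL\<^esub> (strictified f \<otimes>\<^bsub>KL\<^esub> strictified g)
      = lax \<pi> (Tgt KH f) (Tgt KH g) \<cdot>\<^bsub>KL\<^esub> ((far \<pi> f \<cdot>\<^bsub>KL\<^esub> cmpr (Src KH f)) \<otimes>\<^bsub>KL\<^esub> (far \<pi> g \<cdot>\<^bsub>KL\<^esub> cmpr (Src KH g)))"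
    using l st 7 by (simp add: comparison_append comparison_strictified)
  also have "\<dots> = (lax \<pi> (Tgt KH f) (Tgt KH g) \<cdot>\<^bsub>KL\<^esub> (far \<pi> f \<otimes>\<^bsub>KL\<^esub> far \<pi> g)) \<cdot>\<^bsub>KL\<^esub> (cmpr (Src KH f) \<otimes>\<^bsub>KL\<^esub> cmpr (Src KH g))"
    using l 7 by simp
  also have "\<dots> = far \<pi> (f \<otimes>\<^bsub>KH\<^esub> g) \<cdot>\<^bsub>KL\<^esub> cmpr (Src KH f @ Src KH g)"
    using l 7 by (simp flip: far_ten add: comparison_append)
  finally show ?case
    using l st 7 by (intro strictified_eqI) (simp_all add: concat_image_append)
next
  case (8 a b)
  then have l: "a \<in> lists (types QH)" "b \<in> lists (types QH)" by simp_all
  have cI: "concat (map ob1 xs) = concat_image \<pi> xs" for xs by (simp add: concat_image_def)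
  have ob: "concat_image \<pi> a \<in> lists (types QL)" "concat_image \<pi> b \<in> lists (types QL)"
    using B.src_Ob[of "cmpr a"] B.src_Ob[of "cmpr b"] l by simp_all
  have "cmpr (b @ a) \<cdot>\<^bsub>KL\<^esub> Swap KL (concat_image \<pi> a) (concat_image \<pi> b)
      = lax \<pi> b a \<cdot>\<^bsub>KL\<^esub> (cmpr b \<otimes>\<^bsub>KL\<^esub> cmpr a) \<cdot>\<^bsub>KL\<^esub> Swap KL (concat_image \<pi> a) (concat_image \<pi> b)"
    using l ob by (simp add: comparison_append)
  also have "\<dots> = (lax \<pi> b a \<cdot>\<^bsub>KL\<^esub> Swap KL (fob \<pi> a) (fob \<pi> b)) \<cdot>\<^bsub>KL\<^esub> (cmpr a \<otimes>\<^bsub>KL\<^esub> cmpr b)"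
    using l ob B.swap_nat[of "cmpr a" "cmpr b" "fob \<pi> a" "fob \<pi> b"] by simp
  also have "\<dots> = far \<pi> (Swap KH a b) \<cdot>\<^bsub>KL\<^esub> cmpr (a @ b)"
    using l ob by (simp flip: far_swap add: comparison_append)
  finally show ?case
    using l ob unfolding cI by (intro strictified_eqI) (simp_all add: concat_image_append)
next
  case (9 a)
  then have l: "a \<in> lists (types QH)" by simp
  have cI: "concat (map ob1 xs) = concat_image \<pi> xs" for xs by (simp add: concat_image_def)
  have ob: "concat_image \<pi> a \<in> lists (types QL)"
    using B.src_Ob[of "cmpr a"] l by simp
  have "cmpr (a @ a) \<cdot>\<^bsub>KL\<^esub> Copy KL (concat_image \<pi> a) = far \<pi> (Copy KH a) \<cdot>\<^bsub>KL\<^esub> cmpr a"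
    using l ob B.copy_cmp_det[of "cmpr a"] by (simp add: comparison_append far_copy)
  then show ?case
    using l ob unfolding cI by (intro strictified_eqI) (simp_all add: concat_image_append)
qed

end

definition strict_mfunctor ::
  "('b list, 'n) mcat \<Rightarrow> ('a \<Rightarrow> 'b list) \<Rightarrow> ('m \<Rightarrow> 'n) \<Rightarrow> ('a list, 'm, 'b list, 'n) mfunctor" where
  "strict_mfunctor B ob F =
     \<lparr> fob = (\<lambda>xs. concat (map ob xs)), far = F,
       lax = (\<lambda>xs ys. Ident B (concat (map ob (xs @ ys)))), unt = Ident B [] \<rparr>"

lemma strict_mfunctor_simps [simp]:
  "fob (strict_mfunctor B ob F) xs = concat (map ob xs)"
  "far (strict_mfunctor B ob F) = F"
  "lax (strict_mfunctor B ob F) xs ys = Ident B (concat (map ob (xs @ ys)))"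
  "unt (strict_mfunctor B ob F) = Ident B []"
  by (simp_all add: strict_mfunctor_def)

context strict_functor
begin

lemma markov_functor_strict: "markov_functor A B (strict_mfunctor B ob F)"
  unfolding markov_functor_def
  by (intro conjI allI ballI) (simp_all add: in_hom_iff)

end

section \<open>Downward abstractions restrict to interchange abstractions\<close>

lemma distinct_concat_map_D: "\<lbrakk>distinct (concat (map p xs)); x \<in> set xs\<rbrakk> \<Longrightarrow> distinct (p x)"
  by (induction xs) auto

lemma concat_map_disjoint:
  assumes "distinct (concat (map p xs))" "distinct xs" "x \<in> set xs" "y \<in> set xs" "x \<noteq> y"
  shows "set (p x) \<inter> set (p y) = {}"
  using assms by (induction xs) auto

lemma distinct_concat_map:
  assumes "distinct xs" "\<And>x. x \<in> set xs \<Longrightarrow> distinct (p x)"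
    "\<And>x y. \<lbrakk>x \<in> set xs; y \<in> set xs; x \<noteq> y\<rbrakk> \<Longrightarrow> set (p x) \<inter> set (p y) = {}"
  shows "distinct (concat (map p xs))"
  using assms
proof (induction xs)
  case (Cons x xs)
  have "set (p x) \<inter> set (p y) = {}" if "y \<in> set xs" for y
    using Cons.prems(3)[of x y] Cons.prems(1) that by auto
  then show ?case using Cons by auto
qed simp

context strict_markov
begin

lemma list_tensor_ar_replicate_cmp:
  assumes "f \<in> Ar K" "g \<in> Ar K" "Src K g = Tgt K f"
  shows "list_tensor_ar K (replicate n g) \<cdot> list_tensor_ar K (replicate n f) = list_tensor_ar K (replicate n (g \<cdot> f))"
proof (induction n)
  case (Suc n)
  have "set (replicate n f) \<subseteq> Ar K" "set (replicate n g) \<subseteq> Ar K" using assms by auto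
  then show ?case using Suc assms by simp
qed simp

text \<open>The input of an interchange query consists of \<open>n + 1\<close> copies of one list;
  this turns a tensor product along it into equal blocks, one for each copy.\<close>

lemma list_tensor_ar_concat_replicate:
  assumes "set fs \<subseteq> Ar K"
  shows "list_tensor_ar K (concat (replicate n fs)) = list_tensor_ar K (replicate n (list_tensor_ar K fs))"
proof (induction n)
  case (Suc n)
  have "set (concat (replicate n fs)) \<subseteq> Ar K" using assms by (auto simp: set_replicate_conv_if)
  then show ?case using Suc assms by (simp add: list_tensor_ar_append)
qed simp

lemma list_tensor_ar_replicate_typing:
  assumes "f \<in> Ar K"
  shows "list_tensor_ar K (replicate n f) \<in> Ar K"
    "Src K (list_tensor_ar K (replicate n f)) = concat (replicate n (Src K f))"
    "Tgt K (list_tensor_ar K (replicate n f)) = concat (replicate n (Tgt K f))"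
proof -
  have "set (replicate n f) \<subseteq> Ar K" using assms by auto
  from list_tensor_ar_typing[OF this]
  show "list_tensor_ar K (replicate n f) \<in> Ar K"
    "Src K (list_tensor_ar K (replicate n f)) = concat (replicate n (Src K f))"
    "Tgt K (list_tensor_ar K (replicate n f)) = concat (replicate n (Tgt K f))"
    by (simp_all add: map_replicate)
qed

end

section \<open>Transformations between two models, expressed in the strictification\<close>

locale model_pair = markov_category C + L: markov_model C L + H: markov_model C H
  for C :: "('o, 'm) mcat" and L :: "('v, 'o, 'm) causal_model" and H :: "('u, 'o, 'm) causal_model"
begin

abbreviation "S \<equiv> strictify C"
abbreviation "QL \<equiv> int_signature L"
abbreviation "QH \<equiv> int_signature H"
abbreviation "KL \<equiv> free_markov QL"
abbreviation "KH \<equiv> free_markov QH"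

text \<open>\<open>\<tau>\<close> as a morphism of the strictification, where its monoidality
  becomes an equation with the strict tensor product.\<close>

definition component :: "('u, 'v) int_functor \<Rightarrow> ('u list \<Rightarrow> 'm) \<Rightarrow> 'u list \<Rightarrow> 'o list \<times> 'm \<times> 'o list" where
  "component \<pi> \<tau> xs = (map (val L) (fob \<pi> xs), \<tau> xs, map (val H) xs)"

lemma component_simps [simp]:
  "Src S (component \<pi> \<tau> xs) = map (val L) (fob \<pi> xs)" "Tgt S (component \<pi> \<tau> xs) = map (val H) xs"
  "underlying (component \<pi> \<tau> xs) = \<tau> xs"
  by (simp_all add: component_def strictify_simps underlying_def)

text \<open>All axioms are moved into the strictification, where \<open>join\<close> disappears into
  \<open>\<boxtimes>\<close>. The unit axiom is recovered in \<open>r4\<close> from terminality of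
  the empty list.\<close>

lemma markov_transformation_iff:
  assumes "free_functor QH QL \<pi>"
  shows "markov_transformation KH C (functor_comp C (int_model C L) \<pi>) (int_model C H) \<tau> \<longleftrightarrow>
    (\<forall>xs \<in> lists (verts H). component \<pi> \<tau> xs \<in> Ar S \<and> deterministic S (component \<pi> \<tau> xs)) \<and>
    (\<forall>f \<in> Ar KH. component \<pi> \<tau> (Tgt KH f) \<bullet> L.sem (far \<pi> f) = H.sem f \<bullet> component \<pi> \<tau> (Src KH f)) \<and>
    (\<forall>xs \<in> lists (verts H). \<forall>ys \<in> lists (verts H).
      component \<pi> \<tau> (xs @ ys) \<bullet> L.sem (lax \<pi> xs ys) = component \<pi> \<tau> xs \<boxtimes> component \<pi> \<tau> ys)"
    (is "?l \<longleftrightarrow> ?r1 \<and> ?r2 \<and> ?r3")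
proof -
  interpret P: free_functor QH QL \<pi> by fact
  let ?T = "component \<pi> \<tau>"
  have vL: "map (val L) xs \<in> lists (Ob C)" if "xs \<in> lists (verts L)" for xs using that L.val_Ob by auto
  have vH: "map (val H) xs \<in> lists (Ob C)" if "xs \<in> lists (verts H)" for xs using that H.val_Ob by auto
  have fob: "fob \<pi> xs \<in> lists (verts L)" if "xs \<in> lists (verts H)" for xs using P.fob_Ob[of xs] that by simp
  have r1: "(\<forall>a \<in> Ob KH. \<tau> a \<in> hom C (fob (functor_comp C (int_model C L) \<pi>) a) (fob (int_model C H) a) \<and>
      deterministic C (\<tau> a)) \<longleftrightarrow> ?r1"
  proof -
    have "\<tau> a \<in> hom C (fob (functor_comp C (int_model C L) \<pi>) a) (fob (int_model C H) a) \<and>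
        deterministic C (\<tau> a) \<longleftrightarrow> ?T a \<in> Ar S \<and> deterministic S (?T a)" if "a \<in> lists (verts H)" for a
    proof -
      have "?T a \<in> Ar S \<longleftrightarrow> \<tau> a \<in> hom C (fob (functor_comp C (int_model C L) \<pi>) a) (fob (int_model C H) a)"
        using vL[OF fob[OF that]] vH[OF that]
        by (simp add: component_def strictify_simps functor_comp_def in_hom_iff)
      then show ?thesis using deterministic_strictify_iff by (auto simp: component_def)
    qed
    then show ?thesis by simp
  qed
  have r2: "\<tau> b \<cdot>\<^bsub>C\<^esub> far (functor_comp C (int_model C L) \<pi>) f = far (int_model C H) f \<cdot>\<^bsub>C\<^esub> \<tau> a \<longleftrightarrow>
      ?T b \<bullet> L.sem (far \<pi> f) = H.sem f \<bullet> ?T a"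
    if f: "f \<in> Ar KH" "Src KH f = a" "Tgt KH f = b" and r1: ?r1 for f a b
  proof -
    have ab: "a \<in> lists (verts H)" "b \<in> lists (verts H)" using P.Src_Tgt_lists[OF f(1)] f by auto
    have Ar: "?T a \<in> Ar S" "?T b \<in> Ar S" "L.sem (far \<pi> f) \<in> Ar S" "H.sem f \<in> Ar S"
      using r1 ab f by auto
    have "?T b \<bullet> L.sem (far \<pi> f) = H.sem f \<bullet> ?T a \<longleftrightarrow>
        underlying (?T b \<bullet> L.sem (far \<pi> f)) = underlying (H.sem f \<bullet> ?T a)"
      using Ar f by (auto intro!: strictify_eqI)
    then show ?thesis
      using Ar by (simp add: strictify_cmp functor_comp_def L.far_int_model H.far_int_model)
  qed
  have r3: "\<tau> (xs @ ys) \<cdot>\<^bsub>C\<^esub> lax (functor_comp C (int_model C L) \<pi>) xs ys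
      = lax (int_model C H) xs ys \<cdot>\<^bsub>C\<^esub> (\<tau> xs \<otimes>\<^bsub>C\<^esub> \<tau> ys) \<longleftrightarrow>
      ?T (xs @ ys) \<bullet> L.sem (lax \<pi> xs ys) = ?T xs \<boxtimes> ?T ys"
    if l: "xs \<in> lists (verts H)" "ys \<in> lists (verts H)" and r1: ?r1 for xs ys
  proof -
    let ?j = "join C (map (val L) (fob \<pi> xs)) (map (val L) (fob \<pi> ys))"
    have Ar: "?T xs \<in> Ar S" "?T ys \<in> Ar S" "?T (xs @ ys) \<in> Ar S" "L.sem (lax \<pi> xs ys) \<in> Ar S"
      "lax \<pi> xs ys \<in> Ar KL"
      using r1 l by auto
    have *: "Src S (L.sem (lax \<pi> xs ys)) = map (val L) (fob \<pi> xs) @ map (val L) (fob \<pi> ys)"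
       "Tgt S (L.sem (lax \<pi> xs ys)) = map (val L) (fob \<pi> (xs @ ys))"
      using l Ar(5) by simp_all
    have j: "iso C ?j" "Src C ?j = tlist C (map (val L) (fob \<pi> xs)) \<odot>\<^bsub>C\<^esub> tlist C (map (val L) (fob \<pi> ys))"
      "Tgt C ?j = tlist C (map (val L) (fob \<pi> xs @ fob \<pi> ys))" "?j \<in> Ar C"
      using vL[OF fob[OF l(1)]] vL[OF fob[OF l(2)]] by simp_all
    have "?T (xs @ ys) \<bullet> L.sem (lax \<pi> xs ys) = ?T xs \<boxtimes> ?T ys \<longleftrightarrow>
        underlying (?T (xs @ ys) \<bullet> L.sem (lax \<pi> xs ys)) = underlying (?T xs \<boxtimes> ?T ys)"
      using Ar(1-4) * by (auto intro!: strictify_eqI)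
    \<comment> \<open>Precomposition with the invertible \<open>?j\<close> turns the strict tensor
      product into that of \<open>C\<close>.\<close>
    also have "\<dots> \<longleftrightarrow> underlying (?T (xs @ ys) \<bullet> L.sem (lax \<pi> xs ys)) \<cdot>\<^bsub>C\<^esub> ?j = underlying (?T xs \<boxtimes> ?T ys) \<cdot>\<^bsub>C\<^esub> ?j"
    proof -
      have "?T (xs @ ys) \<bullet> L.sem (lax \<pi> xs ys) \<in> Ar S" "?T xs \<boxtimes> ?T ys \<in> Ar S"
        "Src S (?T (xs @ ys) \<bullet> L.sem (lax \<pi> xs ys)) = map (val L) (fob \<pi> xs @ fob \<pi> ys)"
        "Src S (?T xs \<boxtimes> ?T ys) = map (val L) (fob \<pi> xs @ fob \<pi> ys)"
        using Ar(1-4) * by simp_all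
      note u = underlying_simps[OF this(1)] underlying_simps[OF this(2)] this(3,4)
      show ?thesis
        using iso_cancel_right[OF j(1), of "underlying (?T (xs @ ys) \<bullet> L.sem (lax \<pi> xs ys))" "underlying (?T xs \<boxtimes> ?T ys)"]
          u j by auto
    qed
    also have "\<dots> \<longleftrightarrow> \<tau> (xs @ ys) \<cdot>\<^bsub>C\<^esub> underlying (L.sem (lax \<pi> xs ys)) \<cdot>\<^bsub>C\<^esub> ?j
        = join C (map (val H) xs) (map (val H) ys) \<cdot>\<^bsub>C\<^esub> (\<tau> xs \<otimes>\<^bsub>C\<^esub> \<tau> ys)"
      using underlying_ten[OF Ar(1,2)] strictify_cmp[OF Ar(4,3)] underlying_simps[OF Ar(3)] underlying_simps[OF Ar(4)] j *
      by simp
    finally show ?thesis by (simp add: functor_comp_def L.far_int_model)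
  qed
  have r4: "\<tau> [] \<cdot>\<^bsub>C\<^esub> unt (functor_comp C (int_model C L) \<pi>) = unt (int_model C H)" if r1: ?r1
  proof -
    have Ar: "?T [] \<in> Ar S" "L.sem (unt \<pi>) \<in> Ar S" using r1 by auto
    have *: "Src S (L.sem (unt \<pi>)) = []" "Tgt S (L.sem (unt \<pi>)) = map (val L) (fob \<pi> [])"
      using P.unt_typing(1-3) by simp_all
    have "?T [] \<bullet> L.sem (unt \<pi>) = Ident S []"
      using L.S.terminal[of "?T [] \<bullet> L.sem (unt \<pi>)"] Ar * by simp
    moreover have "underlying (Ident S []) = Ident C (Unit C)"
      by (simp add: strictify_simps underlying_def)
    ultimately have "\<tau> [] \<cdot>\<^bsub>C\<^esub> underlying (L.sem (unt \<pi>)) = Ident C (Unit C)"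
      using strictify_cmp[OF Ar(2,1)] by simp
    then show ?thesis
      using underlying_simps[OF Ar(2)] * by (simp add: functor_comp_def L.far_int_model)
  qed
  show ?thesis
  proof
    assume ?l
    then have l: "\<forall>a \<in> Ob KH. \<tau> a \<in> hom C (fob (functor_comp C (int_model C L) \<pi>) a) (fob (int_model C H) a) \<and>
        deterministic C (\<tau> a)"
      "\<And>a b f. f \<in> hom KH a b \<Longrightarrow> \<tau> b \<cdot>\<^bsub>C\<^esub> far (functor_comp C (int_model C L) \<pi>) f = far (int_model C H) f \<cdot>\<^bsub>C\<^esub> \<tau> a"
      "\<forall>a \<in> Ob KH. \<forall>b \<in> Ob KH. \<tau> (a \<odot>\<^bsub>KH\<^esub> b) \<cdot>\<^bsub>C\<^esub> lax (functor_comp C (int_model C L) \<pi>) a b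
        = lax (int_model C H) a b \<cdot>\<^bsub>C\<^esub> (\<tau> a \<otimes>\<^bsub>C\<^esub> \<tau> b)"
      unfolding markov_transformation_def by blast+
    have 1: ?r1 using l(1) unfolding r1 .
    moreover have ?r2
    proof
      fix f assume f: "f \<in> Ar KH"
      show "?T (Tgt KH f) \<bullet> L.sem (far \<pi> f) = H.sem f \<bullet> ?T (Src KH f)"
        by (rule r2[THEN iffD1, OF f HOL.refl HOL.refl 1]) (rule l(2), simp add: in_hom_iff f)
    qed
    moreover have ?r3 using l(3) r3 1 by simp
    ultimately show "?r1 \<and> ?r2 \<and> ?r3" by blast
  next
    assume r: "?r1 \<and> ?r2 \<and> ?r3"
    then have 1: ?r1 by blast
    have "\<tau> b \<cdot>\<^bsub>C\<^esub> far (functor_comp C (int_model C L) \<pi>) f = far (int_model C H) f \<cdot>\<^bsub>C\<^esub> \<tau> a"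
      if "f \<in> hom KH a b" for f a b
      using r2[of f a b] that r by (auto simp: in_hom_iff)
    moreover have "\<forall>a \<in> Ob KH. \<forall>b \<in> Ob KH. \<tau> (a \<odot>\<^bsub>KH\<^esub> b) \<cdot>\<^bsub>C\<^esub> lax (functor_comp C (int_model C L) \<pi>) a b
        = lax (int_model C H) a b \<cdot>\<^bsub>C\<^esub> (\<tau> a \<otimes>\<^bsub>C\<^esub> \<tau> b)"
      using r3 r by simp
    ultimately show ?l
      unfolding markov_transformation_def using 1 r1 r4 by simp
  qed
qed

text \<open>Monoidality determines \<open>\<tau>\<close> from its components at single variables:
  its iteration along the list splits off one variable at a time.\<close>

lemma component_comparison:
  assumes "free_functor QH QL \<pi>" "markov_transformation KH C (functor_comp C (int_model C L) \<pi>) (int_model C H) \<tau>"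
    and "xs \<in> lists (verts H)"
  shows "component \<pi> \<tau> xs \<bullet> L.sem (comparison QL \<pi> xs) = list_tensor_ar S (map (\<lambda>X. component \<pi> \<tau> [X]) xs)"
proof -
  interpret P: free_functor QH QL \<pi> by fact
  let ?T = "component \<pi> \<tau>"
  note T = assms(2)[unfolded markov_transformation_iff[OF assms(1)]]
  show ?thesis
    using assms(3)
  proof (induction xs)
    case Nil
    have "?T [] \<in> Ar S" using T by simp
    then show ?case
      using L.S.terminal[of "?T [] \<bullet> L.sem (unt \<pi>)"] P.unt_typing by simp
  next
    case (Cons x xs)
    then have l: "[x] \<in> lists (verts H)" "xs \<in> lists (verts H)" by auto
    have Ar: "?T [x] \<in> Ar S" "?T xs \<in> Ar S" "?T (x # xs) \<in> Ar S" using T l Cons.prems by auto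
    have lx: "lax \<pi> [x] xs \<in> Ar KL" "Src KL (lax \<pi> [x] xs) = fob \<pi> [x] @ fob \<pi> xs"
      "Tgt KL (lax \<pi> [x] xs) = fob \<pi> (x # xs)" using l P.lax_typing[of "[x]" xs] by simp_all
    have fx: "fob \<pi> [x] \<in> lists (verts L)" using P.fob_Ob[of "[x]"] l by simp
    have vfx: "map (val L) (fob \<pi> [x]) \<in> lists (Ob C)" using fx L.val_Ob by auto
    have c: "P.cmpr xs \<in> Ar KL" "Tgt KL (P.cmpr xs) = fob \<pi> xs" using P.comparison_simps[of xs] l by simp_all
    have "?T (x # xs) \<bullet> L.sem (P.cmpr (x # xs))
        = (?T ([x] @ xs) \<bullet> L.sem (lax \<pi> [x] xs)) \<bullet> (Ident S (map (val L) (fob \<pi> [x])) \<boxtimes> L.sem (P.cmpr xs))"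
      using Ar lx c fx vfx L.F.ident[of "fob \<pi> [x]"] by (simp del: L.F.ident)
    also have "\<dots> = (?T [x] \<boxtimes> ?T xs) \<bullet> (Ident S (map (val L) (fob \<pi> [x])) \<boxtimes> L.sem (P.cmpr xs))"
    proof -
      have "?T ([x] @ xs) \<bullet> L.sem (lax \<pi> [x] xs) = ?T [x] \<boxtimes> ?T xs" using T l by blast
      then show ?thesis by simp
    qed
    also have "\<dots> = ?T [x] \<boxtimes> (?T xs \<bullet> L.sem (P.cmpr xs))"
      using Ar c vfx by simp
    finally show ?case using Cons.IH l(2) by simp
  qed
qed

lemma intervention_sets_image:
  assumes "intervention_sets H Ss" "disjoint_family_on p (verts H)" "\<And>X. X \<in> nins H \<Longrightarrow> p X \<subseteq> nins L"
  shows "intervention_sets L (map (image_set p) Ss)"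
  using assms(1)
proof (induction Ss)
  case (Cons A Ss)
  then have A: "A \<subseteq> nins H" "\<forall>T \<in> set Ss. A \<inter> T = {}" "intervention_sets H Ss"
    by (simp_all add: intervention_sets_Cons)
  have "image_set p A \<inter> image_set p T = {}" if "T \<in> set Ss" for T
  proof -
    have T: "T \<subseteq> nins H" "A \<inter> T = {}" using A that by (auto simp: intervention_sets_def)
    have "p X \<inter> p Y = {}" if "X \<in> A" "Y \<in> T" for X Y
      using that T A(1) H.nins_verts by (intro disjoint_family_onD[OF assms(2)]) auto
    then show ?thesis unfolding image_set_def by blast
  qed
  then show ?case using Cons.IH[OF A(3)] A(1) assms(3) by (auto simp: intervention_sets_Cons image_set_def)
qed simp

lemma wireQ_typing:
  assumes "set xs \<subseteq> verts L" "set ys \<subseteq> set xs"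
  shows "wireQ L xs ys \<in> Ar KL" "Src KL (wireQ L xs ys) = xs" "Tgt KL (wireQ L xs ys) = ys"
proof -
  have "(\<lambda>x. [x]) ` set xs \<subseteq> Ob KL" using assms(1) by auto
  then show "wireQ L xs ys \<in> Ar KL" "Src KL (wireQ L xs ys) = xs" "Tgt KL (wireQ L xs ys) = ys"
    using assms(2) by simp_all
qed

lemma query_Ar:
  "(Ss, A) \<in> gens QL \<Longrightarrow> query QL (Ss, A) \<in> Ar KL \<and> Src KL (query QL (Ss, A)) = gsrc QL (Ss, A) \<and>
    Tgt KL (query QL (Ss, A)) = gtgt QL (Ss, A)"
  "(Ts, B) \<in> gens QH \<Longrightarrow> query QH (Ts, B) \<in> Ar KH \<and> Src KH (query QH (Ts, B)) = gsrc QH (Ts, B) \<and>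
    Tgt KH (query QH (Ts, B)) = gtgt QH (Ts, B)"
  using L.wt_gen[of Ss A] H.wt_gen[of Ts B] by (simp_all add: query_def del: wt.simps)

end

section \<open>A downward abstraction on variables and queries\<close>

locale downward = model_pair +
  fixes \<pi> and \<tau>
  assumes down: "(\<pi>, \<tau>) \<in> downward_int_abstractions C L H"
begin

sublocale P: free_functor QH QL \<pi>
  using down by unfold_locales (simp add: downward_int_abstractions_def downward_abstraction_def)

abbreviation "p \<equiv> \<lambda>X. fob \<pi> [X]"
abbreviation "t \<equiv> \<lambda>X. component \<pi> \<tau> [X]"
abbreviation "tens xs \<equiv> list_tensor_ar S (map t xs)"

lemma transformation:
  "markov_transformation KH C (functor_comp C (int_model C L) \<pi>) (int_model C H) \<tau>"
  and epic_component: "xs \<in> lists (verts H) \<Longrightarrow> epic C (\<tau> xs)"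
  and variables: "maps_variables L H \<pi>" and queries: "maps_queries L H \<pi>"
  using down by (simp_all add: downward_int_abstractions_def downward_abstraction_def)

lemmas transformation' = transformation[unfolded markov_transformation_iff[OF P.free_functor_axioms]]

lemma p_verts: "X \<in> verts H \<Longrightarrow> set (p X) \<subseteq> verts L"
  using P.fob_Ob[of "[X]"] by auto

lemma p_ins: "image_set (\<lambda>X. set (p X)) (ins H) = ins L"
  using variables H.ins_verts by (simp add: maps_variables_def concat_image_def image_set_def)

lemma p_nins: "X \<in> nins H \<Longrightarrow> set (p X) \<subseteq> nins L"
  using variables H.nins_verts by (auto simp: maps_variables_def concat_image_def)

lemma distinct_p: "X \<in> verts H \<Longrightarrow> distinct (p X)"
proof -
  assume "X \<in> verts H"
  then consider "X \<in> ins H" | "X \<in> nins H" by (auto simp: nins_def)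
  then show ?thesis
    using variables H.ins_verts H.nins_verts distinct_concat_map_D[of p]
    by cases (auto simp: maps_variables_def concat_image_def)
qed

text \<open>\<open>maps_variables\<close> gives distinctness separately for inputs and for
  non-inputs. Between the two kinds, the images lie in the disjoint sets \<open>ins L\<close> and
  \<open>nins L\<close>.\<close>

lemma disjoint_p:
  assumes "X \<in> verts H" "Y \<in> verts H" "X \<noteq> Y"
  shows "set (p X) \<inter> set (p Y) = {}"
proof -
  have i: "set (p X) \<subseteq> ins L" if "X \<in> ins H" for X using p_ins that by (auto simp: image_set_def)
  have d: "distinct (concat (map p (list_of (ins H))))" "distinct (concat (map p (list_of (nins H))))"
    using variables by (simp_all add: maps_variables_def concat_image_def)
  consider "X \<in> ins H" "Y \<in> ins H" | "X \<in> nins H" "Y \<in> nins H" | "X \<in> ins H" "Y \<in> nins H" | "X \<in> nins H" "Y \<in> ins H"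
    using assms by (auto simp: nins_def)
  then show ?thesis
  proof cases
    case 1
    then show ?thesis using concat_map_disjoint[OF d(1)] H.ins_verts assms(3) by simp
  next
    case 2
    then show ?thesis using concat_map_disjoint[OF d(2)] H.nins_verts assms(3) by simp
  next
    case 3
    then show ?thesis using i[of X] p_nins[of Y] by (auto simp: nins_def)
  next
    case 4
    then show ?thesis using i[of Y] p_nins[of X] by (auto simp: nins_def)
  qed
qed

lemma distinct_concat_p: "\<lbrakk>distinct xs; set xs \<subseteq> verts H\<rbrakk> \<Longrightarrow> distinct (concat (map p xs))"
proof (rule distinct_concat_map)
  fix X Y assume "set xs \<subseteq> verts H" "X \<in> set xs" "Y \<in> set xs" "X \<noteq> Y"
  then show "set (p X) \<inter> set (p Y) = {}" by (intro disjoint_p) auto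
qed (use distinct_p in auto)

lemma concat_p_verts: "set xs \<subseteq> verts H \<Longrightarrow> set (concat (map p xs)) \<subseteq> verts L"
  using p_verts by auto

lemma var_set_eq: "A \<subseteq> verts H \<Longrightarrow> var_set \<pi> A = set (concat (map p (list_of A)))"
  by (auto simp: var_set_def image_set_def)

lemma t_typing:
  assumes "X \<in> verts H"
  shows "t X \<in> Ar S" "Src S (t X) = map (val L) (p X)" "Tgt S (t X) = [val H X]" "deterministic S (t X)"
proof -
  have "[X] \<in> lists (verts H)" using assms by simp
  then show "t X \<in> Ar S" "Src S (t X) = map (val L) (p X)" "Tgt S (t X) = [val H X]" "deterministic S (t X)"
    using transformation' by auto
qed

lemma tens_typing:
  assumes "xs \<in> lists (verts H)"
  shows "tens xs \<in> Ar S" "Src S (tens xs) = map (val L) (concat (map p xs))" "Tgt S (tens xs) = map (val H) xs"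
proof -
  have 1: "set (map t xs) \<subseteq> Ar S" using assms t_typing by auto
  have "map (Src S) (map t xs) = map (\<lambda>X. map (val L) (p X)) xs"
    "map (Tgt S) (map t xs) = map (\<lambda>X. [val H X]) xs"
    using assms t_typing by auto
  then show "tens xs \<in> Ar S" "Src S (tens xs) = map (val L) (concat (map p xs))" "Tgt S (tens xs) = map (val H) xs"
    using L.S.list_tensor_ar_typing[OF 1] by (simp_all add: map_concat comp_def)
qed

lemma tens_eq: "xs \<in> lists (verts H) \<Longrightarrow> tens xs = component \<pi> \<tau> xs \<bullet> L.sem (P.cmpr xs)"
  using component_comparison[OF P.free_functor_axioms transformation] by simp

text \<open>Naturality of \<open>\<tau>\<close> conjugated by comparisons: components at lists
  become tensor products of components at variables, and \<open>far \<pi>\<close> becomes the strict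
  functor.\<close>

lemma tens_natural:
  assumes c: "c \<in> Ar KH"
  shows "tens (Tgt KH c) \<bullet> L.sem (P.strictified c) = H.sem c \<bullet> tens (Src KH c)"
proof -
  have l: "Src KH c \<in> lists (verts H)" "Tgt KH c \<in> lists (verts H)" using P.Src_Tgt_lists[OF c] by simp_all
  let ?T = "component \<pi> \<tau>"
  have T: "?T (Src KH c) \<in> Ar S" "?T (Tgt KH c) \<in> Ar S" using transformation' l by auto
  have n: "?T (Tgt KH c) \<bullet> L.sem (far \<pi> c) = H.sem c \<bullet> ?T (Src KH c)" using transformation' c by blast
  have s: "P.cmpr (Src KH c) \<in> Ar KL" "Tgt KL (P.cmpr (Src KH c)) = fob \<pi> (Src KH c)"
    "P.cmpr (Tgt KH c) \<in> Ar KL" "Src KL (P.cmpr (Tgt KH c)) = concat_image \<pi> (Tgt KH c)"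
    "Tgt KL (P.cmpr (Tgt KH c)) = fob \<pi> (Tgt KH c)"
    using P.comparison_simps[of "Src KH c"] P.comparison_simps[of "Tgt KH c"] l by simp_all
  note st = P.strictified_typing[OF c]
  have "tens (Tgt KH c) \<bullet> L.sem (P.strictified c)
      = ?T (Tgt KH c) \<bullet> L.sem (P.cmpr (Tgt KH c) \<cdot>\<^bsub>KL\<^esub> P.strictified c)"
    using T s st l by (simp add: tens_eq)
  also have "P.cmpr (Tgt KH c) \<cdot>\<^bsub>KL\<^esub> P.strictified c = far \<pi> c \<cdot>\<^bsub>KL\<^esub> P.cmpr (Src KH c)"
    by (rule P.comparison_strictified[OF c])
  also have "?T (Tgt KH c) \<bullet> L.sem (far \<pi> c \<cdot>\<^bsub>KL\<^esub> P.cmpr (Src KH c))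
      = (?T (Tgt KH c) \<bullet> L.sem (far \<pi> c)) \<bullet> L.sem (P.cmpr (Src KH c))"
    using T s c by simp
  also have "\<dots> = H.sem c \<bullet> tens (Src KH c)"
    unfolding n using T s c l by (simp add: tens_eq)
  finally show ?thesis .
qed

abbreviation "w_ins \<equiv> wireQ L (list_of (ins L)) (concat (map p (list_of (ins H))))"
abbreviation "w_out A \<equiv> wireQ L (list_of (var_set \<pi> A)) (concat (map p (list_of A)))"

lemma concat_p_ins: "set (concat (map p (list_of (ins H)))) = ins L"
  using p_ins H.ins_verts by (simp add: image_set_def)

lemma w_ins_typing: "w_ins \<in> Ar KL" "Src KL w_ins = list_of (ins L)"
    "Tgt KL w_ins = concat (map p (list_of (ins H)))"
  using wireQ_typing[of "list_of (ins L)" "concat (map p (list_of (ins H)))"] concat_p_ins L.ins_verts by auto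

lemma var_set_verts: "A \<subseteq> verts H \<Longrightarrow> var_set \<pi> A \<subseteq> verts L"
  using concat_p_verts[of "list_of A"] var_set_eq by simp

lemma w_out_typing: "A \<subseteq> verts H \<Longrightarrow> w_out A \<in> Ar KL" "A \<subseteq> verts H \<Longrightarrow> Src KL (w_out A) = list_of (var_set \<pi> A)"
    "A \<subseteq> verts H \<Longrightarrow> Tgt KL (w_out A) = concat (map p (list_of A))"
  using wireQ_typing[of "list_of (var_set \<pi> A)" "concat (map p (list_of A))"] var_set_verts[of A] var_set_eq[of A]
  by auto

lemma query_gens:
  assumes "intervention_sets H Ss" "A \<subseteq> outs H"
  shows "(map (var_set \<pi>) Ss, var_set \<pi> A) \<in> gens QL"
  using queries assms unfolding maps_queries_def Let_def by blast

text \<open>The equation of \<open>maps_queries\<close> with comparisons eliminated: that of the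
  inputs is absorbed into \<open>strictified\<close>, that of the outputs is cancelled.\<close>

lemma query_eq:
  assumes "intervention_sets H Ss" "A \<subseteq> outs H"
  shows "P.strictified (query QH (Ss, A)) \<cdot>\<^bsub>KL\<^esub> list_tensor_ar KL (replicate (length Ss + 1) w_ins)
    = w_out A \<cdot>\<^bsub>KL\<^esub> query QL (map (var_set \<pi>) Ss, var_set \<pi> A)"
proof -
  let ?q = "query QH (Ss, A)" and ?q' = "query QL (map (var_set \<pi>) Ss, var_set \<pi> A)"
  let ?R = "list_tensor_ar KL (replicate (length Ss + 1) w_ins)"
  have AH: "A \<subseteq> verts H" using assms(2) H.outs_verts by auto
  have "(Ss, A) \<in> gens QH" using assms by simp
  note q = query_Ar(2)[OF this, THEN conjunct1] query_Ar(2)[OF this, THEN conjunct2, THEN conjunct1]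
    query_Ar(2)[OF this, THEN conjunct2, THEN conjunct2]
  note q' = query_Ar(1)[OF query_gens[OF assms]]
  note l = P.Src_Tgt_lists[OF q(1), unfolded q(2,3)]
  note st = P.strictified_typing[OF q(1), unfolded q(2,3)]
  note R = L.G.A.list_tensor_ar_replicate_typing[OF w_ins_typing(1), of "length Ss + 1", unfolded w_ins_typing]
  have cR: "concat (replicate n (concat (map p xs))) = concat_image \<pi> (concat (replicate n xs))" for n xs
    by (induction n) (simp_all add: concat_image_def)
  have "far \<pi> ?q \<cdot>\<^bsub>KL\<^esub> P.cmpr (gsrc QH (Ss, A)) \<cdot>\<^bsub>KL\<^esub> ?R = P.cmpr (list_of A) \<cdot>\<^bsub>KL\<^esub> w_out A \<cdot>\<^bsub>KL\<^esub> ?q'"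
    using queries assms unfolding maps_queries_def Let_def concat_image_def by blast
  moreover have "far \<pi> ?q \<cdot>\<^bsub>KL\<^esub> P.cmpr (gsrc QH (Ss, A)) \<cdot>\<^bsub>KL\<^esub> ?R
      = (far \<pi> ?q \<cdot>\<^bsub>KL\<^esub> P.cmpr (gsrc QH (Ss, A))) \<cdot>\<^bsub>KL\<^esub> ?R"
    using q l R P.comparison_simps[of "gsrc QH (Ss, A)"]
    by (simp add: cR del: replicate_Suc replicate.simps H.int_signature_simps)
       (simp add: cR)
  moreover have "far \<pi> ?q \<cdot>\<^bsub>KL\<^esub> P.cmpr (gsrc QH (Ss, A)) = P.cmpr (list_of A) \<cdot>\<^bsub>KL\<^esub> P.strictified ?q"
    using P.comparison_strictified[OF q(1)] unfolding q(2,3) by simp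
  ultimately have "(P.cmpr (list_of A) \<cdot>\<^bsub>KL\<^esub> P.strictified ?q) \<cdot>\<^bsub>KL\<^esub> ?R = P.cmpr (list_of A) \<cdot>\<^bsub>KL\<^esub> w_out A \<cdot>\<^bsub>KL\<^esub> ?q'"
    by simp
  moreover have lA: "list_of A \<in> lists (types QH)" using l by simp
  note cA = P.comparison_simps[OF lA]
  have gs: "Src KL (P.strictified ?q) = Tgt KL ?R" by (simp only: st R cR H.int_signature_simps)
  ultimately have "P.cmpr (list_of A) \<cdot>\<^bsub>KL\<^esub> (P.strictified ?q \<cdot>\<^bsub>KL\<^esub> ?R) = P.cmpr (list_of A) \<cdot>\<^bsub>KL\<^esub> (w_out A \<cdot>\<^bsub>KL\<^esub> ?q')"
    using L.G.A.cmp_cmp[of ?R "P.strictified ?q" "P.cmpr (list_of A)"] st R cA by simp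
  then show ?thesis
    by (rule L.G.A.iso_cancel_left[rotated])
       (use cA st R gs q' w_out_typing[OF AH] in \<open>simp_all add: concat_image_def\<close>)
qed

lemma tens_set_map: "xs \<in> lists (verts H) \<Longrightarrow> set (map t xs) \<subseteq> Ar S"
  using t_typing(1) by auto

text \<open>Naturality at the query \<open>(Ss, A)\<close>, where \<open>query_eq\<close> replaces
  its image by the low-level interchange channel. For \<open>A = outs H\<close> this is the equation
  of an interchange abstraction, apart from the sorting of blocks.\<close>

lemma tens_interchange:
  assumes "intervention_sets H Ss" "A \<subseteq> outs H"
  shows "tens (list_of A) \<bullet> L.W (list_of (var_set \<pi> A)) (concat (map p (list_of A))) \<bullet>
      interchange_channel C L (map (var_set \<pi>) Ss) (var_set \<pi> A) =
    interchange_channel C H Ss A \<bullet> list_tensor_ar S (replicate (length Ss + 1)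
      (tens (list_of (ins H)) \<bullet> L.W (list_of (ins L)) (concat (map p (list_of (ins H))))))"
proof -
  let ?q = "query QH (Ss, A)" and ?q' = "query QL (map (var_set \<pi>) Ss, var_set \<pi> A)"
  let ?n = "length Ss + 1" and ?li = "list_of (ins H)"
  let ?R = "list_tensor_ar KL (replicate ?n w_ins)"
  let ?W = "L.W (list_of (ins L)) (concat (map p ?li))"
  have AH: "A \<subseteq> verts H" using assms(2) H.outs_verts by auto
  have gH: "(Ss, A) \<in> gens QH" using assms by simp
  note gL = query_gens[OF assms]
  note q = query_Ar(2)[OF gH, THEN conjunct1] query_Ar(2)[OF gH, THEN conjunct2, THEN conjunct1]
    query_Ar(2)[OF gH, THEN conjunct2, THEN conjunct2]
  note q' = query_Ar(1)[OF gL]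
  note st = P.strictified_typing[OF q(1), unfolded q(2,3)]
  note R = L.G.A.list_tensor_ar_replicate_typing[OF w_ins_typing(1), of ?n, unfolded w_ins_typing]
  have cR: "concat (replicate n (concat (map p xs))) = concat_image \<pi> (concat (replicate n xs))" for n xs
    by (induction n) (simp_all add: concat_image_def)
  have gs: "Src KL (P.strictified ?q) = Tgt KL ?R" by (simp only: st R cR H.int_signature_simps)
  have li: "?li \<in> lists (verts H)" using H.ins_verts by auto
  have lA: "list_of A \<in> lists (verts H)" using AH by auto
  have lg: "gsrc QH (Ss, A) \<in> lists (verts H)"
    using P.Src_Tgt_lists[OF q(1)] by (simp only: q H.int_signature_simps)
  have semW: "L.sem w_ins = ?W" "L.sem (w_out A) = L.W (list_of (var_set \<pi> A)) (concat (map p (list_of A)))"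
    using L.sem_wire[of "list_of (ins L)"] L.sem_wire[of "list_of (var_set \<pi> A)"] L.ins_verts var_set_verts[OF AH]
    by simp_all
  have semR: "L.sem ?R = list_tensor_ar S (replicate ?n ?W)"
  proof -
    have "set (replicate ?n w_ins) \<subseteq> Ar KL" using w_ins_typing(1) by auto
    then show ?thesis using L.F.map_list_tensor_ar semW by (simp add: map_replicate)
  qed
  have W: "?W \<in> Ar S" "Src S ?W = map (val L) (list_of (ins L))" "Tgt S ?W = map (val L) (concat (map p ?li))"
    using semW(1) L.F.typing[OF w_ins_typing(1)] w_ins_typing by simp_all
  have tens_src: "tens (gsrc QH (Ss, A)) = list_tensor_ar S (replicate ?n (tens ?li))"
    using L.S.list_tensor_ar_concat_replicate[OF tens_set_map[OF li], of ?n]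
    by (simp only: H.int_signature_simps map_concat map_replicate)
  have sq: "L.sem (P.strictified ?q) \<in> Ar S" "Src S (L.sem (P.strictified ?q)) = Tgt S (L.sem ?R)"
      "Tgt S (L.sem (P.strictified ?q)) = Src S (tens (list_of A))" "L.sem ?R \<in> Ar S"
    using st(1,3) gs R(1) tens_typing[OF lA] by (simp_all add: concat_image_def)
  have "tens (list_of A) \<bullet> L.W (list_of (var_set \<pi> A)) (concat (map p (list_of A))) \<bullet>
      interchange_channel C L (map (var_set \<pi>) Ss) (var_set \<pi> A)
      = tens (list_of A) \<bullet> L.sem (w_out A) \<bullet> L.sem ?q'"
    using semW L.sem_query[OF gL] by simp
  also have "L.sem (w_out A) \<bullet> L.sem ?q' = L.sem (w_out A \<cdot>\<^bsub>KL\<^esub> ?q')"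
    using w_out_typing[OF AH] q' by simp
  also have "\<dots> = L.sem (P.strictified ?q) \<bullet> L.sem ?R"
    unfolding query_eq[OF assms, symmetric] using st(1) R(1) gs by simp
  also have "tens (list_of A) \<bullet> L.sem (P.strictified ?q) \<bullet> L.sem ?R
      = (tens (list_of A) \<bullet> L.sem (P.strictified ?q)) \<bullet> L.sem ?R"
    using sq tens_typing[OF lA] by simp
  also have "tens (list_of A) \<bullet> L.sem (P.strictified ?q) = H.sem ?q \<bullet> tens (gsrc QH (Ss, A))"
    using tens_natural[OF q(1)] unfolding q(2,3) by simp
  also have "(H.sem ?q \<bullet> tens (gsrc QH (Ss, A))) \<bullet> L.sem ?R
      = H.sem ?q \<bullet> (tens (gsrc QH (Ss, A)) \<bullet> L.sem ?R)"
  proof (rule L.S.cmp_cmp)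
    show "Src S (tens (gsrc QH (Ss, A))) = Tgt S (L.sem ?R)"
      using sq(2) st(2) L.F.typing(2)[OF st(1)] tens_typing(2)[OF lg] by (simp only: concat_image_def concat_map_singleton)
    show "Src S (H.sem ?q) = Tgt S (tens (gsrc QH (Ss, A)))"
      using H.F.typing(2)[OF q(1)] tens_typing(3)[OF lg] by (simp only: q concat_map_singleton)
  qed (use q(1) lg tens_typing(1) sq in \<open>simp_all del: H.int_signature_simps\<close>)
  also have "tens (gsrc QH (Ss, A)) \<bullet> L.sem ?R = list_tensor_ar S (replicate ?n (tens ?li \<bullet> ?W))"
    unfolding tens_src semR
    by (rule L.S.list_tensor_ar_replicate_cmp) (use W tens_typing[OF li] in simp_all)
  also have "H.sem ?q = interchange_channel C H Ss A" by (rule H.sem_query[OF gH])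
  finally show ?thesis .
qed

section \<open>The interchange abstraction obtained by restriction\<close>

definition "restricted_ob = fst (restrict_to_variables C L H (\<pi>, \<tau>))"
definition "restricted_tau = snd (restrict_to_variables C L H (\<pi>, \<tau>))"

lemma restrict_eq: "restrict_to_variables C L H (\<pi>, \<tau>) = (restricted_ob, restricted_tau)"
  by (simp add: restricted_ob_def restricted_tau_def)

lemma restricted_ob: "X \<in> verts H \<Longrightarrow> restricted_ob X = set (p X)"
  by (simp add: restricted_ob_def restrict_to_variables_def)

lemma restricted_tau: "X \<in> verts H \<Longrightarrow> restricted_tau X =
    \<tau> [X] \<cdot>\<^bsub>C\<^esub> far (int_model C L) (wireQ L (list_of (set (p X))) (p X))"
  by (simp add: restricted_tau_def restrict_to_variables_def)

lemma restricted_extensional: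
  "restricted_ob \<in> extensional (verts H)" "restricted_tau \<in> extensional (verts H)"
  by (simp_all add: restricted_ob_def restricted_tau_def restrict_to_variables_def)

lemma image_restricted: "A \<subseteq> verts H \<Longrightarrow> image_set restricted_ob A = var_set \<pi> A"
  using restricted_ob by (auto simp: image_set_def var_set_def subset_iff)

text \<open>The list \<open>fob \<pi> [X]\<close> need not be the enumeration that
  \<open>list_of\<close> chooses for its set of entries, so every restricted component carries this
  permutation.\<close>

abbreviation "sorting X \<equiv> L.W (list_of (set (p X))) (p X)"

lemma sorting_iso:
  assumes "X \<in> verts H"
  shows "inverse_arrows S (sorting X) (L.W (p X) (list_of (set (p X))))"
  using p_verts[OF assms] distinct_p[OF assms] by (intro L.S.iso_wire) simp_all

lemma sorting_typing:
  assumes "X \<in> verts H"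
  shows "sorting X \<in> Ar S" "Src S (sorting X) = map (val L) (list_of (set (p X)))"
    "Tgt S (sorting X) = map (val L) (p X)"
  using p_verts[OF assms] by simp_all

lemma restricted_arrow:
  assumes "X \<in> verts H"
  shows "(map (val L) (list_of (restricted_ob X)), restricted_tau X, [val H X]) = t X \<bullet> sorting X"
proof (rule strictify_eqI)
  note s = sorting_typing[OF assms] and tt = t_typing[OF assms]
  show "underlying (map (val L) (list_of (restricted_ob X)), restricted_tau X, [val H X]) =
      underlying (t X \<bullet> sorting X)"
    using L.sem_wire[of "list_of (set (p X))" "p X"] p_verts[OF assms] strictify_cmp[OF s(1) tt(1)]
      restricted_tau[OF assms]
    by (simp add: L.far_int_model) (simp add: underlying_def)
qed (use sorting_typing[OF assms] t_typing[OF assms] restricted_ob[OF assms] in \<open>simp_all add: strictify_simps\<close>)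

lemma tau_list_restricted:
  assumes "xs \<in> lists (verts H)"
  shows "tau_list C L H restricted_ob restricted_tau xs = tens xs \<bullet> list_tensor_ar S (map sorting xs)"
proof -
  have "tau_list C L H restricted_ob restricted_tau xs = list_tensor_ar S (map (\<lambda>X. t X \<bullet> sorting X) xs)"
    unfolding tau_list_def using assms
    by (intro arg_cong[of _ _ "list_tensor_ar S"] map_cong HOL.refl restricted_arrow) auto
  also have "\<dots> = tens xs \<bullet> list_tensor_ar S (map sorting xs)"
    by (rule L.S.list_tensor_ar_cmp[symmetric]) (use assms t_typing sorting_typing in auto)
  finally show ?thesis .
qed

lemma sortings_typing:
  assumes "xs \<in> lists (verts H)"
  shows "list_tensor_ar S (map sorting xs) \<in> Ar S" "iso S (list_tensor_ar S (map sorting xs))"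
    "Src S (list_tensor_ar S (map sorting xs)) = map (val L) (concat (map (\<lambda>X. list_of (set (p X))) xs))"
    "Tgt S (list_tensor_ar S (map sorting xs)) = map (val L) (concat (map p xs))"
proof -
  have 1: "set (map sorting xs) \<subseteq> Ar S" using assms sorting_typing by auto
  have 2: "map (Src S) (map sorting xs) = map (\<lambda>X. map (val L) (list_of (set (p X)))) xs"
    "map (Tgt S) (map sorting xs) = map (\<lambda>X. map (val L) (p X)) xs"
    using assms sorting_typing by auto
  show "list_tensor_ar S (map sorting xs) \<in> Ar S"
    "Src S (list_tensor_ar S (map sorting xs)) = map (val L) (concat (map (\<lambda>X. list_of (set (p X))) xs))"
    "Tgt S (list_tensor_ar S (map sorting xs)) = map (val L) (concat (map p xs))"
    using L.S.list_tensor_ar_typing[OF 1] unfolding 2 by (simp_all add: map_concat comp_def)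
  show "iso S (list_tensor_ar S (map sorting xs))"
    by (rule L.S.iso_list_tensor_ar) (use assms L.S.isoI[OF sorting_iso] in auto)
qed

text \<open>By \<open>list_tensor_wires\<close>, distributing the wires into blocks and then sorting
  each block is one diagram; the arbitrary enumerations of the single blocks cancel.\<close>

lemma tau_set_restricted:
  assumes A: "A \<subseteq> verts H"
  shows "tau_set C L H restricted_ob restricted_tau A =
    tens (list_of A) \<bullet> L.W (list_of (var_set \<pi> A)) (concat (map p (list_of A)))"
proof -
  have fA: "finite A" using A by simp
  have lA: "list_of A \<in> lists (verts H)" using A fA by auto
  let ?l = "\<lambda>X. list_of (set (p X))"
  have m: "concat (map (\<lambda>X. list_of (restricted_ob X)) (list_of A)) = concat (map ?l (list_of A))"
    using fA A restricted_ob by (intro arg_cong[of _ _ concat] map_cong) auto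
  have ws: "set (list_of (var_set \<pi> A)) \<subseteq> verts L" "set (list_of (var_set \<pi> A)) = var_set \<pi> A"
    using var_set_verts[OF A] by simp_all
  have px: "set (p X) \<subseteq> set (list_of (var_set \<pi> A))" if "X \<in> A" for X
    using that ws(2) by (auto simp: var_set_def image_set_def)
  have cl: "set (concat (map ?l (list_of A))) \<subseteq> set (list_of (var_set \<pi> A))" using px fA by auto
  have "tau_set C L H restricted_ob restricted_tau A
      = (tens (list_of A) \<bullet> list_tensor_ar S (map sorting (list_of A))) \<bullet>
        L.W (list_of (var_set \<pi> A)) (concat (map ?l (list_of A)))"
    by (simp only: tau_set_def image_restricted[OF A] tau_list_restricted[OF lA] m)
  also have "\<dots> = tens (list_of A) \<bullet> list_tensor_ar S (map sorting (list_of A)) \<bullet>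
        L.W (list_of (var_set \<pi> A)) (concat (map ?l (list_of A)))"
    by (rule L.S.cmp_cmp) (use tens_typing[OF lA] sortings_typing[OF lA] ws cl in simp_all)
  also have "list_tensor_ar S (map sorting (list_of A)) \<bullet>
        L.W (list_of (var_set \<pi> A)) (concat (map ?l (list_of A)))
      = L.W (list_of (var_set \<pi> A)) (concat (map p (list_of A)))"
    by (rule L.S.list_tensor_wires) (use ws fA px in auto)
  finally show ?thesis .
qed

lemma variable_alignment_restricted: "variable_alignment C L H restricted_ob restricted_tau"
  unfolding variable_alignment_def
proof (intro conjI ballI)
  show "disjoint_family_on restricted_ob (verts H)"
    using disjoint_p restricted_ob by (simp add: disjoint_family_on_def)
  show "image_set restricted_ob (ins H) = ins L"
    using image_restricted[OF H.ins_verts] p_ins by (simp add: var_set_def)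
  \<comment> \<open>The query without interventions and with all outputs is sent to a query of
    \<open>L\<close>, whose outputs lie in \<open>outs L\<close>.\<close>
  show "image_set restricted_ob (outs H) \<subseteq> outs L"
    using image_restricted[OF H.outs_verts] query_gens[of "[]" "outs H"] by simp
next
  fix X assume X: "X \<in> verts H"
  show "restricted_ob X \<subseteq> verts L" using restricted_ob[OF X] p_verts[OF X] by simp
  let ?t0 = "(map (val L) (list_of (restricted_ob X)), restricted_tau X, [val H X])"
  note s = sorting_typing[OF X] and tt = t_typing[OF X]
  have Ar: "?t0 \<in> Ar S" unfolding restricted_arrow[OF X] using s tt by simp
  then show "restricted_tau X \<in> hom C (tlist C (map (val L) (list_of (restricted_ob X)))) (val H X)"
    by (simp add: strictify_simps in_hom_iff)
  have "L.S.det (sorting X)" using p_verts[OF X] by simp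
  then have "L.S.det ?t0" unfolding restricted_arrow[OF X] using s tt by simp
  then show "deterministic C (restricted_tau X)" using deterministic_strictify_iff[OF Ar] by simp
  have u: "underlying ?t0 = restricted_tau X" by (simp add: underlying_def)
  have "restricted_tau X = \<tau> [X] \<cdot>\<^bsub>C\<^esub> underlying (sorting X)"
    using u strictify_cmp[OF s(1) tt(1)] unfolding restricted_arrow[OF X] by simp
  moreover have "epic C (\<tau> [X] \<cdot>\<^bsub>C\<^esub> underlying (sorting X))"
    using epic_component[of "[X]"] X underlying_iso[OF L.S.isoI[OF sorting_iso[OF X]]]
      underlying_simps[OF s(1)] underlying_simps[OF tt(1)] s tt
    by (intro epic_cmp_iso) simp_all
  ultimately show "epic C (restricted_tau X)" by simp
next
  fix xs assume xs: "xs \<in> lists (verts H)"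
  \<comment> \<open>\<open>tau_list\<close> differs from the epic component of \<open>\<tau>\<close>
    at the whole list only by the isomorphism \<open>?i\<close>, composed of sorting and
    comparison.\<close>
  let ?i = "L.sem (P.cmpr xs) \<bullet> list_tensor_ar S (map sorting xs)"
  note so = sortings_typing[OF xs]
  have c: "P.cmpr xs \<in> Ar KL" "Src KL (P.cmpr xs) = concat (map p xs)" "Tgt KL (P.cmpr xs) = fob \<pi> xs" "iso KL (P.cmpr xs)"
    using P.comparison_simps[of xs] xs by (simp_all add: concat_image_def)
  have T: "component \<pi> \<tau> xs \<in> Ar S" using transformation' xs by auto
  have "iso S (L.sem (P.cmpr xs))" using L.F.map_iso[OF c(4)] by (rule L.S.isoI)
  then have i: "iso S ?i" using so c by simp
  have iA: "?i \<in> Ar S" "Tgt S ?i = map (val L) (fob \<pi> xs)" using so c by simp_all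
  have "tau_list C L H restricted_ob restricted_tau xs = component \<pi> \<tau> xs \<bullet> ?i"
    using tau_list_restricted[OF xs] tens_eq[OF xs] T so c by simp
  then have "underlying (tau_list C L H restricted_ob restricted_tau xs) = \<tau> xs \<cdot>\<^bsub>C\<^esub> underlying ?i"
    using strictify_cmp[OF iA(1) T] by simp
  moreover have "epic C (\<tau> xs \<cdot>\<^bsub>C\<^esub> underlying ?i)"
    using epic_component[OF xs] underlying_iso[OF i] underlying_simps[OF iA(1)] underlying_simps[OF T] iA
    by (intro epic_cmp_iso) simp_all
  ultimately show "epic C (underlying (tau_list C L H restricted_ob restricted_tau xs))" by simp
qed (rule restricted_extensional)+

lemma interchange_abstraction_restricted: "interchange_abstraction C L H restricted_ob restricted_tau"
  unfolding interchange_abstraction_def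
proof (intro conjI allI impI variable_alignment_restricted)
  fix Ss assume Ss: "intervention_sets H Ss"
  have m: "map (image_set restricted_ob) Ss = map (var_set \<pi>) Ss"
    using Ss H.nins_verts by (intro map_cong HOL.refl image_restricted) (auto simp: intervention_sets_def)
  have v: "var_set \<pi> (ins H) = ins L" using p_ins by (simp add: var_set_def)
  have A: "outs H \<subseteq> verts H" by (rule H.outs_verts)
  have lA: "list_of (outs H) \<in> lists (verts H)" using A by auto
  have ic: "interchange_channel C L (map (var_set \<pi>) Ss) (var_set \<pi> (outs H)) \<in> Ar S"
    "Tgt S (interchange_channel C L (map (var_set \<pi>) Ss) (var_set \<pi> (outs H))) = map (val L) (list_of (var_set \<pi> (outs H)))"
    using query_gens[OF Ss subset_refl] var_set_verts[OF A]
    by (intro L.interchange_channel_typing; simp)+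
  have ws: "set (list_of (var_set \<pi> (outs H))) \<subseteq> verts L"
    "set (concat (map p (list_of (outs H)))) \<subseteq> set (list_of (var_set \<pi> (outs H)))"
    using var_set_verts[OF A] var_set_eq[OF A] by simp_all
  show "tau_set C L H restricted_ob restricted_tau (outs H) \<bullet>
      interchange_channel C L (map (image_set restricted_ob) Ss) (image_set restricted_ob (outs H)) =
    interchange_channel C H Ss (outs H) \<bullet>
      list_tensor_ar S (replicate (length Ss + 1) (tau_set C L H restricted_ob restricted_tau (ins H)))"
    unfolding m image_restricted[OF A] tau_set_restricted[OF A] tau_set_restricted[OF H.ins_verts] v
      tens_interchange[OF Ss subset_refl, symmetric]
    by (rule L.S.cmp_cmp) (use ic tens_typing[OF lA] ws in simp_all)
qed

end

section \<open>Downward abstractions with the same restriction\<close>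

context model_pair
begin

lemma KL_markov: "strict_markov KL"
  by (rule strict_markov_free_markov)

lemma transformation_free_iff:
  assumes "free_functor QH QL \<pi>" "free_functor QH QL \<pi>'"
  shows "markov_transformation KH KL \<pi> \<pi>' \<alpha> \<longleftrightarrow>
    (\<forall>xs \<in> lists (verts H). \<alpha> xs \<in> Ar KL \<and> Src KL (\<alpha> xs) = fob \<pi> xs \<and> Tgt KL (\<alpha> xs) = fob \<pi>' xs \<and>
      deterministic KL (\<alpha> xs)) \<and>
    (\<forall>f \<in> Ar KH. \<alpha> (Tgt KH f) \<cdot>\<^bsub>KL\<^esub> far \<pi> f = far \<pi>' f \<cdot>\<^bsub>KL\<^esub> \<alpha> (Src KH f)) \<and>
    (\<forall>xs \<in> lists (verts H). \<forall>ys \<in> lists (verts H).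
      \<alpha> (xs @ ys) \<cdot>\<^bsub>KL\<^esub> lax \<pi> xs ys = lax \<pi>' xs ys \<cdot>\<^bsub>KL\<^esub> (\<alpha> xs \<otimes>\<^bsub>KL\<^esub> \<alpha> ys)) \<and>
    \<alpha> [] \<cdot>\<^bsub>KL\<^esub> unt \<pi> = unt \<pi>'"
proof -
  have 1: "(\<forall>a b. \<forall>f \<in> hom KH a b. \<alpha> b \<cdot>\<^bsub>KL\<^esub> far \<pi> f = far \<pi>' f \<cdot>\<^bsub>KL\<^esub> \<alpha> a) \<longleftrightarrow>
    (\<forall>f \<in> Ar KH. \<alpha> (Tgt KH f) \<cdot>\<^bsub>KL\<^esub> far \<pi> f = far \<pi>' f \<cdot>\<^bsub>KL\<^esub> \<alpha> (Src KH f))"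
    by (auto simp: in_hom_iff)
  have 2: "\<alpha> a \<in> hom KL (fob \<pi> a) (fob \<pi>' a) \<and> deterministic KL (\<alpha> a) \<longleftrightarrow>
     \<alpha> a \<in> Ar KL \<and> Src KL (\<alpha> a) = fob \<pi> a \<and> Tgt KL (\<alpha> a) = fob \<pi>' a \<and> deterministic KL (\<alpha> a)" for a
    by (auto simp: in_hom_iff)
  show ?thesis
    unfolding markov_transformation_def 1 2 by simp
qed

end

locale downward_pair = model_pair + D: downward C L H \<pi> \<tau> + E: downward C L H \<pi>' \<tau>'
  for \<pi> \<tau> \<pi>' \<tau>'
begin

text \<open>The components agree after sorting. The two sortings differ by the diagram from one list
  of \<open>X\<close> to the other, and the invertible sorting is cancelled.\<close>

lemma restricted_eq_imp_component:
  assumes "restrict_to_variables C L H (\<pi>, \<tau>) = restrict_to_variables C L H (\<pi>', \<tau>')" "X \<in> verts H"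
  shows "set (D.p X) = set (E.p X)" "D.t X = E.t X \<bullet> L.W (D.p X) (E.p X)"
proof -
  have r: "D.restricted_ob = E.restricted_ob" "D.restricted_tau = E.restricted_tau"
    using assms(1) D.restrict_eq E.restrict_eq by auto
  show s: "set (D.p X) = set (E.p X)" using r D.restricted_ob E.restricted_ob assms(2) by metis
  note v = D.p_verts[OF assms(2)] and sD = D.sorting_typing[OF assms(2)] and sE = E.sorting_typing[OF assms(2)]
    and tD = D.t_typing[OF assms(2)] and tE = E.t_typing[OF assms(2)]
  have "D.t X \<bullet> D.sorting X = E.t X \<bullet> E.sorting X"
    using D.restricted_arrow[OF assms(2)] E.restricted_arrow[OF assms(2)] r by simp
  also have "E.sorting X = L.W (D.p X) (E.p X) \<bullet> D.sorting X"
    using v s by (simp add: L.S.wire_wire)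
  finally have "D.t X \<bullet> D.sorting X = (E.t X \<bullet> L.W (D.p X) (E.p X)) \<bullet> D.sorting X"
    using v s tE sD by simp
  then show "D.t X = E.t X \<bullet> L.W (D.p X) (E.p X)"
    by (rule L.S.iso_cancel_right[OF L.S.isoI[OF D.sorting_iso[OF assms(2)]]]) (use v s tD tE sD in simp_all)
qed

lemma component_imp_restricted_eq:
  assumes "\<And>X. X \<in> verts H \<Longrightarrow> set (D.p X) = set (E.p X) \<and> D.t X = E.t X \<bullet> L.W (D.p X) (E.p X)"
  shows "restrict_to_variables C L H (\<pi>, \<tau>) = restrict_to_variables C L H (\<pi>', \<tau>')"
proof -
  have "D.restricted_ob X = E.restricted_ob X" if "X \<in> verts H" for X
    using assms[OF that] D.restricted_ob[OF that] E.restricted_ob[OF that] by simp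
  then have ob: "D.restricted_ob = E.restricted_ob"
    using D.restricted_extensional(1) E.restricted_extensional(1) extensionalityI by blast
  have "D.restricted_tau X = E.restricted_tau X" if X: "X \<in> verts H" for X
  proof -
    note v = D.p_verts[OF X] and sD = D.sorting_typing[OF X] and tE = E.t_typing[OF X]
    have s: "set (D.p X) = set (E.p X)" and t: "D.t X = E.t X \<bullet> L.W (D.p X) (E.p X)" using assms[OF X] by auto
    have "D.t X \<bullet> D.sorting X = E.t X \<bullet> L.W (D.p X) (E.p X) \<bullet> D.sorting X"
      unfolding t using v s tE sD by simp
    also have "L.W (D.p X) (E.p X) \<bullet> D.sorting X = E.sorting X"
      using v s by (simp add: L.S.wire_wire)
    finally show ?thesis
      using D.restricted_arrow[OF X] E.restricted_arrow[OF X] by (metis prod.inject)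
  qed
  then have "D.restricted_tau = E.restricted_tau"
    using D.restricted_extensional(2) E.restricted_extensional(2) extensionalityI by blast
  then show ?thesis using ob D.restrict_eq E.restrict_eq by simp
qed

text \<open>At a single variable the given isomorphism permutes distinct names, so by
  \<open>perms_eq_wire\<close> it is the wiring diagram that
  \<open>component_imp_restricted_eq\<close> asks for.\<close>

lemma same_imp_restricted_eq:
  assumes "((\<pi>, \<tau>), (\<pi>', \<tau>')) \<in> same_abstraction C L H"
  shows "restrict_to_variables C L H (\<pi>, \<tau>) = restrict_to_variables C L H (\<pi>', \<tau>')"
proof (rule component_imp_restricted_eq)
  fix X assume X: "X \<in> verts H"
  obtain \<alpha> where \<alpha>: "\<alpha> [X] \<in> perms QL (D.p X) (E.p X)" "\<tau>' [X] \<cdot>\<^bsub>C\<^esub> far (int_model C L) (\<alpha> [X]) = \<tau> [X]"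
    using assms X unfolding same_abstraction_def by auto
  note w = perms_eq_wire[OF \<alpha>(1) D.distinct_p[OF X]]
  have s: "set (D.p X) = set (E.p X)" using w(2) by (metis mset_eq_setD)
  note v = D.p_verts[OF X] and tE = E.t_typing[OF X]
  have sem: "L.sem (\<alpha> [X]) = L.W (D.p X) (E.p X)" using L.sem_wire v w(1) by simp
  have Ar: "L.W (D.p X) (E.p X) \<in> Ar S" "Src S (L.W (D.p X) (E.p X)) = map (val L) (D.p X)"
    "Tgt S (L.W (D.p X) (E.p X)) = map (val L) (E.p X)" using v s by simp_all
  have "D.t X = E.t X \<bullet> L.W (D.p X) (E.p X)"
  proof (rule strictify_eqI)
    show "underlying (D.t X) = underlying (E.t X \<bullet> L.W (D.p X) (E.p X))"
      using strictify_cmp[OF Ar(1) tE(1)] \<alpha>(2) by (simp add: L.far_int_model sem)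
  qed (use Ar tE in simp_all)
  then show "set (D.p X) = set (E.p X) \<and> D.t X = E.t X \<bullet> L.W (D.p X) (E.p X)" using s by simp
qed

end

section \<open>The isomorphism between two abstractions with equal restrictions\<close>

locale same_restriction = downward_pair +
  assumes same: "restrict_to_variables C L H (\<pi>, \<tau>) = restrict_to_variables C L H (\<pi>', \<tau>')"
begin

lemmas same_p = restricted_eq_imp_component(1)[OF same]
lemmas same_t = restricted_eq_imp_component(2)[OF same]

abbreviation "reorder X \<equiv> wireQ L (D.p X) (E.p X)"
abbreviation "reorders xs \<equiv> list_tensor_ar KL (map reorder xs)"

lemma reorder_typing:
  assumes "X \<in> verts H"
  shows "reorder X \<in> Ar KL" "Src KL (reorder X) = D.p X" "Tgt KL (reorder X) = E.p X"
    "deterministic KL (reorder X)" "iso KL (reorder X)" "L.sem (reorder X) = L.W (D.p X) (E.p X)"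
    "reorder X \<in> perms QL (D.p X) (E.p X)"
proof -
  note v = D.p_verts[OF assms] and s = same_p[OF assms]
  show "reorder X \<in> Ar KL" "Src KL (reorder X) = D.p X" "Tgt KL (reorder X) = E.p X"
    using wireQ_typing[OF v] s by auto
  have o: "(\<lambda>x. [x]) ` set (D.p X) \<subseteq> Ob KL" using v by auto
  then show "deterministic KL (reorder X)" by (rule L.G.A.det_wire)
  show "iso KL (reorder X)"
    by (rule L.G.A.isoI[OF L.G.A.iso_wire]) (use o s D.distinct_p[OF assms] E.distinct_p[OF assms] in auto)
  show "L.sem (reorder X) = L.W (D.p X) (E.p X)" by (rule L.sem_wire[OF v])
  show "reorder X \<in> perms QL (D.p X) (E.p X)"
    by (rule wire_in_perms) (use v s D.distinct_p[OF assms] E.distinct_p[OF assms] in auto)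
qed

lemma reorders_set: "xs \<in> lists (verts H) \<Longrightarrow> set (map reorder xs) \<subseteq> Ar KL"
  using reorder_typing(1) by auto

lemma reorders_typing:
  assumes "xs \<in> lists (verts H)"
  shows "reorders xs \<in> Ar KL" "Src KL (reorders xs) = concat_image \<pi> xs" "Tgt KL (reorders xs) = concat_image \<pi>' xs"
    "deterministic KL (reorders xs)" "iso KL (reorders xs)"
proof -
  have 1: "map (Src KL) (map reorder xs) = map D.p xs" "map (Tgt KL) (map reorder xs) = map E.p xs"
    using assms reorder_typing by auto
  show "reorders xs \<in> Ar KL" "Src KL (reorders xs) = concat_image \<pi> xs" "Tgt KL (reorders xs) = concat_image \<pi>' xs"
    using L.G.A.list_tensor_ar_typing[OF reorders_set[OF assms]] unfolding 1 by (simp_all add: concat_image_def)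
  show "deterministic KL (reorders xs)"
    by (rule L.G.A.det_list_tensor_ar) (use assms reorder_typing in auto)
  show "iso KL (reorders xs)"
    by (rule L.G.A.iso_list_tensor_ar) (use assms reorder_typing in auto)
qed

lemma reorders_append:
  "\<lbrakk>xs \<in> lists (verts H); ys \<in> lists (verts H)\<rbrakk> \<Longrightarrow> reorders (xs @ ys) = reorders xs \<otimes>\<^bsub>KL\<^esub> reorders ys"
  using L.G.A.list_tensor_ar_append[OF reorders_set reorders_set] by simp

lemma same_var_set: "A \<subseteq> verts H \<Longrightarrow> var_set \<pi> A = var_set \<pi>' A"
  using same_p by (auto simp: var_set_def image_set_def)

text \<open>The sets \<open>var_set\<close> agree, so both functors are prescribed by the same
  low-level query. Reordering turns the input and output diagrams of the first functor into those of
  the second, and the invertible input permutation \<open>?RD\<close> is cancelled.\<close>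

lemma reorders_query:
  assumes q: "(Ss, A) \<in> gens QH"
  shows "reorders (gtgt QH (Ss, A)) \<cdot>\<^bsub>KL\<^esub> D.P.strictified (query QH (Ss, A)) =
    E.P.strictified (query QH (Ss, A)) \<cdot>\<^bsub>KL\<^esub> reorders (gsrc QH (Ss, A))"
proof -
  have Ss: "intervention_sets H Ss" "A \<subseteq> outs H" using q by auto
  have A: "A \<subseteq> verts H" using Ss H.outs_verts by auto
  let ?q = "query QH (Ss, A)" and ?q' = "query QL (map (var_set \<pi>) Ss, var_set \<pi> A)"
  let ?n = "length Ss + 1" and ?li = "list_of (ins H)"
  have m: "map (var_set \<pi>') Ss = map (var_set \<pi>) Ss" "var_set \<pi>' A = var_set \<pi> A"
  proof -
    have "B \<subseteq> verts H" if "B \<in> set Ss" for B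
      using Ss(1) that H.nins_verts by (auto simp: intervention_sets_def)
    then show "map (var_set \<pi>') Ss = map (var_set \<pi>) Ss" using same_var_set by simp
    show "var_set \<pi>' A = var_set \<pi> A" using same_var_set[OF A] by simp
  qed
  let ?RD = "list_tensor_ar KL (replicate ?n D.w_ins)" and ?RE = "list_tensor_ar KL (replicate ?n E.w_ins)"
  note qD = D.query_eq[OF Ss] and qE = E.query_eq[OF Ss, unfolded m]
  note qt = query_Ar(2)[OF q, THEN conjunct1] query_Ar(2)[OF q, THEN conjunct2, THEN conjunct1]
    query_Ar(2)[OF q, THEN conjunct2, THEN conjunct2]
  note q' = query_Ar(1)[OF D.query_gens[OF Ss]]
  note stD = D.P.strictified_typing[OF qt(1), unfolded qt(2,3)]
    and stE = E.P.strictified_typing[OF qt(1), unfolded qt(2,3)]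
  have lg: "gsrc QH (Ss, A) \<in> lists (verts H)" "gtgt QH (Ss, A) \<in> lists (verts H)"
    using D.P.Src_Tgt_lists[OF qt(1)] by (simp_all only: qt H.int_signature_simps)
  have li: "?li \<in> lists (verts H)" "list_of A \<in> lists (verts H)" using H.ins_verts A by auto
  have obL: "(\<lambda>x. [x]) ` X \<subseteq> Ob KL" if "X \<subseteq> verts L" for X using that by auto
  have wi: "reorders ?li \<cdot>\<^bsub>KL\<^esub> D.w_ins = E.w_ins"
    by (rule L.G.A.list_tensor_wires)
      (use obL[OF L.ins_verts] L.ins_verts D.concat_p_ins same_p H.ins_verts li in auto)
  have wo: "reorders (list_of A) \<cdot>\<^bsub>KL\<^esub> D.w_out A = E.w_out A"
    unfolding m(2)
    by (rule L.G.A.list_tensor_wires)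
      (use obL[OF D.var_set_verts[OF A]] D.var_set_verts[OF A] D.var_set_eq[OF A] same_p A in \<open>auto simp: subset_iff\<close>)
  note wit = D.w_ins_typing
  note RD = L.G.A.list_tensor_ar_replicate_typing[OF D.w_ins_typing(1), of ?n, unfolded wit]
  have isoRD: "iso KL ?RD"
  proof (rule L.G.A.iso_list_tensor_ar)
    fix f assume "f \<in> set (replicate ?n D.w_ins)"
    then have f: "f = D.w_ins" by auto
    have "inverse_arrows KL D.w_ins (wireQ L (concat (map D.p ?li)) (list_of (ins L)))"
      by (rule L.G.A.iso_wire)
        (use obL[OF L.ins_verts] L.ins_verts D.concat_p_ins D.distinct_concat_p[of ?li] H.ins_verts in auto)
    then show "iso KL f" unfolding f by (rule L.G.A.isoI)
  qed
  have rs: "reorders (gsrc QH (Ss, A)) = list_tensor_ar KL (replicate ?n (reorders ?li))"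
    using L.G.A.list_tensor_ar_concat_replicate[OF reorders_set[OF li(1)], of ?n]
    by (simp only: H.int_signature_simps map_concat map_replicate)
  have RR: "reorders (gsrc QH (Ss, A)) \<cdot>\<^bsub>KL\<^esub> ?RD = ?RE"
    unfolding rs wi[symmetric]
    by (rule L.G.A.list_tensor_ar_replicate_cmp)
      (use reorders_typing[OF li(1)] wit in \<open>simp_all add: concat_image_def\<close>)
  have cR: "concat (replicate n (concat (map D.p xs))) = concat_image \<pi> (concat (replicate n xs))" for n xs
    by (induction n) (simp_all add: concat_image_def)
  have gs: "Tgt KL ?RD = concat_image \<pi> (gsrc QH (Ss, A))" by (simp only: RD cR H.int_signature_simps)
  note rg = reorders_typing[OF lg(1)] and rt = reorders_typing[OF lg(2)]
  have "(reorders (gtgt QH (Ss, A)) \<cdot>\<^bsub>KL\<^esub> D.P.strictified ?q) \<cdot>\<^bsub>KL\<^esub> ?RD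
      = reorders (gtgt QH (Ss, A)) \<cdot>\<^bsub>KL\<^esub> (D.P.strictified ?q \<cdot>\<^bsub>KL\<^esub> ?RD)"
    by (rule L.G.A.cmp_cmp) (use rt stD RD(1) gs in simp_all)
  also have "\<dots> = reorders (list_of A) \<cdot>\<^bsub>KL\<^esub> (D.w_out A \<cdot>\<^bsub>KL\<^esub> ?q')" unfolding qD by simp
  also have "\<dots> = E.w_out A \<cdot>\<^bsub>KL\<^esub> ?q'"
    by (rule L.G.A.cmp_extend[OF wo])
      (use reorders_typing[OF li(2)] D.w_out_typing[OF A] q' in \<open>simp_all add: concat_image_def\<close>)
  also have "\<dots> = E.P.strictified ?q \<cdot>\<^bsub>KL\<^esub> (reorders (gsrc QH (Ss, A)) \<cdot>\<^bsub>KL\<^esub> ?RD)"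
    using qE unfolding RR m by simp
  also have "\<dots> = (E.P.strictified ?q \<cdot>\<^bsub>KL\<^esub> reorders (gsrc QH (Ss, A))) \<cdot>\<^bsub>KL\<^esub> ?RD"
    by (rule L.G.A.cmp_cmp[symmetric]) (use rg stE RD(1) gs in simp_all)
  finally show ?thesis
    by (rule L.G.A.iso_cancel_right[OF isoRD]) (use rg rt stD stE gs in simp_all)
qed

lemma reorders_natural:
  assumes "c \<in> Ar KH"
  shows "reorders (Tgt KH c) \<cdot>\<^bsub>KL\<^esub> D.P.strictified c = E.P.strictified c \<cdot>\<^bsub>KL\<^esub> reorders (Src KH c)"
proof (rule strict_natural[OF D.P.strict_functor_strictified E.P.strict_functor_strictified _ _ _ _ assms])
  fix q assume "wt QH (TGen q)"
  then show "reorders (gtgt QH q) \<cdot>\<^bsub>KL\<^esub> D.P.strictified (query QH q) = E.P.strictified (query QH q) \<cdot>\<^bsub>KL\<^esub> reorders (gsrc QH q)"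
    using reorders_query by (cases q) (simp del: H.int_signature_simps(3,4))
qed (use reorder_typing in auto)

text \<open>Between the strictified functors the isomorphism is the blockwise reordering;
  conjugation by the comparisons transports it to the functors themselves.\<close>

definition "comparison_iso xs = E.P.cmpr xs \<cdot>\<^bsub>KL\<^esub> reorders xs \<cdot>\<^bsub>KL\<^esub> inverse_of KL (D.P.cmpr xs)"

lemma comparison_iso_typing:
  assumes "xs \<in> lists (verts H)"
  shows "comparison_iso xs \<in> Ar KL" "Src KL (comparison_iso xs) = fob \<pi> xs" "Tgt KL (comparison_iso xs) = fob \<pi>' xs"
    "deterministic KL (comparison_iso xs)" "iso KL (comparison_iso xs)"
    "comparison_iso xs \<cdot>\<^bsub>KL\<^esub> D.P.cmpr xs = E.P.cmpr xs \<cdot>\<^bsub>KL\<^esub> reorders xs"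
proof -
  have xs: "xs \<in> lists (types QH)" using assms by simp
  note d = D.P.comparison_simps[OF xs] and e = E.P.comparison_simps[OF xs] and r = reorders_typing[OF assms]
  show "comparison_iso xs \<in> Ar KL" "Src KL (comparison_iso xs) = fob \<pi> xs" "Tgt KL (comparison_iso xs) = fob \<pi>' xs"
    "deterministic KL (comparison_iso xs)" "iso KL (comparison_iso xs)"
    "comparison_iso xs \<cdot>\<^bsub>KL\<^esub> D.P.cmpr xs = E.P.cmpr xs \<cdot>\<^bsub>KL\<^esub> reorders xs"
    unfolding comparison_iso_def using d e r L.G.A.det_inverse_of[OF d(5,4)] by simp_all
qed

text \<open>Naturality and monoidality are checked after precomposition with invertible comparisons,
  where they become statements about the strictified functors and \<open>reorders\<close>.\<close>

lemma transformation_comparison_iso: "markov_transformation KH KL \<pi> \<pi>' comparison_iso"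
  unfolding transformation_free_iff[OF D.P.free_functor_axioms E.P.free_functor_axioms]
proof (intro conjI ballI)
  fix c assume c: "c \<in> Ar KH"
  have l: "Src KH c \<in> lists (verts H)" "Tgt KH c \<in> lists (verts H)" using D.P.Src_Tgt_lists[OF c] by auto
  have l': "Src KH c \<in> lists (types QH)" "Tgt KH c \<in> lists (types QH)" using l by simp_all
  note ds = D.P.comparison_simps[OF l'(1)] and dt = D.P.comparison_simps[OF l'(2)]
    and es = E.P.comparison_simps[OF l'(1)] and et = E.P.comparison_simps[OF l'(2)]
    and rs = reorders_typing[OF l(1)] and rt = reorders_typing[OF l(2)]
    and ir = comparison_iso_typing[OF l(1)] and it = comparison_iso_typing[OF l(2)]
    and stD = D.P.strictified_typing[OF c] and stE = E.P.strictified_typing[OF c]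
    and fD = D.P.far_typing[OF c] and fE = E.P.far_typing[OF c]
  have "(comparison_iso (Tgt KH c) \<cdot>\<^bsub>KL\<^esub> far \<pi> c) \<cdot>\<^bsub>KL\<^esub> D.P.cmpr (Src KH c)
      = comparison_iso (Tgt KH c) \<cdot>\<^bsub>KL\<^esub> (D.P.cmpr (Tgt KH c) \<cdot>\<^bsub>KL\<^esub> D.P.strictified c)"
    unfolding D.P.comparison_strictified[OF c] using it fD ds by simp
  also have "\<dots> = (E.P.cmpr (Tgt KH c) \<cdot>\<^bsub>KL\<^esub> reorders (Tgt KH c)) \<cdot>\<^bsub>KL\<^esub> D.P.strictified c"
    by (rule L.G.A.cmp_extend[OF it(6)]) (use it dt stD in simp_all)
  also have "\<dots> = E.P.cmpr (Tgt KH c) \<cdot>\<^bsub>KL\<^esub> (reorders (Tgt KH c) \<cdot>\<^bsub>KL\<^esub> D.P.strictified c)"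
    using et rt stD by simp
  also have "\<dots> = (E.P.cmpr (Tgt KH c) \<cdot>\<^bsub>KL\<^esub> E.P.strictified c) \<cdot>\<^bsub>KL\<^esub> reorders (Src KH c)"
    unfolding reorders_natural[OF c] using et rs stE by simp
  also have "\<dots> = far \<pi>' c \<cdot>\<^bsub>KL\<^esub> (comparison_iso (Src KH c) \<cdot>\<^bsub>KL\<^esub> D.P.cmpr (Src KH c))"
    unfolding E.P.comparison_strictified[OF c] ir(6) using fE es rs by simp
  also have "\<dots> = (far \<pi>' c \<cdot>\<^bsub>KL\<^esub> comparison_iso (Src KH c)) \<cdot>\<^bsub>KL\<^esub> D.P.cmpr (Src KH c)"
    using fE ir(1-3) ds by simp
  finally show "comparison_iso (Tgt KH c) \<cdot>\<^bsub>KL\<^esub> far \<pi> c = far \<pi>' c \<cdot>\<^bsub>KL\<^esub> comparison_iso (Src KH c)"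
    by (rule L.G.A.iso_cancel_right[OF ds(4)]) (use it ir ds fD fE in simp_all)
next
  fix xs ys assume l: "xs \<in> lists (verts H)" "ys \<in> lists (verts H)"
  then have l': "xs \<in> lists (types QH)" "ys \<in> lists (types QH)" and l2: "xs @ ys \<in> lists (verts H)" by auto
  note dx = D.P.comparison_simps[OF l'(1)] and dy = D.P.comparison_simps[OF l'(2)]
    and ex = E.P.comparison_simps[OF l'(1)] and ey = E.P.comparison_simps[OF l'(2)]
    and rx = reorders_typing[OF l(1)] and ry = reorders_typing[OF l(2)]
    and ix = comparison_iso_typing[OF l(1)] and iy = comparison_iso_typing[OF l(2)] and ixy = comparison_iso_typing[OF l2]
    and lD = D.P.lax_typing[OF l'] and lE = E.P.lax_typing[OF l']
  let ?d = "D.P.cmpr xs \<otimes>\<^bsub>KL\<^esub> D.P.cmpr ys"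
  have "(comparison_iso (xs @ ys) \<cdot>\<^bsub>KL\<^esub> lax \<pi> xs ys) \<cdot>\<^bsub>KL\<^esub> ?d = comparison_iso (xs @ ys) \<cdot>\<^bsub>KL\<^esub> D.P.cmpr (xs @ ys)"
    unfolding D.P.comparison_append[OF l'] using ixy(1-3) lD dx dy by simp
  also have "\<dots> = (lax \<pi>' xs ys \<cdot>\<^bsub>KL\<^esub> (E.P.cmpr xs \<otimes>\<^bsub>KL\<^esub> E.P.cmpr ys)) \<cdot>\<^bsub>KL\<^esub> (reorders xs \<otimes>\<^bsub>KL\<^esub> reorders ys)"
    unfolding ixy(6) E.P.comparison_append[OF l'] reorders_append[OF l] ..
  also have "\<dots> = lax \<pi>' xs ys \<cdot>\<^bsub>KL\<^esub> ((E.P.cmpr xs \<cdot>\<^bsub>KL\<^esub> reorders xs) \<otimes>\<^bsub>KL\<^esub> (E.P.cmpr ys \<cdot>\<^bsub>KL\<^esub> reorders ys))"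
    using lE ex ey rx ry by simp
  also have "\<dots> = (lax \<pi>' xs ys \<cdot>\<^bsub>KL\<^esub> (comparison_iso xs \<otimes>\<^bsub>KL\<^esub> comparison_iso ys)) \<cdot>\<^bsub>KL\<^esub> ?d"
    unfolding ix(6)[symmetric] iy(6)[symmetric] using lE ix(1-3) iy(1-3) dx dy by simp
  finally show "comparison_iso (xs @ ys) \<cdot>\<^bsub>KL\<^esub> lax \<pi> xs ys = lax \<pi>' xs ys \<cdot>\<^bsub>KL\<^esub> (comparison_iso xs \<otimes>\<^bsub>KL\<^esub> comparison_iso ys)"
    by (rule L.G.A.iso_cancel_right[rotated]) (use lE lD ix iy ixy dx dy in simp_all)
next
  show "comparison_iso [] \<cdot>\<^bsub>KL\<^esub> unt \<pi> = unt \<pi>'"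
    using comparison_iso_typing(6)[of "[]"] E.P.unt_typing by simp
qed (use comparison_iso_typing in auto)

lemma same_abstraction_of_restricted_eq: "((\<pi>, \<tau>), (\<pi>', \<tau>')) \<in> same_abstraction C L H"
proof -
  \<comment> \<open>At one variable both comparisons are identities, which leaves the permutation
    demanded by \<open>same_abstraction\<close>.\<close>
  have single: "comparison_iso [X] = reorder X" if "X \<in> verts H" for X
  proof -
    have X: "X \<in> types QH" using that by simp
    have o: "D.p X \<in> Ob KL" "E.p X \<in> Ob KL" using D.p_verts[OF that] E.p_verts[OF that] by auto
    show ?thesis
      using reorder_typing[OF that] o
      unfolding comparison_iso_def D.P.comparison_single[OF X] E.P.comparison_single[OF X] by simp
  qed
  have "\<tau>' xs \<cdot>\<^bsub>C\<^esub> far (int_model C L) (comparison_iso xs) = \<tau> xs" if xs: "xs \<in> lists (verts H)" for xs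
  proof -
    have xs': "xs \<in> lists (types QH)" using xs by simp
    note d = D.P.comparison_simps[OF xs'] and e = E.P.comparison_simps[OF xs'] and r = reorders_typing[OF xs]
      and i = comparison_iso_typing[OF xs]
    have T: "component \<pi> \<tau> xs \<in> Ar S" "component \<pi>' \<tau>' xs \<in> Ar S"
      using D.transformation' E.transformation' xs by auto
    have semr: "L.sem (reorders xs) = list_tensor_ar S (map (\<lambda>X. L.W (D.p X) (E.p X)) xs)"
    proof -
      have "map L.sem (map reorder xs) = map (\<lambda>X. L.W (D.p X) (E.p X)) xs"
        using xs reorder_typing(6) by auto
      then show ?thesis using L.F.map_list_tensor_ar[OF reorders_set[OF xs]] by (simp only:)
    qed
    have dt: "D.tens xs = E.tens xs \<bullet> L.sem (reorders xs)"
    proof -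
      have "D.tens xs = list_tensor_ar S (map (\<lambda>X. E.t X \<bullet> L.W (D.p X) (E.p X)) xs)"
        using xs by (intro arg_cong[of _ _ "list_tensor_ar S"] map_cong HOL.refl same_t) auto
      also have "\<dots> = E.tens xs \<bullet> list_tensor_ar S (map (\<lambda>X. L.W (D.p X) (E.p X)) xs)"
      proof (rule L.S.list_tensor_ar_cmp[symmetric])
        fix X assume "X \<in> set xs"
        then have X: "X \<in> verts H" using xs by auto
        show "L.W (D.p X) (E.p X) \<in> Ar S" "E.t X \<in> Ar S" "Src S (E.t X) = Tgt S (L.W (D.p X) (E.p X))"
          using D.p_verts[OF X] E.p_verts[OF X] same_p[OF X] E.t_typing[OF X] by simp_all
      qed
      finally show ?thesis unfolding semr .
    qed
    \<comment> \<open>After cancelling the comparison the claim is \<open>dt\<close>, the tensor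
      product of the relations \<open>same_t\<close> at single variables.\<close>
    have "component \<pi>' \<tau>' xs \<bullet> L.sem (comparison_iso xs) = component \<pi> \<tau> xs"
    proof (rule L.S.iso_cancel_right)
      show "iso S (L.sem (D.P.cmpr xs))" using L.F.map_iso[OF d(4)] by (rule L.S.isoI)
      have "(component \<pi>' \<tau>' xs \<bullet> L.sem (comparison_iso xs)) \<bullet> L.sem (D.P.cmpr xs)
          = component \<pi>' \<tau>' xs \<bullet> L.sem (comparison_iso xs \<cdot>\<^bsub>KL\<^esub> D.P.cmpr xs)"
        using T i(1-3) d by simp
      also have "\<dots> = E.tens xs \<bullet> L.sem (reorders xs)"
        unfolding i(6) E.tens_eq[OF xs] using T e r by simp
      also have "\<dots> = component \<pi> \<tau> xs \<bullet> L.sem (D.P.cmpr xs)"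
        unfolding dt[symmetric] by (rule D.tens_eq[OF xs])
      finally show "(component \<pi>' \<tau>' xs \<bullet> L.sem (comparison_iso xs)) \<bullet> L.sem (D.P.cmpr xs) =
          component \<pi> \<tau> xs \<bullet> L.sem (D.P.cmpr xs)" .
    qed (use T i d in simp_all)
    then have "underlying (component \<pi>' \<tau>' xs \<bullet> L.sem (comparison_iso xs)) = \<tau> xs" by simp
    then show ?thesis
      using strictify_cmp[of "L.sem (comparison_iso xs)" "component \<pi>' \<tau>' xs"] T i(1) by (simp add: L.far_int_model)
  qed
  then show ?thesis
    unfolding same_abstraction_def
    using D.down E.down transformation_comparison_iso comparison_iso_typing(5) single reorder_typing(7)
    by (auto intro!: exI[of _ comparison_iso])
qed

end

section \<open>Lifting an interchange abstraction\<close>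

lemma strict_functor_comp:
  assumes "strict_functor A B ob F" "strict_functor B D ob' G"
  shows "strict_functor A D (\<lambda>x. concat (map ob' (ob x))) (\<lambda>c. G (F c))"
proof -
  interpret F: strict_functor A B ob F by fact
  interpret G: strict_functor B D ob' G by fact
  have c: "concat (map ob' (concat (map ob xs))) = concat (map (\<lambda>x. concat (map ob' (ob x))) xs)" for xs
    by (rule G.concat_map_ob)
  show ?thesis
  proof (unfold_locales, goal_cases)
    case (1 a)
    then have "concat (map ob' (ob x)) \<in> Ob D" if "x \<in> set a" for x
      using F.ob_Ob[OF 1] that G.ob_Ob[of "ob x"] G.B.concat_Ob[of "map ob' (ob x)"] by (auto simp: image_subset_iff)
    then show ?case by auto
  qed (simp_all add: c)
qed

lemma perms_ten:
  assumes "f \<in> perms Q xs ys" "g \<in> perms Q xs' ys'"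
  shows "f \<otimes>\<^bsub>free_markov Q\<^esub> g \<in> perms Q (xs @ xs') (ys @ ys')"
proof -
  obtain s t where "f = tclass Q s" "wt Q s" "perm_term s" "tsrc Q s = xs" "ttgt Q s = ys"
    "g = tclass Q t" "wt Q t" "perm_term t" "tsrc Q t = xs'" "ttgt Q t = ys'"
    using assms unfolding perms_def by auto
  then show ?thesis unfolding perms_def by (auto intro!: exI[of _ "TTen s t"])
qed

lemma perms_replicate:
  assumes "f \<in> perms Q xs ys"
  shows "list_tensor_ar (free_markov Q) (replicate n f) \<in> perms Q (concat (replicate n xs)) (concat (replicate n ys))"
proof (induction n)
  case 0
  have "tclass Q (TId []) \<in> perms Q [] []" unfolding perms_def by (auto intro!: exI[of _ "TId []"])
  then show ?case by (simp add: list_tensor_ar_def free_markov_simps(5))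
next
  case (Suc n)
  then show ?case using perms_ten[OF assms Suc] by (simp add: list_tensor_ar_def)
qed

section \<open>Extending an alignment freely to lists and queries\<close>

locale alignment = model_pair C L H
  for C :: "('o, 'm) mcat" and L :: "('v, 'o, 'm) causal_model" and H :: "('u, 'o, 'm) causal_model" +
  fixes p0 :: "'u \<Rightarrow> 'v set" and \<tau>0 :: "'u \<Rightarrow> 'm"
  assumes abstraction: "interchange_abstraction C L H p0 \<tau>0"
begin

lemma aligned: "variable_alignment C L H p0 \<tau>0"
  using abstraction by (simp add: interchange_abstraction_def)

lemma p0_verts: "X \<in> verts H \<Longrightarrow> p0 X \<subseteq> verts L"
  and p0_disjoint: "disjoint_family_on p0 (verts H)"
  and p0_ins: "image_set p0 (ins H) = ins L"
  and p0_outs: "image_set p0 (outs H) \<subseteq> outs L"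
  and epic_tau_list: "xs \<in> lists (verts H) \<Longrightarrow> epic C (underlying (tau_list C L H p0 \<tau>0 xs))"
  and extensional: "p0 \<in> extensional (verts H)" "\<tau>0 \<in> extensional (verts H)"
  using aligned unfolding variable_alignment_def by blast+

lemma tau0: "X \<in> verts H \<Longrightarrow> \<tau>0 X \<in> hom C (tlist C (map (val L) (list_of (p0 X)))) (val H X)"
   "X \<in> verts H \<Longrightarrow> deterministic C (\<tau>0 X)"
  using aligned unfolding variable_alignment_def by blast+

text \<open>An alignment prescribes the image of the inputs; as this is all of \<open>ins L\<close>,
  disjointness keeps the images of non-inputs away from it.\<close>

lemma p0_nins: "X \<in> nins H \<Longrightarrow> p0 X \<subseteq> nins L"
proof -
  assume X: "X \<in> nins H"
  then have "p0 X \<inter> p0 Y = {}" if "Y \<in> ins H" for Y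
    using that H.ins_verts by (intro disjoint_family_onD[OF p0_disjoint]) (auto simp: nins_def)
  then have "p0 X \<inter> image_set p0 (ins H) = {}" unfolding image_set_def by blast
  then show ?thesis
    using p0_verts[of X] X unfolding p0_ins nins_def by blast
qed

abbreviation "p \<equiv> \<lambda>X. list_of (p0 X)"
abbreviation "cp xs \<equiv> concat (map p xs)"
abbreviation "im \<equiv> image_set p0"

lemma p_simps: "X \<in> verts H \<Longrightarrow> distinct (p X)" "X \<in> verts H \<Longrightarrow> set (p X) = p0 X"
  using p0_verts by simp_all

lemma distinct_cp: "\<lbrakk>distinct xs; set xs \<subseteq> verts H\<rbrakk> \<Longrightarrow> distinct (cp xs)"
proof (rule distinct_concat_map)
  fix X Y assume "set xs \<subseteq> verts H" "X \<in> set xs" "Y \<in> set xs" "X \<noteq> Y"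
  then show "set (p X) \<inter> set (p Y) = {}"
    using disjoint_family_onD[OF p0_disjoint, of X Y] p_simps(2)[of X] p_simps(2)[of Y] by auto
qed (use p_simps(1) in auto)

lemma set_cp: "set xs \<subseteq> verts H \<Longrightarrow> set (cp xs) = im (set xs)"
  using p_simps(2) by (auto simp: image_set_def subset_iff)

lemma im_verts: "A \<subseteq> verts H \<Longrightarrow> im A \<subseteq> verts L"
  using p0_verts by (auto simp: image_set_def)

lemma im_gens: "(Ss, A) \<in> gens QH \<Longrightarrow> (map im Ss, im A) \<in> gens QL"
  using intervention_sets_image[OF _ p0_disjoint p0_nins] p0_outs by (auto simp: image_set_def)

definition t :: "'u \<Rightarrow> 'o list \<times> 'm \<times> 'o list" where
  "t X = (map (val L) (p X), \<tau>0 X, [val H X])"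

abbreviation "tens xs \<equiv> list_tensor_ar S (map t xs)"

lemma t_typing:
  assumes X: "X \<in> verts H"
  shows "t X \<in> Ar S" "Src S (t X) = map (val L) (p X)" "Tgt S (t X) = [val H X]" "deterministic S (t X)"
proof -
  have "map (val L) (p X) \<in> lists (Ob C)" using p0_verts[OF X] p_simps(2)[OF X] by (intro L.map_val_Ob) simp
  then show Ar: "t X \<in> Ar S"
    using tau0(1)[OF X] H.val_Ob[OF X] by (simp add: t_def strictify_simps in_hom_iff)
  show "Src S (t X) = map (val L) (p X)" "Tgt S (t X) = [val H X]" by (simp_all add: t_def strictify_simps)
  show "deterministic S (t X)"
    using deterministic_strictify_iff[OF Ar[unfolded t_def]] tau0(2)[OF X] by (simp add: t_def)
qed

lemma tens_set: "xs \<in> lists (verts H) \<Longrightarrow> set (map t xs) \<subseteq> Ar S"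
  using t_typing(1) by auto

lemma tens_typing:
  assumes "xs \<in> lists (verts H)"
  shows "tens xs \<in> Ar S" "Src S (tens xs) = map (val L) (cp xs)" "Tgt S (tens xs) = map (val H) xs"
    "deterministic S (tens xs)"
proof -
  have 1: "map (Src S) (map t xs) = map (\<lambda>X. map (val L) (p X)) xs"
    "map (Tgt S) (map t xs) = map (\<lambda>X. [val H X]) xs"
    using assms t_typing by auto
  show "tens xs \<in> Ar S" "Src S (tens xs) = map (val L) (cp xs)" "Tgt S (tens xs) = map (val H) xs"
    using L.S.list_tensor_ar_typing[OF tens_set[OF assms]] unfolding 1 by (simp_all add: map_concat comp_def)
  show "deterministic S (tens xs)"
    by (rule L.S.det_list_tensor_ar) (use assms t_typing in auto)
qed

lemma tau_list_eq: "tau_list C L H p0 \<tau>0 xs = tens xs"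
  by (simp add: tau_list_def t_def[abs_def])

lemma tau_set_eq: "tau_set C L H p0 \<tau>0 A = tens (list_of A) \<bullet> L.W (list_of (im A)) (cp (list_of A))"
  by (simp add: tau_set_def tau_list_eq)

lemma wires_typing:
  assumes A: "A \<subseteq> verts H"
  shows "L.W (list_of (im A)) (cp (list_of A)) \<in> Ar S"
    "Src S (L.W (list_of (im A)) (cp (list_of A))) = map (val L) (list_of (im A))"
    "Tgt S (L.W (list_of (im A)) (cp (list_of A))) = map (val L) (cp (list_of A))"
  using im_verts[OF A] set_cp[of "list_of A"] A by simp_all

text \<open>The abstraction equation for all outputs is marginalized to the outputs in \<open>A\<close>.\<close>

lemma tens_interchange:
  assumes Ss: "intervention_sets H Ss" and A: "A \<subseteq> outs H"
  shows "tens (list_of A) \<bullet> L.W (list_of (im A)) (cp (list_of A)) \<bullet> interchange_channel C L (map im Ss) (im A) =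
    interchange_channel C H Ss A \<bullet> list_tensor_ar S (replicate (length Ss + 1)
      (tens (list_of (ins H)) \<bullet> L.W (list_of (ins L)) (cp (list_of (ins H)))))"
proof -
  let ?O = "outs H"
  let ?lo = "list_of (outs H)" and ?lA = "list_of A"
  let ?icL = "interchange_channel C L (map im Ss)" and ?icH = "interchange_channel C H Ss"
  let ?R = "list_tensor_ar S (replicate (length Ss + 1) (tens (list_of (ins H)) \<bullet> L.W (list_of (ins L)) (cp (list_of (ins H)))))"
  have O: "?O \<subseteq> verts H" and AH: "A \<subseteq> verts H" using H.outs_verts A by auto
  have lO: "?lo \<in> lists (verts H)" "?lA \<in> lists (verts H)" "list_of (ins H) \<in> lists (verts H)"
    using O AH H.ins_verts by auto
  have sets: "set ?lo = ?O" "set ?lA = A" using O AH by simp_all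
  note wO = wires_typing[OF O] and wA = wires_typing[OF AH] and wI = wires_typing[OF H.ins_verts, unfolded p0_ins]
  note tO = tens_typing[OF lO(1)] and tA = tens_typing[OF lO(2)] and tI = tens_typing[OF lO(3)]
  have imL: "intervention_sets L (map im Ss)" "im ?O \<subseteq> verts L" "im A \<subseteq> im ?O"
    using im_gens[of Ss ?O] Ss im_verts[OF O] A by (auto simp: image_set_def)
  note icL = L.interchange_channel_typing[OF imL(1,2)]
  note icH = H.interchange_channel_typing[OF Ss O]
  have eq: "(tens ?lo \<bullet> L.W (list_of (im ?O)) (cp ?lo)) \<bullet> ?icL (im ?O) = ?icH ?O \<bullet> ?R"
    using abstraction Ss unfolding interchange_abstraction_def tau_set_eq p0_ins by blast
  have R: "?R \<in> Ar S" "Tgt S ?R = Src S (?icH ?O)"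
    using L.S.list_tensor_ar_replicate_typing[of "tens (list_of (ins H)) \<bullet> L.W (list_of (ins L)) (cp (list_of (ins H)))" "length Ss + 1"]
      tI wI icH(2) by (simp_all add: map_concat map_replicate)
  have HW: "H.W ?lo ?lA \<in> Ar S" "Src S (H.W ?lo ?lA) = map (val H) ?lo" using O sets A by simp_all
  \<comment> \<open>Marginalizing at the high level becomes marginalizing at the low level: the
    deterministic components slide through the wiring, and \<open>wire_block\<close> regroups blocks
    into single low-level wires.\<close>
  have nat: "H.W ?lo ?lA \<bullet> tens ?lo = tens ?lA \<bullet> L.W (cp ?lo) (cp ?lA)"
  proof -
    have "H.W ?lo ?lA \<bullet> tens ?lo = tens ?lA \<bullet> wire S (\<lambda>X. concat (map (\<lambda>x. [val L x]) (p X))) ?lo ?lA"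
      by (rule L.S.wire_natural) (use sets O A t_typing in auto)
    also have "wire S (\<lambda>X. concat (map (\<lambda>x. [val L x]) (p X))) ?lo ?lA = L.W (cp ?lo) (cp ?lA)"
    proof (rule L.S.wire_block)
      fix X Y assume "X \<in> set ?lo" "Y \<in> set ?lo" "X \<noteq> Y"
      then show "set (p X) \<inter> set (p Y) = {}"
        using disjoint_family_onD[OF p0_disjoint, of X Y] p_simps(2)[of X] p_simps(2)[of Y] sets O by auto
    next
      fix X assume "X \<in> set ?lo"
      then have "X \<in> verts H" using sets O by auto
      then show "distinct (p X)" "(\<lambda>x. [val L x]) ` set (p X) \<subseteq> Ob S"
        using p_simps p0_verts[of X] by simp_all
    qed (use sets A in auto)
    finally show ?thesis .
  qed
  have cps: "set (cp ?lo) = im ?O" "set (cp ?lA) = im A" "set (list_of (im ?O)) = im ?O" "set (list_of (im A)) = im A"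
    using set_cp[of ?lo] set_cp[of ?lA] sets O AH im_verts[OF O] im_verts[OF AH] by simp_all
  have "?icH A \<bullet> ?R = H.W ?lo ?lA \<bullet> (?icH ?O \<bullet> ?R)"
    unfolding H.interchange_channel_marginal[OF Ss O A]
    by (rule L.S.cmp_cmp[OF R(1) icH(1) HW(1) R(2)[symmetric]]) (simp only: HW(2) icH(3))
  also have "\<dots> = H.W ?lo ?lA \<bullet> tens ?lo \<bullet> L.W (list_of (im ?O)) (cp ?lo) \<bullet> ?icL (im ?O)"
    unfolding eq[symmetric]
    by (subst L.S.cmp_cmp[OF icL(1) wO(1) tO(1)]) (simp_all only: wO icL tO)
  also have "\<dots> = (tens ?lA \<bullet> L.W (cp ?lo) (cp ?lA)) \<bullet> L.W (list_of (im ?O)) (cp ?lo) \<bullet> ?icL (im ?O)"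
    by (rule L.S.cmp_extend[OF nat]) (use HW tO wO icL in simp_all)
  also have "\<dots> = tens ?lA \<bullet> L.W (cp ?lo) (cp ?lA) \<bullet> L.W (list_of (im ?O)) (cp ?lo) \<bullet> ?icL (im ?O)"
    by (rule L.S.cmp_cmp) (use tA wO icL cps imL in simp_all)
  also have "L.W (cp ?lo) (cp ?lA) \<bullet> L.W (list_of (im ?O)) (cp ?lo) \<bullet> ?icL (im ?O)
      = L.W (list_of (im ?O)) (cp ?lA) \<bullet> ?icL (im ?O)"
    by (rule L.wireM_wireM_cmp) (use icL cps imL in simp_all)
  \<comment> \<open>The diagram is factored through the enumeration of \<open>im A\<close>, so that
    the low-level channel can be marginalized to \<open>im A\<close>.\<close>
  also have "\<dots> = L.W (list_of (im A)) (cp ?lA) \<bullet> L.W (list_of (im ?O)) (list_of (im A)) \<bullet> ?icL (im ?O)"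
    by (rule L.wireM_wireM_cmp[symmetric]) (use icL cps imL in simp_all)
  also have "L.W (list_of (im ?O)) (list_of (im A)) \<bullet> ?icL (im ?O) = ?icL (im A)"
    by (rule L.interchange_channel_marginal[OF imL(1,2,3), symmetric])
  finally show ?thesis ..
qed

abbreviation "w_ins \<equiv> wireQ L (list_of (ins L)) (cp (list_of (ins H)))"
abbreviation "w_ins' \<equiv> wireQ L (cp (list_of (ins H))) (list_of (ins L))"
abbreviation "w_out A \<equiv> wireQ L (list_of (im A)) (cp (list_of A))"

text \<open>The value forced by \<open>maps_queries\<close> when all comparisons are identities:
  solving for the image of the query moves each input permutation \<open>w_ins\<close> to the other
  side as its inverse \<open>w_ins'\<close>.\<close>

definition gen :: "'u set list \<times> 'u set \<Rightarrow> ('v, 'v set list \<times> 'v set) trm set" where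
  "gen = (\<lambda>(Ss, A). w_out A \<cdot>\<^bsub>KL\<^esub> query QL (map im Ss, im A) \<cdot>\<^bsub>KL\<^esub>
    list_tensor_ar KL (replicate (length Ss + 1) w_ins'))"

lemma set_cp_ins: "set (cp (list_of (ins H))) = ins L"
  using set_cp[of "list_of (ins H)"] p0_ins H.ins_verts by simp

lemma w_ins_typing: "w_ins \<in> Ar KL" "Src KL w_ins = list_of (ins L)" "Tgt KL w_ins = cp (list_of (ins H))"
    "w_ins' \<in> Ar KL" "Src KL w_ins' = cp (list_of (ins H))" "Tgt KL w_ins' = list_of (ins L)"
  using wireQ_typing[of "list_of (ins L)" "cp (list_of (ins H))"] wireQ_typing[of "cp (list_of (ins H))" "list_of (ins L)"]
    set_cp_ins L.ins_verts by auto

lemma w_ins_inverse: "w_ins' \<cdot>\<^bsub>KL\<^esub> w_ins = Ident KL (list_of (ins L))"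
    "w_ins \<cdot>\<^bsub>KL\<^esub> w_ins' = Ident KL (cp (list_of (ins H)))"
proof -
  have o: "(\<lambda>x. [x]) ` ins L \<subseteq> Ob KL" using L.ins_verts by auto
  have d: "distinct (cp (list_of (ins H)))" using distinct_cp H.ins_verts by simp
  show "w_ins' \<cdot>\<^bsub>KL\<^esub> w_ins = Ident KL (list_of (ins L))"
    "w_ins \<cdot>\<^bsub>KL\<^esub> w_ins' = Ident KL (cp (list_of (ins H)))"
    using o d set_cp_ins L.ins_verts
    by (simp_all add: L.G.A.wire_wire L.G.A.wire_self del: set_concat)
qed

lemma w_out_typing:
  assumes A: "A \<subseteq> verts H"
  shows "w_out A \<in> Ar KL" "Src KL (w_out A) = list_of (im A)" "Tgt KL (w_out A) = cp (list_of A)"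
  using wireQ_typing[of "list_of (im A)" "cp (list_of A)"] im_verts[OF A] set_cp[of "list_of A"] A by simp_all

lemma cp_concat_replicate: "cp (concat (replicate n xs)) = concat (replicate n (cp xs))"
  by (induction n) simp_all

lemma gen_typing:
  assumes q: "(Ss, A) \<in> gens QH"
  shows "gen (Ss, A) \<in> Ar KL" "Src KL (gen (Ss, A)) = cp (gsrc QH (Ss, A))" "Tgt KL (gen (Ss, A)) = cp (gtgt QH (Ss, A))"
proof -
  have A: "A \<subseteq> verts H" using q H.outs_verts by auto
  note w = w_out_typing[OF A] and q' = query_Ar(1)[OF im_gens[OF q]]
  note R = L.G.A.list_tensor_ar_replicate_typing[OF w_ins_typing(4), of "length Ss + 1", unfolded w_ins_typing]
  have t: "Src KL (query QL (map im Ss, im A)) = Tgt KL (list_tensor_ar KL (replicate (length Ss + 1) w_ins'))"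
    using q' R(3) by simp
  show "gen (Ss, A) \<in> Ar KL" "Tgt KL (gen (Ss, A)) = cp (gtgt QH (Ss, A))"
    unfolding gen_def using w q' R(1) t by simp_all
  have "Src KL (gen (Ss, A)) = Src KL (list_tensor_ar KL (replicate (length Ss + 1) w_ins'))"
    unfolding gen_def using w q' R(1) t by simp
  then show "Src KL (gen (Ss, A)) = cp (gsrc QH (Ss, A))"
    by (simp only: R H.int_signature_simps cp_concat_replicate)
qed

sublocale I: term_interpretation KL QH p gen
proof -
  interpret K: strict_markov KL by (rule KL_markov)
  show "term_interpretation KL QH p gen"
  proof unfold_locales
    fix X assume "X \<in> types QH"
    then show "p X \<in> Ob KL" using p0_verts[of X] p_simps(2)[of X] by (auto simp: in_lists_conv_set)
  next
    fix q assume "wt QH (TGen q)"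
    then show "gen q \<in> Ar KL \<and> Src KL (gen q) = cp (gsrc QH q) \<and> Tgt KL (gen q) = cp (gtgt QH q)"
      using gen_typing by (cases q) (simp del: H.int_signature_simps(3,4))
  qed
qed

definition "ext c = interp_in KL p gen (trep c)"

lemma strict_functor_ext: "strict_functor KH KL p ext"
  using I.strict_functor_axioms by (simp add: ext_def[abs_def])

lemma ext_query: "(Ss, A) \<in> gens QH \<Longrightarrow> ext (query QH (Ss, A)) = gen (Ss, A)"
  using I.interp_in_trep[OF H.wt_gen] by (simp add: ext_def query_def)

definition lifted_functor :: "('u, 'v) int_functor" where
  "lifted_functor = strict_mfunctor KL p ext"

definition lifted_tau :: "'u list \<Rightarrow> 'm" where
  "lifted_tau xs = underlying (tens xs)"

lemma lifted_simps [simp]: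
  "fob lifted_functor xs = cp xs" "far lifted_functor = ext"
  "lax lifted_functor xs ys = Ident KL (cp (xs @ ys))" "unt lifted_functor = Ident KL []"
  by (simp_all add: lifted_functor_def)

lemma markov_functor_lifted: "markov_functor KH KL lifted_functor"
  unfolding lifted_functor_def by (rule strict_functor.markov_functor_strict[OF strict_functor_ext])

lemma component_lifted: "xs \<in> lists (verts H) \<Longrightarrow> component lifted_functor lifted_tau xs = tens xs"
  using tens_typing[of xs] by (intro strictify_eqI) (simp_all add: lifted_tau_def)

text \<open>Naturality at a query is \<open>tens_interchange\<close> once \<open>w_ins\<close> and
  \<open>w_ins'\<close> have cancelled on every copy of the inputs.\<close>

lemma tens_query:
  assumes q: "(Ss, A) \<in> gens QH"
  shows "tens (gtgt QH (Ss, A)) \<bullet> L.sem (ext (query QH (Ss, A))) = H.sem (query QH (Ss, A)) \<bullet> tens (gsrc QH (Ss, A))"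
proof -
  let ?n = "length Ss + 1" and ?li = "list_of (ins H)"
  let ?R = "list_tensor_ar KL (replicate ?n w_ins')"
  let ?W = "L.W (list_of (ins L)) (cp ?li)" and ?W' = "L.W (cp ?li) (list_of (ins L))"
  have Ss: "intervention_sets H Ss" "A \<subseteq> outs H" using q by auto
  have A: "A \<subseteq> verts H" using Ss H.outs_verts by auto
  have l: "list_of A \<in> lists (verts H)" "?li \<in> lists (verts H)" using A H.ins_verts by auto
  note w = w_out_typing[OF A] and q' = query_Ar(1)[OF im_gens[OF q]]
  note R = L.G.A.list_tensor_ar_replicate_typing[OF w_ins_typing(4), of ?n, unfolded w_ins_typing]
  have t: "Src KL (query QL (map im Ss, im A)) = Tgt KL ?R" using q' R(3) by simp
  note tA = tens_typing[OF l(1)] and tI = tens_typing[OF l(2)]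
  have semW: "L.sem w_ins' = ?W'" "L.sem w_ins = ?W" "L.sem (w_out A) = L.W (list_of (im A)) (cp (list_of A))"
    using L.sem_wire[of "cp ?li"] L.sem_wire[of "list_of (ins L)"] L.sem_wire[of "list_of (im A)"]
      L.ins_verts set_cp_ins im_verts[OF A] by simp_all
  have semR: "L.sem ?R = list_tensor_ar S (replicate ?n ?W')"
  proof -
    have "set (replicate ?n w_ins') \<subseteq> Ar KL" using w_ins_typing(4) by auto
    from L.F.map_list_tensor_ar[OF this] show ?thesis by (simp only: map_replicate semW)
  qed
  have Wt: "?W \<in> Ar S" "Src S ?W = map (val L) (list_of (ins L))" "Tgt S ?W = map (val L) (cp ?li)"
    "?W' \<in> Ar S" "Src S ?W' = map (val L) (cp ?li)" "Tgt S ?W' = map (val L) (list_of (ins L))"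
    using L.F.typing[OF w_ins_typing(1)] L.F.typing[OF w_ins_typing(4)] w_ins_typing unfolding semW by simp_all
  have WW: "?W \<bullet> ?W' = Ident S (map (val L) (cp ?li))"
  proof -
    have "L.sem (w_ins \<cdot>\<^bsub>KL\<^esub> w_ins') = ?W \<bullet> ?W'" using w_ins_typing by (simp add: semW)
    moreover have "cp ?li \<in> Ob KL" using set_cp_ins L.ins_verts by (simp add: in_lists_conv_set del: set_concat) blast
    ultimately show ?thesis unfolding w_ins_inverse by simp
  qed
  have icL: "interchange_channel C L (map im Ss) (im A) \<in> Ar S"
     "Tgt S (interchange_channel C L (map im Ss) (im A)) = map (val L) (list_of (im A))"
     "Src S (interchange_channel C L (map im Ss) (im A)) = Tgt S (L.sem ?R)"
    using L.F.typing[OF q'[THEN conjunct1]] q' R t unfolding L.sem_query[OF im_gens[OF q]] by simp_all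
  note icH = H.interchange_channel_typing[OF Ss(1) A]
  let ?T = "tens ?li \<bullet> ?W"
  have T: "?T \<in> Ar S" "Src S ?T = map (val L) (list_of (ins L))" "Tgt S ?T = map (val H) ?li"
    using tI Wt by simp_all
  note RT = L.S.list_tensor_ar_replicate_typing[OF T(1), of ?n]
    and RW = L.S.list_tensor_ar_replicate_typing[OF Wt(4), of ?n]
  have "tens (gtgt QH (Ss, A)) \<bullet> L.sem (ext (query QH (Ss, A)))
      = tens (list_of A) \<bullet> L.sem (w_out A \<cdot>\<^bsub>KL\<^esub> query QL (map im Ss, im A) \<cdot>\<^bsub>KL\<^esub> ?R)"
    by (simp add: ext_query[OF q] gen_def)
  also have "L.sem (w_out A \<cdot>\<^bsub>KL\<^esub> query QL (map im Ss, im A) \<cdot>\<^bsub>KL\<^esub> ?R)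
      = L.W (list_of (im A)) (cp (list_of A)) \<bullet> interchange_channel C L (map im Ss) (im A) \<bullet> L.sem ?R"
    using w q' R(1) t by (simp add: L.sem_query[OF im_gens[OF q]] semW del: replicate_Suc)
  also have "tens (list_of A) \<bullet> L.W (list_of (im A)) (cp (list_of A)) \<bullet> interchange_channel C L (map im Ss) (im A) \<bullet> L.sem ?R
      = (tens (list_of A) \<bullet> L.W (list_of (im A)) (cp (list_of A)) \<bullet> interchange_channel C L (map im Ss) (im A)) \<bullet> L.sem ?R"
    using tA wires_typing[OF A] icL R(1) by simp
  also have "\<dots> = (interchange_channel C H Ss A \<bullet> list_tensor_ar S (replicate ?n ?T)) \<bullet> L.sem ?R"
    by (simp only: tens_interchange[OF Ss])
  also have "\<dots> = interchange_channel C H Ss A \<bullet> (list_tensor_ar S (replicate ?n ?T) \<bullet> list_tensor_ar S (replicate ?n ?W'))"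
    unfolding semR
    by (rule L.S.cmp_cmp[OF RW(1) RT(1) icH(1)])
      (simp_all only: RT RW T Wt icH map_concat map_replicate)
  also have "list_tensor_ar S (replicate ?n ?T) \<bullet> list_tensor_ar S (replicate ?n ?W')
      = list_tensor_ar S (replicate ?n (?T \<bullet> ?W'))"
    by (rule L.S.list_tensor_ar_replicate_cmp[OF Wt(4) T(1)]) (simp only: T Wt)
  also have "?T \<bullet> ?W' = tens ?li"
    by (subst L.S.cmp_cmp[OF Wt(4,1) tI(1)]) (simp_all only: Wt tI WW L.S.cmp_ident)
  also have "list_tensor_ar S (replicate ?n (tens ?li)) = tens (gsrc QH (Ss, A))"
    using L.S.list_tensor_ar_concat_replicate[OF tens_set[OF l(2)], of ?n]
    by (simp only: H.int_signature_simps map_concat map_replicate)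
  also have "interchange_channel C H Ss A = H.sem (query QH (Ss, A))" by (rule H.sem_query[OF q, symmetric])
  finally show ?thesis .
qed

text \<open>The free extension followed by the model of \<open>L\<close> is again strict, so
  \<open>strict_natural\<close> reduces naturality to queries. Monoidality holds because
  \<open>lifted_tau\<close> is a tensor product along the list.\<close>

lemma transformation_lifted:
  "markov_transformation KH C (functor_comp C (int_model C L) lifted_functor) (int_model C H) lifted_tau"
proof -
  have ff: "free_functor QH QL lifted_functor" by unfold_locales (rule markov_functor_lifted)
  have sf: "strict_functor KH S (\<lambda>X. map (val L) (p X)) (\<lambda>c. L.sem (ext c))"
    using strict_functor_comp[OF strict_functor_ext L.F.strict_functor_axioms] by simp
  have nat: "tens (Tgt KH c) \<bullet> L.sem (ext c) = H.sem c \<bullet> tens (Src KH c)" if "c \<in> Ar KH" for c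
  proof (rule strict_natural[OF sf H.F.strict_functor_axioms _ _ _ _ that])
    fix q assume "wt QH (TGen q)"
    then show "tens (gtgt QH q) \<bullet> L.sem (ext (query QH q)) = H.sem (query QH q) \<bullet> tens (gsrc QH q)"
      using tens_query by (cases q) (simp del: H.int_signature_simps(3,4))
  qed (use t_typing in auto)
  show ?thesis
    unfolding markov_transformation_iff[OF ff]
  proof (intro conjI ballI)
    fix xs assume xs: "xs \<in> lists (verts H)"
    show "component lifted_functor lifted_tau xs \<in> Ar S" "deterministic S (component lifted_functor lifted_tau xs)"
      unfolding component_lifted[OF xs] using tens_typing[OF xs] by simp_all
  next
    fix c assume c: "c \<in> Ar KH"
    then have "Src KH c \<in> lists (verts H)" "Tgt KH c \<in> lists (verts H)"
      using free_functor.Src_Tgt_lists[OF ff c] by simp_all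
    then show "component lifted_functor lifted_tau (Tgt KH c) \<bullet> L.sem (far lifted_functor c) =
        H.sem c \<bullet> component lifted_functor lifted_tau (Src KH c)"
      using nat[OF c] by (simp add: component_lifted)
  next
    fix xs ys assume l: "xs \<in> lists (verts H)" "ys \<in> lists (verts H)"
    then have l2: "xs @ ys \<in> lists (verts H)" by simp
    have "set (cp (xs @ ys)) \<subseteq> verts L" using set_cp[of "xs @ ys"] im_verts[of "set (xs @ ys)"] l2 by auto
    then have "cp (xs @ ys) \<in> Ob KL" by auto
    then have "L.sem (Ident KL (cp (xs @ ys))) = Ident S (map (val L) (cp (xs @ ys)))"
      using L.F.ident[of "cp (xs @ ys)"] by simp
    then show "component lifted_functor lifted_tau (xs @ ys) \<bullet> L.sem (lax lifted_functor xs ys) =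
        component lifted_functor lifted_tau xs \<boxtimes> component lifted_functor lifted_tau ys"
      unfolding component_lifted[OF l(1)] component_lifted[OF l(2)] component_lifted[OF l2] lifted_simps
      using tens_typing[OF l2] L.S.list_tensor_ar_append[OF tens_set tens_set, OF l]
      by (simp del: L.F.ident)
  qed
qed

lemma comparison_lifted: "xs \<in> lists (verts H) \<Longrightarrow> comparison QL lifted_functor xs = Ident KL (cp xs)"
proof (induction xs)
  case (Cons X xs)
  have "p Y \<in> Ob KL" if "Y \<in> verts H" for Y
    using p0_verts[OF that] p_simps(2)[OF that] by (auto simp: in_lists_conv_set)
  then have "p X \<in> Ob KL" "cp xs \<in> Ob KL" using Cons.prems by (auto simp: in_lists_conv_set)
  then show ?case using Cons by simp
qed simp

lemma var_set_lifted: "A \<subseteq> verts H \<Longrightarrow> var_set lifted_functor A = im A"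
  using p_simps(2) by (auto simp: var_set_def image_set_def subset_iff)

lemma concat_image_lifted: "concat_image lifted_functor xs = cp xs"
  by (simp add: concat_image_def)

text \<open>The comparisons of the strict lifted functor are identities, and the factor
  \<open>?R'\<close> built into \<open>gen\<close> cancels the input permutations
  \<open>?R\<close>.\<close>

lemma lifted_query:
  assumes q: "(Ss, A) \<in> gens QH"
  shows "far lifted_functor (query QH (Ss, A)) \<cdot>\<^bsub>KL\<^esub> comparison QL lifted_functor (gsrc QH (Ss, A)) \<cdot>\<^bsub>KL\<^esub>
      list_tensor_ar KL (replicate (length Ss + 1) w_ins) =
    comparison QL lifted_functor (list_of A) \<cdot>\<^bsub>KL\<^esub> w_out A \<cdot>\<^bsub>KL\<^esub> query QL (map im Ss, im A)"
proof -
  let ?n = "length Ss + 1"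
  let ?R = "list_tensor_ar KL (replicate ?n w_ins)" and ?R' = "list_tensor_ar KL (replicate ?n w_ins')"
  have A: "A \<subseteq> verts H" using q H.outs_verts by auto
  have lA: "list_of A \<in> lists (verts H)" "list_of (ins H) \<in> lists (verts H)" using A H.ins_verts by auto
  then have lg: "gsrc QH (Ss, A) \<in> lists (verts H)" by (auto simp: in_lists_conv_set)
  note g = gen_typing[OF q] and w = w_out_typing[OF A] and q' = query_Ar(1)[OF im_gens[OF q]]
  note R = L.G.A.list_tensor_ar_replicate_typing[OF w_ins_typing(1), of ?n, unfolded w_ins_typing]
    and R' = L.G.A.list_tensor_ar_replicate_typing[OF w_ins_typing(4), of ?n, unfolded w_ins_typing]
  have cg: "cp (gsrc QH (Ss, A)) = Tgt KL ?R" by (simp only: R H.int_signature_simps cp_concat_replicate)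
  have sq: "Src KL (query QL (map im Ss, im A)) = concat (replicate ?n (list_of (ins L)))" using q' by simp
  have "?R' \<cdot>\<^bsub>KL\<^esub> ?R = list_tensor_ar KL (replicate ?n (Ident KL (list_of (ins L))))"
    unfolding w_ins_inverse(1)[symmetric]
    by (rule L.G.A.list_tensor_ar_replicate_cmp) (use w_ins_typing in simp_all)
  also have "\<dots> = Ident KL (concat (replicate ?n (list_of (ins L))))"
  proof -
    have o: "list_of (ins L) \<in> lists (verts L)" using L.ins_verts by auto
    have "list_tensor_ar KL (replicate k (Ident KL (list_of (ins L)))) = Ident KL (concat (replicate k (list_of (ins L))))" for k
    proof (induction k)
      case (Suc k)
      have "concat (replicate k (list_of (ins L))) \<in> lists (verts L)" using o by (induction k) auto
      then show ?case using Suc o by simp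
    qed simp
    then show ?thesis .
  qed
  finally have RR: "?R' \<cdot>\<^bsub>KL\<^esub> ?R = Ident KL (concat (replicate ?n (list_of (ins L))))" .
  have "far lifted_functor (query QH (Ss, A)) \<cdot>\<^bsub>KL\<^esub> comparison QL lifted_functor (gsrc QH (Ss, A)) \<cdot>\<^bsub>KL\<^esub> ?R
      = gen (Ss, A) \<cdot>\<^bsub>KL\<^esub> ?R"
    unfolding comparison_lifted[OF lg] cg lifted_simps ext_query[OF q]
    by (subst L.G.A.ident_cmp) (simp_all only: R)
  also have "\<dots> = w_out A \<cdot>\<^bsub>KL\<^esub> query QL (map im Ss, im A) \<cdot>\<^bsub>KL\<^esub> ?R' \<cdot>\<^bsub>KL\<^esub> ?R"
  proof -
    have t: "Src KL (query QL (map im Ss, im A)) = Tgt KL ?R'" "Src KL ?R' = Tgt KL ?R" by (simp_all only: sq R R')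
    then show ?thesis unfolding gen_def case_prod_conv using w q' R(1) R'(1) by (simp del: replicate.simps)
  qed
  also have "\<dots> = w_out A \<cdot>\<^bsub>KL\<^esub> query QL (map im Ss, im A)"
    unfolding RR by (subst L.G.A.cmp_ident) (use q' sq in simp_all)
  also have "\<dots> = comparison QL lifted_functor (list_of A) \<cdot>\<^bsub>KL\<^esub> w_out A \<cdot>\<^bsub>KL\<^esub> query QL (map im Ss, im A)"
    unfolding comparison_lifted[OF lA(1)] using w q' by simp
  finally show ?thesis .
qed

lemma maps_queries_lifted: "maps_queries L H lifted_functor"
  unfolding maps_queries_def Let_def
proof (intro allI impI)
  fix Ss A assume q: "intervention_sets H Ss \<and> A \<subseteq> outs H"
  then have q': "(Ss, A) \<in> gens QH" by simp
  have v: "map (var_set lifted_functor) Ss = map im Ss" "var_set lifted_functor A = im A"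
  proof -
    have "B \<subseteq> verts H" if "B \<in> set Ss" for B
      using q that H.nins_verts by (auto simp: intervention_sets_def)
    then show "map (var_set lifted_functor) Ss = map im Ss" using var_set_lifted by simp
    show "var_set lifted_functor A = im A" using q H.outs_verts by (intro var_set_lifted) auto
  qed
  show "(map (var_set lifted_functor) Ss, var_set lifted_functor A) \<in> gens QL \<and>
    far lifted_functor (query QH (Ss, A)) \<cdot>\<^bsub>KL\<^esub> comparison QL lifted_functor (gsrc QH (Ss, A)) \<cdot>\<^bsub>KL\<^esub>
      list_tensor_ar KL (replicate (length Ss + 1)
        (wireQ L (list_of (ins L)) (concat_image lifted_functor (list_of (ins H))))) =
    comparison QL lifted_functor (list_of A) \<cdot>\<^bsub>KL\<^esub>
      wireQ L (list_of (var_set lifted_functor A)) (concat_image lifted_functor (list_of A)) \<cdot>\<^bsub>KL\<^esub>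
      query QL (map (var_set lifted_functor) Ss, var_set lifted_functor A)"
    unfolding v concat_image_lifted using im_gens[OF q'] lifted_query[OF q'] by blast
qed

text \<open>The witnesses are the permutations that already occur in \<open>lifted_query\<close>:
  \<open>w_out A\<close> for the outputs and one \<open>w_ins\<close> for each copy of the
  inputs.\<close>

lemma sends_queries_lifted: "sends_queries_to_queries QL QH lifted_functor"
  unfolding sends_queries_to_queries_def
proof
  fix q assume q0: "q \<in> gens QH"
  obtain Ss A where q: "q = (Ss, A)" by (cases q)
  have qg: "(Ss, A) \<in> gens QH" using q0 q by simp
  have A: "A \<subseteq> verts H" using qg H.outs_verts by auto
  have "w_out A \<in> perms QL (list_of (im A)) (cp (list_of A))"
    by (rule wire_in_perms)
      (use im_verts[OF A] set_cp[of "list_of A"] distinct_cp[of "list_of A"] A in simp_all)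
  then have 1: "w_out A \<in> perms QL (gtgt QL (map im Ss, im A)) (concat_image lifted_functor (gtgt QH q))"
    by (simp only: q L.int_signature_simps H.int_signature_simps concat_image_lifted)
  have "w_ins \<in> perms QL (list_of (ins L)) (cp (list_of (ins H)))"
    by (rule wire_in_perms)
      (use L.ins_verts set_cp_ins distinct_cp[of "list_of (ins H)"] H.ins_verts in simp_all)
  then have "list_tensor_ar KL (replicate (length Ss + 1) w_ins) \<in>
      perms QL (concat (replicate (length Ss + 1) (list_of (ins L)))) (concat (replicate (length Ss + 1) (cp (list_of (ins H)))))"
    by (rule perms_replicate)
  then have 2: "list_tensor_ar KL (replicate (length Ss + 1) w_ins) \<in>
      perms QL (gsrc QL (map im Ss, im A)) (concat_image lifted_functor (gsrc QH q))"
    by (simp only: q L.int_signature_simps H.int_signature_simps concat_image_lifted cp_concat_replicate length_map)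
  show "\<exists>q' \<in> gens QL. \<exists>p \<in> perms QL (gsrc QL q') (concat_image lifted_functor (gsrc QH q)).
      \<exists>p' \<in> perms QL (gtgt QL q') (concat_image lifted_functor (gtgt QH q)).
        far lifted_functor (query QH q) \<cdot>\<^bsub>KL\<^esub> comparison QL lifted_functor (gsrc QH q) \<cdot>\<^bsub>KL\<^esub> p =
        comparison QL lifted_functor (gtgt QH q) \<cdot>\<^bsub>KL\<^esub> p' \<cdot>\<^bsub>KL\<^esub> query QL q'"
  proof (intro bexI)
    show "far lifted_functor (query QH q) \<cdot>\<^bsub>KL\<^esub> comparison QL lifted_functor (gsrc QH q) \<cdot>\<^bsub>KL\<^esub>
        list_tensor_ar KL (replicate (length Ss + 1) w_ins) =
      comparison QL lifted_functor (gtgt QH q) \<cdot>\<^bsub>KL\<^esub> w_out A \<cdot>\<^bsub>KL\<^esub> query QL (map im Ss, im A)"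
      using lifted_query[OF qg] by (simp only: q H.int_signature_simps(4))
  qed (rule 1 2 im_gens[OF qg])+
qed

lemma maps_variables_lifted: "maps_variables L H lifted_functor"
  unfolding maps_variables_def concat_image_lifted
proof (intro conjI)
  show "distinct (cp (list_of (ins H)))" "distinct (cp (list_of (nins H)))"
    using distinct_cp H.ins_verts H.nins_verts by simp_all
  show "set (cp (list_of (ins H))) = ins L" by (rule set_cp_ins)
  show "set (cp (list_of (nins H))) \<subseteq> nins L"
    using set_cp[of "list_of (nins H)"] H.nins_verts p0_nins by (auto simp: image_set_def)
qed

lemma downward_lifted: "(lifted_functor, lifted_tau) \<in> downward_int_abstractions C L H"
proof -
  have "\<forall>xs \<in> Ob KH. epic C (lifted_tau xs)"
    using epic_tau_list by (simp add: lifted_tau_def tau_list_eq)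
  then show ?thesis
    unfolding downward_int_abstractions_def downward_abstraction_def
    using L.query_model_int_model H.query_model_int_model markov_functor_lifted sends_queries_lifted
      transformation_lifted maps_variables_lifted maps_queries_lifted
    by blast
qed

text \<open>The lift sends \<open>[X]\<close> to \<open>list_of (p0 X)\<close>, so the sorting
  permutation of the restriction is an identity. Outside \<open>verts H\<close> both sides have the
  default value of extensional functions.\<close>

lemma restrict_lifted: "restrict_to_variables C L H (lifted_functor, lifted_tau) = (p0, \<tau>0)"
proof -
  have "lifted_tau [X] \<cdot>\<^bsub>C\<^esub> far (int_model C L) (wireQ L (list_of (set (fob lifted_functor [X]))) (fob lifted_functor [X])) = \<tau>0 X"
    if X: "X \<in> verts H" for X
  proof -
    have s: "list_of (set (fob lifted_functor [X])) = p X" using p_simps(2)[OF X] by simp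
    have v: "set (p X) \<subseteq> verts L" using p_simps(2)[OF X] p0_verts[OF X] by simp
    have "L.sem (wireQ L (p X) (p X)) = Ident S (map (val L) (p X))"
      using L.sem_wire[OF v] p_simps(1)[OF X] v by (simp add: L.S.wire_self)
    then have "far (int_model C L) (wireQ L (p X) (p X)) = Ident C (tlist C (map (val L) (p X)))"
      by (simp add: L.far_int_model strictify_simps underlying_def)
    moreover have "lifted_tau [X] = \<tau>0 X"
      using t_typing(1)[OF X] by (simp add: lifted_tau_def) (simp add: t_def underlying_def)
    ultimately show ?thesis using tau0(1)[OF X] unfolding s by (simp add: in_hom_iff)
  qed
  then show ?thesis
    using extensional p_simps(2)
    by (auto simp: restrict_to_variables_def fun_eq_iff restrict_def extensional_def)
qed

end

section \<open>The kernel and the image of restriction\<close>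

context model_pair
begin

text \<open>\<open>same_abstraction\<close> is exactly the kernel of restriction. That it is an
  equivalence relation thus follows without composing or inverting transformations.\<close>

lemma same_abstraction_iff:
  "(x, y) \<in> same_abstraction C L H \<longleftrightarrow> x \<in> downward_int_abstractions C L H \<and>
    y \<in> downward_int_abstractions C L H \<and> restrict_to_variables C L H x = restrict_to_variables C L H y"
proof -
  obtain \<pi> \<tau> \<pi>' \<tau>' where [simp]: "x = (\<pi>, \<tau>)" "y = (\<pi>', \<tau>')" by (cases x; cases y)
  show ?thesis
  proof
    assume xy: "(x, y) \<in> same_abstraction C L H"
    then have d: "(\<pi>, \<tau>) \<in> downward_int_abstractions C L H" "(\<pi>', \<tau>') \<in> downward_int_abstractions C L H"
      by (auto simp: same_abstraction_def)
    interpret downward_pair C L H \<pi> \<tau> \<pi>' \<tau>' by unfold_locales (rule d)+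
    show "x \<in> downward_int_abstractions C L H \<and> y \<in> downward_int_abstractions C L H \<and>
        restrict_to_variables C L H x = restrict_to_variables C L H y"
      using d same_imp_restricted_eq xy by simp
  next
    assume r: "x \<in> downward_int_abstractions C L H \<and>
      y \<in> downward_int_abstractions C L H \<and> restrict_to_variables C L H x = restrict_to_variables C L H y"
    interpret same_restriction C L H \<pi> \<tau> \<pi>' \<tau>' by unfold_locales (use r in simp_all)
    show "(x, y) \<in> same_abstraction C L H" using same_abstraction_of_restricted_eq by simp
  qed
qed

lemma restrict_image:
  "restrict_to_variables C L H ` downward_int_abstractions C L H = {(\<pi>, \<tau>). interchange_abstraction C L H \<pi> \<tau>}"
proof (intro equalityI subsetI)
  fix y assume "y \<in> restrict_to_variables C L H ` downward_int_abstractions C L H"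
  then obtain \<pi> \<tau> where d: "(\<pi>, \<tau>) \<in> downward_int_abstractions C L H" "y = restrict_to_variables C L H (\<pi>, \<tau>)"
    by auto
  interpret downward C L H \<pi> \<tau> by unfold_locales (rule d)
  show "y \<in> {(\<pi>, \<tau>). interchange_abstraction C L H \<pi> \<tau>}"
    using interchange_abstraction_restricted d(2) restrict_eq by simp
next
  fix y assume "y \<in> {(\<pi>, \<tau>). interchange_abstraction C L H \<pi> \<tau>}"
  then obtain p0 \<tau>0 where y: "y = (p0, \<tau>0)" "interchange_abstraction C L H p0 \<tau>0" by auto
  interpret alignment C L H p0 \<tau>0 by unfold_locales (rule y)
  show "y \<in> restrict_to_variables C L H ` downward_int_abstractions C L H"
    using downward_lifted restrict_lifted y(1) by (metis imageI)
qed

end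

text \<open>The factorization of a map through the quotient by its kernel; \<open>the_elem\<close>
  extracts the common value on a class.\<close>

lemma bij_betw_quotient_kernel:
  assumes r: "\<And>x y. (x, y) \<in> r \<longleftrightarrow> x \<in> A \<and> y \<in> A \<and> f x = f y"
  shows "equiv A r" "f respects r" "bij_betw (\<lambda>c. the_elem (f ` c)) (A // r) (f ` A)"
proof -
  show eq: "equiv A r"
    by (rule equivI) (auto simp: refl_on_def sym_def trans_def r)
  show resp: "f respects r"
    by (auto simp: congruent_def r)
  have el: "the_elem (f ` (r `` {x})) = f x" if "x \<in> A" for x
  proof -
    have "f ` (r `` {x}) = {f x}" using that r by auto
    then show ?thesis by simp
  qed
  show "bij_betw (\<lambda>c. the_elem (f ` c)) (A // r) (f ` A)"
  proof (rule bij_betw_imageI)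
    show "inj_on (\<lambda>c. the_elem (f ` c)) (A // r)"
    proof (rule inj_onI)
      fix c d assume "c \<in> A // r" "d \<in> A // r" and e: "the_elem (f ` c) = the_elem (f ` d)"
      then obtain x y where xy: "x \<in> A" "c = r `` {x}" "y \<in> A" "d = r `` {y}" by (auto elim!: quotientE)
      then have "(x, y) \<in> r" using e el r by simp
      then show "c = d" using equiv_class_eq[OF eq] xy by simp
    qed
    show "(\<lambda>c. the_elem (f ` c)) ` (A // r) = f ` A"
      using el by (auto simp: quotient_def image_iff)
  qed
qed

theorem proposition29:
  fixes C :: "('o, 'm) mcat"
    and L :: "('v, 'o, 'm) causal_model"
    and H :: "('u, 'o, 'm) causal_model"
  assumes "markov_category C"
    and "causal_model C L"
    and "causal_model C H"
  shows "equiv (downward_int_abstractions C L H) (same_abstraction C L H) \<and>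
    restrict_to_variables C L H respects same_abstraction C L H \<and>
    bij_betw (\<lambda>c. the_elem (restrict_to_variables C L H ` c))
      (downward_int_abstractions C L H // same_abstraction C L H)
      {(\<pi>, \<tau>). interchange_abstraction C L H \<pi> \<tau>}"
proof -
  interpret markov_category C by fact
  interpret model_pair C L H by unfold_locales (rule assms)+
  show ?thesis
    using bij_betw_quotient_kernel[OF same_abstraction_iff] unfolding restrict_image by blast
qed

end
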